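(* For every $\alpha>0$ the Riemann-Hilbert problem $RHP^{\to}$ has a unique solution $M^{\to}$, and for every $\alpha\le0$ the Riemann-Hilbert problem $RHP^{\leftarrow}$ has a unique solution $M^{\leftarrow}$ (both problems being defined in the context).
   Context: Powers of $z$ are principal branches (cut along $(-\infty,0]$); $\sigma_3=\mathrm{diag}(1,-1)$, $z^{a\sigma_3}=\mathrm{diag}(z^a,z^{-a})$, $e^{a\sigma_3}=\mathrm{diag}(e^a,e^{-a})$; and $$\mathfrak m(z)=z^{-\sigma_3/4}\,\tfrac{1}{\sqrt2}\begin{pmatrix}1&1\\-1&1\end{pmatrix}e^{-\frac{\pi i}{4}\sigma_3}.$$ The contour $\Sigma^{\leftarrow}$ consists of $(-\infty,0)$ and the two rays $\arg z=\pm\frac23\pi$, all oriented from infinity towards $0$; $\Sigma^{\to}$ is $\Sigma^{\leftarrow}$ together with $(0,\alpha)$ oriented from $0$ to $\alpha$. Subscripts $+$ and $-$ denote boundary values from the left and right sides of the oriented contour. A solution is a $2\times2$ matrix function $M$ analytic off the contour (including its finite endpoints), with boundary values continuous on the contour away from $0$ (and $\alpha$), with at most logarithmic singularities at these points, satisfying the jump relations below and $M(z)=(I+O(z^{-1}))\,\mathfrak m(z)$ as $z\to\infty$ off the contour. $RHP^{\to}$ ($\alpha>0$): $M_+=M_-\begin{pmatrix}1& e^{-\frac43z^{3/2}}\\ 0&1\end{pmatrix}$ on $(0,\alpha)$; $M_+=M_-\begin{pmatrix}1&0\\ e^{\frac43z^{3/2}}&1\end{pmatrix}$ on $\arg z=\pm\frac23\pi$;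 $M_+=M_-\begin{pmatrix}0&1\\-1&0\end{pmatrix}$ on $(-\infty,0)$. $RHP^{\leftarrow}$ ($\alpha\le0$): $M_+=M_-\begin{pmatrix}1&0\\ e^{\frac43z^{3/2}+2\alpha z^{1/2}}&1\end{pmatrix}$ on $\arg z=\pm\frac23\pi$; $M_+=M_-\begin{pmatrix}0&1\\-1&0\end{pmatrix}$ on $(-\infty,0)$. *)

theory Defs
  imports "HOL-Complex_Analysis.Complex_Analysis" "HOL-Library.Landau_Symbols"
begin

type_synonym cmat2 = "complex^2^2"

definition mat2 :: "complex \<Rightarrow> complex \<Rightarrow> complex \<Rightarrow> complex \<Rightarrow> cmat2" where
  "mat2 a b c d = vector [vector [a, b], vector [c, d]]"

definition zpow_sigma3 :: "complex \<Rightarrow> complex \<Rightarrow> cmat2" where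
  "zpow_sigma3 z a = mat2 (z powr a) 0 0 (z powr (- a))"

definition exp_sigma3 :: "complex \<Rightarrow> cmat2" where
  "exp_sigma3 a = mat2 (exp a) 0 0 (exp (- a))"

definition mfrak :: "complex \<Rightarrow> cmat2" where
  "mfrak z = zpow_sigma3 z (- 1 / 4)
     ** mat2 (1 / sqrt 2) (1 / sqrt 2) (- 1 / sqrt 2) (1 / sqrt 2)
     ** exp_sigma3 (- (of_real pi * \<i> / 4))"

text \<open>
  An oriented straight arc is a triple \<open>(S, t, J)\<close>: the arc \<open>S\<close> without its endpoints, a
  tangent direction \<open>t\<close> giving the orientation, and the jump matrix \<open>J\<close> on it.
  As the arcs are straight, the left and right sides of \<open>S\<close> near \<open>z \<in> S\<close> are the half-planes
  cut out by the line through \<open>z\<close> with direction \<open>t\<close>.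
\<close>

type_synonym jump_arc = "complex set \<times> complex \<times> (complex \<Rightarrow> cmat2)"

definition left_side :: "complex \<Rightarrow> complex \<Rightarrow> complex set" where
  "left_side t z = {w. Im ((w - z) / t) > 0}"

definition right_side :: "complex \<Rightarrow> complex \<Rightarrow> complex set" where
  "right_side t z = {w. Im ((w - z) / t) < 0}"

definition satisfies_jump :: "(complex \<Rightarrow> cmat2) \<Rightarrow> jump_arc \<Rightarrow> bool" where
  "satisfies_jump M = (\<lambda>(S, t, J). \<exists>Mp Mm.
     continuous_on S Mp \<and> continuous_on S Mm \<and>
     (\<forall>z\<in>S. (M \<longlongrightarrow> Mp z) (at z within left_side t z) \<and>
            (M \<longlongrightarrow> Mm z) (at z within right_side t z) \<and>
            Mp z = Mm z ** J z))"

text \<open>\<open>E\<close> is the set of finite endpoints of the arcs; it is included in the contour.\<close>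

definition contour :: "jump_arc set \<Rightarrow> complex set \<Rightarrow> complex set" where
  "contour arcs E = E \<union> (\<Union>(S, t, J)\<in>arcs. S)"

definition log_singularity :: "complex set \<Rightarrow> (complex \<Rightarrow> cmat2) \<Rightarrow> complex \<Rightarrow> bool" where
  "log_singularity \<Gamma> M e \<longleftrightarrow>
     (\<forall>i j. (\<lambda>z. M z $ i $ j) \<in> O[at e within - \<Gamma>](\<lambda>z. of_real (ln (norm (z - e)))))"

definition normalized_at_infinity :: "complex set \<Rightarrow> (complex \<Rightarrow> cmat2) \<Rightarrow> bool" where
  "normalized_at_infinity \<Gamma> M \<longleftrightarrow>
     (\<exists>R. (\<forall>i j. (\<lambda>z. R z $ i $ j) \<in> O[inf at_infinity (principal (- \<Gamma>))](\<lambda>z. 1 / z)) \<and>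
          (\<forall>\<^sub>F z in inf at_infinity (principal (- \<Gamma>)). M z = (mat 1 + R z) ** mfrak z))"

definition rh_solution :: "jump_arc set \<Rightarrow> complex set \<Rightarrow> (complex \<Rightarrow> cmat2) \<Rightarrow> bool" where
  "rh_solution arcs E M \<longleftrightarrow>
     (\<forall>i j. (\<lambda>z. M z $ i $ j) analytic_on - contour arcs E) \<and>
     (\<forall>a\<in>arcs. satisfies_jump M a) \<and>
     (\<forall>e\<in>E. log_singularity (contour arcs E) M e) \<and>
     normalized_at_infinity (contour arcs E) M"

definition ray :: "real \<Rightarrow> complex set" where
  "ray \<theta> = {z. z \<noteq> 0 \<and> Arg z = \<theta>}"

text \<open>A ray from infinity towards 0 at angle \<open>\<theta>\<close> has direction \<open>- cis \<theta>\<close>.\<close>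

definition arcs_right :: "real \<Rightarrow> jump_arc set" where
  "arcs_right \<alpha> =
     {(of_real ` {0<..<\<alpha>}, 1, \<lambda>z. mat2 1 (exp (- (4 / 3) * z powr (3 / 2))) 0 1),
      (ray (2 / 3 * pi), - cis (2 / 3 * pi), \<lambda>z. mat2 1 0 (exp (4 / 3 * z powr (3 / 2))) 1),
      (ray (- (2 / 3 * pi)), - cis (- (2 / 3 * pi)),
         \<lambda>z. mat2 1 0 (exp (4 / 3 * z powr (3 / 2))) 1),
      (of_real ` {..<0::real}, 1, \<lambda>z. mat2 0 1 (- 1) 0)}"

definition arcs_left :: "real \<Rightarrow> jump_arc set" where
  "arcs_left \<alpha> =
     {(ray (2 / 3 * pi), - cis (2 / 3 * pi),
         \<lambda>z. mat2 1 0 (exp (4 / 3 * z powr (3 / 2) + 2 * of_real \<alpha> * z powr (1 / 2))) 1),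
      (ray (- (2 / 3 * pi)), - cis (- (2 / 3 * pi)),
         \<lambda>z. mat2 1 0 (exp (4 / 3 * z powr (3 / 2) + 2 * of_real \<alpha> * z powr (1 / 2))) 1),
      (of_real ` {..<0::real}, 1, \<lambda>z. mat2 0 1 (- 1) 0)}"

definition Sigma_right :: "real \<Rightarrow> complex set" where
  "Sigma_right \<alpha> = contour (arcs_right \<alpha>) {0, of_real \<alpha>}"

definition Sigma_left :: "real \<Rightarrow> complex set" where
  "Sigma_left \<alpha> = contour (arcs_left \<alpha>) {0}"

definition RHP_right :: "real \<Rightarrow> (complex \<Rightarrow> cmat2) \<Rightarrow> bool" where
  "RHP_right \<alpha> M \<longleftrightarrow> rh_solution (arcs_right \<alpha>) {0, of_real \<alpha>} M"

definition RHP_left :: "real \<Rightarrow> (complex \<Rightarrow> cmat2) \<Rightarrow> bool" where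
  "RHP_left \<alpha> M \<longleftrightarrow> rh_solution (arcs_left \<alpha>) {0} M"

end

theory Submission
  imports Defs "HOL-Probability.Probability"
begin

text \<open>
  Both problems are cases of one problem with parameters \<open>(\<beta>, \<gamma>)\<close>: the phase is
  \<open>\<theta> = 2/3 z powr (3/2) + \<beta> z powr (1/2)\<close> and the upper triangular jump lives on \<open>(0, \<gamma>)\<close>; the
  first problem is \<open>(0, \<alpha>)\<close>, the second one \<open>(\<alpha>, 0)\<close>.

  After stripping \<open>exp (\<theta> \<sigma>\<^sub>3)\<close> and undoing the opening of lenses, only the unipotent jump of a logarithm
  \<open>Ln (z - \<gamma>)\<close> remains, so a solution has rows \<open>(y, g + y * Ln (z - \<gamma>) / (2 \<pi> \<i>))\<close> with \<open>y\<close>, \<open>g\<close> entire.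
  Such rows come from the Airy kernel \<open>K\<close> on \<open>(a, \<infinity>)\<close>, \<open>a = \<beta> + \<gamma>\<close>, which is the square of the Airy
  transform cut off to half-lines, hence a positive contraction without eigenvalue \<open>1\<close>. Solving
  \<open>u = v + K u\<close> for \<open>v = Ai, Ai'\<close> gives entire \<open>u\<close>; by the Christoffel-Darboux form of \<open>K\<close>, the Cauchy integrals of
  \<open>u * (- Ai', Ai)\<close> yield a matrix \<open>X = I + O(1/z)\<close> which maps \<open>(Ai, Ai')\<close> to an entire vector. The solution is
  \<open>X\<close> times the Airy parametrix at \<open>z + \<beta>\<close>, up to a constant triangular prefactor.

  For uniqueness, the \<open>2 \<times> 2\<close> determinants formed by a row of one solution and a row of another
  one have no jump, as all jump matrices have determinant \<open>1\<close>. They extend to bounded entire functions.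
\<close>

section \<open>The Airy function\<close>

text \<open>The main obstacle is to exclude the eigenvalue 1 for every \<open>a\<close>, without any
  smallness. On the whole line the Airy transform is controlled only through conditionally
  convergent integrals, so a weight \<open>exp (\<epsilon> * t)\<close> is inserted: the weighted
  composition is an explicit heat kernel, and letting \<epsilon> tend to 0 gives a contraction onto
  a half-line with any endpoint. The transform of a fixed point then has no mass between -1 and 0;
  being entire, it is 0, and so is the fixed point. Working with pointwise envelopes makes the
  resolvent equation hold at every real point, so that its solution can be continued to the plane.
  The endpoint \<open>\<beta> + \<gamma>\<close> is the branch point \<open>\<gamma>\<close> seen in
  the variable \<open>z + \<beta>\<close>. The prefactor is needed because the phase at
  \<open>z + \<beta>\<close> differs from \<theta> by about \<beta>^2 / 4 times
  \<open>z powr (- 1 / 2)\<close>, which leaves a constant in the lower left entry. The expansion at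
  infinity must be uniform up to the negative axis, where \<open>Airy\<close> oscillates; past the
  rays, rotated Airy functions take its place, and the three-term relation between them is what
  opening the lenses expresses.\<close>

lemma has_field_derivative_parameter_integral:
  fixes f :: "complex \<Rightarrow> 'a \<Rightarrow> complex"
  assumes U: "open U" "z \<in> U"
    and hol: "\<And>k. k \<in> space M \<Longrightarrow> (\<lambda>z. f z k) holomorphic_on U"
    and meas: "\<And>z. z \<in> U \<Longrightarrow> f z \<in> borel_measurable M"
    and dom: "\<And>z. z \<in> U \<Longrightarrow> \<exists>r>0. \<exists>g. integrable M g \<and>
                (\<forall>w\<in>ball z r \<inter> U. \<forall>k\<in>space M. norm (f w k) \<le> g k)"
  shows "((\<lambda>z. \<integral>k. f z k \<partial>M) has_field_derivative (\<integral>k. deriv (\<lambda>z. f z k) z \<partial>M)) (at z)"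
    and "integrable M (\<lambda>k. deriv (\<lambda>z. f z k) z)"
proof -
  obtain r0 g where r0: "r0 > 0" and g: "integrable M g"
    and b0: "\<forall>w\<in>ball z r0 \<inter> U. \<forall>k\<in>space M. norm (f w k) \<le> g k"
    using dom[OF U(2)] by blast
  obtain r1 where r1: "r1 > 0" "cball z r1 \<subseteq> U"
    using U open_contains_cball by blast
  \<comment> \<open>A third, so that the disc of radius \<open>r\<close> about any point of
    \<open>ball z r\<close> stays in \<open>ball z (3*r)\<close>, where \<open>g\<close> dominates.
    Cauchy's inequality on that disc bounds the derivative by \<open>g k / r\<close>, and the
    difference quotients inherit this majorant.\<close>
  define r where "r = min r0 r1 / 3"
  have r: "r > 0" using r0 r1 by (simp add: r_def)
  have sub: "ball z (3*r) \<subseteq> U" using r1 by (auto simp: r_def subset_iff)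
  have b: "norm (f w k) \<le> g k" if "w \<in> ball z (3*r)" "k \<in> space M" for w k
    using b0 sub that by (auto simp: r_def subset_iff)
  have db: "norm (deriv (\<lambda>z. f z k) w) \<le> g k / r" if w: "w \<in> ball z r" and k: "k \<in> space M" for w k
  proof -
    have s: "cball w r \<subseteq> ball z (3*r)"
    proof
      fix x assume "x \<in> cball w r"
      then show "x \<in> ball z (3*r)" using w r dist_triangle[of z x w] by auto
    qed
    have h: "(\<lambda>z. f z k) holomorphic_on cball w r"
      by (rule holomorphic_on_subset[OF hol[OF k]]) (use s sub in auto)
    have "norm ((deriv ^^ 1) (\<lambda>z. f z k) w) \<le> fact 1 * g k / r ^ 1"
    proof (rule Cauchy_inequality)
      show "(\<lambda>z. f z k) holomorphic_on ball w r" using h holomorphic_on_subset ball_subset_cball by blast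
      show "continuous_on (cball w r) (\<lambda>z. f z k)" using h holomorphic_on_imp_continuous_on by blast
      fix x assume "norm (w - x) = r"
      then have "x \<in> cball w r" by (simp add: dist_norm)
      then show "norm (f x k) \<le> g k" using b s k by blast
    qed (use r in auto)
    then show ?thesis by simp
  qed
  have der: "((\<lambda>z. f z k) has_field_derivative deriv (\<lambda>z. f z k) w) (at w)"
    if "w \<in> ball z r" "k \<in> space M" for w k
    using hol[OF that(2)] U(1) sub that(1) r
    by (intro holomorphic_derivI[of _ U]) (auto simp: subset_iff)
  have lip: "norm (f w k - f z k) \<le> g k / r * norm (w - z)" if "w \<in> ball z r" "k \<in> space M" for w k
    by (rule field_differentiable_bound[of "ball z r"])
       (use that r db der in \<open>auto intro: has_field_derivative_at_within\<close>)
  have int0: "integrable M (f w)" if "w \<in> ball z r" for w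
    by (rule Bochner_Integration.integrable_bound[OF g]) 
       (use that sub r b in \<open>auto intro!: meas AE_I2 simp: subset_iff dist_norm intro: order_trans[OF _ abs_ge_self]\<close>)
  have main: "integrable M (\<lambda>k. deriv (\<lambda>z. f z k) z) \<and>
     (\<lambda>n. \<integral>k. (f (X n) k - f z k) / (X n - z) \<partial>M) \<longlonglongrightarrow> (\<integral>k. deriv (\<lambda>z. f z k) z \<partial>M)"
    if X: "\<And>n. X n \<in> ball z r - {z}" "X \<longlonglongrightarrow> z" for X
  proof -
    have lim: "(\<lambda>n. (f (X n) k - f z k) / (X n - z)) \<longlonglongrightarrow> deriv (\<lambda>z. f z k) z" if k: "k \<in> space M" for k
    proof -
      have "((\<lambda>w. (f w k - f z k) / (w - z)) \<longlongrightarrow> deriv (\<lambda>z. f z k) z) (at z)"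
        using der[of z k] r k by (simp add: has_field_derivative_iff)
      then show ?thesis
        using X unfolding tendsto_at_iff_sequentially comp_def by auto
    qed
    have m1: "(\<lambda>k. (f (X n) k - f z k) / (X n - z)) \<in> borel_measurable M" for n
      using X(1)[of n] sub r U(2) by (intro borel_measurable_divide borel_measurable_diff meas borel_measurable_const) auto
    have m2: "(\<lambda>k. deriv (\<lambda>z. f z k) z) \<in> borel_measurable M"
      by (rule borel_measurable_LIMSEQ_metric[OF m1 lim])
    have gi: "integrable M (\<lambda>k. g k / r)" using g by simp
    have bd: "norm ((f (X n) k - f z k) / (X n - z)) \<le> g k / r" if "k \<in> space M" for n k
      using lip[of "X n" k] X(1)[of n] that by (auto simp: norm_divide divide_le_eq)
    have ae: "AE k in M. (\<lambda>n. (f (X n) k - f z k) / (X n - z)) \<longlonglongrightarrow> deriv (\<lambda>z. f z k) z"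
      "\<And>n. AE k in M. norm ((f (X n) k - f z k) / (X n - z)) \<le> g k / r"
      using lim bd by (auto intro!: AE_I2)
    show ?thesis
      using integrable_dominated_convergence[OF m2 m1 gi ae] integral_dominated_convergence[OF m2 m1 gi ae] by blast
  qed
  have X0: "(\<lambda>n. z + of_real (r / 2 / real (Suc n))) \<longlonglongrightarrow> z"
  proof -
    have "(\<lambda>n. z + of_real (r / 2 * inverse (real (Suc n)))) \<longlonglongrightarrow> z + of_real (r / 2 * 0)"
      by (intro tendsto_intros LIMSEQ_inverse_real_of_nat)
    then show ?thesis by (simp add: field_simps)
  qed
  have X1: "z + of_real (r / 2 / real (Suc n)) \<in> ball z r - {z}" for n
  proof -
    have "r / 2 / real (Suc n) \<le> r / 2 / 1" using r by (intro divide_left_mono) auto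
    moreover have "0 < r / 2 / real (Suc n)" using r by (intro divide_pos_pos) auto
    ultimately have "\<bar>r / 2 / real (Suc n)\<bar> < r" using r by linarith
    moreover have "r / 2 / real (Suc n) \<noteq> 0" using r by simp
    ultimately show ?thesis by (simp add: dist_norm norm_of_real del: of_real_divide of_nat_Suc)
  qed
  show "integrable M (\<lambda>k. deriv (\<lambda>z. f z k) z)" using main[OF X1 X0] by blast
  show "((\<lambda>z. \<integral>k. f z k \<partial>M) has_field_derivative (\<integral>k. deriv (\<lambda>z. f z k) z \<partial>M)) (at z)"
    unfolding has_field_derivative_iff tendsto_at_iff_sequentially comp_def
  proof (intro allI impI)
    fix X assume X: "\<forall>i. X i \<in> UNIV - {z}" "X \<longlonglongrightarrow> z"
    have "eventually (\<lambda>n. X n \<in> ball z r) sequentially"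
      using topological_tendstoD[OF X(2), of "ball z r"] r by simp
    then obtain N where N: "\<And>n. n \<ge> N \<Longrightarrow> X n \<in> ball z r" by (auto simp: eventually_sequentially)
    have "(\<lambda>n. \<integral>k. (f (X (n+N)) k - f z k) / (X (n+N) - z) \<partial>M) \<longlonglongrightarrow> (\<integral>k. deriv (\<lambda>z. f z k) z \<partial>M)"
      using main[OF _ LIMSEQ_ignore_initial_segment[OF X(2)], of N] N X by auto
    moreover have "(\<integral>k. (f (X (n+N)) k - f z k) / (X (n+N) - z) \<partial>M)
       = ((\<integral>k. f (X (n+N)) k \<partial>M) - (\<integral>k. f z k \<partial>M)) / (X (n+N) - z)" for n
      using int0[of "X (n+N)"] int0[of z] N r by simp
    ultimately have "(\<lambda>n. ((\<integral>k. f (X (n+N)) k \<partial>M) - (\<integral>k. f z k \<partial>M)) / (X (n+N) - z)) \<longlonglongrightarrow> (\<integral>k. deriv (\<lambda>z. f z k) z \<partial>M)"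
      by (simp only:)
    then show "(\<lambda>n. ((\<integral>k. f (X n) k \<partial>M) - (\<integral>k. f z k \<partial>M)) / (X n - z)) \<longlonglongrightarrow> (\<integral>k. deriv (\<lambda>z. f z k) z \<partial>M)"
      by (rule LIMSEQ_offset)
  qed
qed

lemma integrable_dominated:
  fixes f :: "'a \<Rightarrow> 'b::{banach, second_countable_topology}"
  assumes "integrable M g" "f \<in> borel_measurable M" "\<And>x. x \<in> space M \<Longrightarrow> norm (f x) \<le> g x"
  shows "integrable M f"
  by (rule Bochner_Integration.integrable_bound[OF assms(1,2)]) (use assms(3) in \<open>auto intro!: AE_I2 intro: order_trans[OF _ abs_ge_self]\<close>)

lemma integrable_gaussian:
  fixes c :: real
  assumes "c > 0"
  shows "integrable lborel (\<lambda>k. exp (- c * k\<^sup>2))"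
proof -
  have "integrable lborel (\<lambda>k. std_normal_density (0 + sqrt (2 * c) * k) * (0 + sqrt (2 * c) * k) ^ 0)"
    using assms integrable_std_normal_moment[of 0]
    by (subst lborel_integrable_real_affine_iff) simp_all
  then have "integrable lborel (\<lambda>k. sqrt (2 * pi) * std_normal_density (sqrt (2 * c) * k))"
    by simp
  then show ?thesis
    using assms by (simp add: std_normal_density_def power_mult_distrib real_sqrt_mult)
qed

section \<open>The Airy integral on shifted horizontal lines\<close>

definition airy_phase :: "complex \<Rightarrow> complex \<Rightarrow> complex" where
  "airy_phase z \<zeta> = exp (\<i> * (\<zeta> ^ 3 / 3 + z * \<zeta>))"

text \<open>On the real line the oscillatory integral converges only conditionally. One unit higher,
  the cubic phase contributes a factor \<open>exp (- k\<^sup>2)\<close>, so the integral converges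
  absolutely and dominated convergence applies.\<close>

definition Airy :: "complex \<Rightarrow> complex" where
  "Airy z = (\<integral>k. airy_phase z (of_real k + \<i>) \<partial>lborel) / (2 * pi)"

lemma norm_airy_phase:
  "norm (airy_phase z \<zeta>) = exp (- Im \<zeta> * (Re \<zeta>)\<^sup>2 + Im \<zeta> ^ 3 / 3 - Im \<zeta> * Re z - Re \<zeta> * Im z)"
proof -
  have "Re (\<i> * (\<zeta> ^ 3 / 3 + z * \<zeta>)) = - Im \<zeta> * (Re \<zeta>)\<^sup>2 + Im \<zeta> ^ 3 / 3 - Im \<zeta> * Re z - Re \<zeta> * Im z"
    by (simp add: power3_eq_cube power2_eq_square field_simps)
  then show ?thesis by (simp add: airy_phase_def)
qed

text \<open>The term \<open>- Im \<zeta> * (Re \<zeta>)\<^sup>2\<close> supplies a Gaussian of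
  strength at least \<open>a1\<close>, which is halved three times: to absorb the term linear in
  \<open>Im z\<close>, to pass from \<open>x\<close> to the integration variable \<open>k\<close>,
  and to absorb the power of order \<open>n\<close>. Hence the remaining \<open>a1 / 8\<close>. The
  bound is uniform in \<open>\<eta>\<close> and \<open>z\<close> because it has to justify
  differentiation in both.\<close>

lemma airy_phase_dominated:
  fixes a1 B X :: real
  assumes "a1 > 0"
  shows "\<exists>C. \<forall>\<eta> z k. a1 \<le> Re \<eta> \<longrightarrow> norm \<eta> \<le> B \<longrightarrow> norm z \<le> X \<longrightarrow>
    norm ((of_real k + \<i> * \<eta>) ^ n * airy_phase z (of_real k + \<i> * \<eta>)) \<le> C * exp (- (a1 / 8) * k\<^sup>2)"
proof (intro exI allI impI)
  fix \<eta> z :: complex and k :: real assume h: "a1 \<le> Re \<eta>" "norm \<eta> \<le> B" "norm z \<le> X"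
  define x where "x = k - Im \<eta>"
  define a where "a = Re \<eta>"
  have a: "a1 \<le> a" "0 < a" "a \<le> B" "\<bar>Im \<eta>\<bar> \<le> B" "B > 0" "\<bar>Re z\<bar> \<le> X" "\<bar>Im z\<bar> \<le> X" "X \<ge> 0"
    using h assms complex_Re_le_cmod[of \<eta>] abs_Im_le_cmod[of \<eta>] abs_Re_le_cmod[of z] abs_Im_le_cmod[of z] norm_ge_zero[of z]
    by (auto simp: a_def simp del: norm_ge_zero)
  have k: "k\<^sup>2 \<le> 2 * x\<^sup>2 + 2 * B\<^sup>2"
  proof -
    have "(Im \<eta>)\<^sup>2 \<le> B\<^sup>2" using a by (simp add: abs_le_square_iff[symmetric])
    moreover have "0 \<le> (x - Im \<eta>)\<^sup>2" by simp
    ultimately show ?thesis unfolding x_def by (simp add: power2_eq_square algebra_simps)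
  qed
  have 1: "- x * Im z \<le> a1 / 2 * x\<^sup>2 + X\<^sup>2 / (2 * a1)"
  proof -
    have "- x * Im z \<le> \<bar>x\<bar> * X" using a using abs_ge_self[of "- x * Im z"] mult_left_mono[of "\<bar>Im z\<bar>" X "\<bar>x\<bar>"] by (simp add: abs_mult)
    also have "0 \<le> (a1 * \<bar>x\<bar> - X)\<^sup>2 / (2 * a1)" using assms by simp
    then have "\<bar>x\<bar> * X \<le> a1 / 2 * x\<^sup>2 + X\<^sup>2 / (2 * a1)" using assms
      by (simp add: power2_diff power_mult_distrib field_simps power2_eq_square)
    finally show ?thesis .
  qed
  have 2: "a ^ 3 / 3 \<le> B ^ 3"
    using power_mono[of a B 3] zero_less_power[of B 3] a by linarith
  have 3: "- a * Re z \<le> B * X"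
  proof -
    have "- a * Re z \<le> a * \<bar>Re z\<bar>" using a using abs_ge_minus_self[of "a * Re z"] by (simp add: abs_mult)
    also have "\<dots> \<le> B * X" using a by (intro mult_mono) auto
    finally show ?thesis .
  qed
  have 4: "- a * x\<^sup>2 \<le> - a1 * x\<^sup>2" using a by (simp add: mult_right_mono)
  have 5: "- (a1 / 2) * x\<^sup>2 \<le> - (a1 / 4) * k\<^sup>2 + a1 / 2 * B\<^sup>2"
    using mult_left_mono[OF k, of "a1 / 4"] assms by (simp add: algebra_simps)
  have 6: "real n * \<bar>k\<bar> \<le> a1 / 8 * k\<^sup>2 + 2 * (real n)\<^sup>2 / a1"
  proof -
    have "0 \<le> (a1 * \<bar>k\<bar> - 4 * real n)\<^sup>2 / (8 * a1)" using assms by simp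
    then show ?thesis using assms by (simp add: power2_diff power_mult_distrib field_simps power2_eq_square)
  qed
  have e: "Re (of_real k + \<i> * \<eta>) = x" "Im (of_real k + \<i> * \<eta>) = a" by (auto simp: x_def a_def)
  have n1: "norm (of_real k + \<i> * \<eta>) \<le> exp (\<bar>k\<bar> + B)"
  proof -
    have "norm (of_real k + \<i> * \<eta>) \<le> \<bar>k\<bar> + norm \<eta>" using norm_triangle_ineq[of "of_real k" "\<i> * \<eta>"] by (simp add: norm_mult)
    also have "\<dots> \<le> 1 + (\<bar>k\<bar> + B)" using h by simp
    also have "\<dots> \<le> exp (\<bar>k\<bar> + B)" by (rule exp_ge_add_one_self)
    finally show ?thesis .
  qed
  have "norm ((of_real k + \<i> * \<eta>) ^ n * airy_phase z (of_real k + \<i> * \<eta>))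
     \<le> exp (\<bar>k\<bar> + B) ^ n * exp (- a * x\<^sup>2 + a ^ 3 / 3 - a * Re z - x * Im z)"
    unfolding norm_mult norm_power norm_airy_phase e
    by (intro mult_right_mono power_mono n1) auto
  also have "\<dots> = exp (real n * \<bar>k\<bar> + real n * B - a * x\<^sup>2 + a ^ 3 / 3 - a * Re z - x * Im z)"
    by (simp add: exp_of_nat_mult[symmetric] exp_add[symmetric] algebra_simps)
  also have "\<dots> \<le> exp ((2 * (real n)\<^sup>2 / a1 + real n * B + B ^ 3 + B * X + X\<^sup>2 / (2 * a1) + a1 / 2 * B\<^sup>2) + - (a1 / 8) * k\<^sup>2)"
    using 1 2 3 4 5 6 by (subst exp_le_cancel_iff) linarith
  finally show "norm ((of_real k + \<i> * \<eta>) ^ n * airy_phase z (of_real k + \<i> * \<eta>))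
     \<le> exp (2 * (real n)\<^sup>2 / a1 + real n * B + B ^ 3 + B * X + X\<^sup>2 / (2 * a1) + a1 / 2 * B\<^sup>2) * exp (- (a1 / 8) * k\<^sup>2)"
    by (simp only: exp_add)
qed

text \<open>The parameter \<open>\<eta>\<close> is complex on purpose: its real part is the height
  of the line, while its imaginary part only translates along the line. Holomorphy in
  \<open>\<eta>\<close> together with translation invariance then replaces a contour
  deformation.\<close>

definition airy_int :: "nat \<Rightarrow> complex \<Rightarrow> complex \<Rightarrow> complex" where
  "airy_int n z \<eta> = (\<integral>k. (of_real k + \<i> * \<eta>) ^ n * airy_phase z (of_real k + \<i> * \<eta>) \<partial>lborel)"

lemma airy_phase_holomorphic [holomorphic_intros]:
  "f holomorphic_on A \<Longrightarrow> g holomorphic_on A \<Longrightarrow> (\<lambda>z. airy_phase (f z) (g z)) holomorphic_on A"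
  unfolding airy_phase_def by (intro holomorphic_intros) auto

lemma borel_measurable_airy_phase [measurable]:
  assumes [measurable]: "f \<in> borel_measurable M" "g \<in> borel_measurable M"
  shows "(\<lambda>x. airy_phase (f x) (g x)) \<in> borel_measurable M"
  unfolding airy_phase_def by measurable

lemma integrable_airy_int:
  assumes "Re \<eta> > 0"
  shows "integrable lborel (\<lambda>k. (of_real k + \<i> * \<eta>) ^ n * airy_phase z (of_real k + \<i> * \<eta>))"
proof -
  obtain C where C: "\<And>k. norm ((of_real k + \<i> * \<eta>) ^ n * airy_phase z (of_real k + \<i> * \<eta>)) \<le> C * exp (- (Re \<eta> / 8) * k\<^sup>2)"
    using airy_phase_dominated[OF assms, of "norm \<eta>" "norm z" n] by blast
  show ?thesis
    by (rule integrable_dominated[OF integrable_mult_right[OF integrable_gaussian[of "Re \<eta> / 8"]]])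
       (use assms C in auto)
qed

lemma airy_int_deriv_z:
  assumes "Re \<eta> > 0"
  shows "((\<lambda>z. airy_int n z \<eta>) has_field_derivative \<i> * airy_int (Suc n) z \<eta>) (at z)"
proof -
  have d: "deriv (\<lambda>z. \<zeta> ^ n * airy_phase z \<zeta>) w = \<i> * (\<zeta> ^ Suc n * airy_phase w \<zeta>)" for \<zeta> w
    by (rule DERIV_imp_deriv) (auto intro!: derivative_eq_intros simp: airy_phase_def)
  have "((\<lambda>z. airy_int n z \<eta>) has_field_derivative
     (\<integral>k. deriv (\<lambda>z. (of_real k + \<i> * \<eta>) ^ n * airy_phase z (of_real k + \<i> * \<eta>)) z \<partial>lborel)) (at z)"
    unfolding airy_int_def
  proof (rule has_field_derivative_parameter_integral[of UNIV])
    fix z :: complex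
    obtain C where C: "\<And>w k. norm w \<le> norm z + 1 \<Longrightarrow> norm ((of_real k + \<i> * \<eta>) ^ n * airy_phase w (of_real k + \<i> * \<eta>)) \<le> C * exp (- (Re \<eta> / 8) * k\<^sup>2)"
      using airy_phase_dominated[OF assms, of "norm \<eta>" "norm z + 1" n] by blast
    show "\<exists>r>0. \<exists>g. integrable lborel g \<and> (\<forall>w\<in>ball z r \<inter> UNIV. \<forall>k\<in>space lborel. norm ((of_real k + \<i> * \<eta>) ^ n * airy_phase w (of_real k + \<i> * \<eta>)) \<le> g k)"
    proof (intro exI conjI ballI)
      show "integrable lborel (\<lambda>k. C * exp (- (Re \<eta> / 8) * k\<^sup>2))"
        using assms by (intro integrable_mult_right integrable_gaussian) auto
      fix w k assume "w \<in> ball z 1 \<inter> UNIV"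
      then have "norm w \<le> norm z + 1" using norm_triangle_ineq2[of w z] by (auto simp: dist_norm norm_minus_commute)
      then show "norm ((of_real k + \<i> * \<eta>) ^ n * airy_phase w (of_real k + \<i> * \<eta>)) \<le> C * exp (- (Re \<eta> / 8) * k\<^sup>2)" by (rule C)
    qed simp
  qed (auto intro!: holomorphic_intros)
  then show ?thesis by (simp only: d) (simp add: airy_int_def)
qed

lemma airy_int_deriv_eta:
  assumes "Re \<eta> > 0"
  shows "((\<lambda>\<eta>. airy_int 0 z \<eta>) has_field_derivative - (airy_int 2 z \<eta> + z * airy_int 0 z \<eta>)) (at \<eta>)"
proof -
  have d: "deriv (\<lambda>\<eta>. airy_phase z (of_real k + \<i> * \<eta>)) \<eta>
     = - ((of_real k + \<i> * \<eta>) ^ 2 * airy_phase z (of_real k + \<i> * \<eta>) + z * airy_phase z (of_real k + \<i> * \<eta>))" for k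
    by (rule DERIV_imp_deriv, unfold airy_phase_def)
       (rule derivative_eq_intros refl | simp add: field_simps power2_eq_square)+
  have "((\<lambda>\<eta>. \<integral>k. airy_phase z (of_real k + \<i> * \<eta>) \<partial>lborel) has_field_derivative
     (\<integral>k. deriv (\<lambda>\<eta>. airy_phase z (of_real k + \<i> * \<eta>)) \<eta> \<partial>lborel)) (at \<eta>)"
  proof (rule has_field_derivative_parameter_integral[of "{\<eta>. Re \<eta> > 0}"])
    fix \<eta> :: complex assume "\<eta> \<in> {\<eta>. Re \<eta> > 0}"
    then have e: "Re \<eta> > 0" by simp
    define a where "a = Re \<eta> / 2"
    have a: "a > 0" using e by (simp add: a_def)
    obtain C where C: "\<And>w k. a \<le> Re w \<Longrightarrow> norm w \<le> norm \<eta> + a \<Longrightarrow> norm (airy_phase z (of_real k + \<i> * w)) \<le> C * exp (- (a / 8) * k\<^sup>2)"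
      using airy_phase_dominated[OF a, of "norm \<eta> + a" "norm z" 0] by auto
    show "\<exists>r>0. \<exists>g. integrable lborel g \<and> (\<forall>w\<in>ball \<eta> r \<inter> {\<eta>. Re \<eta> > 0}. \<forall>k\<in>space lborel. norm (airy_phase z (of_real k + \<i> * w)) \<le> g k)"
    proof (intro exI conjI ballI)
      show "integrable lborel (\<lambda>k. C * exp (- (a / 8) * k\<^sup>2))"
        using a by (intro integrable_mult_right integrable_gaussian) auto
      fix w k assume w: "w \<in> ball \<eta> a \<inter> {\<eta>. Re \<eta> > 0}"
      then have "norm w \<le> norm \<eta> + a" using norm_triangle_ineq2[of w \<eta>] by (auto simp: dist_norm norm_minus_commute)
      moreover have "a \<le> Re w" using w abs_Re_le_cmod[of "\<eta> - w"] by (auto simp: dist_norm a_def)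
      ultimately show "norm (airy_phase z (of_real k + \<i> * w)) \<le> C * exp (- (a / 8) * k\<^sup>2)" by (intro C)
    qed (use a in simp)
  qed (use assms in \<open>auto intro!: holomorphic_intros simp: open_halfspace_Re_gt\<close>)
  then have "((\<lambda>\<eta>. airy_int 0 z \<eta>) has_field_derivative
     (\<integral>k. - ((of_real k + \<i> * \<eta>) ^ 2 * airy_phase z (of_real k + \<i> * \<eta>) + z * airy_phase z (of_real k + \<i> * \<eta>)) \<partial>lborel)) (at \<eta>)"
    by (simp only: d) (simp add: airy_int_def)
  also have "(\<integral>k. - ((of_real k + \<i> * \<eta>) ^ 2 * airy_phase z (of_real k + \<i> * \<eta>) + z * airy_phase z (of_real k + \<i> * \<eta>)) \<partial>lborel)
     = - (airy_int 2 z \<eta> + z * airy_int 0 z \<eta>)"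
    using integrable_airy_int[OF assms, of 2 z] integrable_airy_int[OF assms, of 0 z]
    by (simp add: airy_int_def)
  finally show ?thesis .
qed

lemma airy_int_shift: "airy_int n z (\<eta> + \<i> * of_real b) = airy_int n z \<eta>"
  unfolding airy_int_def
  by (subst lborel_integral_real_affine[of 1 _ b]) (simp_all add: algebra_simps)

text \<open>Translation does not change the integral, so its derivative in the imaginary direction
  of \<open>\<eta>\<close> is 0; for a holomorphic function the full derivative is then 0. That
  derivative is minus the left-hand side, so the Airy equation and the independence of the height
  are one and the same fact.\<close>

lemma airy_int_deriv_eta_zero:
  assumes "Re \<eta> > 0"
  shows "airy_int 2 z \<eta> + z * airy_int 0 z \<eta> = 0"
proof -
  define D where "D = - (airy_int 2 z \<eta> + z * airy_int 0 z \<eta>)"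
  have "((\<lambda>b. airy_int 0 z (\<eta> + \<i> * b)) has_field_derivative D * \<i>) (at 0)"
    using airy_int_deriv_eta[OF assms, of z] unfolding D_def
    by (intro DERIV_chain'[where g = "\<lambda>\<eta>. airy_int 0 z \<eta>"]) (auto intro!: derivative_eq_intros)
  then have "((\<lambda>b. airy_int 0 z (\<eta> + \<i> * of_real b)) has_vector_derivative D * \<i>) (at 0)"
    using has_vector_derivative_real_field[of "\<lambda>b. airy_int 0 z (\<eta> + \<i> * b)" "D * \<i>" 0 UNIV] by simp
  moreover have "((\<lambda>b::real. airy_int 0 z (\<eta> + \<i> * of_real b)) has_vector_derivative 0) (at 0)"
    by (simp add: airy_int_shift)
  ultimately have "D * \<i> = 0" using vector_derivative_unique_at by fastforce
  then have "- (airy_int 2 z \<eta> + z * airy_int 0 z \<eta>) = 0" by (simp only: D_def) simp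
  then show ?thesis by (simp only: neg_equal_0_iff_equal)
qed

lemma airy_int_const:
  assumes "Re \<eta> > 0" "Re \<eta>' > 0"
  shows "airy_int 0 z \<eta> = airy_int 0 z \<eta>'"
proof (rule DERIV_zero_connected_constant[of "{\<eta>. Re \<eta> > 0}" "{}"])
  show "continuous_on {\<eta>. 0 < Re \<eta>} (airy_int 0 z)"
    using airy_int_deriv_eta by (auto intro!: DERIV_continuous continuous_at_imp_continuous_on)
  show "\<forall>x\<in>{\<eta>. 0 < Re \<eta>} - {}. (airy_int 0 z has_field_derivative 0) (at x)"
    using airy_int_deriv_eta airy_int_deriv_eta_zero by fastforce
qed (use assms in \<open>auto simp: open_halfspace_Re_gt intro!: convex_connected convex_halfspace_Re_gt\<close>)

lemma Airy_eq:
  assumes "Re \<eta> > 0"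
  shows "Airy z = airy_int 0 z \<eta> / (2 * pi)"
  using airy_int_const[of 1 \<eta> z] assms by (simp add: Airy_def airy_int_def)

lemma Airy_has_deriv:
  assumes "Re \<eta> > 0"
  shows "(Airy has_field_derivative \<i> * airy_int 1 z \<eta> / (2 * pi)) (at z)"
  unfolding Airy_eq[OF assms, abs_def] using airy_int_deriv_z[OF assms, of 0 z]
  by (intro derivative_eq_intros) auto

definition Airy' :: "complex \<Rightarrow> complex" where "Airy' = deriv Airy"

lemma Airy'_eq:
  assumes "Re \<eta> > 0"
  shows "Airy' z = \<i> * airy_int 1 z \<eta> / (2 * pi)"
  unfolding Airy'_def by (rule DERIV_imp_deriv[OF Airy_has_deriv[OF assms]])

lemma Airy_deriv: "(Airy has_field_derivative Airy' z) (at z)"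
  using Airy_has_deriv[of 1 z] Airy'_eq[of 1 z] by simp

lemma Airy'_deriv: "(Airy' has_field_derivative z * Airy z) (at z)"
proof -
  have "(Airy' has_field_derivative \<i> * (\<i> * airy_int 2 z 1) / (2 * pi)) (at z)"
    unfolding Airy'_eq[of 1, simplified, abs_def] using airy_int_deriv_z[of 1 1 z]
    by (intro derivative_eq_intros) (auto simp: numeral_2_eq_2)
  moreover have "airy_int 2 z 1 = - (z * airy_int 0 z 1)"
    using airy_int_deriv_eta_zero[of 1 z] by (simp add: eq_neg_iff_add_eq_0)
  ultimately show ?thesis using Airy_eq[of 1 z] by simp
qed

section \<open>Rotated Airy functions and bounds in strips\<close>

lemma airy_ode_unique:
  fixes f g :: "complex \<Rightarrow> complex"
  assumes f: "\<And>z. (f has_field_derivative g z) (at z)"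
    and g: "\<And>z. (g has_field_derivative z * f z) (at z)"
    and "f 0 = 0" "g 0 = 0"
  shows "f z = 0"
proof -
  have hol: "f holomorphic_on UNIV" using f by (auto simp: holomorphic_on_open)
  have hn: "(deriv ^^ n) f holomorphic_on UNIV" for n
    by (rule holomorphic_higher_deriv[OF hol]) auto
  have dn: "((deriv ^^ n) f has_field_derivative (deriv ^^ Suc n) f z) (at z)" for n z
    using holomorphic_derivI[OF hn[of n], of z] by simp
  \<comment> \<open>The truncated index \<open>n - 1\<close> is harmless at \<open>n = 0\<close>,
    where its coefficient is 0. At the origin the recursion ties each derivative to the one three
    orders below.\<close>
  have rec: "(deriv ^^ (n + 2)) f = (\<lambda>z. z * (deriv ^^ n) f z + of_nat n * (deriv ^^ (n - 1)) f z)" for n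
  proof (induction n)
    case 0
    have "deriv f = g" "deriv g = (\<lambda>z. z * f z)" using f g by (auto intro!: DERIV_imp_deriv)
    then show ?case by (simp add: numeral_2_eq_2)
  next
    case (Suc n)
    have "deriv (\<lambda>z. z * (deriv ^^ n) f z + of_nat n * (deriv ^^ (n - 1)) f z) z
       = z * (deriv ^^ Suc n) f z + of_nat (Suc n) * (deriv ^^ n) f z" for z
    proof (rule DERIV_imp_deriv)
      have "((\<lambda>z. of_nat n * (deriv ^^ (n - 1)) f z) has_field_derivative of_nat n * (deriv ^^ n) f z) (at z)"
        using dn[of "n - 1" z] by (cases n) (auto intro!: DERIV_cmult simp del: funpow.simps)
      moreover have "((\<lambda>z. z * (deriv ^^ n) f z) has_field_derivative 1 * (deriv ^^ n) f z + (deriv ^^ Suc n) f z * z) (at z)"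
        by (intro DERIV_mult DERIV_ident dn)
      ultimately have "((\<lambda>z. z * (deriv ^^ n) f z + of_nat n * (deriv ^^ (n - 1)) f z) has_field_derivative
         (1 * (deriv ^^ n) f z + (deriv ^^ Suc n) f z * z) + of_nat n * (deriv ^^ n) f z) (at z)"
        by (rule DERIV_add[rotated])
      then show "((\<lambda>z. z * (deriv ^^ n) f z + of_nat n * (deriv ^^ (n - 1)) f z) has_field_derivative
         z * (deriv ^^ Suc n) f z + of_nat (Suc n) * (deriv ^^ n) f z) (at z)"
        by (simp add: algebra_simps)
    qed
    moreover have "(deriv ^^ (Suc n + 2)) f = deriv ((deriv ^^ (n + 2)) f)" by simp
    ultimately show ?case unfolding Suc.IH by auto
  qed
  have "(deriv ^^ n) f 0 = 0" for n
  proof (induction n rule: less_induct)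
    case (less n)
    consider "n = 0" | "n = 1" | m where "n = m + 2" by (metis One_nat_def add_2_eq_Suc' not0_implies_Suc)
    then show ?case
    proof cases
      case 2
      have "deriv f 0 = g 0" using f by (auto intro!: DERIV_imp_deriv)
      then show ?thesis using 2 assms by simp
    next
      case 3
      have "of_nat m * (deriv ^^ (m - 1)) f 0 = 0" using less.IH[of "m - 1"] 3 by (cases m) auto
      then show ?thesis using 3 by (simp only: rec) simp
    qed (use assms in simp)
  qed
  then show ?thesis
    by (intro holomorphic_fun_eq_0_on_connected[OF hol, of 0]) (auto simp: connected_UNIV)
qed

definition omega3 :: complex where "omega3 = cis (2 * pi / 3)"

lemma omega3_eq: "omega3 = Complex (-1/2) (sqrt 3 / 2)"
  by (simp add: omega3_def complex_eq_iff cos_120 sin_120)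

lemma omega3_cube [simp]: "omega3 ^ 3 = 1"
  unfolding omega3_def Complex.DeMoivre by simp

lemma omega3_sum: "1 + omega3 + omega3\<^sup>2 = 0"
  by (simp add: omega3_eq complex_eq_iff power2_eq_square)

text \<open>Since \<open>omega3 ^ 3 = 1\<close>, rotating the argument by \<open>omega3\<close>
  preserves the Airy equation, so the sum is again a solution. Both of its initial data at 0 contain
  the factor \<open>1 + omega3 + omega3\<^sup>2\<close>, which is 0.\<close>

lemma Airy_connection: "Airy z + omega3 * Airy (omega3 * z) + omega3\<^sup>2 * Airy (omega3\<^sup>2 * z) = 0"
proof (rule airy_ode_unique[where f = "\<lambda>z. Airy z + omega3 * Airy (omega3 * z) + omega3\<^sup>2 * Airy (omega3\<^sup>2 * z)"
    and g = "\<lambda>z. Airy' z + omega3 * (omega3 * Airy' (omega3 * z)) + omega3\<^sup>2 * (omega3\<^sup>2 * Airy' (omega3\<^sup>2 * z))"])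
  have c: "omega3 * omega3 * omega3 = 1" using omega3_cube by (simp add: power3_eq_cube)
  have A: "((\<lambda>z. Airy (a * z)) has_field_derivative a * Airy' (a * z)) (at z)" for a z
    using DERIV_chain'[where g = Airy, OF DERIV_cmult_Id[of a] Airy_deriv, of z] by (simp add: ac_simps)
  have A': "((\<lambda>z. Airy' (a * z)) has_field_derivative a * (a * z * Airy (a * z))) (at z)" for a z
    using DERIV_chain'[where g = Airy', OF DERIV_cmult_Id[of a] Airy'_deriv, of z] by (simp add: ac_simps)
  fix z
  show "((\<lambda>z. Airy z + omega3 * Airy (omega3 * z) + omega3\<^sup>2 * Airy (omega3\<^sup>2 * z)) has_field_derivative
    Airy' z + omega3 * (omega3 * Airy' (omega3 * z)) + omega3\<^sup>2 * (omega3\<^sup>2 * Airy' (omega3\<^sup>2 * z))) (at z)"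
    by (intro DERIV_add DERIV_cmult A Airy_deriv)
  have "((\<lambda>z. Airy' z + omega3 * (omega3 * Airy' (omega3 * z)) + omega3\<^sup>2 * (omega3\<^sup>2 * Airy' (omega3\<^sup>2 * z))) has_field_derivative
    z * Airy z + omega3 * (omega3 * (omega3 * (omega3 * z * Airy (omega3 * z)))) + omega3\<^sup>2 * (omega3\<^sup>2 * (omega3\<^sup>2 * (omega3\<^sup>2 * z * Airy (omega3\<^sup>2 * z))))) (at z)"
    by (intro DERIV_add DERIV_cmult A' Airy'_deriv)
  also have "z * Airy z + omega3 * (omega3 * (omega3 * (omega3 * z * Airy (omega3 * z)))) + omega3\<^sup>2 * (omega3\<^sup>2 * (omega3\<^sup>2 * (omega3\<^sup>2 * z * Airy (omega3\<^sup>2 * z))))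
     = z * (Airy z + omega3 * Airy (omega3 * z) + omega3\<^sup>2 * Airy (omega3\<^sup>2 * z))"
    using c by algebra
  finally show "((\<lambda>z. Airy' z + omega3 * (omega3 * Airy' (omega3 * z)) + omega3\<^sup>2 * (omega3\<^sup>2 * Airy' (omega3\<^sup>2 * z))) has_field_derivative
     z * (Airy z + omega3 * Airy (omega3 * z) + omega3\<^sup>2 * Airy (omega3\<^sup>2 * z))) (at z)" .
next
  have "Airy 0 + omega3 * Airy (omega3 * 0) + omega3\<^sup>2 * Airy (omega3\<^sup>2 * 0) = Airy 0 * (1 + omega3 + omega3\<^sup>2)"
    by (simp add: algebra_simps)
  then show "Airy 0 + omega3 * Airy (omega3 * 0) + omega3\<^sup>2 * Airy (omega3\<^sup>2 * 0) = 0"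
    by (simp add: omega3_sum)
  have "Airy' 0 + omega3 * (omega3 * Airy' (omega3 * 0)) + omega3\<^sup>2 * (omega3\<^sup>2 * Airy' (omega3\<^sup>2 * 0)) = Airy' 0 * (1 + omega3 + omega3\<^sup>2)"
    unfolding mult_zero_right using omega3_cube by algebra
  then show "Airy' 0 + omega3 * (omega3 * Airy' (omega3 * 0)) + omega3\<^sup>2 * (omega3\<^sup>2 * Airy' (omega3\<^sup>2 * 0)) = 0"
    by (simp add: omega3_sum)
qed

text \<open>The height of the contour is free, and a real shift of \<open>z\<close> multiplies the
  modulus of the integrand by exactly \<open>exp (- \<eta> * Re z)\<close>. As every
  \<open>\<eta> > 0\<close> is allowed, large rates give decay to the right and small ones limit the
  growth to the left.\<close>

lemma Airy_bound:
  assumes "\<eta> > 0"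
  shows "\<exists>C>0. \<forall>z. \<bar>Im z\<bar> \<le> Y \<longrightarrow> norm (Airy z) \<le> C * exp (- \<eta> * Re z) \<and> norm (Airy' z) \<le> C * exp (- \<eta> * Re z)"
proof -
  have *: "\<exists>C\<ge>0. \<forall>z. \<bar>Im z\<bar> \<le> Y \<longrightarrow> norm (airy_int n z \<eta>) \<le> C * exp (- \<eta> * Re z)" for n
  proof -
    obtain C where C0: "\<forall>\<eta>' z k. \<eta> \<le> Re \<eta>' \<longrightarrow> norm \<eta>' \<le> \<eta> \<longrightarrow> norm z \<le> Y \<longrightarrow>
        norm ((of_real k + \<i> * \<eta>') ^ n * airy_phase z (of_real k + \<i> * \<eta>')) \<le> C * exp (- (\<eta> / 8) * k\<^sup>2)"
      using airy_phase_dominated[of \<eta> \<eta> Y n] assms by blast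
    have C: "norm ((of_real k + \<i> * \<eta>) ^ n * airy_phase z (of_real k + \<i> * \<eta>)) \<le> C * exp (- (\<eta> / 8) * k\<^sup>2)"
      if "norm z \<le> Y" for z k
      using C0[rule_format, of "of_real \<eta>" z k] assms that by simp
    have gi: "integrable lborel (\<lambda>k. C * exp (- (\<eta> / 8) * k\<^sup>2))"
      using assms by (intro integrable_mult_right integrable_gaussian) auto
    define D where "D = (\<integral>k. C * exp (- (\<eta> / 8) * k\<^sup>2) \<partial>lborel)"
    have "norm (airy_int n z \<eta>) \<le> \<bar>D\<bar> * exp (- \<eta> * Re z)" if "\<bar>Im z\<bar> \<le> Y" for z
    proof -
      have "norm (airy_int n z \<eta>) \<le> (\<integral>k. C * exp (- (\<eta> / 8) * k\<^sup>2) * exp (- \<eta> * Re z) \<partial>lborel)"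
        unfolding airy_int_def
      proof (rule Bochner_Integration.integral_norm_bound_integral)
        fix k :: real
        have "norm (airy_phase z (of_real k + \<i> * \<eta>)) = norm (airy_phase (\<i> * Im z) (of_real k + \<i> * \<eta>)) * exp (- \<eta> * Re z)"
          unfolding norm_airy_phase exp_add[symmetric] by (simp add: algebra_simps)
        then show "norm ((of_real k + \<i> * \<eta>) ^ n * airy_phase z (of_real k + \<i> * \<eta>)) \<le> C * exp (- (\<eta> / 8) * k\<^sup>2) * exp (- \<eta> * Re z)"
          using C[of "\<i> * Im z" k] that by (simp add: norm_mult norm_power)
      qed (use integrable_airy_int[of "of_real \<eta>" n z] assms gi in auto)
      also have "\<dots> = D * exp (- \<eta> * Re z)" by (simp add: D_def)
      also have "\<dots> \<le> \<bar>D\<bar> * exp (- \<eta> * Re z)" by (intro mult_right_mono) auto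
      finally show ?thesis .
    qed
    then show ?thesis by (intro exI[of _ "\<bar>D\<bar>"]) auto
  qed
  obtain C0 C1 where C: "C0 \<ge> 0" "C1 \<ge> 0" "\<And>z. \<bar>Im z\<bar> \<le> Y \<Longrightarrow> norm (airy_int 0 z \<eta>) \<le> C0 * exp (- \<eta> * Re z)"
      "\<And>z. \<bar>Im z\<bar> \<le> Y \<Longrightarrow> norm (airy_int 1 z \<eta>) \<le> C1 * exp (- \<eta> * Re z)"
    using *[of 0] *[of 1] by metis
  have e: "Re (complex_of_real \<eta>) > 0" using assms by simp
  have p: "x / (2 * pi) \<le> x" if "x \<ge> 0" for x
    using that pi_ge_two by (simp add: divide_le_eq mult_le_cancel_left1)
  show ?thesis
  proof (intro exI[of _ "C0 + C1 + 1"] conjI allI impI)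
    fix z assume z: "\<bar>Im z\<bar> \<le> Y"
    have "norm (Airy z) \<le> norm (airy_int 0 z \<eta>)" using p[of "norm (airy_int 0 z \<eta>)"] 
      by (simp add: Airy_eq[OF e] norm_divide norm_mult)
    also have "\<dots> \<le> (C0 + C1 + 1) * exp (- \<eta> * Re z)" 
      using C(3)[OF z] by (rule order_trans) (use C in \<open>auto intro!: mult_right_mono\<close>)
    finally show "norm (Airy z) \<le> (C0 + C1 + 1) * exp (- \<eta> * Re z)" .
    have "norm (Airy' z) \<le> norm (airy_int 1 z \<eta>)" using p[of "norm (airy_int 1 z \<eta>)"] 
      by (simp add: Airy'_eq[OF e] norm_divide norm_mult)
    also have "\<dots> \<le> (C0 + C1 + 1) * exp (- \<eta> * Re z)" 
      using C(4)[OF z] by (rule order_trans) (use C in \<open>auto intro!: mult_right_mono\<close>)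
    finally show "norm (Airy' z) \<le> (C0 + C1 + 1) * exp (- \<eta> * Re z)" .
  qed (use C in auto)
qed

section \<open>Gaussian integrals and saddle point asymptotics\<close>

lemma lborel_integral_odd:
  fixes f :: "real \<Rightarrow> complex"
  assumes "\<And>x. f (- x) = - f x"
  shows "(\<integral>x. f x \<partial>lborel) = 0"
proof -
  have "(\<integral>x. f x \<partial>lborel) = (\<integral>x. f (0 + (-1) * x) \<partial>lborel)"
    by (subst lborel_integral_real_affine[of "-1" f 0]) auto
  also have "\<dots> = - (\<integral>x. f x \<partial>lborel)" by (simp add: assms)
  finally show ?thesis by simp
qed

text \<open>Conjugation turns \<open>\<zeta>\<close> into \<open>- cnj \<zeta>\<close>, a reflection
  that maps the integration line of height 1 to itself.\<close>

lemma Airy_conj_real: "Airy (of_real x) \<in> \<real>"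
proof -
  have c: "cnj (airy_phase (of_real x) \<zeta>) = airy_phase (of_real x) (- cnj \<zeta>)" for \<zeta>
    by (simp add: airy_phase_def exp_cnj algebra_simps)
  have "cnj (\<integral>k. airy_phase (of_real x) (of_real k + \<i>) \<partial>lborel) = (\<integral>k. airy_phase (of_real x) (of_real (0 + (-1) * k) + \<i>) \<partial>lborel)"
    by (subst Bochner_Integration.integral_cnj[symmetric]) (simp add: c)
  also have "\<dots> = (\<integral>k. airy_phase (of_real x) (of_real k + \<i>) \<partial>lborel)"
    by (subst lborel_integral_real_affine[of "-1" _ 0]) auto
  finally show ?thesis by (simp add: Airy_def Reals_cnj_iff)
qed

lemma integral_gaussian_real:
  fixes a :: real
  assumes "a > 0"
  shows "(\<integral>k. exp (- a * k\<^sup>2) \<partial>lborel) = sqrt (pi / a)"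
proof -
  define \<sigma> where "\<sigma> = 1 / sqrt (2 * a)"
  have \<sigma>: "\<sigma> > 0" "\<sigma>\<^sup>2 = 1 / (2 * a)" using assms by (auto simp: \<sigma>_def power_divide)
  have "normal_density 0 \<sigma> k = sqrt (a / pi) * exp (- a * k\<^sup>2)" for k
    using assms by (simp add: normal_density_def \<sigma> real_sqrt_divide)
  then have "1 = (\<integral>k. sqrt (a / pi) * exp (- a * k\<^sup>2) \<partial>lborel)"
    using integral_normal_density[OF \<sigma>(1), of 0] by simp
  then have "1 = sqrt (a / pi) * (\<integral>k. exp (- a * k\<^sup>2) \<partial>lborel)" by simp
  then show ?thesis using assms by (simp add: real_sqrt_divide field_simps)
qed

text \<open>Both sides are holomorphic in the right half-plane and agree for real arguments between
  1 and 2, so the identity theorem applies. The principal root is the right branch, being positive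
  on the positive axis.\<close>

lemma integral_gaussian_complex:
  assumes "Re \<eta> > 0"
  shows "(\<integral>k. exp (- \<eta> * of_real k ^ 2) \<partial>lborel) = sqrt pi / csqrt \<eta>"
proof -
  define G where "G = (\<lambda>\<eta>::complex. (\<integral>k. exp (- \<eta> * of_real k ^ 2) \<partial>lborel))"
  let ?U = "{\<eta>::complex. Re \<eta> > 0}"
  have U: "open ?U" "connected ?U"
    by (auto simp: open_halfspace_Re_gt intro!: convex_connected convex_halfspace_Re_gt)
  have G: "G holomorphic_on ?U"
    unfolding holomorphic_on_open[OF U(1)]
  proof
    fix \<eta> assume e: "\<eta> \<in> ?U"
    have "(G has_field_derivative (\<integral>k. deriv (\<lambda>\<eta>. exp (- \<eta> * of_real k ^ 2)) \<eta> \<partial>lborel)) (at \<eta>)"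
      unfolding G_def
    proof (rule has_field_derivative_parameter_integral[OF U(1) e])
      fix z assume z: "z \<in> ?U"
      show "\<exists>r>0. \<exists>g. integrable lborel g \<and> (\<forall>w\<in>ball z r \<inter> ?U. \<forall>k\<in>space lborel. norm (exp (- w * (of_real k)\<^sup>2)) \<le> g k)"
      proof (intro exI conjI ballI)
        show "integrable lborel (\<lambda>k. exp (- (Re z / 2) * k\<^sup>2))" using z by (intro integrable_gaussian) auto
        fix w k assume "w \<in> ball z (Re z / 2) \<inter> ?U"
        then have "Re z / 2 \<le> Re w" using abs_Re_le_cmod[of "z - w"] by (auto simp: dist_norm)
        from mult_right_mono[OF this, of "k\<^sup>2"]
        show "norm (exp (- w * (of_real k)\<^sup>2)) \<le> exp (- (Re z / 2) * k\<^sup>2)"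
          by (auto simp: of_real_power[symmetric] simp del: of_real_power)
      qed (use z in auto)
    qed (auto intro!: holomorphic_intros)
    then show "\<exists>f'. (G has_field_derivative f') (at \<eta>)" by blast
  qed
  have "G \<eta> - sqrt pi / csqrt \<eta> = 0"
  proof (rule analytic_continuation[of "\<lambda>\<eta>. G \<eta> - sqrt pi / csqrt \<eta>", OF _ U])
    show "(\<lambda>\<eta>. G \<eta> - complex_of_real (sqrt pi) / csqrt \<eta>) holomorphic_on ?U"
      using G by (auto intro!: holomorphic_intros simp: complex_nonpos_Reals_iff)
    show "of_real ` {1<..<2::real} \<subseteq> ?U" by auto
    have "(1::real) islimpt {1<..<2}" by (rule islimpt_greaterThanLessThan1) simp
    then show "complex_of_real 1 islimpt of_real ` {1<..<2::real}"
      unfolding islimpt_approachable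
      by (metis dist_of_real imageI of_real_eq_iff)
    fix z :: complex assume "z \<in> of_real ` {1<..<2::real}"
    then obtain a where a: "z = of_real a" "a > 1" by auto
    have "G z = of_real (\<integral>k. exp (- a * k\<^sup>2) \<partial>lborel)"
      unfolding a G_def by (subst integral_complex_of_real[symmetric]) (simp add: exp_of_real[symmetric])
    then show "G z - sqrt pi / csqrt z = 0"
      using a by (subst (asm) integral_gaussian_real) (auto simp: real_sqrt_divide csqrt_of_real)
  qed (use assms in auto)
  then show ?thesis by (simp add: G_def)
qed

lemma cis_minus_taylor_bound: "norm (exp (\<i> * of_real x) - 1) \<le> \<bar>x\<bar>" "norm (exp (\<i> * of_real x) - 1 - \<i> * of_real x) \<le> x\<^sup>2 / 2"
  using iexp_approx1[of x 0] iexp_approx1[of x 1]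
  by (auto simp: numeral_2_eq_2 algebra_simps)

lemma gaussian_moment_bound:
  "\<exists>C\<ge>0. \<forall>a>0. integrable lborel (\<lambda>k. \<bar>k\<bar> ^ n * exp (- a * k\<^sup>2)) \<and>
     (\<integral>k. \<bar>k\<bar> ^ n * exp (- a * k\<^sup>2) \<partial>lborel) \<le> C / sqrt a ^ Suc n"
proof -
  have "integrable lborel (\<lambda>k. \<bar>std_normal_density (0 + sqrt 2 * k) * (0 + sqrt 2 * k) ^ n\<bar>)"
    by (intro integrable_abs, subst lborel_integrable_real_affine_iff) (simp_all add: integrable_std_normal_moment)
  then have "integrable lborel (\<lambda>k. sqrt (2 * pi) / sqrt 2 ^ n * \<bar>std_normal_density (0 + sqrt 2 * k) * (0 + sqrt 2 * k) ^ n\<bar>)"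
    by (rule integrable_mult_right)
  also have "(\<lambda>k. sqrt (2 * pi) / sqrt 2 ^ n * \<bar>std_normal_density (0 + sqrt 2 * k) * (0 + sqrt 2 * k) ^ n\<bar>) = (\<lambda>k::real. \<bar>k\<bar> ^ n * exp (- k\<^sup>2))"
    by (auto simp: std_normal_density_def power_mult_distrib abs_mult power_abs fun_eq_iff)
  finally have i1: "integrable lborel (\<lambda>k::real. \<bar>k\<bar> ^ n * exp (- k\<^sup>2))" .
  define D where "D = (\<integral>k. \<bar>k\<bar> ^ n * exp (- (k::real)\<^sup>2) \<partial>lborel)"
  have D: "D \<ge> 0" unfolding D_def by simp
  have "integrable lborel (\<lambda>k. \<bar>k\<bar> ^ n * exp (- a * k\<^sup>2)) \<and>
     (\<integral>k. \<bar>k\<bar> ^ n * exp (- a * k\<^sup>2) \<partial>lborel) \<le> D / sqrt a ^ Suc n" if a: "a > 0" for a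
  proof -
    have e: "(\<lambda>k. \<bar>k\<bar> ^ n * exp (- a * k\<^sup>2)) = (\<lambda>k. 1 / sqrt a ^ n * (\<bar>0 + sqrt a * k\<bar> ^ n * exp (- (0 + sqrt a * k)\<^sup>2)))"
      using a by (auto simp: fun_eq_iff power_mult_distrib abs_mult)
    have "integrable lborel (\<lambda>k. \<bar>0 + sqrt a * k\<bar> ^ n * exp (- (0 + sqrt a * k)\<^sup>2))"
      using a by (subst lborel_integrable_real_affine_iff) (auto simp: i1)
    then have 1: "integrable lborel (\<lambda>k. \<bar>k\<bar> ^ n * exp (- a * k\<^sup>2))" unfolding e by (rule integrable_mult_right)
    have "D = sqrt a * (\<integral>k. \<bar>0 + sqrt a * k\<bar> ^ n * exp (- (0 + sqrt a * k)\<^sup>2) \<partial>lborel)"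
      unfolding D_def using a by (subst lborel_integral_real_affine[of "sqrt a" _ 0]) auto
    then have "(\<integral>k. \<bar>k\<bar> ^ n * exp (- a * k\<^sup>2) \<partial>lborel) = D / sqrt a ^ Suc n"
      unfolding e using a by simp
    with 1 show ?thesis by simp
  qed
  with D show ?thesis by blast
qed

text \<open>For the argument \<open>\<eta>\<^sup>2\<close> the point \<open>\<i> * \<eta>\<close> is
  a saddle of the phase and lies on the line of integration. The term linear in \<open>k\<close>
  therefore drops out, and the cubic remainder is an oscillation of modulus 1.\<close>

lemma airy_phase_saddle:
  "airy_phase (\<eta>\<^sup>2) (of_real k + \<i> * \<eta>) = exp (- (2/3) * \<eta> ^ 3) * (exp (- \<eta> * of_real k ^ 2) * exp (\<i> * of_real (k ^ 3 / 3)))"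
  unfolding airy_phase_def exp_add[symmetric]
  by (rule arg_cong[of _ _ exp]) (simp add: field_simps power2_eq_square power3_eq_cube)

text \<open>The sector is written as \<open>c * norm \<eta> \<le> Re \<eta>\<close>, with \<open>\<eta>\<close> the square root of the argument.\<close>

lemma Airy_asymptotics:
  assumes "c > 0"
  shows "\<exists>C\<ge>0. \<forall>\<eta>. \<eta> \<noteq> 0 \<and> c * norm \<eta> \<le> Re \<eta> \<longrightarrow> (\<exists>r r'. norm r \<le> C / norm \<eta> ^ 3 \<and> norm r' \<le> C / norm \<eta> ^ 3 \<and>
     Airy (\<eta>\<^sup>2) = exp (- (2/3) * \<eta> ^ 3) / (2 * sqrt pi * csqrt \<eta>) * (1 + r) \<and>
     Airy' (\<eta>\<^sup>2) = - exp (- (2/3) * \<eta> ^ 3) * csqrt \<eta> / (2 * sqrt pi) * (1 + r'))"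
proof -
  obtain C6 where C6: "C6 \<ge> 0" "\<And>a. a > 0 \<Longrightarrow> integrable lborel (\<lambda>k::real. \<bar>k\<bar> ^ 6 * exp (- a * k\<^sup>2))"
    "\<And>a. a > 0 \<Longrightarrow> (\<integral>k. \<bar>k\<bar> ^ 6 * exp (- a * k\<^sup>2) \<partial>lborel) \<le> C6 / sqrt a ^ 7"
    using gaussian_moment_bound[of 6] by auto
  obtain C4 where C4: "C4 \<ge> 0" "\<And>a. a > 0 \<Longrightarrow> integrable lborel (\<lambda>k::real. \<bar>k\<bar> ^ 4 * exp (- a * k\<^sup>2))"
    "\<And>a. a > 0 \<Longrightarrow> (\<integral>k. \<bar>k\<bar> ^ 4 * exp (- a * k\<^sup>2) \<partial>lborel) \<le> C4 / sqrt a ^ 5"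
    using gaussian_moment_bound[of 4] by auto
  have m: "integrable lborel (\<lambda>k::real. \<bar>k\<bar> ^ n * exp (- a * k\<^sup>2))" if "a > 0" for a n
    using gaussian_moment_bound[of n] that by auto
  define d where "d = sqrt c"
  have d: "d > 0" using assms by (simp add: d_def)
  define C where "C = C6 / d ^ 7 + C4 / d ^ 5"
  have C0: "C \<ge> 0" using C6(1) C4(1) d by (simp add: C_def)
  have pi1: "sqrt pi \<ge> 1" using pi_ge_two by simp
  show ?thesis
  proof (intro exI[of _ C] conjI allI impI C0)
    fix \<eta> assume e: "\<eta> \<noteq> 0 \<and> c * norm \<eta> \<le> Re \<eta>"
    define a where "a = Re \<eta>"
    define h where "h = sqrt (norm \<eta>)"
    have h: "h > 0" "h ^ 2 = norm \<eta>" using e by (auto simp: h_def)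
    have a: "a > 0" using e assms by (auto simp: a_def intro: less_le_trans[of _ "c * norm \<eta>"])
    have sa: "sqrt a \<ge> d * h" using e by (simp add: a_def d_def h_def real_sqrt_mult[symmetric])
    have dh: "d * h > 0" using d h by simp
    have cs0: "csqrt \<eta> \<noteq> 0" "csqrt \<eta> * csqrt \<eta> = \<eta>" using e power2_csqrt[of \<eta>] by (auto simp: power2_eq_square)
    define G where "G = (\<lambda>k::real. exp (- \<eta> * of_real k ^ 2))"
    define E where "E = (\<lambda>k::real. exp (\<i> * of_real (k ^ 3 / 3)))"
    have nG: "norm (G k) = exp (- a * k\<^sup>2)" for k
      by (simp add: G_def a_def of_real_power[symmetric] del: of_real_power)
    have nE: "norm (E k) = 1" for k by (simp add: E_def del: of_real_power of_real_divide)
    have [measurable]: "G \<in> borel_measurable borel" "E \<in> borel_measurable borel" by (auto simp: G_def E_def)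
    have iG: "integrable lborel (\<lambda>k. of_real k ^ n * G k)" for n
      by (rule integrable_dominated[OF m[of a n]]) (use a nG in \<open>auto simp: norm_mult norm_power\<close>)
    have iGE: "integrable lborel (\<lambda>k. of_real k ^ n * (G k * E k))" for n
      by (rule integrable_dominated[OF m[of a n]]) (use a nG nE in \<open>auto simp: norm_mult norm_power\<close>)
    define I0 where "I0 = (\<integral>k. G k * E k \<partial>lborel)"
    define I1 where "I1 = (\<integral>k. of_real k * (G k * E k) \<partial>lborel)"
    have G0: "(\<integral>k. G k \<partial>lborel) = sqrt pi / csqrt \<eta>"
      using integral_gaussian_complex[of \<eta>] a by (simp add: G_def a_def)
    have G3: "(\<integral>k. of_real k ^ 3 * G k \<partial>lborel) = 0" by (rule lborel_integral_odd) (simp add: G_def)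
    have G1: "(\<integral>k. of_real k * G k \<partial>lborel) = 0" by (rule lborel_integral_odd) (simp add: G_def)
    \<comment> \<open>The expansion of \<open>E\<close> keeps its cubic term, whose integral against
      the even Gaussian is 0. The rest is quadratic in \<open>k ^ 3\<close>, so the sixth moment
      bounds it; multiplied by \<open>csqrt \<eta>\<close> it gives the relative error
      \<open>1 / h ^ 6\<close>, that is \<open>1 / norm \<eta> ^ 3\<close>.\<close>
    have I0: "norm (I0 - sqrt pi / csqrt \<eta>) \<le> C6 / (d * h) ^ 7"
    proof -
      have "I0 - sqrt pi / csqrt \<eta> = (\<integral>k. G k * E k - G k - \<i> / 3 * (of_real k ^ 3 * G k) \<partial>lborel)"
        using iGE[of 0] iG[of 0] iG[of 3] by (simp add: I0_def G0[symmetric] G3)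
      also have "norm \<dots> \<le> (\<integral>k. \<bar>k\<bar> ^ 6 * exp (- a * k\<^sup>2) \<partial>lborel)"
      proof (rule Bochner_Integration.integral_norm_bound_integral)
        show "integrable lborel (\<lambda>k. G k * E k - G k - \<i> / 3 * (of_real k ^ 3 * G k))"
          using iGE[of 0] iG[of 0] iG[of 3] by simp
        fix k :: real
        have "G k * E k - G k - \<i> / 3 * (of_real k ^ 3 * G k) = G k * (E k - 1 - \<i> * of_real (k ^ 3 / 3))"
          by (simp add: algebra_simps)
        also have "norm \<dots> \<le> exp (- a * k\<^sup>2) * ((k ^ 3 / 3)\<^sup>2 / 2)"
          unfolding norm_mult nG E_def by (intro mult_left_mono cis_minus_taylor_bound) auto
        also have "\<dots> \<le> \<bar>k\<bar> ^ 6 * exp (- a * k\<^sup>2)"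
        proof -
          have "(k ^ 3 / 3)\<^sup>2 / 2 = \<bar>k\<bar> ^ 6 / 18" by (simp add: power_divide power_mult[symmetric] power_even_abs)
          also have "\<dots> \<le> \<bar>k\<bar> ^ 6" by simp
          finally show ?thesis by (simp add: mult.commute mult_right_mono)
        qed
        finally show "norm (G k * E k - G k - \<i> / 3 * (of_real k ^ 3 * G k)) \<le> \<bar>k\<bar> ^ 6 * exp (- a * k\<^sup>2)" .
      qed (use C6 a in auto)
      also have "\<dots> \<le> C6 / sqrt a ^ 7" using C6(3) a by blast
      also have "\<dots> \<le> C6 / (d * h) ^ 7" using C6(1) sa dh a d h by (intro divide_left_mono power_mono mult_pos_pos zero_less_power) auto
      finally show ?thesis .
    qed
    \<comment> \<open>Here the term without \<open>E\<close> is already odd, so one order of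
      expansion suffices. The fourth moment gives \<open>1 / h ^ 5\<close>, and division by
      \<open>csqrt \<eta>\<close> leads to the same relative order.\<close>
    have I1: "norm I1 \<le> C4 / (d * h) ^ 5"
    proof -
      have "I1 = (\<integral>k. of_real k * (G k * E k) - of_real k * G k \<partial>lborel)"
        using iGE[of 1] iG[of 1] by (simp add: I1_def G1)
      also have "norm \<dots> \<le> (\<integral>k. \<bar>k\<bar> ^ 4 * exp (- a * k\<^sup>2) \<partial>lborel)"
      proof (rule Bochner_Integration.integral_norm_bound_integral)
        show "integrable lborel (\<lambda>k. of_real k * (G k * E k) - of_real k * G k)"
          using iGE[of 1] iG[of 1] by simp
        fix k :: real
        have "of_real k * (G k * E k) - of_real k * G k = of_real k * G k * (E k - 1)"
          by (simp add: algebra_simps)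
        also have "norm \<dots> \<le> \<bar>k\<bar> * exp (- a * k\<^sup>2) * \<bar>k ^ 3 / 3\<bar>"
          unfolding norm_mult nG E_def norm_of_real by (intro mult_left_mono cis_minus_taylor_bound) auto
        also have "\<dots> = \<bar>k\<bar> ^ 4 * exp (- a * k\<^sup>2) / 3"
          by (simp add: power_abs eval_nat_numeral abs_mult)
        also have "\<dots> \<le> \<bar>k\<bar> ^ 4 * exp (- a * k\<^sup>2)"
          using zero_le_power[of "\<bar>k\<bar>" 4] by simp
        finally show "norm (of_real k * (G k * E k) - of_real k * G k) \<le> \<bar>k\<bar> ^ 4 * exp (- a * k\<^sup>2)" .
      qed (use C4 a in auto)
      also have "\<dots> \<le> C4 / sqrt a ^ 5" using C4(3) a by blast
      also have "\<dots> \<le> C4 / (d * h) ^ 5" using C4(1) sa dh a d h by (intro divide_left_mono power_mono mult_pos_pos zero_less_power) auto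
      finally show ?thesis .
    qed
    define r where "r = (I0 - sqrt pi / csqrt \<eta>) * csqrt \<eta> / sqrt pi"
    define r' where "r' = r - \<i> * I1 / (sqrt pi * csqrt \<eta>)"
    have h6: "norm \<eta> ^ 3 = h ^ 6" by (simp add: h(2)[symmetric] power_mult[symmetric])
    have dp: "x / sqrt pi \<le> x" if "x \<ge> 0" for x
      using that pi1 by (simp add: divide_le_eq mult_le_cancel_left1)
    have nr: "norm r \<le> C6 / d ^ 7 / h ^ 6"
    proof -
      have "norm r = norm (I0 - sqrt pi / csqrt \<eta>) * h / sqrt pi"
        by (simp add: r_def norm_mult norm_divide h_def)
      also have "\<dots> \<le> norm (I0 - sqrt pi / csqrt \<eta>) * h" using h by (intro dp) auto
      also have "\<dots> \<le> C6 / (d * h) ^ 7 * h" using I0 h by (intro mult_right_mono) auto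
      also have "\<dots> = C6 / d ^ 7 / h ^ 6" using h d by (simp add: power_mult_distrib field_simps numeral_eq_Suc)
      finally show ?thesis .
    qed
    have nI: "norm (\<i> * I1 / (sqrt pi * csqrt \<eta>)) \<le> C4 / d ^ 5 / h ^ 6"
    proof -
      have "norm (\<i> * I1 / (sqrt pi * csqrt \<eta>)) = (norm I1 / h) / sqrt pi"
        by (simp add: norm_mult norm_divide h_def)
      also have "\<dots> \<le> norm I1 / h" using h by (intro dp) auto
      also have "\<dots> \<le> C4 / (d * h) ^ 5 / h" using I1 h by (intro divide_right_mono) auto
      also have "\<dots> = C4 / d ^ 5 / h ^ 6" using h d by (simp add: power_mult_distrib field_simps numeral_eq_Suc)
      finally show ?thesis .
    qed
    have C': "C / norm \<eta> ^ 3 = C6 / d ^ 7 / h ^ 6 + C4 / d ^ 5 / h ^ 6" by (simp add: h6 C_def add_divide_distrib)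
    have "C6 / d ^ 7 / h ^ 6 \<ge> 0" "C4 / d ^ 5 / h ^ 6 \<ge> 0" using C6(1) C4(1) d h by auto
    then have b: "norm r \<le> C / norm \<eta> ^ 3" "norm r' \<le> C / norm \<eta> ^ 3"
      using nr nI norm_triangle_ineq4[of r "\<i> * I1 / (sqrt pi * csqrt \<eta>)"] unfolding C' r'_def by linarith+
    have e': "Re \<eta> > 0" using a by (simp add: a_def)
    have ph: "airy_phase (\<eta>\<^sup>2) (of_real k + \<i> * \<eta>) = exp (- (2/3) * \<eta> ^ 3) * (G k * E k)" for k
      unfolding airy_phase_saddle G_def E_def ..
    have A0: "airy_int 0 (\<eta>\<^sup>2) \<eta> = exp (- (2/3) * \<eta> ^ 3) * I0"
      by (simp add: airy_int_def ph I0_def)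
    have A1: "airy_int 1 (\<eta>\<^sup>2) \<eta> = exp (- (2/3) * \<eta> ^ 3) * (I1 + \<i> * \<eta> * I0)"
    proof -
      have "airy_int 1 (\<eta>\<^sup>2) \<eta> = (\<integral>k. exp (- (2/3) * \<eta> ^ 3) * (of_real k * (G k * E k) + \<i> * \<eta> * (G k * E k)) \<partial>lborel)"
        unfolding airy_int_def ph by (simp add: algebra_simps)
      also have "\<dots> = exp (- (2/3) * \<eta> ^ 3) * (I1 + \<i> * \<eta> * I0)"
        using iGE[of 0] iGE[of 1] by (simp add: I0_def I1_def)
      finally show ?thesis .
    qed
    have sp: "complex_of_real (sqrt pi) * complex_of_real (sqrt pi) = of_real pi"
      by (simp flip: of_real_mult)
    have sp0: "complex_of_real (sqrt pi) \<noteq> 0" by simp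
    have I0r: "I0 = sqrt pi / csqrt \<eta> * (1 + r)" using cs0 sp0 by (simp add: r_def field_simps)
    have I1r: "\<i> * I1 = sqrt pi * csqrt \<eta> * (r - r')" using cs0 sp0 by (simp add: r'_def)
    have F1: "Airy (\<eta>\<^sup>2) = exp (- (2/3) * \<eta> ^ 3) / (2 * sqrt pi * csqrt \<eta>) * (1 + r)"
      unfolding Airy_eq[OF e'] A0 I0r using cs0 sp0 by (simp add: sp[symmetric])
    have "\<i> * (I1 + \<i> * \<eta> * I0) = \<i> * I1 - \<eta> * I0" by (simp add: algebra_simps)
    also have "\<dots> = - sqrt pi * csqrt \<eta> * (1 + r')"
      unfolding I1r I0r using cs0 by (simp add: field_simps) (metis (no_types) cs0(2) mult.assoc mult.commute)
    finally have I: "\<i> * (I1 + \<i> * \<eta> * I0) = - sqrt pi * csqrt \<eta> * (1 + r')" .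
    have "Airy' (\<eta>\<^sup>2) = exp (- (2/3) * \<eta> ^ 3) * (\<i> * (I1 + \<i> * \<eta> * I0)) / (2 * pi)"
      unfolding Airy'_eq[OF e'] A1 by (simp add: ac_simps)
    then have F2: "Airy' (\<eta>\<^sup>2) = - exp (- (2/3) * \<eta> ^ 3) * csqrt \<eta> / (2 * sqrt pi) * (1 + r')"
      unfolding I using sp0 by (simp add: sp[symmetric])
    show "\<exists>r r'. norm r \<le> C / norm \<eta> ^ 3 \<and> norm r' \<le> C / norm \<eta> ^ 3 \<and>
     Airy (\<eta>\<^sup>2) = exp (- (2/3) * \<eta> ^ 3) / (2 * sqrt pi * csqrt \<eta>) * (1 + r) \<and>
     Airy' (\<eta>\<^sup>2) = - exp (- (2/3) * \<eta> ^ 3) * csqrt \<eta> / (2 * sqrt pi) * (1 + r')"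
      using b F1 F2 by blast
  qed
qed

section \<open>Positive contractions with a Hilbert-Schmidt kernel\<close>

lemma norm_integral_le_integral:
  fixes f :: "'a \<Rightarrow> 'b::{banach, second_countable_topology}"
  assumes "integrable M f" "integrable M g" "\<And>x. x \<in> space M \<Longrightarrow> norm (f x) \<le> g x"
  shows "norm (\<integral>x. f x \<partial>M) \<le> (\<integral>x. g x \<partial>M)"
  using integral_norm_bound[of M f] integral_mono[OF integrable_norm[OF assms(1)] assms(2,3)] by linarith

text \<open>A product envelope \<open>m x * m y\<close> in place of mere square integrability of the
  kernel: images under \<open>T\<close> are bounded at each point, and all uses of Fubini and
  dominated convergence draw on the same majorant.\<close>

locale hilbert_schmidt_kernel = sigma_finite_measure M for M :: "'a measure" +
  fixes K :: "'a \<Rightarrow> 'a \<Rightarrow> real" and m :: "'a \<Rightarrow> real"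
  assumes space_M [simp]: "space M = UNIV"
    and K_measurable [measurable]: "(\<lambda>(x, y). K x y) \<in> borel_measurable (M \<Otimes>\<^sub>M M)"
    and m_measurable [measurable]: "m \<in> borel_measurable M"
    and m_nonneg: "m x \<ge> 0"
    and m_square_integrable: "integrable M (\<lambda>x. (m x)\<^sup>2)"
    and K_bound: "\<bar>K x y\<bar> \<le> m x * m y"
    and K_sym: "K x y = K y x"
begin

text \<open>These are functions, not classes modulo null sets, and the envelope stands in for a
  norm. The resolvent equation will thus hold at every point, which matters once its solution is
  identified with the restriction of an entire function.\<close>

definition adm :: "('a \<Rightarrow> real) \<Rightarrow> bool" where
  "adm f \<longleftrightarrow> f \<in> borel_measurable M \<and> (\<exists>c. \<forall>x. \<bar>f x\<bar> \<le> c * m x)"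

definition T :: "('a \<Rightarrow> real) \<Rightarrow> 'a \<Rightarrow> real" where
  "T f x = (\<integral>y. K x y * f y \<partial>M)"

definition ip :: "('a \<Rightarrow> real) \<Rightarrow> ('a \<Rightarrow> real) \<Rightarrow> real" where
  "ip f g = (\<integral>x. f x * g x \<partial>M)"

definition S :: real where "S = ip m m"

sublocale MM: pair_sigma_finite M M ..

lemma admI: "f \<in> borel_measurable M \<Longrightarrow> (\<And>x. \<bar>f x\<bar> \<le> c * m x) \<Longrightarrow> adm f"
  by (auto simp: adm_def)

lemma admD [measurable_dest]: "adm f \<Longrightarrow> f \<in> borel_measurable M" by (simp add: adm_def)

lemma admE:
  assumes "adm f" obtains c where "c \<ge> 0" "\<And>x. \<bar>f x\<bar> \<le> c * m x"
proof -
  obtain c where c: "\<And>x. \<bar>f x\<bar> \<le> c * m x" using assms by (auto simp: adm_def)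
  have "\<bar>f x\<bar> \<le> \<bar>c\<bar> * m x" for x
    using c[of x] mult_right_mono[of c "\<bar>c\<bar>" "m x"] m_nonneg[of x] by linarith
  then show ?thesis using that[of "\<bar>c\<bar>"] by simp
qed

lemma adm_m: "adm m" by (rule admI[of _ 1]) (auto simp: m_nonneg)

lemma adm_K: "adm (K x)"
  by (rule admI[of _ "m x"]) (auto simp: K_bound)

lemma adm_add: assumes "adm f" "adm g" shows "adm (\<lambda>x. f x + g x)"
proof -
  obtain c d where "\<And>x. \<bar>f x\<bar> \<le> c * m x" "\<And>x. \<bar>g x\<bar> \<le> d * m x" using assms by (meson admE)
  then have "\<bar>f x + g x\<bar> \<le> (c + d) * m x" for x
    by (smt (verit) distrib_right)
  then show ?thesis using assms by (intro admI[of _ "c + d"]) (auto dest: admD)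
qed

lemma adm_cmult: assumes "adm f" shows "adm (\<lambda>x. a * f x)"
proof -
  obtain c where "\<And>x. \<bar>f x\<bar> \<le> c * m x" using assms by (meson admE)
  then have "\<bar>a * f x\<bar> \<le> (\<bar>a\<bar> * c) * m x" for x
    by (simp add: abs_mult mult.assoc mult_left_mono)
  then show ?thesis using assms by (intro admI[of _ "\<bar>a\<bar> * c"]) (auto dest: admD)
qed

lemma adm_diff: assumes "adm f" "adm g" shows "adm (\<lambda>x. f x - g x)"
  using adm_add[OF assms(1) adm_cmult[OF assms(2), of "-1"]] by simp

lemma adm_sum: assumes "\<And>i. i \<in> I \<Longrightarrow> adm (F i)" shows "adm (\<lambda>x. \<Sum>i\<in>I. F i x)"
  using assms
proof (induction I rule: infinite_finite_induct)
  case (insert i I) then show ?case using adm_add[of "F i" "\<lambda>x. \<Sum>i\<in>I. F i x"] by simp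
qed (auto intro!: admI[of _ 0])

lemma ip_integrable: assumes "adm f" "adm g" shows "integrable M (\<lambda>x. f x * g x)"
proof -
  obtain c d where c: "c \<ge> 0" "\<And>x. \<bar>f x\<bar> \<le> c * m x" and d: "d \<ge> 0" "\<And>x. \<bar>g x\<bar> \<le> d * m x"
    using assms by (meson admE)
  have "norm (f x * g x) \<le> c * d * (m x)\<^sup>2" for x
    using mult_mono[OF c(2)[of x] d(2)[of x]] c d m_nonneg[of x] by (simp add: abs_mult power2_eq_square ac_simps)
  then show ?thesis
    using assms by (intro integrable_dominated[OF integrable_mult_right[OF m_square_integrable, of "c * d"]]) (auto dest: admD)
qed

lemma ip_commute: "ip f g = ip g f" by (simp add: ip_def mult.commute)

lemma ip_nonneg: "ip f f \<ge> 0" by (simp add: ip_def)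

lemma ip_add: "adm f \<Longrightarrow> adm g \<Longrightarrow> adm h \<Longrightarrow> ip (\<lambda>x. f x + g x) h = ip f h + ip g h"
  by (simp add: ip_def distrib_right ip_integrable)

lemma ip_diff: "adm f \<Longrightarrow> adm g \<Longrightarrow> adm h \<Longrightarrow> ip (\<lambda>x. f x - g x) h = ip f h - ip g h"
  by (simp add: ip_def left_diff_distrib ip_integrable)

lemma ip_cmult: "ip (\<lambda>x. a * f x) h = a * ip f h"
  by (simp add: ip_def mult.assoc)

lemma ip_diff_diff:
  assumes "adm f" "adm g"
  shows "ip (\<lambda>x. f x - g x) (\<lambda>x. f x - g x) = ip f f + ip g g - 2 * ip f g"
  using assms ip_diff[OF assms adm_diff[OF assms]] ip_diff[OF assms assms(1)] ip_diff[OF assms assms(2)]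
  by (simp add: ip_commute)

lemma ip_Cauchy_Schwarz:
  assumes f: "adm f" and g: "adm g"
  shows "(ip f g)\<^sup>2 \<le> ip f f * ip g g"
proof -
  have q: "0 \<le> ip f f - 2 * t * ip f g + t\<^sup>2 * ip g g" for t
    using ip_nonneg[of "\<lambda>x. f x - t * g x"] ip_diff_diff[OF f adm_cmult[OF g, of t]]
    by (simp add: ip_cmult ip_commute[of _ "\<lambda>x. t * g x"] ip_commute[of f g] power2_eq_square)
  show ?thesis
  proof (cases "ip g g = 0")
    case True
    have "ip f g = 0"
    proof (rule ccontr)
      assume "ip f g \<noteq> 0"
      \<comment> \<open>With \<open>ip g g = 0\<close> the quadratic in \<open>t\<close> is affine,
        and the chosen \<open>t\<close> makes its value -1.\<close>
      then show False using q[of "(ip f f + 1) / (2 * ip f g)"] True by simp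
    qed
    then show ?thesis using True by simp
  next
    case False
    then have g0: "ip g g > 0" using ip_nonneg[of g] by simp
    show ?thesis using q[of "ip f g / ip g g"] g0 by (simp add: field_simps power2_eq_square)
  qed
qed

lemma T_eq_ip: "T f x = ip (K x) f" by (simp add: T_def ip_def)

lemma S_nonneg: "S \<ge> 0" by (simp add: S_def ip_nonneg)

lemma ip_K_le: "ip (K x) (K x) \<le> (m x)\<^sup>2 * S"
proof -
  have "ip (K x) (K x) \<le> (\<integral>y. (m x)\<^sup>2 * (m y * m y) \<partial>M)"
    unfolding ip_def
  proof (rule integral_mono)
    fix y
    show "K x y * K x y \<le> (m x)\<^sup>2 * (m y * m y)"
      using mult_mono[OF K_bound[of x y] K_bound[of x y]] m_nonneg[of x] m_nonneg[of y] 
      by (simp add: power2_eq_square ac_simps)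
  qed (use ip_integrable[OF adm_K adm_K] ip_integrable[OF adm_m adm_m] in auto)
  then show ?thesis by (simp add: S_def ip_def)
qed

text \<open>Cauchy-Schwarz against the section \<open>K x\<close>: one application of
  \<open>T\<close> turns mean-square control into control at each point. This is why the convergence
  arguments below spend one extra \<open>T\<close>.\<close>

lemma T_bound:
  assumes "adm f"
  shows "\<bar>T f x\<bar> \<le> sqrt S * sqrt (ip f f) * m x"
proof -
  have "(T f x)\<^sup>2 \<le> (m x)\<^sup>2 * S * ip f f"
    unfolding T_eq_ip using ip_Cauchy_Schwarz[OF adm_K assms] mult_right_mono[OF ip_K_le ip_nonneg]
    by (rule order_trans)
  then have "\<bar>T f x\<bar> \<le> sqrt ((m x)\<^sup>2 * S * ip f f)" using real_le_rsqrt by (metis real_sqrt_abs real_sqrt_le_mono)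
  also have "\<dots> = sqrt S * sqrt (ip f f) * m x" using m_nonneg[of x] by (simp add: real_sqrt_mult)
  finally show ?thesis .
qed

lemma T_measurable [measurable]:
  assumes [measurable]: "f \<in> borel_measurable M"
  shows "T f \<in> borel_measurable M"
  unfolding T_def by measurable

lemma adm_T: "adm f \<Longrightarrow> adm (T f)"
  by (rule admI[OF _ T_bound]) (auto dest: admD)

lemma adm_Tn: "adm f \<Longrightarrow> adm ((T ^^ n) f)"
  by (induction n) (auto intro: adm_T)

lemma T_add: "adm f \<Longrightarrow> adm g \<Longrightarrow> T (\<lambda>x. f x + g x) = (\<lambda>x. T f x + T g x)"
  unfolding T_eq_ip ip_commute[of "K _"] using ip_add adm_K by auto

lemma T_diff: "adm f \<Longrightarrow> adm g \<Longrightarrow> T (\<lambda>x. f x - g x) = (\<lambda>x. T f x - T g x)"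
  unfolding T_eq_ip ip_commute[of "K _"] using ip_diff adm_K by auto

lemma T_sum:
  assumes "\<And>i. i \<in> I \<Longrightarrow> adm (F i)" shows "T (\<lambda>x. \<Sum>i\<in>I. F i x) = (\<lambda>x. \<Sum>i\<in>I. T (F i) x)"
  using assms
proof (induction I rule: infinite_finite_induct)
  case (insert i I) then show ?case using T_add[of "F i" "\<lambda>x. \<Sum>i\<in>I. F i x"] by (simp add: adm_sum)
qed (auto simp: T_def)

lemma ip_T:
  assumes f: "adm f" and g: "adm g"
  shows "ip (T f) g = ip f (T g)"
proof -
  obtain c d where c: "c \<ge> 0" "\<And>x. \<bar>f x\<bar> \<le> c * m x" and d: "d \<ge> 0" "\<And>x. \<bar>g x\<bar> \<le> d * m x"
    using assms by (meson admE)
  have [measurable]: "f \<in> borel_measurable M" "g \<in> borel_measurable M" using assms by (auto dest: admD)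
  have I: "integrable (M \<Otimes>\<^sub>M M) (\<lambda>(x, y). g x * (K x y * f y))"
  proof (rule MM.Fubini_integrable)
    have i: "integrable M (\<lambda>y. norm (g x * (K x y * f y)))" for x
      using ip_integrable[OF adm_K f] by simp
    then show "AE x in M. integrable M (\<lambda>y. case (x, y) of (x, y) \<Rightarrow> g x * (K x y * f y))"
      using ip_integrable[OF adm_K f] by (auto intro!: AE_I2)
    have "integrable M (\<lambda>x. \<integral>y. norm (g x * (K x y * f y)) \<partial>M)"
    proof (rule integrable_dominated)
      show "integrable M (\<lambda>x. c * d * S * (m x)\<^sup>2)" using m_square_integrable by simp
      fix x
      have "(\<integral>y. norm (g x * (K x y * f y)) \<partial>M) \<le> (\<integral>y. c * d * (m x)\<^sup>2 * (m y * m y) \<partial>M)"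
      proof (rule integral_mono[OF i])
        show "integrable M (\<lambda>y. c * d * (m x)\<^sup>2 * (m y * m y))" using ip_integrable[OF adm_m adm_m] by simp
        fix y
        have "norm (g x * (K x y * f y)) \<le> d * m x * ((m x * m y) * (c * m y))"
          using c d m_nonneg unfolding real_norm_def abs_mult
          by (intro mult_mono K_bound) (auto simp: m_nonneg)
        then show "norm (g x * (K x y * f y)) \<le> c * d * (m x)\<^sup>2 * (m y * m y)" by (simp add: power2_eq_square ac_simps)
      qed
      also have "\<dots> = c * d * (m x)\<^sup>2 * S" by (simp add: S_def ip_def)
      finally show "norm (\<integral>y. norm (g x * (K x y * f y)) \<partial>M) \<le> c * d * S * (m x)\<^sup>2"
        by (simp add: mult.assoc mult.commute[of "(m x)\<^sup>2"])
    qed measurable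
    then show "integrable M (\<lambda>x. \<integral>y. norm (case (x, y) of (x, y) \<Rightarrow> g x * (K x y * f y)) \<partial>M)" by simp
  qed measurable
  have "ip (T f) g = (\<integral>x. (\<integral>y. g x * (K x y * f y) \<partial>M) \<partial>M)"
    by (simp add: ip_def T_def mult.commute)
  also have "\<dots> = (\<integral>y. (\<integral>x. g x * (K x y * f y) \<partial>M) \<partial>M)"
    using MM.Fubini_integral[OF I] by simp
  also have "\<dots> = (\<integral>y. f y * (\<integral>x. K y x * g x \<partial>M) \<partial>M)"
    by (subst K_sym) (simp add: ac_simps)
  finally show ?thesis by (simp add: ip_def T_def)
qed

lemma ip_Tn: "adm f \<Longrightarrow> adm g \<Longrightarrow> ip ((T ^^ n) f) g = ip f ((T ^^ n) g)"
proof (induction n arbitrary: g)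
  case (Suc n)
  have "ip ((T ^^ Suc n) f) g = ip ((T ^^ n) f) (T g)" using ip_T[OF adm_Tn[OF Suc.prems(1)] Suc.prems(2)] by simp
  also have "\<dots> = ip f ((T ^^ n) (T g))" using Suc adm_T by simp
  finally show ?case by (simp add: funpow_swap1)
qed simp

lemma T_convergence:
  assumes F: "\<And>n. F n \<in> borel_measurable M" "\<And>n x. \<bar>F n x\<bar> \<le> c * m x" and lim: "\<And>x. (\<lambda>n. F n x) \<longlonglongrightarrow> G x"
  shows "adm G" "(\<lambda>n. T (F n) x) \<longlonglongrightarrow> T G x" "G \<in> borel_measurable M" "\<bar>G x\<bar> \<le> c * m x"
proof -
  show G: "G \<in> borel_measurable M" by (rule borel_measurable_LIMSEQ_real[OF lim F(1)])
  show b: "\<bar>G x\<bar> \<le> c * m x" for x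
    by (rule LIMSEQ_le_const2[OF tendsto_rabs[OF lim]]) (use F(2) in auto)
  show "adm G" by (rule admI[OF G b])
  show "(\<lambda>n. T (F n) x) \<longlonglongrightarrow> T G x"
    unfolding T_def
  proof (rule integral_dominated_convergence[where w = "\<lambda>y. c * m x * (m y)\<^sup>2"])
    show "integrable M (\<lambda>y. c * m x * (m y)\<^sup>2)" using m_square_integrable by simp
    show "AE y in M. norm (K x y * F n y) \<le> c * m x * (m y)\<^sup>2" for n
    proof (rule AE_I2)
      fix y
      have "norm (K x y * F n y) \<le> (m x * m y) * (c * m y)"
        unfolding real_norm_def abs_mult using m_nonneg by (intro mult_mono K_bound F) auto
      then show "norm (K x y * F n y) \<le> c * m x * (m y)\<^sup>2" by (simp add: power2_eq_square ac_simps)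
    qed
  qed (use F G in \<open>auto intro!: tendsto_intros lim AE_I2\<close>)
qed

end

section \<open>Iterates and resolvent of a positive contraction\<close>

locale positive_contraction_kernel = hilbert_schmidt_kernel +
  assumes T_positive: "adm f \<Longrightarrow> 0 \<le> ip f (T f)"
    and T_contraction: "adm f \<Longrightarrow> ip f (T f) \<le> ip f f"
    and T_no_fixpoint: "adm f \<Longrightarrow> T f = f \<Longrightarrow> f = (\<lambda>x. 0)"
begin

text \<open>Cauchy-Schwarz for the semidefinite form \<open>ip f (T g)\<close> turns \<open>T \<le> 1\<close> into \<open>T\<^sup>2 \<le> T\<close>.\<close>

lemma ip_T_T_le: assumes f: "adm f" shows "ip (T f) (T f) \<le> ip f (T f)"
proof -
  define g where "g = T f"
  have g: "adm g" using f by (simp add: g_def adm_T)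
  define a b c where "a = ip f (T f)" and "b = ip g (T f)" and "c = ip g (T g)"
  have fg: "ip f (T g) = b" using ip_T[OF f g] by (simp add: b_def ip_commute g_def)
  have q: "0 \<le> a - 2 * t * b + t\<^sup>2 * c" for t
  proof -
    define h where "h = (\<lambda>x. f x - t * g x)"
    have h: "adm h" unfolding h_def by (intro adm_diff adm_cmult f g)
    have "T h = (\<lambda>x. T f x - t * T g x)"
      unfolding h_def using T_diff[OF f adm_cmult[OF g, of t]] by (simp add: T_def mult.left_commute)
    then have "ip h (T h) = ip (\<lambda>x. T f x - t * T g x) h" by (simp add: ip_commute)
    also have "\<dots> = ip (T f) h - t * ip (T g) h"
      using ip_diff[OF adm_T[OF f] adm_cmult[OF adm_T[OF g], of t] h] by (simp add: ip_cmult)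
    also have "ip (T f) h = a - t * b"
      using ip_diff[OF f adm_cmult[OF g, of t] adm_T[OF f]] by (simp add: h_def a_def b_def ip_cmult ip_commute[of "T f"])
    also have "ip (T g) h = b - t * c"
      using ip_diff[OF f adm_cmult[OF g, of t] adm_T[OF g]] fg by (simp add: h_def c_def ip_cmult ip_commute[of "T g"])
    finally show ?thesis using T_positive[OF h] by (simp add: power2_eq_square algebra_simps)
  qed
  have cb: "c \<le> b" using T_contraction[OF g] by (simp add: b_def c_def g_def)
  have "0 \<le> a - 2 * b + c" using q[of 1] by simp
  with cb show ?thesis by (simp add: a_def b_def g_def)
qed

text \<open>The parity of the exponent decides. By symmetry an even power gives the squared norm of
  \<open>(T ^^ k) f\<close>, an odd one the form of \<open>T\<close> at that function. The step from
  even to odd is the contraction property, the step from odd to even is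
  \<open>ip_T_T_le\<close>.\<close>

lemma ip_Tn_decreasing: assumes f: "adm f" shows "ip f ((T ^^ Suc n) f) \<le> ip f ((T ^^ n) f)" "0 \<le> ip f ((T ^^ n) f)"
proof -
  have 1: "ip f ((T ^^ (k + k)) f) = ip ((T ^^ k) f) ((T ^^ k) f)" for k
    using ip_Tn[OF f adm_Tn[OF f], of k k] by (simp add: funpow_add)
  have 2: "ip f ((T ^^ Suc (k + k)) f) = ip ((T ^^ k) f) (T ((T ^^ k) f))" for k
    using ip_Tn[OF f adm_T[OF adm_Tn[OF f]], of k k] by (simp add: funpow_add funpow_swap1)
  consider k where "n = k + k" | k where "n = Suc (k + k)" by (metis evenE oddE mult_2 Suc_eq_plus1)
  then show "ip f ((T ^^ Suc n) f) \<le> ip f ((T ^^ n) f)"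
  proof cases
    case (1 k) then show ?thesis using \<open>\<And>k. ip f ((T ^^ (k + k)) f) = _\<close> 2 T_contraction[OF adm_Tn[OF f]] by simp
  next
    case (2 k)
    have "Suc n = Suc k + Suc k" using 2 by simp
    then show ?thesis using 1[of "Suc k"] \<open>\<And>k. ip f ((T ^^ Suc (k + k)) f) = _\<close>[of k] 2 ip_T_T_le[OF adm_Tn[OF f]] by simp
  qed
  consider k where "n = k + k" | k where "n = Suc (k + k)" by (metis evenE oddE mult_2 Suc_eq_plus1)
  then show "0 \<le> ip f ((T ^^ n) f)"
    by cases (use 1 2 ip_nonneg T_positive[OF adm_Tn[OF f]] in auto)
qed

lemma norm_Tn_le: assumes f: "adm f" shows "ip ((T ^^ n) f) ((T ^^ n) f) \<le> ip f f"
proof -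
  have "ip f ((T ^^ k) f) \<le> ip f f" for k
  proof (induction k)
    case (Suc k) then show ?case using ip_Tn_decreasing(1)[OF f, of k] by linarith
  qed simp
  then show ?thesis using ip_Tn[OF f adm_Tn[OF f], of n n] by (simp add: funpow_add[symmetric] flip: comp_apply[of "T ^^ n"])
qed

text \<open>The product of the iterates \<open>i\<close> and \<open>j\<close> depends only on
  \<open>i + j\<close> and converges, being decreasing and nonnegative, so the iterates are Cauchy
  in mean square. One more \<open>T\<close> makes them Cauchy at each point, and the limit is a
  fixed point of \<open>T\<close>, hence 0.\<close>

lemma Tn_tendsto_zero:
  assumes f: "adm f"
  shows "(\<lambda>n. (T ^^ n) f x) \<longlonglongrightarrow> 0"
proof -
  define a where "a = (\<lambda>n. ip f ((T ^^ n) f))"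
  have ipnm: "ip ((T ^^ i) f) ((T ^^ j) f) = a (i + j)" for i j
    using ip_Tn[OF f adm_Tn[OF f], of i j] by (simp add: a_def funpow_add)
  have "decseq a" unfolding a_def using ip_Tn_decreasing[OF f] by (intro decseq_SucI) auto
  then obtain L where L: "a \<longlonglongrightarrow> L"
    using decseq_convergent[of a 0] ip_Tn_decreasing(2)[OF f] unfolding a_def by metis
  have "Cauchy (\<lambda>n. (T ^^ Suc n) f x)" for x
  proof (rule metric_CauchyI)
    fix e :: real assume e: "e > 0"
    define C where "C = sqrt S * m x + 1"
    have C: "C > 0" "sqrt S * m x \<le> C" using S_nonneg m_nonneg[of x] by (auto simp: C_def intro: add_nonneg_pos)
    \<comment> \<open>A quarter, because \<open>a (i + i) + a (j + j) - 2 * a (i + j)\<close>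
      collects four errors, each below \<open>\<delta>\<close>.\<close>
    define \<delta> where "\<delta> = (e / C)\<^sup>2 / 4"
    have \<delta>: "\<delta> > 0" using e C by (simp add: \<delta>_def)
    obtain N where N: "\<And>n. n \<ge> N \<Longrightarrow> \<bar>a n - L\<bar> < \<delta>"
      using L \<delta> unfolding LIMSEQ_iff real_norm_def by blast
    show "\<exists>N. \<forall>i\<ge>N. \<forall>j\<ge>N. dist ((T ^^ Suc i) f x) ((T ^^ Suc j) f x) < e"
    proof (intro exI allI impI)
      fix i j assume ij: "N \<le> i" "N \<le> j"
      define h where "h = (\<lambda>x. (T ^^ i) f x - (T ^^ j) f x)"
      have h: "adm h" unfolding h_def by (intro adm_diff adm_Tn f)
      have "ip h h = a (i + i) + a (j + j) - 2 * a (i + j)"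
        unfolding h_def using ip_diff_diff[OF adm_Tn[OF f, of i] adm_Tn[OF f, of j]] by (simp add: ipnm)
      then have "ip h h < (e / C)\<^sup>2"
        using N[of "i + i"] N[of "j + j"] N[of "i + j"] ij unfolding \<delta>_def by linarith
      then have "sqrt (ip h h) < e / C" using real_sqrt_less_mono[of "ip h h" "(e / C)\<^sup>2"] e C by simp
      moreover have "(T ^^ Suc i) f x - (T ^^ Suc j) f x = T h x"
        unfolding h_def using T_diff[OF adm_Tn[OF f, of i] adm_Tn[OF f, of j]] by simp
      moreover have "\<bar>T h x\<bar> \<le> sqrt (ip h h) * C"
        using T_bound[OF h, of x] mult_left_mono[OF C(2), of "sqrt (ip h h)"] ip_nonneg[of h] by (simp add: ac_simps)
      ultimately show "dist ((T ^^ Suc i) f x) ((T ^^ Suc j) f x) < e"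
        using C by (simp add: dist_real_def field_simps)
    qed
  qed
  then have "convergent (\<lambda>n. (T ^^ Suc n) f x)" for x by (simp add: Cauchy_convergent_iff)
  then obtain g where g: "\<And>x. (\<lambda>n. (T ^^ Suc n) f x) \<longlonglongrightarrow> g x" unfolding convergent_def by metis
  have b: "\<bar>(T ^^ Suc n) f x\<bar> \<le> sqrt S * sqrt (ip f f) * m x" for n x
  proof -
    have "\<bar>(T ^^ Suc n) f x\<bar> \<le> sqrt S * sqrt (ip ((T ^^ n) f) ((T ^^ n) f)) * m x"
      using T_bound[OF adm_Tn[OF f]] by simp
    also have "\<dots> \<le> sqrt S * sqrt (ip f f) * m x"
      using S_nonneg m_nonneg norm_Tn_le[OF f] by (intro mult_right_mono mult_left_mono) auto
    finally show ?thesis .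
  qed
  note conv = T_convergence[OF admD[OF adm_Tn[OF f]] b g]
  have "T g x = g x" for x
    using conv(2)[of x] LIMSEQ_Suc[OF g[of x]] by (auto intro: LIMSEQ_unique)
  then have "g = (\<lambda>x. 0)" using T_no_fixpoint conv(1) by blast
  then show ?thesis using LIMSEQ_imp_Suc[OF g[of x]] by simp
qed

text \<open>\<open>(T ^^ n) (K x)\<close> is the section at \<open>x\<close> of the kernel of
  \<open>T ^^ Suc n\<close>, so this is the squared Hilbert-Schmidt norm of that power, one index
  higher than the notation suggests.\<close>

definition HS :: "nat \<Rightarrow> real" where
  "HS n = (\<integral>x. ip ((T ^^ n) (K x)) ((T ^^ n) (K x)) \<partial>M)"

lemma Tn_K_measurable [measurable]: "(\<lambda>(x, y). (T ^^ n) (K x) y) \<in> borel_measurable (M \<Otimes>\<^sub>M M)"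
proof (induction n)
  case (Suc n)
  note [measurable] = Suc
  have "(\<lambda>(x, y). \<integral>w. K y w * (T ^^ n) (K x) w \<partial>M) \<in> borel_measurable (M \<Otimes>\<^sub>M M)"
    by measurable
  also have "(\<lambda>(x, y). \<integral>w. K y w * (T ^^ n) (K x) w \<partial>M) = (\<lambda>(x, y). (T ^^ Suc n) (K x) y)"
    by (intro ext) (auto simp: T_def[of "(T ^^ n) (K x)" for x])
  finally show ?case .
qed simp

lemma HS_integrable:
  "(\<lambda>x. ip ((T ^^ n) (K x)) ((T ^^ n) (K x))) \<in> borel_measurable M"
  "ip ((T ^^ n) (K x)) ((T ^^ n) (K x)) \<le> S * (m x)\<^sup>2"
  "integrable M (\<lambda>x. ip ((T ^^ n) (K x)) ((T ^^ n) (K x)))"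
proof -
  show 1: "(\<lambda>x. ip ((T ^^ n) (K x)) ((T ^^ n) (K x))) \<in> borel_measurable M"
    unfolding ip_def by measurable
  show 2: "ip ((T ^^ n) (K x)) ((T ^^ n) (K x)) \<le> S * (m x)\<^sup>2" for x
    using order_trans[OF norm_Tn_le[OF adm_K] ip_K_le[of x], of n] by (simp add: mult.commute)
  show "integrable M (\<lambda>x. ip ((T ^^ n) (K x)) ((T ^^ n) (K x)))"
    by (rule integrable_dominated[OF integrable_mult_right[OF m_square_integrable] 1]) (use 2 ip_nonneg in auto)
qed

text \<open>Iterates of each single section tend to 0 at every point. Dominated convergence, in the
  second variable and then in the first, upgrades this to Hilbert-Schmidt norms and hence to
  operator norms. This is where the square-integrable envelope does the work of compactness.\<close>

lemma HS_tendsto_zero: "HS \<longlonglongrightarrow> 0"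
proof -
  have "(\<lambda>n. ip ((T ^^ n) (K x)) ((T ^^ n) (K x))) \<longlonglongrightarrow> 0" for x
  proof -
    have "(\<lambda>n. \<integral>y. (T ^^ Suc n) (K x) y * (T ^^ Suc n) (K x) y \<partial>M) \<longlonglongrightarrow> (\<integral>y. 0 \<partial>M)"
    proof (rule integral_dominated_convergence[where w = "\<lambda>y. (sqrt S * sqrt (ip (K x) (K x)))\<^sup>2 * (m y)\<^sup>2"])
      show "integrable M (\<lambda>y. (sqrt S * sqrt (ip (K x) (K x)))\<^sup>2 * (m y)\<^sup>2)" using m_square_integrable by simp
      show "(\<lambda>y. (T ^^ Suc n) (K x) y * (T ^^ Suc n) (K x) y) \<in> borel_measurable M" for n
        using admD[OF adm_Tn[OF adm_K]] by (intro borel_measurable_times) auto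
      show "AE y in M. (\<lambda>n. (T ^^ Suc n) (K x) y * (T ^^ Suc n) (K x) y) \<longlonglongrightarrow> 0"
        using LIMSEQ_Suc[OF Tn_tendsto_zero[OF adm_K]] by (intro AE_I2 tendsto_mult_zero) auto
      show "AE y in M. norm ((T ^^ Suc n) (K x) y * (T ^^ Suc n) (K x) y) \<le> (sqrt S * sqrt (ip (K x) (K x)))\<^sup>2 * (m y)\<^sup>2" for n
      proof (rule AE_I2)
        fix y
        have "\<bar>(T ^^ Suc n) (K x) y\<bar> \<le> sqrt S * sqrt (ip ((T ^^ n) (K x)) ((T ^^ n) (K x))) * m y"
          using T_bound[OF adm_Tn[OF adm_K]] by simp
        also have "\<dots> \<le> sqrt S * sqrt (ip (K x) (K x)) * m y"
          using S_nonneg m_nonneg norm_Tn_le[OF adm_K] by (intro mult_right_mono mult_left_mono) auto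
        finally have "\<bar>(T ^^ Suc n) (K x) y\<bar>\<^sup>2 \<le> (sqrt S * sqrt (ip (K x) (K x)) * m y)\<^sup>2"
          by (intro power_mono) auto
        then show "norm ((T ^^ Suc n) (K x) y * (T ^^ Suc n) (K x) y) \<le> (sqrt S * sqrt (ip (K x) (K x)))\<^sup>2 * (m y)\<^sup>2"
          by (simp add: power2_eq_square abs_mult ac_simps)
      qed
    qed auto
    then show ?thesis unfolding ip_def by (intro LIMSEQ_imp_Suc[of "\<lambda>n. \<integral>y. (T ^^ n) (K x) y * (T ^^ n) (K x) y \<partial>M"]) simp
  qed
  then have "(\<lambda>n. HS n) \<longlonglongrightarrow> (\<integral>x. 0 \<partial>M)"
    unfolding HS_def
    using HS_integrable ip_nonneg
    by (intro integral_dominated_convergence[where w = "\<lambda>x. S * (m x)\<^sup>2"])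
       (auto intro!: AE_I2 integrable_mult_right m_square_integrable)
  then show ?thesis by simp
qed

lemma norm_Tn_HS:
  assumes f: "adm f"
  shows "ip ((T ^^ Suc n) f) ((T ^^ Suc n) f) \<le> HS n * ip f f"
proof -
  have "(T ^^ Suc n) f x * (T ^^ Suc n) f x \<le> ip ((T ^^ n) (K x)) ((T ^^ n) (K x)) * ip f f" for x
  proof -
    have "(T ^^ Suc n) f x = ip ((T ^^ n) (K x)) f"
      using ip_Tn[OF adm_K f, of n] by (simp add: T_eq_ip)
    then show ?thesis using ip_Cauchy_Schwarz[OF adm_Tn[OF adm_K] f] by (simp add: power2_eq_square)
  qed
  then have "ip ((T ^^ Suc n) f) ((T ^^ Suc n) f) \<le> (\<integral>x. ip ((T ^^ n) (K x)) ((T ^^ n) (K x)) * ip f f \<partial>M)"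
    unfolding ip_def[of "(T ^^ Suc n) f"]
    by (intro integral_mono ip_integrable adm_Tn f integrable_mult_left HS_integrable)
  then show ?thesis by (simp add: HS_def)
qed

text \<open>A power \<open>B = T ^^ Suc n\<close> has norm at most 1/2, so the Neumann series
  \<open>u\<close> of \<open>B\<close> at \<open>v\<close> converges and \<open>u = v + B u\<close>.
  The sum of \<open>T ^^ i\<close> over \<open>i < Suc n\<close>, followed by \<open>1 - T\<close>,
  telescopes to \<open>1 - B\<close>; applied to \<open>u\<close> it therefore solves the equation
  for \<open>T\<close> itself.\<close>

theorem resolvent_exists:
  assumes v: "adm v"
  shows "\<exists>y. adm y \<and> (\<forall>x. y x = v x + T y x)"
proof -
  \<comment> \<open>\<open>HS\<close> bounds squared norms, so 1/4 corresponds to the ratio 1/2 of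
    the geometric majorant below.\<close>
  obtain n where n: "HS n < 1 / 4"
    using HS_tendsto_zero by (metis eventually_sequentially order_tendstoD(2) le_refl zero_less_divide_1_iff zero_less_numeral)
  define B where "B = T ^^ Suc n"
  have B: "adm (B f)" if "adm f" for f unfolding B_def using adm_Tn[OF that] .
  have Bj: "adm ((B ^^ j) f)" if "adm f" for j f using that by (induction j) (auto intro: B)
  have q: "ip (B f) (B f) \<le> ip f f / 4" if f: "adm f" for f
    using norm_Tn_HS[OF f, of n] mult_right_mono[OF less_imp_le[OF n] ip_nonneg[of f]] by (simp add: B_def)
  have qj: "ip ((B ^^ j) v) ((B ^^ j) v) \<le> ip v v / 4 ^ j" for j
  proof (induction j)
    case (Suc j) then show ?case using q[OF Bj[OF v, of j]] by simp
  qed simp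
  define c where "c = sqrt S * sqrt (ip v v)"
  have c: "c \<ge> 0" using S_nonneg ip_nonneg by (simp add: c_def)
  have bj: "\<bar>(B ^^ Suc j) v x\<bar> \<le> c * m x * (1 / 2) ^ j" for j x
  proof -
    have "\<bar>(B ^^ Suc j) v x\<bar> \<le> sqrt S * sqrt (ip ((T ^^ n) ((B ^^ j) v)) ((T ^^ n) ((B ^^ j) v))) * m x"
      using T_bound[OF adm_Tn[OF Bj[OF v]], of n j x] by (simp add: B_def)
    also have "\<dots> \<le> sqrt S * sqrt (ip v v / 4 ^ j) * m x"
      using S_nonneg m_nonneg norm_Tn_le[OF Bj[OF v, of j], of n] qj[of j] by (intro mult_right_mono mult_left_mono) auto
    also have "sqrt (ip v v / 4 ^ j) = sqrt (ip v v) * (1 / 2) ^ j"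
    proof -
      have "sqrt ((4::real) ^ j) = 2 ^ j" by (simp add: real_sqrt_power)
      then show ?thesis by (simp add: real_sqrt_divide power_divide)
    qed
    finally show ?thesis by (simp add: c_def ac_simps)
  qed
  obtain c0 where c0: "c0 \<ge> 0" "\<And>x. \<bar>v x\<bar> \<le> c0 * m x" using admE[OF v] by blast
  define U where "U = (\<lambda>J x. \<Sum>j<J. (B ^^ j) v x)"
  have U: "adm (U J)" for J unfolding U_def by (intro adm_sum Bj v)
  have sm: "summable (\<lambda>j. (B ^^ j) v x)" for x
  proof -
    have "summable (\<lambda>j. (B ^^ Suc j) v x)"
      by (rule summable_comparison_test'[OF summable_mult[OF summable_geometric[of "1/2"], of "c * m x"]])
         (use bj in \<open>auto simp del: funpow.simps\<close>)
    then show ?thesis by (rule summable_Suc_iff[THEN iffD1])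
  qed
  define u where "u = (\<lambda>x. \<Sum>j. (B ^^ j) v x)"
  have Uu: "(\<lambda>J. U J x) \<longlonglongrightarrow> u x" for x
    unfolding U_def u_def by (rule summable_LIMSEQ[OF sm])
  have Ub: "\<bar>U J x\<bar> \<le> (c0 + 2 * c) * m x" for J x
  proof (cases J)
    case 0 then show ?thesis using c0 c m_nonneg[of x] by (simp add: U_def)
  next
    case (Suc J')
    have "\<bar>U J x\<bar> \<le> \<bar>v x\<bar> + (\<Sum>j<J'. \<bar>(B ^^ Suc j) v x\<bar>)"
      unfolding U_def Suc sum.lessThan_Suc_shift
      using sum_abs[of "\<lambda>j. (B ^^ Suc j) v x" "{..<J'}"] unfolding funpow_0 by linarith
    also have "(\<Sum>j<J'. \<bar>(B ^^ Suc j) v x\<bar>) \<le> (\<Sum>j<J'. c * m x * (1 / 2) ^ j)"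
      by (intro sum_mono bj)
    also have "\<dots> = c * m x * (\<Sum>j<J'. (1 / 2) ^ j)" by (simp add: sum_distrib_left)
    also have "\<dots> \<le> c * m x * 2"
    proof (intro mult_left_mono)
      show "(\<Sum>j<J'. (1 / 2 :: real) ^ j) \<le> 2" by (simp add: sum_gp_strict)
    qed (use c m_nonneg in auto)
    finally show ?thesis using c0(2)[of x] by (simp add: algebra_simps)
  qed
  \<comment> \<open>Envelope and convergence are carried through the induction together: dominated
    convergence for the next \<open>T\<close> needs a bound that is uniform in the partial sums
    \<open>U J\<close>.\<close>
  have Ti: "adm ((T ^^ i) u) \<and> (\<exists>d. \<forall>J x. \<bar>(T ^^ i) (U J) x\<bar> \<le> d * m x) \<and> (\<forall>x. (\<lambda>J. (T ^^ i) (U J) x) \<longlonglongrightarrow> (T ^^ i) u x)" for i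
  proof (induction i)
    case 0
    show ?case using T_convergence(1)[OF admD[OF U] Ub Uu] Ub Uu by auto
  next
    case (Suc i)
    then obtain d where d: "\<And>J x. \<bar>(T ^^ i) (U J) x\<bar> \<le> d * m x" by blast
    have lim: "\<And>x. (\<lambda>J. (T ^^ i) (U J) x) \<longlonglongrightarrow> (T ^^ i) u x" using Suc by blast
    have "d * m x \<le> \<bar>d\<bar> * m x" for x using m_nonneg by (intro mult_right_mono) auto
    with d have d': "\<bar>(T ^^ i) (U J) x\<bar> \<le> \<bar>d\<bar> * m x" for J x by (meson order_trans)
    have "\<bar>T ((T ^^ i) (U J)) x\<bar> \<le> \<bar>d\<bar> * S * m x" for J x
    proof -
      have "norm (\<integral>y. K x y * (T ^^ i) (U J) y \<partial>M) \<le> (\<integral>y. \<bar>d\<bar> * m x * (m y * m y) \<partial>M)"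
      proof (rule norm_integral_le_integral)
        fix y
        have "norm (K x y * (T ^^ i) (U J) y) \<le> (m x * m y) * (\<bar>d\<bar> * m y)"
          unfolding real_norm_def abs_mult using m_nonneg by (intro mult_mono K_bound d') auto
        then show "norm (K x y * (T ^^ i) (U J) y) \<le> \<bar>d\<bar> * m x * (m y * m y)" by (simp add: ac_simps)
      qed (use ip_integrable[OF adm_K adm_Tn[OF U]] ip_integrable[OF adm_m adm_m] in auto)
      also have "\<dots> = \<bar>d\<bar> * m x * S" by (simp add: S_def ip_def)
      finally show ?thesis by (simp add: T_def[of "(T ^^ i) (U J)"] ac_simps)
    qed
    then have "\<exists>d. \<forall>J x. \<bar>(T ^^ Suc i) (U J) x\<bar> \<le> d * m x" by auto
    moreover have "(\<lambda>J. (T ^^ Suc i) (U J) x) \<longlonglongrightarrow> (T ^^ Suc i) u x" for x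
      using T_convergence(2)[OF admD[OF adm_Tn[OF U]] d' lim] by simp
    moreover have "adm ((T ^^ Suc i) u)" using Suc adm_T by simp
    ultimately show ?case by blast
  qed
  have TnU: "(T ^^ i) (U J) = (\<lambda>x. \<Sum>j<J. (T ^^ i) ((B ^^ j) v) x)" for i J
  proof (induction i)
    case (Suc i) then show ?case using T_sum[of "{..<J}" "\<lambda>j. (T ^^ i) ((B ^^ j) v)"] adm_Tn[OF Bj[OF v]] by simp
  qed (simp add: U_def)
  have BU: "B (U J) x = U (Suc J) x - v x" for J x
    unfolding B_def TnU unfolding B_def[symmetric] U_def sum.lessThan_Suc_shift by simp
  have Bu: "B u x = u x - v x" for x
  proof (rule LIMSEQ_unique)
    show "(\<lambda>J. B (U J) x) \<longlonglongrightarrow> B u x" unfolding B_def using Ti by blast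
    show "(\<lambda>J. B (U J) x) \<longlonglongrightarrow> u x - v x" unfolding BU by (intro tendsto_intros LIMSEQ_Suc Uu)
  qed
  define y where "y = (\<lambda>x. \<Sum>i<Suc n. (T ^^ i) u x)"
  have "adm y" unfolding y_def using Ti by (intro adm_sum) auto
  moreover have "y x = v x + T y x" for x
  proof -
    have "T y x = (\<Sum>i<Suc n. (T ^^ Suc i) u x)"
      unfolding y_def using T_sum[of "{..<Suc n}" "\<lambda>i. (T ^^ i) u"] Ti by simp
    also have "\<dots> = (\<Sum>i<Suc n. (T ^^ i) u x) + B u x - u x"
      using sum.lessThan_Suc_shift[of "\<lambda>i. (T ^^ i) u x" "Suc n"] sum.lessThan_Suc[of "\<lambda>i. (T ^^ i) u x" "Suc n"]
      unfolding B_def by (simp del: funpow.simps sum.lessThan_Suc add: funpow_0)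
    finally show ?thesis by (simp add: Bu y_def)
  qed
  ultimately show ?thesis by blast
qed

end

section \<open>Square-integrable functions and the Airy transform on a half-line\<close>

text \<open>A density on the whole line, not a restricted space: functions remain defined on all
  reals, the resolvent equation can be read at every real point, and endpoints can be varied while
  the functions stay the same.\<close>

definition half_line :: "real \<Rightarrow> real measure" where
  "half_line a = density lborel (\<lambda>x. ennreal (indicator {a..} x))"

lemma space_half_line [simp]: "space (half_line a) = UNIV"
  and sets_half_line [simp, measurable_cong]: "sets (half_line a) = sets borel"
  by (auto simp: half_line_def)

lemma integral_half_line:
  fixes f :: "real \<Rightarrow> 'b::{banach, second_countable_topology}"
  assumes "f \<in> borel_measurable borel"
  shows "(\<integral>x. f x \<partial>half_line a) = (\<integral>x. indicator {a..} x *\<^sub>R f x \<partial>lborel)"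
  unfolding half_line_def using assms by (subst integral_density) auto

lemma integrable_half_line:
  fixes f :: "real \<Rightarrow> 'b::{banach, second_countable_topology}"
  assumes "f \<in> borel_measurable borel"
  shows "integrable (half_line a) f \<longleftrightarrow> integrable lborel (\<lambda>x. indicator {a..} x *\<^sub>R f x)"
  unfolding half_line_def using assms by (subst integrable_density) auto

lemma AE_half_line: "AE x in half_line a. x \<ge> a"
  unfolding half_line_def by (subst AE_density) (auto simp: indicator_def)

interpretation half_line: sigma_finite_measure "half_line a" for a
  unfolding half_line_def by (subst sigma_finite_measure.sigma_finite_iff_density_finite[OF lborel.sigma_finite_measure_axioms]) auto

lemma integrable_lborel_half_line:
  fixes f :: "real \<Rightarrow> 'b::{banach, second_countable_topology}"
  assumes "integrable lborel f"
  shows "integrable (half_line a) f"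
  using assms by (subst integrable_half_line) (auto intro: integrable_mult_indicator)

lemma integrable_exp_half_line:
  fixes c :: real
  assumes "c > 0"
  shows "integrable (half_line a) (\<lambda>x. exp (- c * x))"
proof -
  have "(\<integral>\<^sup>+x. ennreal (exp (- c * x)) * indicator {a..} x \<partial>lborel) = ennreal (0 - (- exp (- c * a) / c))"
  proof (rule nn_integral_FTC_atLeast)
    show "((\<lambda>x. - exp (- c * x) / c) \<longlongrightarrow> 0) at_top" using assms by real_asymp
  qed (use assms in \<open>auto intro!: derivative_eq_intros\<close>)
  also have "(\<integral>\<^sup>+x. ennreal (exp (- c * x)) * indicator {a..} x \<partial>lborel) = (\<integral>\<^sup>+x. ennreal (indicator {a..} x *\<^sub>R exp (- c * x)) \<partial>lborel)"
    by (intro nn_integral_cong) (auto simp: indicator_def)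
  finally have "integrable lborel (\<lambda>x. indicator {a..} x *\<^sub>R exp (- c * x))"
    by (intro integrableI_nn_integral_finite[where x = "0 - (- exp (- c * a) / c)"]) (use assms in \<open>auto intro!: AE_I2\<close>)
  then show ?thesis by (subst integrable_half_line) auto
qed

lemma integrable_exp_abs:
  fixes c :: real
  assumes "c > 0"
  shows "integrable lborel (\<lambda>x. exp (- c * \<bar>x\<bar>))"
proof -
  have 1: "integrable lborel (\<lambda>x. indicator {0..} x *\<^sub>R exp (- c * x))"
    using integrable_exp_half_line[OF assms, of 0] by (subst (asm) integrable_half_line) auto
  have 2: "integrable lborel (\<lambda>x. indicator {0..} (0 + (-1) * x) *\<^sub>R exp (- c * (0 + (-1) * x)))"
    by (subst lborel_integrable_real_affine_iff) (use 1 in auto)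
  show ?thesis
    by (rule integrable_dominated[OF Bochner_Integration.integrable_add[OF 1 2]]) (auto simp: indicator_def abs_if)
qed

lemma Fubini_product_bound:
  fixes g :: "'a \<Rightarrow> 'b \<Rightarrow> 'c::{banach, second_countable_topology}" and p :: "'a \<Rightarrow> real" and q :: "'b \<Rightarrow> real"
  assumes "sigma_finite_measure M" "sigma_finite_measure N"
    and g [measurable]: "(\<lambda>(x, t). g x t) \<in> borel_measurable (M \<Otimes>\<^sub>M N)"
    and p: "integrable M p" and q: "integrable N q"
    and b: "\<And>x t. x \<in> space M \<Longrightarrow> t \<in> space N \<Longrightarrow> norm (g x t) \<le> p x * q t"
  shows "(\<integral>x. (\<integral>t. g x t \<partial>N) \<partial>M) = (\<integral>t. (\<integral>x. g x t \<partial>M) \<partial>N)"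
    and "integrable M (\<lambda>x. \<integral>t. g x t \<partial>N)"
proof -
  interpret sigma_finite_measure M by fact
  interpret N: sigma_finite_measure N by fact
  interpret pair_sigma_finite M N ..
  have i: "integrable N (g x)" if "x \<in> space M" for x
    by (rule integrable_dominated[OF integrable_mult_right[OF q, of "p x"]]) (use that b in auto)
  have "integrable M (\<lambda>x. \<integral>t. norm (g x t) \<partial>N)"
  proof (rule integrable_dominated[OF integrable_mult_left[OF p, of "\<integral>t. q t \<partial>N"]])
    fix x assume x: "x \<in> space M"
    have "(\<integral>t. norm (g x t) \<partial>N) \<le> (\<integral>t. p x * q t \<partial>N)"
      using i[OF x] q b[OF x] by (intro integral_mono) auto
    then show "norm (\<integral>t. norm (g x t) \<partial>N) \<le> p x * (\<integral>t. q t \<partial>N)" by simp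
  qed measurable
  then have I: "integrable (M \<Otimes>\<^sub>M N) (\<lambda>(x, t). g x t)"
    using i by (intro Fubini_integrable) (auto intro!: AE_I2)
  show "(\<integral>x. (\<integral>t. g x t \<partial>N) \<partial>M) = (\<integral>t. (\<integral>x. g x t \<partial>M) \<partial>N)"
    using Fubini_integral[OF I] by simp
  show "integrable M (\<lambda>x. \<integral>t. g x t \<partial>N)" using integrable_fst[OF I] by simp
qed

text \<open>If \<open>A\<close> is the operator with kernel \<open>a\<close>, the inner integral
  over \<open>t\<close> is the kernel of the transpose of \<open>A\<close> composed with
  \<open>A\<close>. Its quadratic form is a squared norm, which is the source of positivity; the
  third claim is the factorization itself, read at each point.\<close>

lemma Fubini_square:
  fixes a :: "'a \<Rightarrow> 'b \<Rightarrow> real" and f r :: "'a \<Rightarrow> real" and q :: "'b \<Rightarrow> real"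
  assumes M: "sigma_finite_measure M" "space M = UNIV" and N: "sigma_finite_measure N"
    and a [measurable]: "(\<lambda>(x, t). a x t) \<in> borel_measurable (M \<Otimes>\<^sub>M N)"
    and f [measurable]: "f \<in> borel_measurable M" and q_meas [measurable]: "q \<in> borel_measurable N"
    and b: "\<And>x t. \<bar>a x t\<bar> \<le> r x * q t" and q0: "\<And>t. q t \<ge> 0"
    and p: "integrable M (\<lambda>x. \<bar>f x\<bar> * r x)" and q: "integrable N (\<lambda>t. (q t)\<^sup>2)"
  shows "(\<integral>t. (\<integral>x. a x t * f x \<partial>M)\<^sup>2 \<partial>N) = (\<integral>x. f x * (\<integral>y. (\<integral>t. a x t * a y t \<partial>N) * f y \<partial>M) \<partial>M)"
    and "integrable N (\<lambda>t. (\<integral>x. a x t * f x \<partial>M)\<^sup>2)"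
    and "\<And>x. (\<integral>t. a x t * (\<integral>y. a y t * f y \<partial>M) \<partial>N) = (\<integral>y. (\<integral>t. a x t * a y t \<partial>N) * f y \<partial>M)"
proof -
  interpret sigma_finite_measure M by (fact M(1))
  interpret N: sigma_finite_measure N by fact
  have ax [measurable]: "a x \<in> borel_measurable N" for x using measurable_Pair2[OF a, of x] M by simp
  define P where "P = (\<integral>x. \<bar>f x\<bar> * r x \<partial>M)"
  define A where "A = (\<lambda>t. \<integral>y. a y t * f y \<partial>M)"
  have r0: "r x * q t \<ge> 0" for x t using b[of x t] by linarith
  have [measurable]: "A \<in> borel_measurable N" unfolding A_def by measurable
  have fx: "\<bar>f x\<bar> * r x * q t \<ge> 0" for x t using mult_nonneg_nonneg[OF _ r0, of "\<bar>f x\<bar>"] by (simp add: mult.assoc)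
  have A: "\<bar>A t\<bar> \<le> P * q t" for t
  proof -
    have "norm (A t) \<le> (\<integral>x. \<bar>f x\<bar> * r x * q t \<partial>M)"
      unfolding A_def
    proof (rule integral_norm_bound[THEN order_trans], rule integral_mono_AE')
      show "AE x in M. norm (a x t * f x) \<le> \<bar>f x\<bar> * r x * q t"
      proof (rule AE_I2)
        fix x show "norm (a x t * f x) \<le> \<bar>f x\<bar> * r x * q t"
          using mult_left_mono[OF b[of x t], of "\<bar>f x\<bar>"] by (simp add: abs_mult ac_simps)
      qed
    qed (use p fx in auto)
    then show ?thesis by (simp add: P_def)
  qed
  have "(\<lambda>t. (A t)\<^sup>2) = (\<lambda>t. \<integral>x. (A t * a x t) * f x \<partial>M)"
    by (simp add: A_def power2_eq_square mult.assoc)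
  then have "(\<integral>t. (A t)\<^sup>2 \<partial>N) = (\<integral>t. (\<integral>x. A t * a x t * f x \<partial>M) \<partial>N)" by simp
  also have "\<dots> = (\<integral>x. (\<integral>t. A t * a x t * f x \<partial>N) \<partial>M)"
  proof (rule Fubini_product_bound(1)[OF M(1) N, symmetric])
    show "integrable M (\<lambda>x. \<bar>f x\<bar> * r x * P)" using p by (intro integrable_mult_left)
    fix x t
    have "norm (A t * a x t * f x) \<le> (P * q t) * (r x * q t) * \<bar>f x\<bar>"
      unfolding real_norm_def abs_mult using r0 A[of t]
      by (intro mult_right_mono mult_mono A b) auto
    then show "norm (A t * a x t * f x) \<le> \<bar>f x\<bar> * r x * P * (q t)\<^sup>2" by (simp add: power2_eq_square ac_simps)
  qed (use q in measurable)
  also have "\<dots> = (\<integral>x. f x * (\<integral>t. a x t * A t \<partial>N) \<partial>M)"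
  proof (rule Bochner_Integration.integral_cong[OF refl])
    fix x
    have "(\<lambda>t. A t * a x t * f x) = (\<lambda>t. f x * (a x t * A t))" by (simp add: ac_simps)
    then show "(\<integral>t. A t * a x t * f x \<partial>N) = f x * (\<integral>t. a x t * A t \<partial>N)" by simp
  qed
  finally have 1: "(\<integral>t. (A t)\<^sup>2 \<partial>N) = (\<integral>x. f x * (\<integral>t. a x t * A t \<partial>N) \<partial>M)" .
  show 2: "(\<integral>t. a x t * (\<integral>y. a y t * f y \<partial>M) \<partial>N) = (\<integral>y. (\<integral>t. a x t * a y t \<partial>N) * f y \<partial>M)" for x
  proof -
    have "(\<integral>t. a x t * (\<integral>y. a y t * f y \<partial>M) \<partial>N) = (\<integral>t. (\<integral>y. a x t * a y t * f y \<partial>M) \<partial>N)" by (simp add: mult.assoc)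
    also have "\<dots> = (\<integral>y. (\<integral>t. a x t * a y t * f y \<partial>N) \<partial>M)"
    proof (rule Fubini_product_bound(1)[OF M(1) N, symmetric])
      show "integrable M (\<lambda>y. \<bar>f y\<bar> * r y * r x)" using p by (intro integrable_mult_left)
      fix y t
      have "norm (a x t * a y t * f y) \<le> (r x * q t) * (r y * q t) * \<bar>f y\<bar>"
        unfolding real_norm_def abs_mult using r0
        by (intro mult_right_mono mult_mono b) auto
      then show "norm (a x t * a y t * f y) \<le> \<bar>f y\<bar> * r y * r x * (q t)\<^sup>2" by (simp add: power2_eq_square ac_simps)
      show "(\<lambda>(y, t). a x t * a y t * f y) \<in> borel_measurable (M \<Otimes>\<^sub>M N)" by measurable
    qed (rule q)
    finally show ?thesis by simp
  qed
  show "(\<integral>t. (\<integral>x. a x t * f x \<partial>M)\<^sup>2 \<partial>N) = (\<integral>x. f x * (\<integral>y. (\<integral>t. a x t * a y t \<partial>N) * f y \<partial>M) \<partial>M)"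
    using 1 by (simp add: A_def 2)
  have "integrable N (\<lambda>t. (A t)\<^sup>2)"
  proof (rule integrable_dominated[OF integrable_mult_right[OF q, of "P\<^sup>2"]])
    fix t
    have "(A t)\<^sup>2 \<le> (P * q t)\<^sup>2" using A[of t] by (metis abs_le_square_iff abs_of_nonneg abs_ge_zero order_trans)
    then show "norm ((A t)\<^sup>2) \<le> P\<^sup>2 * (q t)\<^sup>2" by (simp add: power_mult_distrib)
  qed measurable
  then show "integrable N (\<lambda>t. (\<integral>x. a x t * f x \<partial>M)\<^sup>2)" by (simp add: A_def)
qed

section \<open>Fourier inversion and the weighted Airy transform\<close>

lemma gaussian_fourier:
  fixes c x :: real
  assumes "c > 0"
  shows "(\<integral>k. exp (\<i> * of_real (k * x)) * of_real (exp (- c * k\<^sup>2)) \<partial>lborel) = of_real (sqrt (pi / c) * exp (- x\<^sup>2 / (4 * c)))"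
proof -
  define s where "s = sqrt (2 * c)"
  have s: "s > 0" "s\<^sup>2 = 2 * c" using assms by (auto simp: s_def)
  have "char std_normal_distribution (x / s) = of_real (exp (- ((x / s)\<^sup>2) / 2))"
    using char_std_normal_distribution by metis
  also have "- ((x / s)\<^sup>2) / 2 = - x\<^sup>2 / (4 * c)" by (simp add: power_divide s)
  also have "char std_normal_distribution (x / s) = (\<integral>y. std_normal_density y *\<^sub>R iexp (x / s * y) \<partial>lborel)"
    unfolding char_def by (subst integral_density) (auto simp: normal_density_nonneg)
  also have "\<dots> = s *\<^sub>R (\<integral>k. std_normal_density (0 + s * k) *\<^sub>R iexp (x / s * (0 + s * k)) \<partial>lborel)"
    using s by (subst lborel_integral_real_affine[of s _ 0]) auto
  also have "(\<lambda>k. std_normal_density (0 + s * k) *\<^sub>R iexp (x / s * (0 + s * k)))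
     = (\<lambda>k. of_real (1 / sqrt (2 * pi)) * (exp (\<i> * of_real (k * x)) * of_real (exp (- c * k\<^sup>2))))"
    using s by (auto simp: std_normal_density_def fun_eq_iff power_mult_distrib scaleR_conv_of_real mult.commute)
  finally have "of_real (exp (- x\<^sup>2 / (4 * c))) = of_real (s / sqrt (2 * pi)) * (\<integral>k. exp (\<i> * of_real (k * x)) * of_real (exp (- c * k\<^sup>2)) \<partial>lborel)"
    by (simp add: scaleR_conv_of_real)
  moreover have "s / sqrt (2 * pi) = 1 / sqrt (pi / c)"
    using assms by (simp add: s_def real_sqrt_divide real_sqrt_mult)
  ultimately show ?thesis using assms s by (simp add: field_simps)
qed

text \<open>A Gaussian cutoff in \<open>t\<close>, of width tending to infinity, makes Fubini
  applicable. On the other side it becomes a normal density centred at \<open>\<kappa>\<close> with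
  deviation \<open>d n\<close>, an approximate identity for the bounded continuous function
  \<open>h\<close>.\<close>

lemma fourier_inversion:
  fixes h :: "real \<Rightarrow> complex"
  assumes h: "integrable lborel h" and cont: "continuous_on UNIV h" and bd: "\<And>k. norm (h k) \<le> B"
    and g: "\<And>t. g t = (\<integral>k. h k * exp (\<i> * of_real (k * t)) \<partial>lborel) / (2 * pi)"
    and gi: "integrable lborel g"
  shows "(\<integral>t. g t * exp (- \<i> * of_real (\<kappa> * t)) \<partial>lborel) = h \<kappa>"
proof -
  have [measurable]: "h \<in> borel_measurable borel" "g \<in> borel_measurable borel" using h gi by auto
  define d where "d = (\<lambda>n. 1 / real (Suc n))"
  have d: "d n > 0" for n by (simp add: d_def)
  have d0: "d \<longlonglongrightarrow> 0" unfolding d_def using LIMSEQ_inverse_real_of_nat by (simp add: inverse_eq_divide)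
  define F where "F = (\<lambda>n. \<integral>t. g t * exp (- \<i> * of_real (\<kappa> * t)) * of_real (exp (- ((d n)\<^sup>2 / 2) * t\<^sup>2)) \<partial>lborel)"
  have 1: "F \<longlonglongrightarrow> (\<integral>t. g t * exp (- \<i> * of_real (\<kappa> * t)) \<partial>lborel)"
    unfolding F_def
  proof (rule integral_dominated_convergence[where w = "\<lambda>t. norm (g t)"])
    show "AE t in lborel. (\<lambda>n. g t * exp (- \<i> * of_real (\<kappa> * t)) * of_real (exp (- ((d n)\<^sup>2 / 2) * t\<^sup>2))) \<longlonglongrightarrow> g t * exp (- \<i> * of_real (\<kappa> * t))"
    proof (rule AE_I2)
      fix t
      have "(\<lambda>n. g t * exp (- \<i> * of_real (\<kappa> * t)) * of_real (exp (- ((d n)\<^sup>2 / 2) * t\<^sup>2))) \<longlonglongrightarrow> g t * exp (- \<i> * of_real (\<kappa> * t)) * of_real (exp (- (0\<^sup>2 / 2) * t\<^sup>2))"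
        by (intro tendsto_intros d0) auto
      then show "(\<lambda>n. g t * exp (- \<i> * of_real (\<kappa> * t)) * of_real (exp (- ((d n)\<^sup>2 / 2) * t\<^sup>2))) \<longlonglongrightarrow> g t * exp (- \<i> * of_real (\<kappa> * t))" by simp
    qed
    show "AE t in lborel. norm (g t * exp (- \<i> * of_real (\<kappa> * t)) * of_real (exp (- ((d n)\<^sup>2 / 2) * t\<^sup>2))) \<le> norm (g t)" for n
      by (rule AE_I2) (auto simp: norm_mult mult_left_le)
  qed (use gi in auto)
  have 2: "F n = (\<integral>u. h (\<kappa> + d n * u) * of_real (std_normal_density u) \<partial>lborel)" for n
  proof -
    define c where "c = (d n)\<^sup>2 / 2"
    have c: "c > 0" using less_imp_neq[OF d[of n], symmetric] by (simp add: c_def)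
    have "F n = (\<integral>t. (\<integral>k. h k * exp (\<i> * of_real (k * t)) * (exp (- \<i> * of_real (\<kappa> * t)) * of_real (exp (- c * t\<^sup>2)) / (2 * pi)) \<partial>lborel) \<partial>lborel)"
      unfolding F_def g c_def
      by (intro Bochner_Integration.integral_cong refl) (simp only: integral_mult_left_zero, simp)
    also have "\<dots> = (\<integral>k. (\<integral>t. h k * exp (\<i> * of_real (k * t)) * (exp (- \<i> * of_real (\<kappa> * t)) * of_real (exp (- c * t\<^sup>2)) / (2 * pi)) \<partial>lborel) \<partial>lborel)"
    proof (rule Fubini_product_bound(1)[symmetric, where p = "\<lambda>k. norm (h k)" and q = "\<lambda>t. exp (- c * t\<^sup>2)"])
      show "integrable lborel (\<lambda>t. exp (- c * t\<^sup>2))" using c by (rule integrable_gaussian)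
      fix k t :: real
      have "norm (h k * exp (\<i> * of_real (k * t)) * (exp (- \<i> * of_real (\<kappa> * t)) * of_real (exp (- c * t\<^sup>2)) / (2 * pi))) = norm (h k) * exp (- c * t\<^sup>2) / (2 * pi)"
        by (simp add: norm_mult norm_divide)
      also have "\<dots> \<le> norm (h k) * exp (- c * t\<^sup>2)"
        using pi_ge_two mult_left_mono[of 1 "2 * pi" "norm (h k) * exp (- c * t\<^sup>2)"] by (simp add: divide_le_eq)
      finally show "norm (h k * exp (\<i> * of_real (k * t)) * (exp (- \<i> * of_real (\<kappa> * t)) * of_real (exp (- c * t\<^sup>2)) / (2 * pi))) \<le> norm (h k) * exp (- c * t\<^sup>2)" .
    qed (use h in \<open>auto intro: lborel.sigma_finite_measure_axioms\<close>)
    also have "\<dots> = (\<integral>k. h k / (2 * pi) * (\<integral>t. exp (\<i> * of_real (t * (k - \<kappa>))) * of_real (exp (- c * t\<^sup>2)) \<partial>lborel) \<partial>lborel)"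
    proof (rule Bochner_Integration.integral_cong[OF refl])
      fix k
      have eq: "h k * exp (\<i> * of_real (k * t)) * (exp (- \<i> * of_real (\<kappa> * t)) * of_real (exp (- c * t\<^sup>2)) / (2 * pi))
         = h k / (2 * pi) * (exp (\<i> * of_real (t * (k - \<kappa>))) * of_real (exp (- c * t\<^sup>2)))" for t
      proof -
        have "exp (\<i> * of_real (k * t)) * exp (- \<i> * of_real (\<kappa> * t)) = exp (\<i> * of_real (t * (k - \<kappa>)))"
          unfolding exp_add[symmetric] by (simp add: algebra_simps)
        then show ?thesis by (simp add: field_simps)
      qed
      show "(\<integral>t. h k * exp (\<i> * of_real (k * t)) * (exp (- \<i> * of_real (\<kappa> * t)) * of_real (exp (- c * t\<^sup>2)) / (2 * pi)) \<partial>lborel)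
        = h k / (2 * pi) * (\<integral>t. exp (\<i> * of_real (t * (k - \<kappa>))) * of_real (exp (- c * t\<^sup>2)) \<partial>lborel)"
        by (simp only: eq integral_mult_right_zero)
    qed
    also have "\<dots> = (\<integral>k. h k / (2 * pi) * of_real (sqrt (pi / c) * exp (- (k - \<kappa>)\<^sup>2 / (4 * c))) \<partial>lborel)"
      by (simp only: gaussian_fourier[OF c])
    also have "\<dots> = d n *\<^sub>R (\<integral>u. h (\<kappa> + d n * u) / (2 * pi) * of_real (sqrt (pi / c) * exp (- (\<kappa> + d n * u - \<kappa>)\<^sup>2 / (4 * c))) \<partial>lborel)"
      using d[of n] by (subst lborel_integral_real_affine[of "d n" _ \<kappa>]) auto
    also have "\<dots> = (\<integral>u. d n *\<^sub>R (h (\<kappa> + d n * u) / (2 * pi) * of_real (sqrt (pi / c) * exp (- (\<kappa> + d n * u - \<kappa>)\<^sup>2 / (4 * c)))) \<partial>lborel)"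
      by simp
    also have "\<dots> = (\<integral>u. h (\<kappa> + d n * u) * of_real (std_normal_density u) \<partial>lborel)"
    proof (rule Bochner_Integration.integral_cong[OF refl])
      fix u
      have e: "- (\<kappa> + d n * u - \<kappa>)\<^sup>2 / (4 * c) = - u\<^sup>2 / 2" using less_imp_neq[OF d[of n], symmetric] by (simp add: c_def power_mult_distrib)
      have sq: "sqrt (pi / c) = sqrt (2 * pi) / d n"
        using d[of n] by (simp add: c_def real_sqrt_divide real_sqrt_mult)
      have "sqrt (2 * pi) * sqrt (2 * pi) = 2 * pi" by simp
      then have "d n / (2 * pi) * sqrt (pi / c) = 1 / sqrt (2 * pi)"
        unfolding sq using less_imp_neq[OF d[of n], symmetric] by (simp add: nonzero_divide_eq_eq real_div_sqrt)
      then have "d n / (2 * pi) * (sqrt (pi / c) * exp (- (\<kappa> + d n * u - \<kappa>)\<^sup>2 / (4 * c))) = std_normal_density u"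
        unfolding std_normal_density_def e mult.assoc[symmetric] by (simp only: )
      then have "h (\<kappa> + d n * u) * of_real (d n / (2 * pi) * (sqrt (pi / c) * exp (- (\<kappa> + d n * u - \<kappa>)\<^sup>2 / (4 * c)))) = h (\<kappa> + d n * u) * of_real (std_normal_density u)"
        by simp
      then show "d n *\<^sub>R (h (\<kappa> + d n * u) / (2 * pi) * of_real (sqrt (pi / c) * exp (- (\<kappa> + d n * u - \<kappa>)\<^sup>2 / (4 * c)))) = h (\<kappa> + d n * u) * of_real (std_normal_density u)"
        by (simp add: scaleR_conv_of_real field_simps)
    qed
    finally show ?thesis .
  qed
  have "F \<longlonglongrightarrow> (\<integral>u. h \<kappa> * of_real (std_normal_density u) \<partial>lborel)"
    unfolding 2
  proof (rule integral_dominated_convergence[where w = "\<lambda>u. B * std_normal_density u"])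
    show "AE u in lborel. (\<lambda>n. h (\<kappa> + d n * u) * of_real (std_normal_density u)) \<longlonglongrightarrow> h \<kappa> * of_real (std_normal_density u)"
    proof (rule AE_I2)
      fix u
      have "(\<lambda>n. \<kappa> + d n * u) \<longlonglongrightarrow> \<kappa> + 0 * u" by (intro tendsto_intros d0)
      then have "(\<lambda>n. h (\<kappa> + d n * u)) \<longlonglongrightarrow> h \<kappa>"
        using cont by (intro continuous_on_tendsto_compose[OF cont]) auto
      then show "(\<lambda>n. h (\<kappa> + d n * u) * of_real (std_normal_density u)) \<longlonglongrightarrow> h \<kappa> * of_real (std_normal_density u)"
        by (intro tendsto_intros)
    qed
    show "AE u in lborel. norm (h (\<kappa> + d n * u) * of_real (std_normal_density u)) \<le> B * std_normal_density u" for n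
      by (rule AE_I2) (auto simp: norm_mult normal_density_nonneg intro!: mult_right_mono bd)
    show "integrable lborel (\<lambda>u. B * std_normal_density u)" by (intro integrable_mult_right) (simp add: integrable_normal_density)
  qed measurable
  also have "(\<integral>u. h \<kappa> * of_real (std_normal_density u) \<partial>lborel) = h \<kappa>"
    using integral_normal_density[of 1 0] by (simp add: integrable_normal_density)
  finally show ?thesis using 1 LIMSEQ_unique by blast
qed

definition airy :: "real \<Rightarrow> real" where "airy x = Re (Airy (of_real x))"
definition airy' :: "real \<Rightarrow> real" where "airy' x = Re (Airy' (of_real x))"

lemma of_real_airy: "of_real (airy x) = Airy (of_real x)"
  using Airy_conj_real[of x] by (simp add: airy_def)

lemma Airy_continuous_on [continuous_intros]:
  assumes "continuous_on A f"
  shows "continuous_on A (\<lambda>x. Airy (f x))" "continuous_on A (\<lambda>x. Airy' (f x))"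
proof -
  have "continuous_on UNIV Airy" "continuous_on UNIV Airy'"
    using DERIV_continuous_on[of UNIV Airy Airy', OF has_field_derivative_at_within[OF Airy_deriv]]
      DERIV_continuous_on[of UNIV Airy', OF has_field_derivative_at_within[OF Airy'_deriv]] by auto
  then show "continuous_on A (\<lambda>x. Airy (f x))" "continuous_on A (\<lambda>x. Airy' (f x))"
    using assms by (auto intro: continuous_on_compose2)
qed

lemma Airy_holomorphic_on [holomorphic_intros]:
  assumes "f holomorphic_on A"
  shows "(\<lambda>x. Airy (f x)) holomorphic_on A" "(\<lambda>x. Airy' (f x)) holomorphic_on A"
proof -
  have "Airy holomorphic_on UNIV" "Airy' holomorphic_on UNIV"
    using Airy_deriv Airy'_deriv by (auto simp: holomorphic_on_open)
  then show "(\<lambda>x. Airy (f x)) holomorphic_on A" "(\<lambda>x. Airy' (f x)) holomorphic_on A"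
    using assms by (auto intro: holomorphic_on_compose_gen[unfolded comp_def, where t = UNIV])
qed

lemma Airy_measurable [measurable]: "Airy \<in> borel_measurable borel" "Airy' \<in> borel_measurable borel"
  by (auto intro!: borel_measurable_continuous_onI continuous_intros)

lemma airy_measurable [measurable]: "airy \<in> borel_measurable borel" "airy' \<in> borel_measurable borel"
  unfolding airy_def[abs_def] airy'_def[abs_def] by measurable

lemma airy_vector_deriv: "((\<lambda>x. Airy (of_real x)) has_vector_derivative Airy' (of_real x)) (at x)"
  "((\<lambda>x. Airy' (of_real x)) has_vector_derivative of_real x * Airy (of_real x)) (at x)"
  by (auto intro!: has_vector_derivative_real_field Airy_deriv Airy'_deriv)

lemma of_real_airy': "of_real (airy' x) = Airy' (of_real x)"
proof -
  have "((\<lambda>x. Im (Airy (of_real x))) has_vector_derivative Im (Airy' (of_real x))) (at x)"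
    by (rule bounded_linear.has_vector_derivative[OF bounded_linear_Im airy_vector_deriv(1)])
  moreover have "(\<lambda>x. Im (Airy (of_real x))) = (\<lambda>x. 0)"
    using Airy_conj_real by (simp add: complex_is_Real_iff)
  ultimately have "Im (Airy' (of_real x)) = 0"
    using vector_derivative_unique_at[of "\<lambda>x. 0" _ x 0] by simp
  then show ?thesis by (simp add: airy'_def complex_eq_iff)
qed

lemma airy_bound:
  assumes "\<eta> > 0"
  shows "\<exists>C>0. \<forall>x. \<bar>airy x\<bar> \<le> C * exp (- \<eta> * x) \<and> \<bar>airy' x\<bar> \<le> C * exp (- \<eta> * x)"
proof -
  obtain C where C: "C > 0" "\<And>z. \<bar>Im z\<bar> \<le> 0 \<Longrightarrow> norm (Airy z) \<le> C * exp (- \<eta> * Re z) \<and> norm (Airy' z) \<le> C * exp (- \<eta> * Re z)"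
    using Airy_bound[OF assms, of 0] by blast
  have "\<bar>airy x\<bar> = norm (Airy (of_real x))" "\<bar>airy' x\<bar> = norm (Airy' (of_real x))" for x
    by (simp_all add: of_real_airy[symmetric] of_real_airy'[symmetric])
  then show ?thesis using C(1) C(2)[of "of_real _"] by (intro exI[of _ C]) auto
qed

text \<open>The weight \<open>exp (\<eta> * t)\<close> is compensated by two Airy bounds: rate
  \<open>2 * \<eta>\<close> for \<open>t \<ge> 0\<close> and rate \<open>\<eta> / 2\<close> for
  \<open>t < 0\<close>. The product then decays in both directions.\<close>

lemma airy_two_sided_bound:
  assumes "\<eta> > 0"
  shows "\<exists>C\<ge>0. \<forall>x t. exp (\<eta> * t) * \<bar>airy (x + t)\<bar> \<le> C * (exp (- 2 * \<eta> * x) + exp (- (\<eta> / 2) * x)) * exp (- (\<eta> / 2) * \<bar>t\<bar>)"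
proof -
  obtain C1 where C1: "C1 > 0" "\<And>x. \<bar>airy x\<bar> \<le> C1 * exp (- (2 * \<eta>) * x)" using airy_bound[of "2 * \<eta>"] assms by auto
  obtain C2 where C2: "C2 > 0" "\<And>x. \<bar>airy x\<bar> \<le> C2 * exp (- (\<eta> / 2) * x)" using airy_bound[of "\<eta> / 2"] assms by auto
  have "exp (\<eta> * t) * \<bar>airy (x + t)\<bar> \<le> (C1 + C2) * (exp (- 2 * \<eta> * x) + exp (- (\<eta> / 2) * x)) * exp (- (\<eta> / 2) * \<bar>t\<bar>)" for x t
  proof (cases "t \<ge> 0")
    case True
    have "exp (\<eta> * t) * \<bar>airy (x + t)\<bar> \<le> exp (\<eta> * t) * (C1 * exp (- (2 * \<eta>) * (x + t)))"
      using C1 by (intro mult_left_mono) auto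
    also have "\<dots> = C1 * exp (- 2 * \<eta> * x) * exp (- \<eta> * t)" by (simp add: exp_add[symmetric] algebra_simps)
    also have "\<dots> \<le> (C1 + C2) * (exp (- 2 * \<eta> * x) + exp (- (\<eta> / 2) * x)) * exp (- (\<eta> / 2) * \<bar>t\<bar>)"
      using C1 C2 assms True by (intro mult_mono) (auto simp: mult_right_mono)
    finally show ?thesis .
  next
    case False
    have "exp (\<eta> * t) * \<bar>airy (x + t)\<bar> \<le> exp (\<eta> * t) * (C2 * exp (- (\<eta> / 2) * (x + t)))"
      using C2 by (intro mult_left_mono) auto
    also have "\<dots> = C2 * exp (- (\<eta> / 2) * x) * exp (- (\<eta> / 2) * \<bar>t\<bar>)" using False by (simp add: exp_add[symmetric] field_simps)
    also have "\<dots> \<le> (C1 + C2) * (exp (- 2 * \<eta> * x) + exp (- (\<eta> / 2) * x)) * exp (- (\<eta> / 2) * \<bar>t\<bar>)"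
      using C1 C2 by (intro mult_mono) auto
    finally show ?thesis .
  qed
  then show ?thesis using C1 C2 by (intro exI[of _ "C1 + C2"]) auto
qed

text \<open>Each weighted factor is the Fourier transform of a damped cubic phase at height
  \<open>\<epsilon> / 2\<close>. By inversion the integral pairs the phases at \<open>k\<close> and
  \<open>- k\<close>, so their cubic parts cancel and a Gaussian in \<open>k\<close> remains, whose
  transform is the heat kernel. The constant \<open>\<epsilon> ^ 3 / 12\<close> is twice
  \<open>(\<epsilon> / 2) ^ 3 / 3\<close>.\<close>

lemma airy_heat_kernel:
  fixes \<epsilon> x y :: real
  assumes "\<epsilon> > 0"
  shows "(\<integral>t. (exp (\<epsilon> / 2 * t) * airy (x + t)) * (exp (\<epsilon> / 2 * t) * airy (y + t)) \<partial>lborel)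
     = exp (\<epsilon> ^ 3 / 12 - \<epsilon> * (x + y) / 2 - (x - y)\<^sup>2 / (4 * \<epsilon>)) / sqrt (4 * pi * \<epsilon>)"
proof -
  define \<eta> where "\<eta> = \<epsilon> / 2"
  have \<eta>: "\<eta> > 0" using assms by (simp add: \<eta>_def)
  define h where "h = (\<lambda>y k::real. airy_phase (of_real y) (of_real k + \<i> * of_real \<eta>))"
  define g where "g = (\<lambda>y t. complex_of_real (exp (\<eta> * t) * airy (y + t)))"
  have hi: "integrable lborel (h y)" for y
    unfolding h_def using integrable_airy_int[of "of_real \<eta>" 0] \<eta> by simp
  have nh: "norm (h y k) = exp (- \<eta> * k\<^sup>2 + \<eta> ^ 3 / 3 - \<eta> * y)" for y k
    by (simp add: h_def norm_airy_phase)
  have hb: "norm (h y k) \<le> exp (\<eta> ^ 3 / 3 - \<eta> * y)" for y k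
    unfolding nh using \<eta> by simp
  have hc: "continuous_on UNIV (h y)" for y
    unfolding h_def airy_phase_def by (intro continuous_intros) auto
  have gh: "g y t = (\<integral>k. h y k * exp (\<i> * of_real (k * t)) \<partial>lborel) / (2 * pi)" for y t
  proof -
    have "airy_phase (of_real (y + t)) (of_real k + \<i> * of_real \<eta>) = h y k * exp (\<i> * of_real (k * t)) * exp (- of_real (\<eta> * t))" for k
      unfolding h_def airy_phase_def exp_add[symmetric] by (simp add: algebra_simps)
    then have "Airy (of_real (y + t)) = (\<integral>k. h y k * exp (\<i> * of_real (k * t)) * exp (- of_real (\<eta> * t)) \<partial>lborel) / (2 * pi)"
      using Airy_eq[of "of_real \<eta>"] \<eta> by (simp add: airy_int_def)
    also have "\<dots> = exp (- of_real (\<eta> * t)) * ((\<integral>k. h y k * exp (\<i> * of_real (k * t)) \<partial>lborel) / (2 * pi))" by simp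
    finally have "exp (of_real (\<eta> * t)) * Airy (of_real (y + t)) = (\<integral>k. h y k * exp (\<i> * of_real (k * t)) \<partial>lborel) / (2 * pi)"
      by (simp add: exp_minus field_simps)
    then show ?thesis by (simp add: g_def of_real_airy exp_of_real[symmetric])
  qed
  obtain C where C: "C \<ge> 0" "\<And>x t. exp (\<eta> * t) * \<bar>airy (x + t)\<bar> \<le> C * (exp (- 2 * \<eta> * x) + exp (- (\<eta> / 2) * x)) * exp (- (\<eta> / 2) * \<bar>t\<bar>)"
    using airy_two_sided_bound[OF \<eta>] by blast
  have gi: "integrable lborel (g y)" for y
  proof (rule integrable_dominated[OF integrable_mult_right[OF integrable_exp_abs[of "\<eta> / 2"]]])
    show "norm (g y t) \<le> C * (exp (- 2 * \<eta> * y) + exp (- (\<eta> / 2) * y)) * exp (- (\<eta> / 2) * \<bar>t\<bar>)" for t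
      using C(2)[of t y] unfolding g_def norm_of_real abs_mult by simp
  qed (use \<eta> in \<open>auto simp: g_def\<close>)
  have inv: "(\<integral>t. g y t * exp (\<i> * of_real (k * t)) \<partial>lborel) = h y (- k)" for y k
    using fourier_inversion[OF hi hc hb gh gi, of y "- k"] by simp
  have [measurable]: "g y \<in> borel_measurable borel" "h y \<in> borel_measurable borel" for y using gi hi by auto
  have "of_real (\<integral>t. (exp (\<epsilon> / 2 * t) * airy (x + t)) * (exp (\<epsilon> / 2 * t) * airy (y + t)) \<partial>lborel) = (\<integral>t. g x t * g y t \<partial>lborel)"
    by (subst integral_complex_of_real[symmetric]) (simp add: g_def \<eta>_def)
  also have "\<dots> = (\<integral>t. (\<integral>k. h x k * exp (\<i> * of_real (k * t)) * (g y t / (2 * pi)) \<partial>lborel) \<partial>lborel)"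
    by (subst gh) simp
  also have "\<dots> = (\<integral>k. (\<integral>t. h x k * exp (\<i> * of_real (k * t)) * (g y t / (2 * pi)) \<partial>lborel) \<partial>lborel)"
  proof (rule Fubini_product_bound(1)[symmetric, where p = "\<lambda>k. norm (h x k)" and q = "\<lambda>t. norm (g y t)"])
    fix k t :: real
    have "norm (h x k * exp (\<i> * of_real (k * t)) * (g y t / (2 * pi))) = norm (h x k) * norm (g y t) / (2 * pi)"
      by (simp add: norm_mult norm_divide)
    also have "\<dots> \<le> norm (h x k) * norm (g y t)"
      using pi_ge_two mult_left_mono[of 1 "2 * pi" "norm (h x k) * norm (g y t)"] by (simp add: divide_le_eq)
    finally show "norm (h x k * exp (\<i> * of_real (k * t)) * (g y t / (2 * pi))) \<le> norm (h x k) * norm (g y t)" .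
  qed (use hi gi in \<open>auto intro: lborel.sigma_finite_measure_axioms\<close>)
  also have "\<dots> = (\<integral>k. h x k / (2 * pi) * (\<integral>t. g y t * exp (\<i> * of_real (k * t)) \<partial>lborel) \<partial>lborel)"
  proof (rule Bochner_Integration.integral_cong[OF refl])
    fix k
    have "(\<lambda>t. h x k * exp (\<i> * of_real (k * t)) * (g y t / (2 * pi))) = (\<lambda>t. h x k / (2 * pi) * (g y t * exp (\<i> * of_real (k * t))))"
      by (simp add: fun_eq_iff)
    then show "(\<integral>t. h x k * exp (\<i> * of_real (k * t)) * (g y t / (2 * pi)) \<partial>lborel) = h x k / (2 * pi) * (\<integral>t. g y t * exp (\<i> * of_real (k * t)) \<partial>lborel)"
      by simp
  qed
  also have "\<dots> = (\<integral>k. of_real (exp (\<epsilon> ^ 3 / 12 - \<epsilon> * (x + y) / 2) / (2 * pi)) * (exp (\<i> * of_real (k * (x - y))) * of_real (exp (- \<epsilon> * k\<^sup>2))) \<partial>lborel)"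
  proof (rule Bochner_Integration.integral_cong[OF refl])
    fix k
    have "h x k * h y (- k) = exp (of_real (\<epsilon> ^ 3 / 12 - \<epsilon> * (x + y) / 2)) * (exp (\<i> * of_real (k * (x - y))) * exp (of_real (- \<epsilon> * k\<^sup>2)))"
      unfolding h_def airy_phase_def exp_add[symmetric] \<eta>_def
      by (rule arg_cong[of _ _ exp]) (simp add: field_simps power2_eq_square power3_eq_cube)
    then show "h x k / (2 * pi) * (\<integral>t. g y t * exp (\<i> * of_real (k * t)) \<partial>lborel)
      = of_real (exp (\<epsilon> ^ 3 / 12 - \<epsilon> * (x + y) / 2) / (2 * pi)) * (exp (\<i> * of_real (k * (x - y))) * of_real (exp (- \<epsilon> * k\<^sup>2)))"
      unfolding inv exp_of_real by (simp add: field_simps)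
  qed
  also have "\<dots> = of_real (exp (\<epsilon> ^ 3 / 12 - \<epsilon> * (x + y) / 2) / (2 * pi)) * of_real (sqrt (pi / \<epsilon>) * exp (- (x - y)\<^sup>2 / (4 * \<epsilon>)))"
    by (subst gaussian_fourier[OF assms, symmetric]) simp
  also have "\<dots> = of_real (exp (\<epsilon> ^ 3 / 12 - \<epsilon> * (x + y) / 2) / (2 * pi) * (sqrt (pi / \<epsilon>) * exp (- (x - y)\<^sup>2 / (4 * \<epsilon>))))"
    by (simp only: of_real_mult)
  finally have "(\<integral>t. (exp (\<epsilon> / 2 * t) * airy (x + t)) * (exp (\<epsilon> / 2 * t) * airy (y + t)) \<partial>lborel)
     = exp (\<epsilon> ^ 3 / 12 - \<epsilon> * (x + y) / 2) / (2 * pi) * (sqrt (pi / \<epsilon>) * exp (- (x - y)\<^sup>2 / (4 * \<epsilon>)))"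
    by (simp only: of_real_eq_iff)
  also have "\<dots> = sqrt (pi / \<epsilon>) / (2 * pi) * (exp (\<epsilon> ^ 3 / 12 - \<epsilon> * (x + y) / 2) * exp (- (x - y)\<^sup>2 / (4 * \<epsilon>)))"
    by simp
  also have "sqrt (pi / \<epsilon>) / (2 * pi) = 1 / sqrt (4 * pi * \<epsilon>)"
  proof -
    have "sqrt (pi / \<epsilon>) * sqrt (4 * pi * \<epsilon>) = sqrt ((2 * pi)\<^sup>2)"
      using assms by (subst real_sqrt_mult[symmetric]) (simp add: power2_eq_square)
    then have "sqrt (pi / \<epsilon>) * sqrt (4 * pi * \<epsilon>) = \<bar>2 * pi\<bar>" by (simp only: real_sqrt_abs)
    then have "sqrt (pi / \<epsilon>) * sqrt (4 * pi * \<epsilon>) = 2 * pi" by simp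
    moreover have "sqrt (4 * pi * \<epsilon>) \<noteq> 0" using assms by simp
    ultimately have "sqrt (pi / \<epsilon>) = 2 * pi / sqrt (4 * pi * \<epsilon>)" by (metis nonzero_mult_div_cancel_right)
    then show ?thesis by simp
  qed
  also have "exp (\<epsilon> ^ 3 / 12 - \<epsilon> * (x + y) / 2) * exp (- (x - y)\<^sup>2 / (4 * \<epsilon>)) = exp (\<epsilon> ^ 3 / 12 - \<epsilon> * (x + y) / 2 - (x - y)\<^sup>2 / (4 * \<epsilon>))"
    by (simp add: exp_add[symmetric])
  finally show ?thesis by simp
qed

lemma Airy_superposition_deriv:
  fixes f :: "real \<Rightarrow> complex"
  assumes [measurable]: "f \<in> borel_measurable borel" and f: "\<And>x. norm (f x) \<le> c * exp (- 2 * x)"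
  shows "((\<lambda>z. \<integral>x. Airy (of_real x + z) * f x \<partial>half_line a) has_field_derivative (\<integral>x. Airy' (of_real x + z) * f x \<partial>half_line a)) (at z)"
    and "integrable (half_line a) (\<lambda>x. Airy (of_real x + z) * f x)"
    and "integrable (half_line a) (\<lambda>x. Airy' (of_real x + z) * f x)"
proof -
  have dom: "\<exists>C. \<forall>w\<in>ball z 1. \<forall>x. norm (Airy (of_real x + w) * f x) \<le> C * exp (- 3 * x)" for z
  proof -
    obtain C where C: "C > 0" "\<And>w. \<bar>Im w\<bar> \<le> norm z + 1 \<Longrightarrow> norm (Airy w) \<le> C * exp (- 1 * Re w)"
      using Airy_bound[of 1 "norm z + 1"] by auto
    have "norm (Airy (of_real x + w) * f x) \<le> (C * exp (norm z + 1) * c) * exp (- 3 * x)" if w: "w \<in> ball z 1" for w x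
    proof -
      have "norm w \<le> norm z + 1" using w norm_triangle_ineq2[of w z] by (auto simp: dist_norm norm_minus_commute)
      then have n: "\<bar>Im w\<bar> \<le> norm z + 1" "- Re w \<le> norm z + 1"
        using abs_Im_le_cmod[of w] abs_Re_le_cmod[of w] by linarith+
      have "norm (Airy (of_real x + w)) \<le> C * exp (- 1 * Re (of_real x + w))" using n by (intro C) auto
      also have "\<dots> = C * exp (- Re w) * exp (- x)" by (simp add: exp_add[symmetric])
      also have "\<dots> \<le> C * exp (norm z + 1) * exp (- x)" using C n by (intro mult_right_mono mult_left_mono) auto
      finally have "norm (Airy (of_real x + w) * f x) \<le> (C * exp (norm z + 1) * exp (- x)) * (c * exp (- 2 * x))"
        unfolding norm_mult using f C by (intro mult_mono) auto
      also have "\<dots> = (C * exp (norm z + 1) * c) * (exp (- x) * exp (- 2 * x))" by simp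
      also have "exp (- x) * exp (- 2 * x) = exp (- 3 * x)" by (simp add: exp_add[symmetric])
      finally show ?thesis .
    qed
    then show ?thesis by blast
  qed
  have i3: "integrable (half_line a) (\<lambda>x. C * exp (- 3 * x))" for C :: real
    by (intro integrable_mult_right integrable_exp_half_line) auto
  obtain C where "\<And>x. norm (Airy (of_real x + z) * f x) \<le> C * exp (- 3 * x)" using dom[of z] by force
  then show "integrable (half_line a) (\<lambda>x. Airy (of_real x + z) * f x)"
    by (intro integrable_dominated[OF i3]) auto
  have d: "deriv (\<lambda>z. Airy (of_real x + z) * f x) z = Airy' (of_real x + z) * f x" for x z
  proof (rule DERIV_imp_deriv)
    have "((\<lambda>z. of_real x + z) has_field_derivative 1) (at z)" by (auto intro!: derivative_eq_intros)
    from DERIV_cmult_right[OF DERIV_chain'[where g = Airy, OF this Airy_deriv], of "f x"]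
    show "((\<lambda>z. Airy (of_real x + z) * f x) has_field_derivative Airy' (of_real x + z) * f x) (at z)" by simp
  qed
  have "\<exists>r>0. \<exists>g. integrable (half_line a) g \<and> (\<forall>w\<in>ball z r \<inter> UNIV. \<forall>x\<in>space (half_line a). norm (Airy (of_real x + w) * f x) \<le> g x)" for z
  proof -
    obtain C where "\<forall>w\<in>ball z 1. \<forall>x. norm (Airy (of_real x + w) * f x) \<le> C * exp (- 3 * x)" using dom by blast
    then show ?thesis using i3[of C] by (intro exI[of _ 1] conjI exI[of _ "\<lambda>x. C * exp (- 3 * x)"]) auto
  qed
  note pi = has_field_derivative_parameter_integral[of UNIV z "half_line a" "\<lambda>z x. Airy (of_real x + z) * f x", OF open_UNIV UNIV_I _ _ this, unfolded d]
  show "((\<lambda>z. \<integral>x. Airy (of_real x + z) * f x \<partial>half_line a) has_field_derivative (\<integral>x. Airy' (of_real x + z) * f x \<partial>half_line a)) (at z)"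
    by (rule pi(1)) (auto intro!: holomorphic_intros)
  show "integrable (half_line a) (\<lambda>x. Airy' (of_real x + z) * f x)"
    by (rule pi(2)) (auto intro!: holomorphic_intros)
qed

section \<open>The Airy kernel on a half-line and its resolvent\<close>

definition airy_kernel :: "real \<Rightarrow> real \<Rightarrow> real" where
  "airy_kernel x y = (\<integral>t. airy (x + t) * airy (y + t) \<partial>half_line 0)"

lemma airy_kernel_measurable [measurable]: "(\<lambda>(x, y). airy_kernel x y) \<in> borel_measurable (borel \<Otimes>\<^sub>M borel)"
  unfolding airy_kernel_def by measurable

text \<open>Schur's test: the arithmetic-geometric inequality splits \<open>F x * F y\<close> into
  squares, and in each half the other variable is integrated out against a density of total mass
  1.\<close>

lemma heat_form_bound:
  fixes f :: "real \<Rightarrow> real" and G :: "real \<Rightarrow> real \<Rightarrow> real"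
  assumes [measurable]: "f \<in> borel_measurable borel" "(\<lambda>(x, y). G x y) \<in> borel_measurable (borel \<Otimes>\<^sub>M borel)"
    and f2: "integrable (half_line a) (\<lambda>x. (f x)\<^sup>2)" and s: "s > 0"
    and G: "\<And>x y. a \<le> x \<Longrightarrow> a \<le> y \<Longrightarrow> \<bar>G x y\<bar> \<le> c * normal_density 0 s (x - y)"
  shows "(\<integral>x. f x * (\<integral>y. G x y * f y \<partial>half_line a) \<partial>half_line a) \<le> c * (\<integral>x. (f x)\<^sup>2 \<partial>half_line a)"
proof -
  let ?M = "half_line a"
  interpret MM: pair_sigma_finite ?M ?M ..
  have [measurable]: "G x \<in> borel_measurable borel" for x using measurable_Pair2[OF assms(2), of x] by simp
  \<comment> \<open>\<open>G\<close> is controlled only for arguments at or above \<open>a\<close>,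
    whereas the measure lives on the whole line. The cutoff changes no integral and makes the
    majorant valid at all pairs of points.\<close>
  define F where "F = (\<lambda>x. indicator {a..} x * f x)"
  have [measurable]: "F \<in> borel_measurable borel" unfolding F_def by measurable
  have aeF: "AE x in ?M. f x = F x" using AE_half_line[of a] by eventually_elim (auto simp: F_def)
  have F2: "integrable ?M (\<lambda>x. (F x)\<^sup>2)" 
    using f2 by (rule Bochner_Integration.integrable_cong_AE_imp) (use aeF in \<open>auto elim: AE_mp\<close>)
  have F2': "(\<integral>x. (F x)\<^sup>2 \<partial>?M) = (\<integral>x. (f x)\<^sup>2 \<partial>?M)"
    by (rule integral_cong_AE) (use aeF in \<open>auto elim: AE_mp\<close>)
  have c0: "c \<ge> 0"
  proof -
    have "0 \<le> c * normal_density 0 s (a - a)" using G[of a a] by linarith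
    moreover have "normal_density 0 s (a - a) > 0" using s by (simp add: normal_density_pos)
    ultimately show ?thesis by (simp add: zero_le_mult_iff)
  qed
  define h where "h = (\<lambda>u. normal_density 0 s u)"
  have [measurable]: "h \<in> borel_measurable borel" unfolding h_def by measurable
  have hs: "h (x - y) = h (y - x)" for x y by (simp add: h_def normal_density_def power2_commute)
  have h0: "h u \<ge> 0" for u by (simp add: h_def normal_density_nonneg)
  have hi: "integrable lborel (\<lambda>y. h (x - y))" for x
  proof -
    have "integrable lborel (\<lambda>y. h (x + (-1) * y))"
      by (subst lborel_integrable_real_affine_iff) (use s in \<open>auto simp: h_def integrable_normal_density\<close>)
    then show ?thesis by simp
  qed
  have hI: "integrable ?M (\<lambda>y. h (x - y))" for x by (rule integrable_lborel_half_line[OF hi])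
  have h1: "(\<integral>y. h (x - y) \<partial>?M) \<le> 1" for x
  proof -
    have "(\<integral>y. h (x - y) \<partial>?M) = (\<integral>y. indicator {a..} y *\<^sub>R h (x - y) \<partial>lborel)" by (rule integral_half_line) measurable
    also have "\<dots> \<le> (\<integral>y. h (x - y) \<partial>lborel)"
      using hi h0 by (intro integral_mono integrable_mult_indicator) (auto simp: indicator_def)
    also have "\<dots> = (\<integral>y. h y \<partial>lborel)"
      using lborel_integral_real_affine[of "-1" h x] by simp
    also have "\<dots> = 1" using s by (simp add: h_def integral_normal_density)
    finally show ?thesis .
  qed
  have I1: "integrable (?M \<Otimes>\<^sub>M ?M) (\<lambda>(x, y). (F x)\<^sup>2 * h (x - y))"
  proof (rule MM.Fubini_integrable)
    have "integrable ?M (\<lambda>x. (F x)\<^sup>2 * (\<integral>y. h (x - y) \<partial>?M))"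
      by (rule integrable_dominated[OF F2]) 
         (use h1 h0 in \<open>auto simp: abs_mult intro!: mult_left_le\<close>)
    then show "integrable ?M (\<lambda>x. \<integral>y. norm (case (x, y) of (x, y) \<Rightarrow> (F x)\<^sup>2 * h (x - y)) \<partial>?M)"
      using h0 by (simp add: abs_mult)
    show "AE x in ?M. integrable ?M (\<lambda>y. case (x, y) of (x, y) \<Rightarrow> (F x)\<^sup>2 * h (x - y))"
      using hI by (auto intro!: AE_I2)
  qed measurable
  have I2: "integrable (?M \<Otimes>\<^sub>M ?M) (\<lambda>(x, y). (F y)\<^sup>2 * h (x - y))"
    using MM.integrable_product_swap[OF I1] by (simp add: case_prod_beta' hs)
  have B1: "integral\<^sup>L (?M \<Otimes>\<^sub>M ?M) (\<lambda>(x, y). (F x)\<^sup>2 * h (x - y)) \<le> (\<integral>x. (F x)\<^sup>2 \<partial>?M)"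
  proof -
    have "integral\<^sup>L (?M \<Otimes>\<^sub>M ?M) (\<lambda>(x, y). (F x)\<^sup>2 * h (x - y)) = (\<integral>x. (F x)\<^sup>2 * (\<integral>y. h (x - y) \<partial>?M) \<partial>?M)"
      using MM.integral_fst[OF I1] by simp
    also have "\<dots> \<le> (\<integral>x. (F x)\<^sup>2 \<partial>?M)"
    proof (rule integral_mono_AE')
      show "AE x in ?M. (F x)\<^sup>2 * (\<integral>y. h (x - y) \<partial>?M) \<le> (F x)\<^sup>2" using h1 by (auto intro!: AE_I2 mult_left_le)
    qed (use F2 in auto)
    finally show ?thesis .
  qed
  have B2: "integral\<^sup>L (?M \<Otimes>\<^sub>M ?M) (\<lambda>(x, y). (F y)\<^sup>2 * h (x - y)) \<le> (\<integral>x. (F x)\<^sup>2 \<partial>?M)"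
  proof -
    have "integral\<^sup>L (?M \<Otimes>\<^sub>M ?M) (\<lambda>(x, y). (F y)\<^sup>2 * h (x - y)) = integral\<^sup>L (?M \<Otimes>\<^sub>M ?M) (\<lambda>(x, y). (F x)\<^sup>2 * h (x - y))"
      using MM.integral_product_swap[of "\<lambda>(x, y). (F x)\<^sup>2 * h (x - y)"] I1 by (simp add: case_prod_beta' hs)
    then show ?thesis using B1 by simp
  qed
  have bound: "norm (F x * (G x y * F y)) \<le> c / 2 * ((F x)\<^sup>2 * h (x - y)) + c / 2 * ((F y)\<^sup>2 * h (x - y))" for x y
  proof (cases "a \<le> x \<and> a \<le> y")
    case True
    have "norm (F x * (G x y * F y)) = \<bar>F x * F y\<bar> * \<bar>G x y\<bar>" by (simp add: abs_mult)
    also have "\<dots> \<le> (((F x)\<^sup>2 + (F y)\<^sup>2) / 2) * (c * h (x - y))"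
    proof (rule mult_mono)
      have "0 \<le> (\<bar>F x\<bar> - \<bar>F y\<bar>)\<^sup>2" by simp
      then show "\<bar>F x * F y\<bar> \<le> ((F x)\<^sup>2 + (F y)\<^sup>2) / 2" by (simp add: power2_diff abs_mult)
    qed (use G True in \<open>auto simp: h_def\<close>)
    finally show ?thesis by (simp add: algebra_simps)
  next
    case False
    then have z: "F x * (G x y * F y) = 0" by (auto simp: F_def)
    show ?thesis unfolding z using h0 c0 by simp
  qed
  have I3: "integrable (?M \<Otimes>\<^sub>M ?M) (\<lambda>p. c / 2 * (case p of (x, y) \<Rightarrow> (F x)\<^sup>2 * h (x - y)) + c / 2 * (case p of (x, y) \<Rightarrow> (F y)\<^sup>2 * h (x - y)))"
    by (intro Bochner_Integration.integrable_add integrable_mult_right I1 I2)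
  have I: "integrable (?M \<Otimes>\<^sub>M ?M) (\<lambda>(x, y). F x * (G x y * F y))"
    by (rule integrable_dominated[OF I3]) (measurable, use bound in auto)
  have "(\<integral>x. f x * (\<integral>y. G x y * f y \<partial>?M) \<partial>?M) = (\<integral>x. F x * (\<integral>y. G x y * F y \<partial>?M) \<partial>?M)"
  proof (rule integral_cong_AE)
    have "(\<integral>y. G x y * f y \<partial>?M) = (\<integral>y. G x y * F y \<partial>?M)" for x
    proof (rule integral_cong_AE)
      have "borel_measurable ?M = (borel_measurable borel :: (real \<Rightarrow> real) set)" by (rule measurable_cong_sets) auto
      then show "(\<lambda>y. G x y * f y) \<in> borel_measurable ?M" "(\<lambda>y. G x y * F y) \<in> borel_measurable ?M"
        by (auto intro!: borel_measurable_times)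
      show "AE y in ?M. G x y * f y = G x y * F y" using aeF by (rule eventually_mono) simp
    qed
    then show "AE x in ?M. f x * (\<integral>y. G x y * f y \<partial>?M) = F x * (\<integral>y. G x y * F y \<partial>?M)"
      using aeF by (auto elim: AE_mp)
  qed measurable
  also have "\<dots> = integral\<^sup>L (?M \<Otimes>\<^sub>M ?M) (\<lambda>(x, y). F x * (G x y * F y))"
    using MM.integral_fst[OF I] by simp
  also have "\<dots> \<le> integral\<^sup>L (?M \<Otimes>\<^sub>M ?M) (\<lambda>p. c / 2 * (case p of (x, y) \<Rightarrow> (F x)\<^sup>2 * h (x - y)) + c / 2 * (case p of (x, y) \<Rightarrow> (F y)\<^sup>2 * h (x - y)))"
    using bound by (intro integral_mono I I3) (auto intro: order_trans[OF abs_ge_self])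
  also have "\<dots> = c / 2 * integral\<^sup>L (?M \<Otimes>\<^sub>M ?M) (\<lambda>(x, y). (F x)\<^sup>2 * h (x - y)) + c / 2 * integral\<^sup>L (?M \<Otimes>\<^sub>M ?M) (\<lambda>(x, y). (F y)\<^sup>2 * h (x - y))"
    using I1 I2 by simp
  also have "\<dots> \<le> c / 2 * (\<integral>x. (F x)\<^sup>2 \<partial>?M) + c / 2 * (\<integral>x. (F x)\<^sup>2 \<partial>?M)"
    using c0 B1 B2 by (intro add_mono mult_left_mono) auto
  finally show ?thesis by (simp add: F2')
qed

text \<open>With the weight \<open>exp (\<epsilon> * t)\<close> the squared transform is a heat
  kernel form, bounded by the factor \<open>exp (\<epsilon> ^ 3 / 12 - \<epsilon> * a)\<close> on
  the half-line. From \<open>b\<close> on, the weight is at least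
  \<open>exp (\<epsilon> * b)\<close>. Both factors tend to 1 with \<epsilon>. The endpoint
  \<open>b\<close> is arbitrary because the values 0 and -1 will be played off against each
  other.\<close>

lemma airy_transform_contraction:
  fixes f :: "real \<Rightarrow> real"
  assumes [measurable]: "f \<in> borel_measurable borel" and f: "\<And>x. \<bar>f x\<bar> \<le> c * exp (- 2 * x)"
  shows "(\<integral>t. (\<integral>x. airy (x + t) * f x \<partial>half_line a)\<^sup>2 \<partial>half_line b) \<le> (\<integral>x. (f x)\<^sup>2 \<partial>half_line a)"
    and "integrable (half_line b) (\<lambda>t. (\<integral>x. airy (x + t) * f x \<partial>half_line a)\<^sup>2)"
proof -
  let ?M = "half_line a"
  define A where "A = (\<lambda>t. \<integral>x. airy (x + t) * f x \<partial>?M)"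
  have [measurable]: "A \<in> borel_measurable borel" unfolding A_def by measurable
  have f2: "integrable ?M (\<lambda>x. (f x)\<^sup>2)"
  proof (rule integrable_dominated)
    show "integrable ?M (\<lambda>x. c\<^sup>2 * exp (- 4 * x))" by (intro integrable_mult_right integrable_exp_half_line) auto
    fix x
    have "(f x)\<^sup>2 \<le> (c * exp (- 2 * x))\<^sup>2" using f[of x] by (metis abs_ge_zero power2_abs power_mono)
    also have "\<dots> = c\<^sup>2 * exp (- 4 * x)" by (simp add: power_mult_distrib power2_eq_square[of "exp _"] exp_add[symmetric])
    finally show "norm ((f x)\<^sup>2) \<le> c\<^sup>2 * exp (- 4 * x)" by simp
  qed measurable
  have main: "integrable lborel (\<lambda>t. exp (\<epsilon> * t) * (A t)\<^sup>2)"
     "(\<integral>t. exp (\<epsilon> * t) * (A t)\<^sup>2 \<partial>lborel) \<le> exp (\<epsilon> ^ 3 / 12 - \<epsilon> * a) * (\<integral>x. (f x)\<^sup>2 \<partial>?M)" if \<epsilon>: "\<epsilon> > 0" for \<epsilon>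
  proof -
    define k where "k = (\<lambda>x t. exp (\<epsilon> / 2 * t) * airy (x + t))"
    obtain C where C: "C \<ge> 0" "\<And>x t. exp (\<epsilon> / 2 * t) * \<bar>airy (x + t)\<bar> \<le> C * (exp (- 2 * (\<epsilon> / 2) * x) + exp (- (\<epsilon> / 2 / 2) * x)) * exp (- (\<epsilon> / 2 / 2) * \<bar>t\<bar>)"
      using airy_two_sided_bound[of "\<epsilon> / 2"] \<epsilon> by auto
    define r where "r = (\<lambda>x. C * (exp (- 2 * (\<epsilon> / 2) * x) + exp (- (\<epsilon> / 2 / 2) * x)))"
    define q where "q = (\<lambda>t. exp (- (\<epsilon> / 2 / 2) * \<bar>t\<bar>))"
    have kb: "\<bar>k x t\<bar> \<le> r x * q t" for x t using C(2)[of t x] by (simp add: k_def r_def q_def abs_mult)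
    have rp: "integrable ?M (\<lambda>x. \<bar>f x\<bar> * r x)"
    proof (rule integrable_dominated)
      show "integrable ?M (\<lambda>x. c * C * (exp (- (2 + \<epsilon>) * x) + exp (- (2 + \<epsilon> / 4) * x)))"
        using \<epsilon> by (intro integrable_mult_right Bochner_Integration.integrable_add integrable_exp_half_line) auto
      fix x
      have r0: "r x \<ge> 0" using C(1) by (simp add: r_def)
      have "norm (\<bar>f x\<bar> * r x) \<le> c * exp (- 2 * x) * r x" using f[of x] r0 by (simp add: abs_mult mult_right_mono)
      also have "\<dots> = c * C * (exp (- (2 + \<epsilon>) * x) + exp (- (2 + \<epsilon> / 4) * x))"
      proof -
        have "exp (- 2 * x) * exp (- 2 * (\<epsilon> / 2) * x) = exp (- (2 + \<epsilon>) * x)" "exp (- 2 * x) * exp (- (\<epsilon> / 2 / 2) * x) = exp (- (2 + \<epsilon> / 4) * x)"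
          unfolding exp_add[symmetric] by (simp_all add: algebra_simps)
        moreover have "c * exp (- 2 * x) * r x = c * C * (exp (- 2 * x) * exp (- 2 * (\<epsilon> / 2) * x) + exp (- 2 * x) * exp (- (\<epsilon> / 2 / 2) * x))"
          by (simp only: r_def) algebra
        ultimately show ?thesis by metis
      qed
      finally show "norm (\<bar>f x\<bar> * r x) \<le> c * C * (exp (- (2 + \<epsilon>) * x) + exp (- (2 + \<epsilon> / 4) * x))" .
    qed (simp add: r_def)
    have q2: "integrable lborel (\<lambda>t. (q t)\<^sup>2)"
    proof -
      have "(\<lambda>t. (q t)\<^sup>2) = (\<lambda>t. exp (- (\<epsilon> / 2) * \<bar>t\<bar>))"
        by (auto simp: q_def power2_eq_square exp_add[symmetric])
      then show ?thesis using integrable_exp_abs[of "\<epsilon> / 2"] \<epsilon> by simp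
    qed
    have km: "(\<lambda>(x, t). k x t) \<in> borel_measurable (?M \<Otimes>\<^sub>M lborel)" unfolding k_def by measurable
    have qm: "q \<in> borel_measurable lborel" unfolding q_def by measurable
    have kA: "(\<integral>x. k x t * f x \<partial>?M)\<^sup>2 = exp (\<epsilon> * t) * (A t)\<^sup>2" for t
    proof -
      have "(\<integral>x. k x t * f x \<partial>?M) = exp (\<epsilon> / 2 * t) * A t" by (simp add: k_def A_def mult.assoc)
      then show ?thesis by (simp add: power_mult_distrib power2_eq_square[of "exp _"] exp_add[symmetric])
    qed
    have fm: "f \<in> borel_measurable ?M" by measurable
    note FS = Fubini_square[of ?M lborel k f q r, OF half_line.sigma_finite_measure_axioms space_half_line lborel.sigma_finite_measure_axioms km fm qm kb _ rp q2, unfolded kA]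
    show "integrable lborel (\<lambda>t. exp (\<epsilon> * t) * (A t)\<^sup>2)" by (rule FS(2)) (simp add: q_def)
    define G where "G = (\<lambda>x y. \<integral>t. k x t * k y t \<partial>lborel)"
    have Geq: "G x y = exp (\<epsilon> ^ 3 / 12 - \<epsilon> * (x + y) / 2 - (x - y)\<^sup>2 / (4 * \<epsilon>)) / sqrt (4 * pi * \<epsilon>)" for x y
      unfolding G_def k_def by (rule airy_heat_kernel[OF \<epsilon>])
    have "(\<integral>t. exp (\<epsilon> * t) * (A t)\<^sup>2 \<partial>lborel) = (\<integral>x. f x * (\<integral>y. G x y * f y \<partial>?M) \<partial>?M)"
      unfolding G_def by (rule FS(1)) (simp add: q_def)
    also have "\<dots> \<le> exp (\<epsilon> ^ 3 / 12 - \<epsilon> * a) * (\<integral>x. (f x)\<^sup>2 \<partial>?M)"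
    proof (rule heat_form_bound[where s = "sqrt (2 * \<epsilon>)"])
      show "(\<lambda>(x, y). G x y) \<in> borel_measurable (borel \<Otimes>\<^sub>M borel)" unfolding Geq by measurable
      fix x y assume xy: "a \<le> x" "a \<le> y"
      have "\<bar>G x y\<bar> = exp (\<epsilon> ^ 3 / 12 - \<epsilon> * (x + y) / 2) * (exp (- (x - y)\<^sup>2 / (4 * \<epsilon>)) / sqrt (4 * pi * \<epsilon>))"
      proof -
        have "exp (\<epsilon> ^ 3 / 12 - \<epsilon> * (x + y) / 2 - (x - y)\<^sup>2 / (4 * \<epsilon>)) = exp (\<epsilon> ^ 3 / 12 - \<epsilon> * (x + y) / 2) * exp (- (x - y)\<^sup>2 / (4 * \<epsilon>))"
          by (simp add: exp_add[symmetric])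
        moreover have "exp (\<epsilon> ^ 3 / 12 - \<epsilon> * (x + y) / 2 - (x - y)\<^sup>2 / (4 * \<epsilon>)) / sqrt (4 * pi * \<epsilon>) \<ge> 0"
          using \<epsilon> by (intro divide_nonneg_nonneg) auto
        ultimately show ?thesis unfolding Geq using \<epsilon> by simp
      qed
      also have "\<dots> \<le> exp (\<epsilon> ^ 3 / 12 - \<epsilon> * a) * (exp (- (x - y)\<^sup>2 / (4 * \<epsilon>)) / sqrt (4 * pi * \<epsilon>))"
      proof (rule mult_right_mono)
        have "\<epsilon> * (a + a) \<le> \<epsilon> * (x + y)" using xy \<epsilon> by (intro mult_left_mono) auto
        then show "exp (\<epsilon> ^ 3 / 12 - \<epsilon> * (x + y) / 2) \<le> exp (\<epsilon> ^ 3 / 12 - \<epsilon> * a)" by (simp add: algebra_simps)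
      qed (use \<epsilon> in auto)
      also have "exp (- (x - y)\<^sup>2 / (4 * \<epsilon>)) / sqrt (4 * pi * \<epsilon>) = normal_density 0 (sqrt (2 * \<epsilon>)) (x - y)"
        using \<epsilon> by (simp add: normal_density_def ac_simps)
      finally show "\<bar>G x y\<bar> \<le> exp (\<epsilon> ^ 3 / 12 - \<epsilon> * a) * normal_density 0 (sqrt (2 * \<epsilon>)) (x - y)" .
    qed (use f2 \<epsilon> in auto)
    finally show "(\<integral>t. exp (\<epsilon> * t) * (A t)\<^sup>2 \<partial>lborel) \<le> exp (\<epsilon> ^ 3 / 12 - \<epsilon> * a) * (\<integral>x. (f x)\<^sup>2 \<partial>?M)" .
  qed
  have ind: "indicator {b..} t *\<^sub>R (exp (\<epsilon> * b) * (A t)\<^sup>2) \<le> exp (\<epsilon> * t) * (A t)\<^sup>2" if "\<epsilon> > 0" for \<epsilon> t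
    using that by (auto simp: indicator_def intro!: mult_right_mono)
  have iA: "integrable lborel (\<lambda>t. indicator {b..} t *\<^sub>R (exp (\<epsilon> * b) * (A t)\<^sup>2))" if "\<epsilon> > 0" for \<epsilon>
  proof (rule integrable_dominated[OF main(1)[OF that]])
    show "norm (indicator {b..} t *\<^sub>R (exp (\<epsilon> * b) * (A t)\<^sup>2)) \<le> exp (\<epsilon> * t) * (A t)\<^sup>2" for t
      using ind[OF that, of t] by (simp add: abs_mult)
  qed measurable
  show "integrable (half_line b) (\<lambda>t. (\<integral>x. airy (x + t) * f x \<partial>half_line a)\<^sup>2)"
  proof -
    have "integrable lborel (\<lambda>t. exp (- 1 * b) * (indicator {b..} t *\<^sub>R (exp (1 * b) * (A t)\<^sup>2)))"
      by (intro integrable_mult_right iA) auto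
    also have "(\<lambda>t. exp (- 1 * b) * (indicator {b..} t *\<^sub>R (exp (1 * b) * (A t)\<^sup>2))) = (\<lambda>t. indicator {b..} t *\<^sub>R (A t)\<^sup>2)"
      by (auto simp: indicator_def exp_minus)
    finally have "integrable (half_line b) (\<lambda>t. (A t)\<^sup>2)" by (subst integrable_half_line) auto
    then show ?thesis by (simp add: A_def)
  qed
  have le: "exp (\<epsilon> * b) * (\<integral>t. (A t)\<^sup>2 \<partial>half_line b) \<le> exp (\<epsilon> ^ 3 / 12 - \<epsilon> * a) * (\<integral>x. (f x)\<^sup>2 \<partial>?M)" if "\<epsilon> > 0" for \<epsilon>
  proof -
    have "exp (\<epsilon> * b) * (\<integral>t. (A t)\<^sup>2 \<partial>half_line b) = (\<integral>t. exp (\<epsilon> * b) * (A t)\<^sup>2 \<partial>half_line b)" by simp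
    also have "\<dots> = (\<integral>t. indicator {b..} t *\<^sub>R (exp (\<epsilon> * b) * (A t)\<^sup>2) \<partial>lborel)" by (rule integral_half_line) measurable
    also have "\<dots> \<le> (\<integral>t. exp (\<epsilon> * t) * (A t)\<^sup>2 \<partial>lborel)"
      using ind[OF that] by (intro integral_mono iA main that)
    finally show ?thesis using main(2)[OF that] by linarith
  qed
  have "exp (0 * b) * (\<integral>t. (A t)\<^sup>2 \<partial>half_line b) \<le> exp (0 ^ 3 / 12 - 0 * a) * (\<integral>x. (f x)\<^sup>2 \<partial>?M)"
  proof (rule tendsto_le[OF trivial_limit_at_right_real])
    show "((\<lambda>\<epsilon>. exp (\<epsilon> * b) * (\<integral>t. (A t)\<^sup>2 \<partial>half_line b)) \<longlongrightarrow> exp (0 * b) * (\<integral>t. (A t)\<^sup>2 \<partial>half_line b)) (at_right 0)"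
      by (intro tendsto_intros)
    show "((\<lambda>\<epsilon>. exp (\<epsilon> ^ 3 / 12 - \<epsilon> * a) * (\<integral>x. (f x)\<^sup>2 \<partial>?M)) \<longlongrightarrow> exp (0 ^ 3 / 12 - 0 * a) * (\<integral>x. (f x)\<^sup>2 \<partial>?M)) (at_right 0)"
      by (intro tendsto_intros) auto
    show "eventually (\<lambda>\<epsilon>. exp (\<epsilon> * b) * (\<integral>t. (A t)\<^sup>2 \<partial>half_line b) \<le> exp (\<epsilon> ^ 3 / 12 - \<epsilon> * a) * (\<integral>x. (f x)\<^sup>2 \<partial>?M)) (at_right 0)"
      using le by (auto simp: eventually_at_right_field intro!: exI[of _ 1])
  qed
  then show "(\<integral>t. (\<integral>x. airy (x + t) * f x \<partial>half_line a)\<^sup>2 \<partial>half_line b) \<le> (\<integral>x. (f x)\<^sup>2 \<partial>half_line a)"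
    by (simp add: A_def)
qed

theorem airy_resolvent:
  fixes v :: "real \<Rightarrow> real"
  assumes vm: "v \<in> borel_measurable borel" and v: "\<And>x. \<bar>v x\<bar> \<le> c * exp (- 2 * x)"
  shows "\<exists>y\<in>borel_measurable borel. (\<exists>c. \<forall>x. \<bar>y x\<bar> \<le> c * exp (- 2 * x)) \<and>
     (\<forall>x. y x = v x + (\<integral>s. airy_kernel x s * y s \<partial>half_line a))"
proof -
  obtain C where C: "C > 0" "\<And>x. \<bar>airy x\<bar> \<le> C * exp (- 2 * x)"
    using airy_bound[of 2] by auto
  define c0 where "c0 = (\<integral>t. exp (- 4 * t) \<partial>half_line 0)"
  have c0: "c0 \<ge> 0" by (simp add: c0_def)
  \<comment> \<open>The factor \<open>1 + c0\<close> lets one envelope dominate both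
    \<open>C * exp (- 2 * x)\<close> and, as the product \<open>m x * m y\<close>, the kernel bound
    with constant \<open>C\<^sup>2 * c0\<close>.\<close>
  define m where "m = (\<lambda>x. C * (1 + c0) * exp (- 2 * x))"
  have m0: "m x > 0" for x using C c0 by (simp add: m_def)
  have cm: "C * exp (- 2 * x) \<le> m x" for x using C c0 by (simp add: m_def mult_left_le mult_le_cancel_left1)
  have e4: "exp (- 2 * t) * exp (- 2 * t) = exp (- 4 * t)" for t :: real by (simp add: exp_add[symmetric])
  let ?M = "half_line a"
  have airy2: "\<bar>airy (x + t)\<bar> \<le> C * exp (- 2 * x) * exp (- 2 * t)" for x t
    using C(2)[of "x + t"] by (simp add: exp_add[symmetric] algebra_simps)
  have i4: "integrable (half_line b) (\<lambda>t. exp (- 4 * t))" for b by (rule integrable_exp_half_line) simp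
  interpret hilbert_schmidt_kernel ?M airy_kernel m
  proof
    show "integrable ?M (\<lambda>x. (m x)\<^sup>2)"
    proof -
      have "(\<lambda>x. (m x)\<^sup>2) = (\<lambda>x. (C * (1 + c0))\<^sup>2 * exp (- 4 * x))"
        by (auto simp: m_def power_mult_distrib power2_eq_square[of "exp _"] exp_add[symmetric])
      then show ?thesis using i4 by simp
    qed
    fix x y
    have "norm (airy_kernel x y) \<le> (\<integral>t. C\<^sup>2 * exp (- 2 * x) * exp (- 2 * y) * exp (- 4 * t) \<partial>half_line 0)"
      unfolding airy_kernel_def
    proof (rule order_trans[OF integral_norm_bound], rule integral_mono_AE')
      have "norm (airy (x + t) * airy (y + t)) \<le> C\<^sup>2 * exp (- 2 * x) * exp (- 2 * y) * exp (- 4 * t)" for t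
      proof -
        have "norm (airy (x + t) * airy (y + t)) \<le> (C * exp (- 2 * x) * exp (- 2 * t)) * (C * exp (- 2 * y) * exp (- 2 * t))"
          unfolding real_norm_def abs_mult using C by (intro mult_mono airy2) auto
        also have "\<dots> = C\<^sup>2 * exp (- 2 * x) * exp (- 2 * y) * (exp (- 2 * t) * exp (- 2 * t))" by (simp add: power2_eq_square)
        finally show ?thesis unfolding e4 .
      qed
      then show "AE t in half_line 0. norm (airy (x + t) * airy (y + t)) \<le> C\<^sup>2 * exp (- 2 * x) * exp (- 2 * y) * exp (- 4 * t)" by simp
    qed (use i4 in auto)
    also have "\<dots> = C\<^sup>2 * exp (- 2 * x) * exp (- 2 * y) * c0" by (simp add: c0_def)
    also have "\<dots> \<le> C\<^sup>2 * exp (- 2 * x) * exp (- 2 * y) * ((1 + c0) * (1 + c0))"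
      using c0 by (intro mult_left_mono) (auto simp: algebra_simps)
    also have "\<dots> = m x * m y" by (simp add: m_def power2_eq_square)
    finally show "\<bar>airy_kernel x y\<bar> \<le> m x * m y" by simp
    show "airy_kernel x y = airy_kernel y x" by (simp add: airy_kernel_def mult.commute)
    show "m x \<ge> 0" using m0[of x] by simp
  qed (auto simp: m_def)
  define A where "A = (\<lambda>f t. \<integral>x. airy (x + t) * f x \<partial>?M)"
  have admD': "f \<in> borel_measurable borel \<and> (\<exists>c. \<forall>x. \<bar>f x\<bar> \<le> c * exp (- 2 * x))" if f: "adm f" for f
  proof -
    obtain d where "\<And>x. \<bar>f x\<bar> \<le> d * m x" using admE[OF f] by blast
    then show ?thesis using admD[OF f] by (auto simp: m_def mult.assoc[symmetric])
  qed
  have FS: "ip f (T f) = (\<integral>t. (A f t)\<^sup>2 \<partial>half_line 0)" "T f x = (\<integral>t. airy (x + t) * A f t \<partial>half_line 0)" if adm: "adm f" for f x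
  proof -
    obtain d where d: "f \<in> borel_measurable borel" "\<And>x. \<bar>f x\<bar> \<le> d * exp (- 2 * x)" using admD'[OF adm] by blast
    note [measurable] = d(1)
    have p: "integrable ?M (\<lambda>x. \<bar>f x\<bar> * (C * exp (- 2 * x)))"
    proof (rule integrable_dominated)
      show "integrable ?M (\<lambda>x. d * C * exp (- 4 * x))" using i4 by simp
      show "norm (\<bar>f x\<bar> * (C * exp (- 2 * x))) \<le> d * C * exp (- 4 * x)" for x
        unfolding e4[symmetric] using mult_right_mono[OF d(2)[of x], of "C * exp (- 2 * x)"] C by (simp add: abs_mult ac_simps)
    qed measurable
    have q: "integrable (half_line 0) (\<lambda>t. (exp (- 2 * t))\<^sup>2)" using i4[of 0] by (simp only: power2_eq_square e4)
    have fm: "f \<in> borel_measurable ?M" "(\<lambda>t::real. exp (- 2 * t)) \<in> borel_measurable (half_line 0)"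
      "(\<lambda>(x, t). airy (x + t)) \<in> borel_measurable (?M \<Otimes>\<^sub>M half_line 0)" by measurable
    note F = Fubini_square[of ?M "half_line 0" "\<lambda>x t. airy (x + t)" f "\<lambda>t. exp (- 2 * t)" "\<lambda>x. C * exp (- 2 * x)",
      OF half_line.sigma_finite_measure_axioms space_half_line half_line.sigma_finite_measure_axioms fm(3,1,2) airy2 _ p q]
    show "ip f (T f) = (\<integral>t. (A f t)\<^sup>2 \<partial>half_line 0)"
      unfolding ip_def T_def airy_kernel_def A_def by (rule F(1)[symmetric]) simp
    show "T f x = (\<integral>t. airy (x + t) * A f t \<partial>half_line 0)"
      unfolding T_def airy_kernel_def A_def by (rule F(3)[symmetric]) simp
  qed
  have contr: "(\<integral>t. (A f t)\<^sup>2 \<partial>half_line b) \<le> ip f f" "integrable (half_line b) (\<lambda>t. (A f t)\<^sup>2)" if "adm f" for f b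
    using admD'[OF that] airy_transform_contraction[of f _ b a] by (auto simp: A_def ip_def power2_eq_square)
  interpret positive_contraction_kernel ?M airy_kernel m
  proof
    fix f assume f: "adm f"
    show "0 \<le> ip f (T f)" "ip f (T f) \<le> ip f f" using FS(1)[OF f] contr[OF f] by auto
    assume fixp: "T f = f"
    obtain d where d: "f \<in> borel_measurable borel" "\<And>x. \<bar>f x\<bar> \<le> d * exp (- 2 * x)" using admD'[OF f] by blast
    note [measurable] = d(1)
    define Ac where "Ac = (\<lambda>z. \<integral>x. Airy (of_real x + z) * of_real (f x) \<partial>?M)"
    have Ader: "\<exists>D. (Ac has_field_derivative D) (at z)" for z
      using Airy_superposition_deriv(1)[of "\<lambda>x. of_real (f x)" d a z] d unfolding Ac_def by auto
    then have Ahol: "Ac holomorphic_on UNIV" by (simp add: holomorphic_on_open)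
    have AcA: "Ac (of_real t) = of_real (A f t)" for t
    proof -
      have "(\<lambda>x. Airy (of_real x + of_real t) * of_real (f x)) = (\<lambda>x. of_real (airy (x + t) * f x))"
      proof
        fix x
        have "Airy (of_real x + of_real t) = of_real (airy (x + t))" using of_real_airy[of "x + t"] by (simp only: of_real_add)
        then show "Airy (of_real x + of_real t) * of_real (f x) = of_real (airy (x + t) * f x)" by (simp only: of_real_mult)
      qed
      then show ?thesis unfolding Ac_def A_def by (simp only: integral_complex_of_real)
    qed
    have Acont: "continuous_on S (A f)" for S
    proof -
      have "A f = (\<lambda>t. Re (Ac (of_real t)))" by (simp add: AcA)
      moreover have "continuous_on S (\<lambda>t. Re (Ac (of_real t)))"
        by (rule continuous_on_Re, rule continuous_on_compose2[OF holomorphic_on_imp_continuous_on[OF Ahol]])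
           (auto intro: continuous_on_of_real continuous_on_id)
      ultimately show ?thesis by simp
    qed
    have [measurable]: "A f \<in> borel_measurable borel" by (intro borel_measurable_continuous_onI Acont)
    define I where "I = (\<lambda>b. \<integral>t. (A f t)\<^sup>2 \<partial>half_line b)"
    have i: "integrable lborel (\<lambda>t. indicator {b..} t *\<^sub>R (A f t)\<^sup>2)" for b
      using contr(2)[OF f, of b] by (subst (asm) integrable_half_line) auto
    \<comment> \<open>For a fixed point \<open>I 0\<close> is the full squared norm of
      \<open>f\<close>, and \<open>I (- 1)\<close> cannot exceed that norm. So no mass lies between
      -1 and 0: the continuous function \<open>A f\<close> vanishes on a whole interval, its entire
      extension \<open>Ac\<close> everywhere, and then \<open>T f = 0\<close>.\<close>
    have "I (- 1) \<le> I 0" using contr(1)[OF f, of "-1"] FS(1)[OF f] fixp by (simp add: I_def)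
    moreover have "I (- 1) - I 0 = (\<integral>t. indicator {-1..} t *\<^sub>R (A f t)\<^sup>2 - indicator {0..} t *\<^sub>R (A f t)\<^sup>2 \<partial>lborel)"
      using i[of "-1"] i[of 0] by (simp add: I_def integral_half_line)
    moreover have "set_lebesgue_integral lborel {-1..-1/2} (\<lambda>t. (A f t)\<^sup>2) \<le> (\<integral>t. indicator {-1..} t *\<^sub>R (A f t)\<^sup>2 - indicator {0..} t *\<^sub>R (A f t)\<^sup>2 \<partial>lborel)"
      unfolding set_lebesgue_integral_def
    proof (rule integral_mono)
      show "integrable lborel (\<lambda>t. indicator {-1..-1/2} t *\<^sub>R (A f t)\<^sup>2)"
        by (rule integrable_dominated[OF i[of "-1"]]) (auto simp: indicator_def)
    qed (use i in \<open>auto simp: indicator_def\<close>)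
    moreover have "set_lebesgue_integral lborel {-1..-1/2} (\<lambda>t. (A f t)\<^sup>2) = integral {-1..-1/2} (\<lambda>t. (A f t)\<^sup>2)"
      by (intro set_borel_integral_eq_integral borel_integrable_compact[folded set_integrable_def]) (auto intro!: continuous_intros Acont)
    moreover have "integral {-1..-1/2} (\<lambda>t. (A f t)\<^sup>2) \<ge> 0"
      by (intro integral_nonneg integrable_continuous_real continuous_intros Acont) auto
    ultimately have "integral {-1..-1/2} (\<lambda>t. (A f t)\<^sup>2) = 0" by linarith
    then have "\<forall>t\<in>{-1..-1/2}. (A f t)\<^sup>2 = 0"
      by (subst (asm) integral_eq_0_iff) (auto intro!: continuous_intros Acont)
    then have zero: "A f t = 0" if "t \<in> {-1..-1/2}" for t using that by simp
    have Ac0: "Ac z = 0" for z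
    proof (rule analytic_continuation[OF Ahol open_UNIV connected_UNIV, of "of_real ` {-1<..<-1/2::real}" "of_real (- 1)"])
      have "(- 1::real) islimpt {- 1<..<-1/2}" by (rule islimpt_greaterThanLessThan1) simp
      then show "complex_of_real (- 1) islimpt of_real ` {-1<..<-1/2::real}"
        unfolding islimpt_approachable by (metis dist_of_real imageI of_real_eq_iff)
      fix z :: complex assume "z \<in> of_real ` {-1<..<-1/2::real}"
      then show "Ac z = 0" using zero by (auto simp: AcA)
    qed auto
    have "A f t = 0" for t using Ac0[of "of_real t"] by (simp add: AcA)
    then have "T f x = 0" for x using FS(2)[OF f] by simp
    then show "f = (\<lambda>x. 0)" using fixp by auto
  qed
  have "adm v"
  proof (rule admI[of _ "\<bar>c\<bar> / C"])
    fix x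
    have "\<bar>v x\<bar> \<le> \<bar>c\<bar> * exp (- 2 * x)" by (rule order_trans[OF v mult_right_mono[OF abs_ge_self exp_ge_zero]])
    also have "\<dots> = \<bar>c\<bar> / C * (C * exp (- 2 * x))" using C by simp
    also have "\<dots> \<le> \<bar>c\<bar> / C * m x" using C cm by (intro mult_left_mono) auto
    finally show "\<bar>v x\<bar> \<le> \<bar>c\<bar> / C * m x" .
  qed (use vm in auto)
  from resolvent_exists[OF this] obtain y where y: "adm y" "\<And>x. y x = v x + T y x" by blast
  have "\<forall>x. y x = v x + (\<integral>s. airy_kernel x s * y s \<partial>?M)" using y(2) unfolding T_def by blast
  with admD'[OF y(1)] show ?thesis by blast
qed

section \<open>Cauchy integrals of entire densities\<close>

text \<open>Decay is asked for only on the half-line, since the functions in question may grow to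
  the left. Asking for every rate makes the class stable under factors of growth
  \<open>exp s\<close>, in particular under multiplication by the variable.\<close>

definition rapid :: "real \<Rightarrow> (real \<Rightarrow> complex) \<Rightarrow> bool" where
  "rapid a f \<longleftrightarrow> f \<in> borel_measurable borel \<and> (\<forall>p>0. \<exists>C. \<forall>s\<ge>a. norm (f s) \<le> C * exp (- p * s))"

lemma rapidD:
  assumes "rapid a f" "p > 0"
  obtains C where "C > 0" "\<And>s. s \<ge> a \<Longrightarrow> norm (f s) \<le> C * exp (- p * s)"
proof -
  obtain C where C: "\<And>s. s \<ge> a \<Longrightarrow> norm (f s) \<le> C * exp (- p * s)" using assms by (auto simp: rapid_def)
  have "C * exp (- p * s) \<le> (\<bar>C\<bar> + 1) * exp (- p * s)" for s by (intro mult_right_mono) auto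
  then show ?thesis using C that[of "\<bar>C\<bar> + 1"] by (force intro: order_trans)
qed

lemma rapid_measurable: "rapid a f \<Longrightarrow> f \<in> borel_measurable borel" by (simp add: rapid_def)

lemma rapid_add: assumes "rapid a f" "rapid a g" shows "rapid a (\<lambda>s. f s + g s)"
  unfolding rapid_def
proof (intro conjI allI impI)
  fix p :: real assume "p > 0"
  then obtain C D where "\<And>s. s \<ge> a \<Longrightarrow> norm (f s) \<le> C * exp (- p * s)" "\<And>s. s \<ge> a \<Longrightarrow> norm (g s) \<le> D * exp (- p * s)"
    using rapidD[OF assms(1)] rapidD[OF assms(2)] by metis
  then have "norm (f s + g s) \<le> (C + D) * exp (- p * s)" if "s \<ge> a" for s
    using norm_triangle_ineq[of "f s" "g s"] that by (fastforce simp: distrib_right)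
  then show "\<exists>C. \<forall>s\<ge>a. norm (f s + g s) \<le> C * exp (- p * s)" by blast
qed (use assms in \<open>auto simp: rapid_def\<close>)

lemma rapid_bound_mult:
  assumes f: "rapid a f" and g: "g \<in> borel_measurable borel" and b: "\<And>s. s \<ge> a \<Longrightarrow> norm (g s) \<le> D * exp s"
  shows "rapid a (\<lambda>s. g s * f s)"
  unfolding rapid_def
proof (intro conjI allI impI)
  fix p :: real assume "p > 0"
  then obtain C where C: "C > 0" "\<And>s. s \<ge> a \<Longrightarrow> norm (f s) \<le> C * exp (- (p + 1) * s)"
    using rapidD[OF f, of "p + 1"] by auto
  have "norm (g s * f s) \<le> (D * C) * exp (- p * s)" if s: "s \<ge> a" for s
  proof -
    have "norm (g s * f s) \<le> (D * exp s) * (C * exp (- (p + 1) * s))"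
      unfolding norm_mult using b[OF s] C(2)[OF s] order_trans[OF norm_ge_zero b[OF s]] by (intro mult_mono) auto
    also have "\<dots> = (D * C) * (exp s * exp (- (p + 1) * s))" by simp
    also have "exp s * exp (- (p + 1) * s) = exp (- p * s)" by (simp add: exp_add[symmetric] algebra_simps)
    finally show ?thesis .
  qed
  then show "\<exists>C. \<forall>s\<ge>a. norm (g s * f s) \<le> C * exp (- p * s)" by blast
qed (use assms in \<open>auto simp: rapid_def\<close>)

lemma rapid_cmult: "rapid a f \<Longrightarrow> rapid a (\<lambda>s. c * f s)"
proof (erule rapid_bound_mult)
  fix s assume "s \<ge> a"
  then have "1 \<le> exp (- a) * exp s" by (simp add: exp_add[symmetric])
  then have "norm c * 1 \<le> norm c * (exp (- a) * exp s)" by (intro mult_left_mono) auto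
  then show "norm c \<le> norm c * exp (- a) * exp s" by (simp add: mult.assoc)
qed auto

lemma rapid_times_arg: "rapid a f \<Longrightarrow> rapid a (\<lambda>s. of_real s * f s)"
proof (erule rapid_bound_mult)
  fix s assume s: "s \<ge> a"
  show "norm (complex_of_real s) \<le> (1 + \<bar>a\<bar> * exp (- a)) * exp s"
  proof (cases "s \<ge> 0")
    case True
    then have "norm (complex_of_real s) \<le> exp s" using exp_ge_add_one_self[of s] unfolding norm_of_real by linarith
    also have "\<dots> \<le> (1 + \<bar>a\<bar> * exp (- a)) * exp s" by simp
    finally show ?thesis .
  next
    case False
    then have "norm (complex_of_real s) \<le> \<bar>a\<bar> * 1" using s by simp
    also have "\<dots> \<le> \<bar>a\<bar> * (exp (- a) * exp s)" using s by (intro mult_left_mono) (auto simp: exp_add[symmetric])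
    also have "\<dots> \<le> (1 + \<bar>a\<bar> * exp (- a)) * exp s" by (simp add: algebra_simps)
    finally show ?thesis .
  qed
qed auto

lemma rapid_mult: assumes "rapid a f" "rapid a g" shows "rapid a (\<lambda>s. f s * g s)"
proof -
  obtain C where C: "C > 0" "\<And>s. s \<ge> a \<Longrightarrow> norm (f s) \<le> C * exp (- 1 * s)" using rapidD[OF assms(1), of 1] by auto
  show ?thesis
  proof (rule rapid_bound_mult[OF assms(2)])
    fix s assume s: "s \<ge> a"
    have "norm (f s) \<le> C * exp (- s)" using C(2)[OF s] by simp
    also have "\<dots> \<le> C * (exp (- 2 * a) * exp s)" using C s by (intro mult_left_mono) (auto simp: exp_add[symmetric])
    finally show "norm (f s) \<le> C * exp (- 2 * a) * exp s" by (simp add: mult.assoc)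
  qed (use assms in \<open>auto simp: rapid_def\<close>)
qed

lemma rapid_integrable: assumes "rapid a f" shows "integrable (half_line a) f"
proof -
  have [measurable]: "f \<in> borel_measurable borel" using rapid_measurable[OF assms] .
  obtain C where C: "C > 0" "\<And>s. s \<ge> a \<Longrightarrow> norm (f s) \<le> C * exp (- 1 * s)" using rapidD[OF assms, of 1] by auto
  show ?thesis
  proof (rule Bochner_Integration.integrable_bound[of _ "\<lambda>s. C * exp (- 1 * s)"])
    show "AE s in half_line a. norm (f s) \<le> norm (C * exp (- 1 * s))"
      using AE_half_line[of a] C by (auto elim!: eventually_mono)
  qed (use integrable_exp_half_line[of 1 a] in auto)
qed

lemma rapid_bounded: assumes "rapid a f" obtains B where "B \<ge> 0" "\<And>s. s \<ge> a \<Longrightarrow> norm (f s) \<le> B"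
proof -
  obtain C where C: "C > 0" "\<And>s. s \<ge> a \<Longrightarrow> norm (f s) \<le> C * exp (- 1 * s)" using rapidD[OF assms, of 1] by auto
  have "norm (f s) \<le> C * exp (- a)" if "s \<ge> a" for s
    using order_trans[OF C(2)[OF that] mult_left_mono[of "exp (- 1 * s)" "exp (- a)" C]] C(1) that by auto
  then show ?thesis using C(1) that[of "C * exp (- a)"] by simp
qed

lemma rapid_Airy: "rapid a (\<lambda>s. Airy (of_real s))" "rapid a (\<lambda>s. Airy' (of_real s))"
  using airy_bound by (auto simp: rapid_def of_real_airy[symmetric] of_real_airy'[symmetric] intro!: borel_measurable_of_real) metis+

lemma integral_inverse_segment:
  fixes z :: complex
  assumes cd: "c \<le> d" and z: "\<And>s. c \<le> s \<Longrightarrow> s \<le> d \<Longrightarrow> of_real s - z \<notin> \<real>\<^sub>\<le>\<^sub>0"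
  shows "(\<integral>s. indicator {c..d} s *\<^sub>R (1 / (of_real s - z)) \<partial>lborel) = Ln (of_real d - z) - Ln (of_real c - z)"
proof (rule integral_FTC_atLeastAtMost[OF cd])
  fix s assume s: "c \<le> s" "s \<le> d"
  have "((\<lambda>w. Ln (w - z)) has_field_derivative 1 / (of_real s - z)) (at (of_real s))"
    using z[OF s] by (auto intro!: derivative_eq_intros simp: inverse_eq_divide)
  then show "((\<lambda>s. Ln (of_real s - z)) has_vector_derivative 1 / (of_real s - z)) (at s within {c..d})"
    by (rule has_vector_derivative_real_field)
next
  show "continuous_on {c..d} (\<lambda>s. 1 / (of_real s - z))"
    using z by (intro continuous_intros) (metis atLeastAtMost_iff nonpos_Reals_zero_I)
qed

lemma norm_integral_le:
  fixes f :: "'a \<Rightarrow> 'b::{banach, second_countable_topology}"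
  assumes g: "integrable M g" and b: "AE x in M. norm (f x) \<le> g x"
  shows "norm (\<integral>x. f x \<partial>M) \<le> (\<integral>x. g x \<partial>M)"
proof (rule order_trans[OF integral_norm_bound], rule integral_mono_AE'[OF g b])
  show "AE x in M. 0 \<le> g x" using b by eventually_elim (meson norm_ge_zero order_trans)
qed

lemma off_ray: "of_real s - (z::complex) \<notin> \<real>\<^sub>\<le>\<^sub>0" if "z \<notin> of_real ` {a..}" "a \<le> s"
  using that by (auto simp: complex_nonpos_Reals_iff image_iff complex_eq_iff)

text \<open>On \<open>Re z < l\<close>, subtract \<open>P z\<close> from the density on \<open>{a..l}\<close>.\<close>

lemma Cauchy_integral_local:
  fixes P :: "complex \<Rightarrow> complex"
  assumes P: "P holomorphic_on UNIV" and i: "integrable (half_line a) (\<lambda>s. P (of_real s))" and al: "a < l"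
  shows "\<exists>D. D holomorphic_on {z. Re z < l} \<and> (\<forall>z. Re z < l \<longrightarrow> z \<notin> of_real ` {a..} \<longrightarrow>
           (\<integral>s. P (of_real s) / (of_real s - z) \<partial>half_line a) + P z * Ln (of_real a - z) = D z)"
proof -
  let ?M = "half_line a" and ?U = "{z::complex. Re z < l}"
  have U: "open ?U" by (rule open_halfspace_Re_lt)
  have Pc: "continuous_on UNIV P" using P by (rule holomorphic_on_imp_continuous_on)
  have Pd: "(P has_field_derivative deriv P z) (at z)" for z using P holomorphic_derivI by blast
  have P'c: "continuous_on UNIV (deriv P)" using P by (intro holomorphic_on_imp_continuous_on holomorphic_deriv) auto
  have [measurable]: "P \<in> borel_measurable borel" "deriv P \<in> borel_measurable borel"
    using Pc P'c by (auto intro: borel_measurable_continuous_onI)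
  \<comment> \<open>Below \<open>l\<close> the density becomes a difference quotient of
    \<open>P\<close>, holomorphic in \<open>z\<close> once its value on the diagonal is the
    derivative; above \<open>l\<close> the Cauchy kernel is regular because \<open>Re z < l\<close>.
    The part subtracted integrates to a difference of two logarithms, of which \<open>D\<close>
    keeps the one at \<open>l\<close>.\<close>
  define q where "q = (\<lambda>z s. if s \<le> l then (if z = of_real s then deriv P (of_real s) else (P z - P (of_real s)) / (z - of_real s))
     else P (of_real s) / (of_real s - z))"
  define D where "D = (\<lambda>z. (\<integral>s. q z s \<partial>?M) + P z * Ln (of_real l - z))"
  have qm [measurable]: "q z \<in> borel_measurable borel" for z unfolding q_def by measurable
  have qh: "(\<lambda>z. q z s) holomorphic_on ?U" for s
  proof (cases "s \<le> l")
    case True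
    then show ?thesis using holomorphic_on_subset[OF pole_lemma_open[OF P open_UNIV, of "of_real s"]] by (simp add: q_def)
  next
    case False
    then have "(\<lambda>z. P (of_real s) / (of_real s - z)) holomorphic_on ?U" by (intro holomorphic_intros) auto
    then show ?thesis using False by (simp add: q_def)
  qed
  have dom: "\<exists>r>0. \<exists>g. integrable ?M g \<and> (\<forall>w\<in>ball z r \<inter> ?U. \<forall>s\<in>space ?M. s \<ge> a \<longrightarrow> norm (q w s) \<le> g s)" if z: "z \<in> ?U" for z
  proof -
    define r where "r = (l - Re z) / 2"
    have r: "r > 0" using z by (simp add: r_def)
    define K where "K = cball (0::complex) (norm z + r + \<bar>a\<bar> + \<bar>l\<bar>)"
    obtain B where B: "\<And>w. w \<in> K \<Longrightarrow> norm (deriv P w) \<le> B"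
      using compact_imp_bounded[OF compact_continuous_image[OF continuous_on_subset[OF P'c] compact_cball]]
      unfolding K_def bounded_iff by (metis UNIV_I imageI subsetI)
    define g where "g = (\<lambda>s. indicator {a..l} s *\<^sub>R B + norm (P (of_real s)) / r)"
    have "integrable ?M (\<lambda>s. indicator {a..l} s *\<^sub>R B)"
    proof (rule integrable_lborel_half_line)
      have "integrable lborel (indicator {a..l} :: real \<Rightarrow> real)" by (rule integrable_real_indicator) (auto simp: emeasure_lborel_Icc_eq)
      then show "integrable lborel (\<lambda>s. indicator {a..l} s *\<^sub>R B)" by (rule integrable_scaleR_left)
    qed
    then have "integrable ?M g" unfolding g_def using i by (intro Bochner_Integration.integrable_add integrable_divide integrable_norm)
    moreover have "norm (q w s) \<le> g s" if w: "w \<in> ball z r \<inter> ?U" and s: "s \<ge> a" for w s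
    proof (cases "s \<le> l")
      case True
      have "norm w \<le> norm z + r" using w norm_triangle_ineq2[of w z] by (auto simp: dist_norm norm_minus_commute)
      then have wK: "w \<in> K" by (auto simp: K_def)
      have "\<bar>s\<bar> \<le> \<bar>a\<bar> + \<bar>l\<bar>" using s True by linarith
      then have sK: "of_real s \<in> K" using r norm_ge_zero[of z] unfolding K_def mem_cball dist_0_norm norm_of_real by linarith
      have "norm (q w s) \<le> B"
      proof (cases "w = of_real s")
        case True then show ?thesis using B[OF sK] \<open>s \<le> l\<close> by (simp add: q_def)
      next
        case False
        have "norm (P w - P (of_real s)) \<le> B * norm (w - of_real s)"
          using B wK sK by (intro field_differentiable_bound[of K P "deriv P"]) (auto simp: K_def intro: has_field_derivative_at_within Pd)
        then show ?thesis using False \<open>s \<le> l\<close> by (simp add: q_def norm_divide divide_le_eq)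
      qed
      moreover have "norm (P (of_real s)) / r \<ge> 0" using r by simp
      ultimately show ?thesis using s True unfolding g_def by simp
    next
      case False
      have "Re w < Re z + r" using w abs_Re_le_cmod[of "w - z"] by (auto simp: dist_norm norm_minus_commute)
      then have "r \<le> Re (of_real s - w)" using False by (simp add: r_def field_simps)
      then have "r \<le> norm (of_real s - w)" using complex_Re_le_cmod[of "of_real s - w"] by linarith
      then have "norm (P (of_real s) / (of_real s - w)) \<le> norm (P (of_real s)) / r"
        using r by (simp add: norm_divide frac_le)
      then show ?thesis using False by (simp add: q_def g_def)
    qed
    ultimately show ?thesis using r by blast
  qed
  define qq where "qq = (\<lambda>z s. indicator {a..} s *\<^sub>R q z s)"
  have qq: "(\<integral>s. q z s \<partial>?M) = (\<integral>s. qq z s \<partial>?M)" for z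
    by (rule integral_cong_AE) (use AE_half_line[of a] in \<open>auto simp: qq_def elim!: eventually_mono\<close>)
  have "(\<lambda>z. \<integral>s. q z s \<partial>?M) holomorphic_on ?U"
    unfolding holomorphic_on_open[OF U]
  proof
    fix z assume z: "z \<in> ?U"
    have "((\<lambda>z. \<integral>s. qq z s \<partial>?M) has_field_derivative (\<integral>s. deriv (\<lambda>z. qq z s) z \<partial>?M)) (at z)"
    proof (rule has_field_derivative_parameter_integral[OF U z])
      show "(\<lambda>z. qq z s) holomorphic_on ?U" for s
        unfolding qq_def scaleR_conv_of_real by (intro holomorphic_intros qh)
      show "qq z \<in> borel_measurable ?M" for z unfolding qq_def by measurable
      fix z assume "z \<in> ?U"
      from dom[OF this] obtain r g where rg: "r > 0" "integrable ?M g" "\<And>w s. w \<in> ball z r \<inter> ?U \<Longrightarrow> s \<ge> a \<Longrightarrow> norm (q w s) \<le> g s"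
        by auto
      show "\<exists>r>0. \<exists>g. integrable ?M g \<and> (\<forall>w\<in>ball z r \<inter> ?U. \<forall>s\<in>space ?M. norm (qq w s) \<le> g s)"
      proof (intro exI[of _ r] exI[of _ "\<lambda>s. norm (g s)"] conjI ballI)
        fix w s assume "w \<in> ball z r \<inter> ?U"
        then show "norm (qq w s) \<le> norm (g s)"
          using rg(3)[of w s] by (cases "s \<ge> a") (auto simp: qq_def intro: order_trans[OF _ abs_ge_self])
      qed (use rg in auto)
    qed
    then show "\<exists>f'. ((\<lambda>z. \<integral>s. q z s \<partial>?M) has_field_derivative f') (at z)" unfolding qq by blast
  qed
  then have "D holomorphic_on ?U"
    unfolding D_def using holomorphic_on_subset[OF P subset_UNIV]
    by (intro holomorphic_intros) (auto simp: complex_nonpos_Reals_iff)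
  moreover have "(\<integral>s. P (of_real s) / (of_real s - z) \<partial>?M) + P z * Ln (of_real a - z) = D z"
    if z: "Re z < l" "z \<notin> of_real ` {a..}" for z
  proof -
    have nz: "of_real s - z \<notin> \<real>\<^sub>\<le>\<^sub>0" if "a \<le> s" for s using off_ray[OF z(2) that] .
    obtain r g where rg: "r > 0" "integrable ?M g" "\<And>w s. w \<in> ball z r \<inter> ?U \<Longrightarrow> s \<ge> a \<Longrightarrow> norm (q w s) \<le> g s"
      using dom[of z] z by auto
    have i1: "integrable ?M (q z)"
    proof (rule Bochner_Integration.integrable_bound[OF rg(2)])
      show "AE s in ?M. norm (q z s) \<le> norm (g s)"
        using AE_half_line[of a] rg(3)[of z] z rg(1) by (auto elim!: eventually_mono intro: order_trans[OF _ abs_ge_self])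
    qed simp
    have c1: "continuous_on {a..l} (\<lambda>s. 1 / (of_real s - z))"
      using nz by (intro continuous_intros) (metis atLeastAtMost_iff nonpos_Reals_zero_I)
    have i2: "integrable lborel (\<lambda>s. indicator {a..l} s *\<^sub>R (1 / (of_real s - z)))"
      by (rule borel_integrable_compact[OF compact_Icc c1])
    have "(\<integral>s. P (of_real s) / (of_real s - z) \<partial>?M) = (\<integral>s. q z s + P z * (indicator {a..l} s *\<^sub>R (1 / (of_real s - z))) \<partial>?M)"
    proof (rule integral_cong_AE)
      show "AE s in ?M. P (of_real s) / (of_real s - z) = q z s + P z * (indicator {a..l} s *\<^sub>R (1 / (of_real s - z)))"
        using AE_half_line[of a]
      proof (rule eventually_mono)
        fix s assume s: "s \<ge> a"
        then have "z \<noteq> of_real s" using nz[OF s] by auto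
        then have "z - of_real s \<noteq> 0" "of_real s - z \<noteq> 0" by auto
        then show "P (of_real s) / (of_real s - z) = q z s + P z * (indicator {a..l} s *\<^sub>R (1 / (of_real s - z)))"
          using s by (auto simp: q_def indicator_def divide_simps) (auto simp: algebra_simps)
      qed
    qed measurable
    also have "\<dots> = (\<integral>s. q z s \<partial>?M) + P z * (\<integral>s. indicator {a..l} s *\<^sub>R (1 / (of_real s - z)) \<partial>?M)"
      by (subst Bochner_Integration.integral_add[OF i1 integrable_mult_right[OF integrable_lborel_half_line[OF i2]]]) (simp only: integral_mult_right_zero)
    also have "(\<integral>s. indicator {a..l} s *\<^sub>R (1 / (of_real s - z)) \<partial>?M) = (\<integral>s. indicator {a..l} s *\<^sub>R (1 / (of_real s - z)) \<partial>lborel)"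
      by (subst integral_half_line) (auto intro!: Bochner_Integration.integral_cong simp: indicator_def)
    also have "\<dots> = Ln (of_real l - z) - Ln (of_real a - z)"
      using nz al by (intro integral_inverse_segment) auto
    finally show ?thesis by (simp add: D_def algebra_simps)
  qed
  ultimately show ?thesis by blast
qed

text \<open>The density is itself entire, so crossing the ray changes the Cauchy integral by a
  multiple of \<open>P z\<close>. A logarithm cut along the same ray has exactly this jump, and what
  is left continues across.\<close>

lemma Cauchy_integral_entire:
  fixes P :: "complex \<Rightarrow> complex"
  assumes P: "P holomorphic_on UNIV" and i: "integrable (half_line a) (\<lambda>s. P (of_real s))"
  shows "\<exists>D. D holomorphic_on UNIV \<and> (\<forall>z. z \<notin> of_real ` {a..} \<longrightarrow>
           (\<integral>s. P (of_real s) / (of_real s - z) \<partial>half_line a) = D z - P z * Ln (of_real a - z))"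
proof -
  define F where "F = (\<lambda>z. (\<integral>s. P (of_real s) / (of_real s - z) \<partial>half_line a) + P z * Ln (of_real a - z))"
  \<comment> \<open>A vertical approach leaves the ray even if \<open>z\<close> lies on it. The
    limit therefore depends on \<open>F\<close> alone and agrees with every local extension
    \<open>Dl l\<close>, so they need not be compared with one another.\<close>
  define D where "D = (\<lambda>z. Lim (at_right 0) (\<lambda>\<epsilon>. F (z + \<i> * of_real \<epsilon>)))"
  have "\<forall>l. \<exists>D. a < l \<longrightarrow> D holomorphic_on {z. Re z < l} \<and> (\<forall>z. Re z < l \<longrightarrow> z \<notin> of_real ` {a..} \<longrightarrow> F z = D z)"
    using Cauchy_integral_local[OF P i] unfolding F_def by blast
  from choice[OF this] obtain Dl where Dl0: "\<forall>l. a < l \<longrightarrow> Dl l holomorphic_on {z. Re z < l} \<and> (\<forall>z. Re z < l \<longrightarrow> z \<notin> of_real ` {a..} \<longrightarrow> F z = Dl l z)" ..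
  have Dl: "Dl l holomorphic_on {z. Re z < l}" "Re z < l \<Longrightarrow> z \<notin> of_real ` {a..} \<Longrightarrow> F z = Dl l z" if "a < l" for l z
    using Dl0 that by blast+
  have D: "D z = Dl l z" if l: "a < l" "Re z < l" for z l
    unfolding D_def
  proof (rule tendsto_Lim)
    have "isCont (Dl l) z"
      using holomorphic_on_imp_continuous_on[OF Dl(1)[OF l(1)]] l by (simp add: continuous_on_eq_continuous_at open_halfspace_Re_lt)
    moreover have "((\<lambda>\<epsilon>. z + \<i> * of_real \<epsilon>) \<longlongrightarrow> z + \<i> * of_real 0) (at_right 0)" by (intro tendsto_intros)
    ultimately have "((\<lambda>\<epsilon>. Dl l (z + \<i> * of_real \<epsilon>)) \<longlongrightarrow> Dl l z) (at_right 0)"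
      using isCont_tendsto_compose[of z "Dl l" "\<lambda>\<epsilon>. z + \<i> * of_real \<epsilon>" "at_right 0"] by simp
    moreover have "eventually (\<lambda>\<epsilon>. Dl l (z + \<i> * of_real \<epsilon>) = F (z + \<i> * of_real \<epsilon>)) (at_right 0)"
    proof -
      have "eventually (\<lambda>\<epsilon>. \<epsilon> \<in> {0<..<(if Im z < 0 then - Im z else 1)}) (at_right 0)"
        by (rule eventually_at_right_real) simp
      then show ?thesis
      proof (rule eventually_mono)
        fix \<epsilon> assume "\<epsilon> \<in> {0<..<(if Im z < 0 then - Im z else 1)}"
        then have "Im (z + \<i> * of_real \<epsilon>) \<noteq> 0" by (auto split: if_splits)
        then have "z + \<i> * of_real \<epsilon> \<notin> of_real ` {a..}" by (metis Im_complex_of_real imageE)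
        moreover have "Re (z + \<i> * of_real \<epsilon>) < l" using l by simp
        ultimately show "Dl l (z + \<i> * of_real \<epsilon>) = F (z + \<i> * of_real \<epsilon>)" by (intro Dl(2)[OF l(1), symmetric])
      qed
    qed
    ultimately show "((\<lambda>\<epsilon>. F (z + \<i> * of_real \<epsilon>)) \<longlongrightarrow> Dl l z) (at_right 0)"
      by (rule Lim_transform_eventually)
  qed simp
  have "D holomorphic_on UNIV"
    unfolding holomorphic_on_open[OF open_UNIV]
  proof
    fix z :: complex
    define l where "l = max a (Re z) + 1"
    have l: "a < l" "Re z < l" by (auto simp: l_def)
    have "D holomorphic_on {z. Re z < l}"
      by (rule holomorphic_transform[OF Dl(1)[OF l(1)]]) (use D l in auto)
    then show "\<exists>f'. (D has_field_derivative f') (at z)"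
      using l by (auto simp: holomorphic_on_open open_halfspace_Re_lt)
  qed
  moreover have "(\<integral>s. P (of_real s) / (of_real s - z) \<partial>half_line a) = D z - P z * Ln (of_real a - z)" if "z \<notin> of_real ` {a..}" for z
  proof -
    have l: "a < max a (Re z) + 1" "Re z < max a (Re z) + 1" by auto
    show ?thesis using Dl(2)[OF l that] D[OF l] by (simp add: F_def eq_diff_eq)
  qed
  ultimately show ?thesis by blast
qed

lemma ray_distance:
  assumes "z \<notin> complex_of_real ` {a..}"
  obtains d where "d > 0" "\<And>s. a \<le> s \<Longrightarrow> d \<le> norm (of_real s - z)"
proof -
  have "complex_of_real ` {a..} = \<real> \<inter> {z. Re z \<ge> a}"
    by (auto elim!: Reals_cases)
  also have "closed \<dots>" by (intro closed_Int closed_complex_Reals closed_halfspace_Re_ge)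
  finally have cl: "closed (complex_of_real ` {a..})" .
  from separate_point_closed[OF cl assms] obtain d where d: "d > 0" "\<forall>x\<in>complex_of_real ` {a..}. d \<le> dist z x" by blast
  show ?thesis
  proof (rule that[OF d(1)])
    fix s assume "a \<le> s"
    then have "d \<le> dist z (of_real s)" using d(2) by simp
    then show "d \<le> norm (of_real s - z)" by (simp add: dist_norm norm_minus_commute)
  qed
qed

text \<open>Multiplying by \<open>z\<close> replaces \<open>P s\<close> by \<open>Q s = s * P s\<close> up to a constant; near the half-line the
  singular part of the integral of \<open>Q\<close> is \<open>Q (Re z)\<close> times a difference of logarithms of
  equal modulus.\<close>

lemma Cauchy_integral_decay:
  assumes der: "\<And>z. (P has_field_derivative P' z) (at z)"
    and r: "rapid a (\<lambda>s. P (of_real s))" and r': "rapid a (\<lambda>s. P' (of_real s))"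
  shows "\<exists>C R. \<forall>z. z \<notin> of_real ` {a..} \<longrightarrow> R \<le> norm z \<longrightarrow>
      norm (\<integral>s. P (of_real s) / (of_real s - z) \<partial>half_line a) \<le> C / norm z"
proof -
  let ?M = "half_line a"
  define Q where "Q = (\<lambda>s. of_real s * P (of_real s))"
  have rQ: "rapid a Q" unfolding Q_def by (rule rapid_times_arg[OF r])
  have rQ': "rapid a (\<lambda>s. P (of_real s) + of_real s * P' (of_real s))"
    by (intro rapid_add rapid_times_arg r r')
  obtain B1 where B1: "B1 \<ge> 0" "\<And>s. s \<ge> a \<Longrightarrow> norm (Q s) \<le> B1" using rapid_bounded[OF rQ] by blast
  obtain B2 where B2: "B2 \<ge> 0" "\<And>s. s \<ge> a \<Longrightarrow> norm (P (of_real s) + of_real s * P' (of_real s)) \<le> B2" using rapid_bounded[OF rQ'] by blast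
  define J where "J = (\<integral>s. norm (Q s) \<partial>?M)"
  have iQ: "integrable ?M Q" by (rule rapid_integrable[OF rQ])
  have [measurable]: "Q \<in> borel_measurable borel" "(\<lambda>s::real. P (of_real s)) \<in> borel_measurable borel"
    using rapid_measurable rQ r by auto
  define K where "K = J + 2 * B2 + 2 * pi * B1"
  have lip: "norm (Q s - Q x) \<le> B2 * \<bar>s - x\<bar>" if "a \<le> s" "a \<le> x" for s x
  proof -
    have d: "((\<lambda>z. z * P z) has_field_derivative P w + w * P' w) (at w)" for w
      using der by (auto intro!: derivative_eq_intros)
    have "norm ((\<lambda>z. z * P z) (of_real s) - (\<lambda>z. z * P z) (of_real x)) \<le> B2 * norm (complex_of_real s - of_real x)"
    proof (rule field_differentiable_bound[of "closed_segment (of_real s) (of_real x)" _ "\<lambda>w. P w + w * P' w"])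
      fix w assume "w \<in> closed_segment (complex_of_real s) (of_real x)"
      then obtain u where u: "w = (1 - u) *\<^sub>R of_real s + u *\<^sub>R of_real x" "0 \<le> u" "u \<le> 1" by (auto simp: in_segment)
      then have w: "w = of_real ((1 - u) * s + u * x)" by (simp add: scaleR_conv_of_real)
      have "(1 - u) * a + u * a \<le> (1 - u) * s + u * x" using u that by (intro add_mono mult_left_mono) auto
      then have "a \<le> (1 - u) * s + u * x" by (simp add: algebra_simps)
      then show "norm (P w + w * P' w) \<le> B2" unfolding w by (rule B2(2))
    qed (auto intro: has_field_derivative_at_within d)
    then show ?thesis by (simp add: Q_def flip: of_real_diff)
  qed
  have iQz: "integrable ?M (\<lambda>s. Q s / (of_real s - z))" if z: "z \<notin> of_real ` {a..}" for z
  proof -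
    obtain d where d: "d > 0" "\<And>s. a \<le> s \<Longrightarrow> d \<le> norm (of_real s - z)" using ray_distance[OF z] by blast
    show ?thesis
    proof (rule Bochner_Integration.integrable_bound[of _ "\<lambda>s. norm (Q s) / d"])
      show "AE s in ?M. norm (Q s / (of_real s - z)) \<le> norm (norm (Q s) / d)"
        using AE_half_line[of a] d
        by (auto elim!: eventually_mono simp: norm_divide intro!: divide_left_mono mult_pos_pos intro: less_le_trans)
    qed (use iQ in auto)
  qed
  \<comment> \<open>The margin 4 serves the case of a point of the half-line within distance 1 of
    \<open>z\<close>: then \<open>Re z\<close> is large and positive, so the window from
    \<open>x - 1\<close> to \<open>x + 1\<close> lies entirely in the half-line.\<close>
  have bound: "norm (\<integral>s. Q s / (of_real s - z) \<partial>?M) \<le> K" if z: "z \<notin> of_real ` {a..}" "\<bar>a\<bar> + 4 \<le> norm z" for z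
  proof (cases "\<forall>s\<ge>a. 1 \<le> norm (of_real s - z)")
    case True
    have "norm (\<integral>s. Q s / (of_real s - z) \<partial>?M) \<le> J"
      unfolding J_def
    proof (rule norm_integral_le)
      show "AE s in ?M. norm (Q s / (of_real s - z)) \<le> norm (Q s)"
        using AE_half_line[of a]
      proof (rule eventually_mono)
        fix s assume "a \<le> s"
        then have "1 \<le> norm (of_real s - z)" using True by blast
        then show "norm (Q s / (of_real s - z)) \<le> norm (Q s)"
          using mult_left_mono[of 1 "norm (of_real s - z)" "norm (Q s)"] by (simp add: norm_divide divide_le_eq)
      qed
    qed (use iQ in auto)
    also have "\<dots> \<le> K" using B1(1) B2(1) by (simp add: K_def)
    finally show ?thesis .
  next
    case False
    define x where "x = Re z"
    define y where "y = Im z"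
    have zxy: "z = of_real x + \<i> * of_real y" by (simp add: x_def y_def complex_eq_iff)
    obtain s0 where s0: "s0 \<ge> a" "norm (of_real s0 - z) < 1" using False by auto
    have "\<bar>s0 - x\<bar> < 1" "\<bar>y\<bar> < 1"
      using s0(2) abs_Re_le_cmod[of "of_real s0 - z"] abs_Im_le_cmod[of "of_real s0 - z"] by (auto simp: x_def y_def)
    moreover have "norm z \<le> \<bar>x\<bar> + \<bar>y\<bar>" unfolding x_def y_def by (rule cmod_le)
    ultimately have x: "x - 1 \<ge> a" using z(2) s0(1) by linarith
    have y: "y \<noteq> 0" using z(1) x by (auto simp: zxy)
    define N where "N = (\<lambda>s. indicator {x-1..x+1} s :: real)"
    have [measurable]: "N \<in> borel_measurable borel" unfolding N_def by measurable
    have iN: "integrable lborel N" unfolding N_def by (rule integrable_real_indicator) (auto simp: emeasure_lborel_Icc_eq)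
    have nz: "of_real s - z \<notin> \<real>\<^sub>\<le>\<^sub>0" for s using y by (simp add: complex_nonpos_Reals_iff zxy)
    then have nz0: "of_real s - z \<noteq> 0" for s by (metis nonpos_Reals_zero_I)
    have c1: "continuous_on {x-1..x+1} (\<lambda>s. 1 / (of_real s - z))"
      using nz0 by (intro continuous_intros) auto
    have i2: "integrable lborel (\<lambda>s. N s *\<^sub>R (1 / (of_real s - z)))"
      unfolding N_def by (rule borel_integrable_compact[OF compact_Icc c1])
    have "(\<integral>s. N s *\<^sub>R (1 / (of_real s - z)) \<partial>?M) = (\<integral>s. N s *\<^sub>R (1 / (of_real s - z)) \<partial>lborel)"
      using x by (subst integral_half_line) (auto intro!: Bochner_Integration.integral_cong simp: N_def indicator_def)
    also have "\<dots> = Ln (of_real (x + 1) - z) - Ln (of_real (x - 1) - z)"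
      unfolding N_def using nz by (intro integral_inverse_segment) auto
    finally have iL: "(\<integral>s. N s *\<^sub>R (1 / (of_real s - z)) \<partial>?M) = Ln (of_real (x + 1) - z) - Ln (of_real (x - 1) - z)" .
    have nL: "norm (Ln (of_real (x + 1) - z) - Ln (of_real (x - 1) - z)) \<le> 2 * pi"
    proof -
      have "norm (of_real (x + 1) - z) = norm (of_real (x - 1) - z)"
        by (simp add: zxy cmod_def)
      then have "Re (Ln (of_real (x + 1) - z) - Ln (of_real (x - 1) - z)) = 0"
        unfolding minus_complex.sel(1)[of "Ln _"] Re_Ln[OF nz0] by simp
      then have "norm (Ln (of_real (x + 1) - z) - Ln (of_real (x - 1) - z)) = \<bar>Im (Ln (of_real (x + 1) - z)) - Im (Ln (of_real (x - 1) - z))\<bar>"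
        by (simp add: cmod_def)
      also have "\<dots> \<le> 2 * pi"
        using Im_Ln_le_pi[OF nz0, of "x + 1"] Im_Ln_le_pi[OF nz0, of "x - 1"] mpi_less_Im_Ln[OF nz0, of "x + 1"] mpi_less_Im_Ln[OF nz0, of "x - 1"]
        by linarith
      finally show ?thesis .
    qed
    have "norm (\<integral>s. Q s / (of_real s - z) - Q x * (N s *\<^sub>R (1 / (of_real s - z))) \<partial>?M) \<le> (\<integral>s. norm (Q s) + B2 * N s \<partial>?M)"
    proof (rule norm_integral_le)
      show "integrable ?M (\<lambda>s. norm (Q s) + B2 * N s)"
        using iQ integrable_lborel_half_line[OF iN] by auto
      show "AE s in ?M. norm (Q s / (of_real s - z) - Q x * (N s *\<^sub>R (1 / (of_real s - z)))) \<le> norm (Q s) + B2 * N s"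
        using AE_half_line[of a]
      proof (rule eventually_mono)
        fix s assume s: "a \<le> s"
        have sx: "\<bar>s - x\<bar> \<le> norm (of_real s - z)" using abs_Re_le_cmod[of "of_real s - z"] by (simp add: x_def)
        show "norm (Q s / (of_real s - z) - Q x * (N s *\<^sub>R (1 / (of_real s - z)))) \<le> norm (Q s) + B2 * N s"
        proof (cases "s \<in> {x-1..x+1}")
          case True
          have "norm (Q s / (of_real s - z) - Q x * (N s *\<^sub>R (1 / (of_real s - z)))) = norm (Q s - Q x) / norm (of_real s - z)"
            using True by (simp add: N_def norm_divide[symmetric] diff_divide_distrib)
          also have "\<dots> \<le> B2"
            using order_trans[OF lip[OF s] mult_left_mono[OF sx B2(1)]] x nz0[of s] by (simp add: divide_le_eq)
          finally show ?thesis using True by (simp add: N_def add_increasing)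
        next
          case False
          then have "1 \<le> norm (of_real s - z)" using sx by (auto simp: abs_if split: if_splits)
          then show ?thesis using False mult_left_mono[of 1 "norm (of_real s - z)" "norm (Q s)"]
            by (simp add: N_def norm_divide divide_le_eq)
        qed
      qed
    qed
    also have "(\<integral>s. norm (Q s) + B2 * N s \<partial>?M) = J + B2 * (\<integral>s. N s \<partial>?M)"
      using iQ integrable_lborel_half_line[OF iN] by (simp add: J_def)
    also have "(\<integral>s. N s \<partial>?M) = (\<integral>s. N s \<partial>lborel)"
      using x by (subst integral_half_line) (auto intro!: Bochner_Integration.integral_cong simp: N_def indicator_def)
    also have "\<dots> = 2" by (simp add: N_def)
    also have "(\<integral>s. Q s / (of_real s - z) - Q x * (N s *\<^sub>R (1 / (of_real s - z))) \<partial>?M)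
      = (\<integral>s. Q s / (of_real s - z) \<partial>?M) - Q x * (Ln (of_real (x + 1) - z) - Ln (of_real (x - 1) - z))"
      unfolding iL[symmetric]
      by (subst Bochner_Integration.integral_diff[OF iQz[OF z(1)] integrable_mult_right[OF integrable_lborel_half_line[OF i2]]]) (simp only: integral_mult_right_zero)
    finally have 1: "norm ((\<integral>s. Q s / (of_real s - z) \<partial>?M) - Q x * (Ln (of_real (x + 1) - z) - Ln (of_real (x - 1) - z))) \<le> J + B2 * 2" .
    have 2: "norm (Q x * (Ln (of_real (x + 1) - z) - Ln (of_real (x - 1) - z))) \<le> 2 * pi * B1"
      unfolding norm_mult using mult_mono[OF B1(2)[of x] nL B1(1)] x by (simp add: mult.commute)
    show ?thesis using norm_triangle_ineq2[of "\<integral>s. Q s / (of_real s - z) \<partial>?M" "Q x * (Ln (of_real (x + 1) - z) - Ln (of_real (x - 1) - z))"] 1 2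
      unfolding K_def by linarith
  qed
  define C where "C = norm (\<integral>s. P (of_real s) \<partial>?M) + K"
  have "norm (\<integral>s. P (of_real s) / (of_real s - z) \<partial>?M) \<le> C / norm z" if z: "z \<notin> of_real ` {a..}" "\<bar>a\<bar> + 4 \<le> norm z" for z
  proof -
    have "z * (\<integral>s. P (of_real s) / (of_real s - z) \<partial>?M) = (\<integral>s. z * (P (of_real s) / (of_real s - z)) \<partial>?M)"
      by (rule integral_mult_right_zero[symmetric])
    also have "\<dots> = (\<integral>s. Q s / (of_real s - z) - P (of_real s) \<partial>?M)"
    proof (rule integral_cong_AE)
      show "AE s in ?M. z * (P (of_real s) / (of_real s - z)) = Q s / (of_real s - z) - P (of_real s)"
        using AE_half_line[of a]
      proof (rule eventually_mono)
        fix s assume "a \<le> s"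
        then have "of_real s - z \<noteq> 0" using off_ray[OF z(1)] by (metis nonpos_Reals_zero_I)
        then show "z * (P (of_real s) / (of_real s - z)) = Q s / (of_real s - z) - P (of_real s)"
          by (simp add: Q_def field_simps)
      qed
    qed measurable
    also have "\<dots> = (\<integral>s. Q s / (of_real s - z) \<partial>?M) - (\<integral>s. P (of_real s) \<partial>?M)"
      using iQz[OF z(1)] rapid_integrable[OF r] by simp
    also have "norm \<dots> \<le> C"
      using norm_triangle_ineq4[of "\<integral>s. Q s / (of_real s - z) \<partial>?M" "\<integral>s. P (of_real s) \<partial>?M"] bound[OF z] by (simp add: C_def)
    finally have "norm z * norm (\<integral>s. P (of_real s) / (of_real s - z) \<partial>?M) \<le> C" by (simp add: norm_mult)
    moreover have "norm z > 0" using z(2) by linarith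
    ultimately show ?thesis by (simp add: field_simps)
  qed
  then show ?thesis by blast
qed

section \<open>The Christoffel-Darboux formula and the rows of the model matrix\<close>

definition airy_kernel_complex :: "complex \<Rightarrow> real \<Rightarrow> complex" where
  "airy_kernel_complex z s = (\<integral>t. Airy (of_real t + z) * of_real (airy (s + t)) \<partial>half_line 0)"

lemma airy_exp_bound:
  obtains C where "C > 0" "\<And>x. \<bar>airy x\<bar> \<le> C * exp (- 2 * x)" "\<And>x. \<bar>airy' x\<bar> \<le> C * exp (- 2 * x)"
  using airy_bound[of 2] by auto

text \<open>The Wronskian-like expression \<open>F\<close> has derivative \<open>f\<close>, because
  the coefficients of the two shifted Airy equations differ by \<open>of_real s - z\<close>.
  Integration from 0 to infinity, where \<open>F\<close> vanishes, leaves its value at 0.\<close>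

lemma Christoffel_Darboux_Airy:
  "(of_real s - z) * airy_kernel_complex z s = Airy' z * Airy (of_real s) - Airy z * Airy' (of_real s)"
proof -
  define F where "F = (\<lambda>t::real. Airy (of_real t + z) * Airy' (of_real s + of_real t) - Airy' (of_real t + z) * Airy (of_real s + of_real t))"
  define f where "f = (\<lambda>t::real. (of_real s - z) * (Airy (of_real t + z) * Airy (of_real s + of_real t)))"
  have dF: "(F has_vector_derivative f t) (at t within X)" for t X
  proof -
    have sh: "((\<lambda>w. w + c) has_field_derivative 1) (at w)" for c w :: complex by (auto intro!: derivative_eq_intros)
    have A: "((\<lambda>w. Airy (w + c)) has_field_derivative Airy' (w + c)) (at w)"
      "((\<lambda>w. Airy' (w + c)) has_field_derivative (w + c) * Airy (w + c)) (at w)" for c w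
      using DERIV_chain'[where g = Airy, OF sh Airy_deriv, of c w] DERIV_chain'[where g = Airy', OF sh Airy'_deriv, of c w] by simp_all
    have "((\<lambda>w. Airy (w + z) * Airy' (w + of_real s) - Airy' (w + z) * Airy (w + of_real s)) has_field_derivative
       (Airy' (w + z) * Airy' (w + of_real s) + (w + of_real s) * Airy (w + of_real s) * Airy (w + z))
       - ((w + z) * Airy (w + z) * Airy (w + of_real s) + Airy' (w + of_real s) * Airy' (w + z))) (at w)" for w
      by (intro DERIV_diff DERIV_mult A)
    then have "((\<lambda>w. Airy (w + z) * Airy' (w + of_real s) - Airy' (w + z) * Airy (w + of_real s)) has_field_derivative
       (of_real s - z) * (Airy (w + z) * Airy (w + of_real s))) (at w)" for w
      by (rule back_subst[of "\<lambda>D. (_ has_field_derivative D) _"]) (simp add: algebra_simps)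
    from has_vector_derivative_real_field[OF this, of t X] show ?thesis by (simp add: F_def f_def add.commute[of "of_real s"])
  qed
  obtain C1 where C1: "C1 > 0" "\<And>w. \<bar>Im w\<bar> \<le> \<bar>Im z\<bar> \<Longrightarrow> norm (Airy w) \<le> C1 * exp (- 1 * Re w) \<and> norm (Airy' w) \<le> C1 * exp (- 1 * Re w)"
    using Airy_bound[of 1 "\<bar>Im z\<bar>"] by auto
  have b: "norm (Airy (of_real t + z)) \<le> C1 * exp (- Re z) * exp (- t)" "norm (Airy' (of_real t + z)) \<le> C1 * exp (- Re z) * exp (- t)" for t
    using C1(2)[of "of_real t + z"] by (simp_all add: exp_add[symmetric] algebra_simps)
  obtain C2 where C2: "C2 > 0" "\<And>x. \<bar>airy x\<bar> \<le> C2 * exp (- 2 * x)" "\<And>x. \<bar>airy' x\<bar> \<le> C2 * exp (- 2 * x)"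
    using airy_exp_bound by blast
  have b': "norm (Airy (of_real s + of_real t)) \<le> C2 * exp (- 2 * s) * exp (- 2 * t)" "norm (Airy' (of_real s + of_real t)) \<le> C2 * exp (- 2 * s) * exp (- 2 * t)" for t
    using C2(2)[of "s + t"] C2(3)[of "s + t"] of_real_airy[of "s + t", symmetric] of_real_airy'[of "s + t", symmetric]
    by (simp_all add: exp_add[symmetric] algebra_simps)
  define D where "D = C1 * exp (- Re z) * (C2 * exp (- 2 * s))"
  have e3: "exp (- t) * exp (- 2 * t) = exp (- 3 * t)" for t :: real by (simp add: exp_add[symmetric])
  have pb: "norm (u * v) \<le> D * exp (- 3 * t)" if "norm u \<le> C1 * exp (- Re z) * exp (- t)" "norm v \<le> C2 * exp (- 2 * s) * exp (- 2 * t)" for u v :: complex and t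
  proof -
    have "norm (u * v) \<le> (C1 * exp (- Re z) * exp (- t)) * (C2 * exp (- 2 * s) * exp (- 2 * t))"
      unfolding norm_mult using that C1 by (intro mult_mono) auto
    also have "\<dots> = D * (exp (- t) * exp (- 2 * t))" by (simp add: D_def)
    finally show ?thesis unfolding e3 .
  qed
  have Fb: "norm (F t) \<le> 2 * D * exp (- 3 * t)" for t
    using norm_triangle_ineq4[of "Airy (of_real t + z) * Airy' (of_real s + of_real t)" "Airy' (of_real t + z) * Airy (of_real s + of_real t)"]
      pb[OF b(1) b'(2), of t] pb[OF b(2) b'(1), of t] by (simp add: F_def)
  have "((\<lambda>t. 2 * D * exp (- 3 * t)) \<longlongrightarrow> 0) at_top" by real_asymp
  then have F0: "(F \<longlongrightarrow> 0) at_top"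
    by (rule Lim_null_comparison[rotated]) (use Fb in auto)
  have fm [measurable]: "f \<in> borel_measurable borel" unfolding f_def by measurable
  have if': "integrable (half_line 0) (\<lambda>t. Airy (of_real t + z) * Airy (of_real s + of_real t))"
    by (rule integrable_dominated[of _ "\<lambda>t. D * exp (- 3 * t)"]) (use pb[OF b(1) b'(1)] integrable_exp_half_line[of 3 0] in auto)
  have fi: "set_integrable lborel {0..} f"
  proof -
    have "integrable (half_line 0) f" unfolding f_def using if' by simp
    then show ?thesis unfolding set_integrable_def by (subst (asm) integrable_half_line) auto
  qed
  have "((\<lambda>b. set_lebesgue_integral lborel {0..b} f) \<longlongrightarrow> set_lebesgue_integral lborel {0..} f) at_top"
    by (rule tendsto_set_lebesgue_integral_at_top[OF _ fi]) auto
  moreover have "eventually (\<lambda>b. F b - F 0 = set_lebesgue_integral lborel {0..b} f) at_top"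
    using eventually_ge_at_top[of 0]
  proof (rule eventually_mono)
    fix b :: real assume "0 \<le> b"
    have "(\<integral>t. indicator {0..b} t *\<^sub>R f t \<partial>lborel) = F b - F 0"
    proof (rule integral_FTC_atLeastAtMost[OF \<open>0 \<le> b\<close> dF])
      show "continuous_on {0..b} f" unfolding f_def by (intro continuous_intros)
    qed
    then show "F b - F 0 = set_lebesgue_integral lborel {0..b} f" by (simp add: set_lebesgue_integral_def)
  qed
  moreover have "((\<lambda>b. F b - F 0) \<longlongrightarrow> 0 - F 0) at_top" by (intro tendsto_intros F0)
  ultimately have "set_lebesgue_integral lborel {0..} f = 0 - F 0"
    by (blast intro: tendsto_unique[OF trivial_limit_at_top_linorder] Lim_transform_eventually)
  moreover have "set_lebesgue_integral lborel {0..} f = (\<integral>t. f t \<partial>half_line 0)"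
    unfolding set_lebesgue_integral_def by (subst integral_half_line) auto
  moreover have "(\<integral>t. f t \<partial>half_line 0) = (of_real s - z) * airy_kernel_complex z s"
    by (simp add: f_def airy_kernel_complex_def of_real_airy)
  ultimately show ?thesis by (simp add: F_def algebra_simps)
qed

text \<open>One row of the model matrix: \<open>u\<close> solves \<open>u = v + K u\<close> on the half-line, where
  \<open>v = e1 * Airy + e2 * Airy'\<close>, and \<open>(d1, d2)\<close> is the entire part of the row
  \<open>(e1, e2)\<close> plus the Cauchy integral of \<open>u * (- Airy', Airy)\<close>.\<close>

lemma airy_row:
  fixes a e1 e2 :: real
  shows "\<exists>u d1 d2 C R. u holomorphic_on UNIV \<and> d1 holomorphic_on UNIV \<and> d2 holomorphic_on UNIV \<and>
    (\<forall>z. d1 z * Airy z + d2 z * Airy' z = u z) \<and>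
    (\<forall>z. z \<notin> of_real ` {a..} \<longrightarrow> R \<le> norm z \<longrightarrow>
       norm (d1 z + u z * Airy' z * Ln (of_real a - z) - of_real e1) \<le> C / norm z \<and>
       norm (d2 z - u z * Airy z * Ln (of_real a - z) - of_real e2) \<le> C / norm z)"
proof -
  let ?M = "half_line a"
  obtain C where C: "C > 0" "\<And>x. \<bar>airy x\<bar> \<le> C * exp (- 2 * x)" "\<And>x. \<bar>airy' x\<bar> \<le> C * exp (- 2 * x)"
    using airy_exp_bound by blast
  have vb: "\<bar>e1 * airy x + e2 * airy' x\<bar> \<le> (\<bar>e1\<bar> * C + \<bar>e2\<bar> * C) * exp (- 2 * x)" for x
  proof -
    have "\<bar>e1 * airy x + e2 * airy' x\<bar> \<le> \<bar>e1\<bar> * \<bar>airy x\<bar> + \<bar>e2\<bar> * \<bar>airy' x\<bar>"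
      using abs_triangle_ineq[of "e1 * airy x" "e2 * airy' x"] by (simp add: abs_mult)
    also have "\<dots> \<le> \<bar>e1\<bar> * (C * exp (- 2 * x)) + \<bar>e2\<bar> * (C * exp (- 2 * x))"
      using C by (intro add_mono mult_left_mono) auto
    finally show ?thesis by (simp add: algebra_simps)
  qed
  have vm: "(\<lambda>x. e1 * airy x + e2 * airy' x) \<in> borel_measurable borel" by measurable
  from airy_resolvent[OF vm vb] obtain y c where y: "y \<in> borel_measurable borel" "\<And>x. \<bar>y x\<bar> \<le> c * exp (- 2 * x)"
    "\<And>x. y x = (e1 * airy x + e2 * airy' x) + (\<integral>s. airy_kernel x s * y s \<partial>?M)" by blast
  note [measurable] = y(1)
  have c0: "c \<ge> 0" using y(2)[of 0] by simp
  \<comment> \<open>The Airy transform of \<open>y\<close>. Through it the kernel integral becomes a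
    superposition of shifted Airy functions, which makes sense at complex points and so continues
    the resolvent solution to the plane.\<close>
  define R where "R = (\<lambda>t. \<integral>s. airy (s + t) * y s \<partial>?M)"
  have [measurable]: "R \<in> borel_measurable borel" unfolding R_def by measurable
  have e4: "exp (- 2 * t) * exp (- 2 * t) = exp (- 4 * t)" for t :: real by (simp add: exp_add[symmetric])
  have i4: "integrable (half_line b) (\<lambda>t. exp (- 4 * t))" for b by (rule integrable_exp_half_line) simp
  have airy2: "\<bar>airy (s + t)\<bar> \<le> C * exp (- 2 * s) * exp (- 2 * t)" for s t
    using C(2)[of "s + t"] by (simp add: exp_add[symmetric] algebra_simps)
  define r where "r = C * c * (\<integral>s. exp (- 4 * s) \<partial>?M)"
  have Rb: "norm (complex_of_real (R t)) \<le> r * exp (- 2 * t)" for t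
  proof -
    have "norm (R t) \<le> (\<integral>s. C * c * exp (- 2 * t) * exp (- 4 * s) \<partial>?M)"
      unfolding R_def
    proof (rule norm_integral_le)
      have "norm (airy (s + t) * y s) \<le> C * c * exp (- 2 * t) * exp (- 4 * s)" for s
      proof -
        have "norm (airy (s + t) * y s) \<le> (C * exp (- 2 * s) * exp (- 2 * t)) * (c * exp (- 2 * s))"
          unfolding real_norm_def abs_mult using C y(2) by (intro mult_mono airy2) auto
        also have "\<dots> = C * c * exp (- 2 * t) * (exp (- 2 * s) * exp (- 2 * s))" by simp
        finally show ?thesis unfolding e4 .
      qed
      then show "AE s in ?M. norm (airy (s + t) * y s) \<le> C * c * exp (- 2 * t) * exp (- 4 * s)" by simp
    qed (use i4 in auto)
    then show ?thesis by (simp add: r_def ac_simps)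
  qed
  note sup = Airy_superposition_deriv[of "\<lambda>t. of_real (R t)" r 0, OF _ Rb]
  define U where "U = (\<lambda>z. \<integral>t. Airy (of_real t + z) * of_real (R t) \<partial>half_line 0)"
  define U' where "U' = (\<lambda>z. \<integral>t. Airy' (of_real t + z) * of_real (R t) \<partial>half_line 0)"
  have Ud: "(U has_field_derivative U' z) (at z)" for z unfolding U_def U'_def by (rule sup(1)) measurable
  define u where "u = (\<lambda>z. e1 * Airy z + e2 * Airy' z + U z)"
  define u' where "u' = (\<lambda>z. e1 * Airy' z + e2 * (z * Airy z) + U' z)"
  have ud: "(u has_field_derivative u' z) (at z)" for z
    unfolding u_def u'_def by (intro DERIV_add DERIV_cmult Airy_deriv Airy'_deriv Ud)
  have uh: "u holomorphic_on UNIV" using ud by (auto simp: holomorphic_on_open)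
  have Ufub: "U z = (\<integral>s. airy_kernel_complex z s * of_real (y s) \<partial>?M)" for z
  proof -
    obtain B where B: "B > 0" "\<And>w. \<bar>Im w\<bar> \<le> \<bar>Im z\<bar> \<Longrightarrow> norm (Airy w) \<le> B * exp (- 1 * Re w)"
      using Airy_bound[of 1 "\<bar>Im z\<bar>"] by auto
    have "U z = (\<integral>t. (\<integral>s. Airy (of_real t + z) * of_real (airy (s + t) * y s) \<partial>?M) \<partial>half_line 0)"
      unfolding U_def R_def by (subst integral_complex_of_real[symmetric]) (simp only: integral_mult_right_zero)
    also have "\<dots> = (\<integral>s. (\<integral>t. Airy (of_real t + z) * of_real (airy (s + t) * y s) \<partial>half_line 0) \<partial>?M)"
    proof (rule Fubini_product_bound(1)[symmetric, where p = "\<lambda>s. C * c * exp (- 4 * s)" and q = "\<lambda>t. B * exp (- Re z) * exp (- 3 * t)"])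
      fix s t
      have "norm (Airy (of_real t + z)) \<le> B * exp (- Re z) * exp (- t)"
        using B(2)[of "of_real t + z"] by (simp add: exp_add[symmetric] algebra_simps)
      then have "norm (Airy (of_real t + z) * of_real (airy (s + t) * y s)) \<le> (B * exp (- Re z) * exp (- t)) * ((C * exp (- 2 * s) * exp (- 2 * t)) * (c * exp (- 2 * s)))"
        unfolding norm_mult norm_of_real abs_mult using B C y(2) c0 by (intro mult_mono airy2) auto
      also have "\<dots> = C * c * (exp (- 2 * s) * exp (- 2 * s)) * (B * exp (- Re z) * (exp (- t) * exp (- 2 * t)))" by simp
      also have "exp (- t) * exp (- 2 * t) = exp (- 3 * t)" by (simp add: exp_add[symmetric])
      finally show "norm (Airy (of_real t + z) * of_real (airy (s + t) * y s)) \<le> C * c * exp (- 4 * s) * (B * exp (- Re z) * exp (- 3 * t))"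
        unfolding e4 .
    qed (use i4[of a] integrable_exp_half_line[of 3 0] in \<open>auto intro: half_line.sigma_finite_measure_axioms\<close>)
    also have "\<dots> = (\<integral>s. airy_kernel_complex z s * of_real (y s) \<partial>?M)"
      unfolding airy_kernel_complex_def by (simp flip: integral_mult_left_zero add: mult.assoc)
    finally show ?thesis .
  qed
  have uy: "u (of_real x) = of_real (y x)" for x
  proof -
    have "airy_kernel_complex (of_real x) s = of_real (airy_kernel x s)" for s
    proof -
      have "Airy (of_real t + of_real x) = of_real (airy (x + t))" for t
        using of_real_airy[of "x + t"] by (simp only: of_real_add add.commute)
      then show ?thesis unfolding airy_kernel_complex_def airy_kernel_def
        by (simp only: of_real_mult[symmetric] integral_complex_of_real)
    qed
    then have "U (of_real x) = of_real (\<integral>s. airy_kernel x s * y s \<partial>?M)"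
      unfolding Ufub by (simp only: of_real_mult[symmetric] integral_complex_of_real)
    then show ?thesis using y(3)[of x] by (simp add: u_def of_real_airy[symmetric] of_real_airy'[symmetric])
  qed
  \<comment> \<open>\<open>y\<close> is only known to decay at rate 2. The outer Airy factor decays
    at every rate, and it alone depends on \<open>x\<close>.\<close>
  have rU: "rapid a (\<lambda>x. U (of_real x))" "rapid a (\<lambda>x. U' (of_real x))"
  proof -
    have "rapid a (\<lambda>x. \<integral>t. G (x + t) * of_real (R t) \<partial>half_line 0)"
      if [measurable]: "G \<in> borel_measurable borel" and G: "\<And>p. p > 0 \<Longrightarrow> \<exists>C>0. \<forall>x. norm (G x) \<le> C * exp (- p * x)" for G :: "real \<Rightarrow> complex"
      unfolding rapid_def
    proof (intro conjI allI impI)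
      fix p :: real assume p: "p > 0"
      obtain D where D: "D > 0" "\<And>x. norm (G x) \<le> D * exp (- p * x)" using G[OF p] by blast
      have "norm (\<integral>t. G (x + t) * of_real (R t) \<partial>half_line 0) \<le> (D * r * (\<integral>t. exp (- (p + 2) * t) \<partial>half_line 0)) * exp (- p * x)" for x
      proof -
        have "norm (\<integral>t. G (x + t) * of_real (R t) \<partial>half_line 0) \<le> (\<integral>t. D * r * exp (- p * x) * exp (- (p + 2) * t) \<partial>half_line 0)"
        proof (rule norm_integral_le)
          show "integrable (half_line 0) (\<lambda>t. D * r * exp (- p * x) * exp (- (p + 2) * t))"
            using p by (intro integrable_mult_right integrable_exp_half_line) auto
          have "norm (G (x + t) * of_real (R t)) \<le> D * r * exp (- p * x) * exp (- (p + 2) * t)" for t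
          proof -
            have "norm (G (x + t) * of_real (R t)) \<le> (D * exp (- p * (x + t))) * (r * exp (- 2 * t))"
              unfolding norm_mult using D Rb by (intro mult_mono) auto
            also have "\<dots> = D * r * (exp (- p * (x + t)) * exp (- 2 * t))" by simp
            also have "exp (- p * (x + t)) * exp (- 2 * t) = exp (- p * x) * exp (- (p + 2) * t)" by (simp add: exp_add[symmetric] algebra_simps)
            finally show ?thesis by simp
          qed
          then show "AE t in half_line 0. norm (G (x + t) * of_real (R t)) \<le> D * r * exp (- p * x) * exp (- (p + 2) * t)" by simp
        qed
        then show ?thesis by (simp add: ac_simps)
      qed
      then show "\<exists>C. \<forall>x\<ge>a. norm (\<integral>t. G (x + t) * of_real (R t) \<partial>half_line 0) \<le> C * exp (- p * x)" by blast
    qed measurable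
    note * = this
    have g: "\<exists>C>0. \<forall>x. norm (Airy (of_real x)) \<le> C * exp (- p * x)" "\<exists>C>0. \<forall>x. norm (Airy' (of_real x)) \<le> C * exp (- p * x)" if "p > 0" for p
      using airy_bound[OF that] by (auto simp: of_real_airy[symmetric] of_real_airy'[symmetric])
    show "rapid a (\<lambda>x. U (of_real x))" "rapid a (\<lambda>x. U' (of_real x))"
      using *[OF _ g(1)] *[OF _ g(2)] by (simp_all add: U_def U'_def add.commute)
  qed
  have ru: "rapid a (\<lambda>x. u (of_real x))" "rapid a (\<lambda>x. u' (of_real x))"
    unfolding u_def u'_def by (intro rapid_add rapid_cmult rapid_times_arg rapid_Airy rU)+
  \<comment> \<open>The densities satisfy \<open>P1 z * Airy z + P2 z * Airy' z = 0\<close>. In the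
    corresponding combination of Cauchy integrals the logarithms therefore cancel, while
    Christoffel-Darboux turns it into the kernel integral \<open>U\<close>.\<close>
  define P1 where "P1 = (\<lambda>z. - 1 * (u z * Airy' z))"
  define P2 where "P2 = (\<lambda>z. u z * Airy z)"
  have P1d: "(P1 has_field_derivative - 1 * (u' z * Airy' z + (z * Airy z) * u z)) (at z)" for z
    unfolding P1_def by (intro DERIV_cmult DERIV_mult ud Airy'_deriv)
  have P2d: "(P2 has_field_derivative u' z * Airy z + Airy' z * u z) (at z)" for z
    unfolding P2_def by (intro DERIV_mult ud Airy_deriv)
  have rP: "rapid a (\<lambda>s. P1 (of_real s))" "rapid a (\<lambda>s. P2 (of_real s))"
     "rapid a (\<lambda>s. - 1 * (u' (of_real s) * Airy' (of_real s) + (of_real s * Airy (of_real s)) * u (of_real s)))"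
     "rapid a (\<lambda>s. u' (of_real s) * Airy (of_real s) + Airy' (of_real s) * u (of_real s))"
    unfolding P1_def P2_def by (intro rapid_cmult rapid_add rapid_mult ru rapid_Airy rapid_times_arg)+
  have P1h: "P1 holomorphic_on UNIV" and P2h: "P2 holomorphic_on UNIV"
    using P1d P2d by (auto simp: holomorphic_on_open)
  obtain D1 where D1: "D1 holomorphic_on UNIV" "\<And>z. z \<notin> of_real ` {a..} \<Longrightarrow> (\<integral>s. P1 (of_real s) / (of_real s - z) \<partial>?M) = D1 z - P1 z * Ln (of_real a - z)"
    using Cauchy_integral_entire[OF P1h rapid_integrable[OF rP(1)]] by blast
  obtain D2 where D2: "D2 holomorphic_on UNIV" "\<And>z. z \<notin> of_real ` {a..} \<Longrightarrow> (\<integral>s. P2 (of_real s) / (of_real s - z) \<partial>?M) = D2 z - P2 z * Ln (of_real a - z)"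
    using Cauchy_integral_entire[OF P2h rapid_integrable[OF rP(2)]] by blast
  define d1 where "d1 = (\<lambda>z. of_real e1 + D1 z)"
  define d2 where "d2 = (\<lambda>z. of_real e2 + D2 z)"
  have dh: "d1 holomorphic_on UNIV" "d2 holomorphic_on UNIV"
    unfolding d1_def d2_def by (intro holomorphic_intros D1 D2)+
  obtain C1 R1 where C1: "\<And>z. z \<notin> of_real ` {a..} \<Longrightarrow> R1 \<le> norm z \<Longrightarrow> norm (\<integral>s. P1 (of_real s) / (of_real s - z) \<partial>?M) \<le> C1 / norm z"
    using Cauchy_integral_decay[OF P1d rP(1,3)] by blast
  obtain C2 R2 where C2: "\<And>z. z \<notin> of_real ` {a..} \<Longrightarrow> R2 \<le> norm z \<Longrightarrow> norm (\<integral>s. P2 (of_real s) / (of_real s - z) \<partial>?M) \<le> C2 / norm z"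
    using Cauchy_integral_decay[OF P2d rP(2,4)] by blast
  have decay: "norm (d1 z + u z * Airy' z * Ln (of_real a - z) - of_real e1) \<le> max C1 C2 / norm z \<and>
       norm (d2 z - u z * Airy z * Ln (of_real a - z) - of_real e2) \<le> max C1 C2 / norm z"
    if z: "z \<notin> of_real ` {a..}" "max R1 R2 \<le> norm z" for z
  proof
    have "d1 z + u z * Airy' z * Ln (of_real a - z) - of_real e1 = (\<integral>s. P1 (of_real s) / (of_real s - z) \<partial>?M)"
      using D1(2)[OF z(1)] by (simp add: d1_def P1_def)
    then have "norm (d1 z + u z * Airy' z * Ln (of_real a - z) - of_real e1) \<le> C1 / norm z" using C1[OF z(1)] z(2) by simp
    also have "\<dots> \<le> max C1 C2 / norm z" by (intro divide_right_mono) auto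
    finally show "norm (d1 z + u z * Airy' z * Ln (of_real a - z) - of_real e1) \<le> max C1 C2 / norm z" .
    have "d2 z - u z * Airy z * Ln (of_real a - z) - of_real e2 = (\<integral>s. P2 (of_real s) / (of_real s - z) \<partial>?M)"
      using D2(2)[OF z(1)] by (simp add: d2_def P2_def)
    then have "norm (d2 z - u z * Airy z * Ln (of_real a - z) - of_real e2) \<le> C2 / norm z" using C2[OF z(1)] z(2) by simp
    also have "\<dots> \<le> max C1 C2 / norm z" by (intro divide_right_mono) auto
    finally show "norm (d2 z - u z * Airy z * Ln (of_real a - z) - of_real e2) \<le> max C1 C2 / norm z" .
  qed
  have iden: "d1 z * Airy z + d2 z * Airy' z - u z = 0" if z: "Im z > 0" for z
  proof -
    have zr: "z \<notin> of_real ` {a..}" using z by (metis Im_complex_of_real imageE less_irrefl)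
    obtain d where d: "d > 0" "\<And>s. a \<le> s \<Longrightarrow> d \<le> norm (of_real s - z)" using ray_distance[OF zr] by blast
    have ic: "integrable ?M (\<lambda>s. P (of_real s) / (of_real s - z))" if P: "rapid a (\<lambda>s. P (of_real s))" for P :: "complex \<Rightarrow> complex"
    proof (rule Bochner_Integration.integrable_bound[of _ "\<lambda>s. norm (P (of_real s)) / d"])
      have [measurable]: "(\<lambda>s::real. P (of_real s)) \<in> borel_measurable borel" by (rule rapid_measurable[OF P])
      show "(\<lambda>s. P (of_real s) / (of_real s - z)) \<in> borel_measurable ?M" by measurable
      show "AE s in ?M. norm (P (of_real s) / (of_real s - z)) \<le> norm (norm (P (of_real s)) / d)"
        using AE_half_line[of a] d by (auto elim!: eventually_mono simp: norm_divide intro!: frac_le)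
    qed (use rapid_integrable[OF P] in auto)
    have "U z = (\<integral>s. (P1 (of_real s) / (of_real s - z)) * Airy z + (P2 (of_real s) / (of_real s - z)) * Airy' z \<partial>?M)"
      unfolding Ufub
    proof (rule Bochner_Integration.integral_cong[OF refl])
      fix s
      have nz: "of_real s - z \<noteq> 0" using z by (auto simp: complex_eq_iff)
      have kk: "airy_kernel_complex z s = (Airy' z * Airy (of_real s) - Airy z * Airy' (of_real s)) / (of_real s - z)"
        using Christoffel_Darboux_Airy[of s z] nz by (simp add: field_simps)
      show "airy_kernel_complex z s * of_real (y s) = (P1 (of_real s) / (of_real s - z)) * Airy z + (P2 (of_real s) / (of_real s - z)) * Airy' z"
        unfolding kk P1_def P2_def uy by (simp add: diff_divide_distrib algebra_simps)
    qed
    also have "\<dots> = (\<integral>s. P1 (of_real s) / (of_real s - z) \<partial>?M) * Airy z + (\<integral>s. P2 (of_real s) / (of_real s - z) \<partial>?M) * Airy' z"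
      by (subst Bochner_Integration.integral_add[OF integrable_mult_left[OF ic[OF rP(1)]] integrable_mult_left[OF ic[OF rP(2)]]])
         (simp only: integral_mult_left_zero)
    finally show ?thesis
      unfolding D1(2)[OF zr] D2(2)[OF zr] by (simp add: d1_def d2_def u_def P1_def P2_def algebra_simps)
  qed
  have "d1 z * Airy z + d2 z * Airy' z - u z = 0" for z
  proof (rule analytic_continuation_open[of "{z. Im z > 0}" UNIV "\<lambda>z. d1 z * Airy z + d2 z * Airy' z - u z" "\<lambda>z. 0"])
    show "{z. Im z > 0} \<noteq> {}" by (auto intro: exI[of _ \<i>])
    show "(\<lambda>z. d1 z * Airy z + d2 z * Airy' z - u z) holomorphic_on UNIV"
      by (intro holomorphic_intros dh uh)
  qed (use iden in \<open>auto simp: open_halfspace_Im_gt connected_UNIV\<close>)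
  then have "d1 z * Airy z + d2 z * Airy' z = u z" for z by simp
  with uh dh decay show ?thesis by blast
qed

section \<open>Airy columns in the sectors\<close>

text \<open>The constant that gives \<open>airyA\<close> and \<open>airyU\<close> the Wronskian 1
  and the leading coefficients demanded by \<open>mfrak\<close>. Its square is
  \<open>- (2 * of_real pi * \<i>)\<close>, which ties the Wronskian to the factor in front of the
  logarithm.\<close>

definition airy_norm :: complex where "airy_norm = of_real (sqrt (2 * pi)) * cis (- pi / 4)"

definition airyA :: "complex \<Rightarrow> complex" where "airyA z = airy_norm * Airy z"
definition airyA' :: "complex \<Rightarrow> complex" where "airyA' z = airy_norm * Airy' z"
text \<open>\<open>airyU\<close> and \<open>airyL\<close> serve as second column in the upper and in
  the lower half-plane. Their powers of \<open>omega3\<close> and signs make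
  \<open>airyA = airyU - airyL\<close>. Past the rays the first column is represented by
  \<open>- airyL\<close> above and by \<open>airyU\<close> below.\<close>

definition airyU :: "complex \<Rightarrow> complex" where "airyU z = - airy_norm * omega3\<^sup>2 * Airy (omega3\<^sup>2 * z)"
definition airyU' :: "complex \<Rightarrow> complex" where "airyU' z = - airy_norm * omega3 * Airy' (omega3\<^sup>2 * z)"
definition airyL :: "complex \<Rightarrow> complex" where "airyL z = airy_norm * omega3 * Airy (omega3 * z)"
definition airyL' :: "complex \<Rightarrow> complex" where "airyL' z = airy_norm * omega3\<^sup>2 * Airy' (omega3 * z)"

lemma omega3_mult: "omega3 * (omega3 * omega3) = 1"
  using omega3_cube by (simp add: power3_eq_cube mult.assoc)

lemma Airy_scaled_deriv:
  "((\<lambda>z. Airy (a * z)) has_field_derivative a * Airy' (a * z)) (at z)"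
  "((\<lambda>z. Airy' (a * z)) has_field_derivative a * (a * z * Airy (a * z))) (at z)"
  using DERIV_chain'[where g = Airy, OF DERIV_cmult_Id[of a] Airy_deriv, of z]
    DERIV_chain'[where g = Airy', OF DERIV_cmult_Id[of a] Airy'_deriv, of z] by (simp_all add: ac_simps)

lemma airyAUL_deriv:
  "(airyA has_field_derivative airyA' z) (at z)" "(airyA' has_field_derivative z * airyA z) (at z)"
  "(airyU has_field_derivative airyU' z) (at z)" "(airyU' has_field_derivative z * airyU z) (at z)"
  "(airyL has_field_derivative airyL' z) (at z)" "(airyL' has_field_derivative z * airyL z) (at z)"
proof -
  note o = omega3_mult
  have s: "(f has_field_derivative D) (at z) \<Longrightarrow> D = E \<Longrightarrow> (f has_field_derivative E) (at z)" for f D E by simp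
  show "(airyA has_field_derivative airyA' z) (at z)"
    unfolding airyA_def[abs_def] airyA'_def by (intro DERIV_cmult Airy_deriv)
  show "(airyA' has_field_derivative z * airyA z) (at z)"
    unfolding airyA_def airyA'_def[abs_def] by (rule s[OF DERIV_cmult[OF Airy'_deriv]]) simp
  show "(airyU has_field_derivative airyU' z) (at z)"
    unfolding airyU_def[abs_def] airyU'_def by (rule s[OF DERIV_cmult[OF Airy_scaled_deriv(1)]]) (use o in algebra)
  show "(airyU' has_field_derivative z * airyU z) (at z)"
    unfolding airyU_def airyU'_def[abs_def] by (rule s[OF DERIV_cmult[OF Airy_scaled_deriv(2)]]) (use o in algebra)
  show "(airyL has_field_derivative airyL' z) (at z)"
    unfolding airyL_def[abs_def] airyL'_def by (rule s[OF DERIV_cmult[OF Airy_scaled_deriv(1)]]) (simp add: power2_eq_square)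
  show "(airyL' has_field_derivative z * airyL z) (at z)"
    unfolding airyL_def airyL'_def[abs_def] by (rule s[OF DERIV_cmult[OF Airy_scaled_deriv(2)]]) (use o in algebra)
qed

lemma airyAUL_holomorphic:
  "airyA holomorphic_on UNIV" "airyA' holomorphic_on UNIV" "airyU holomorphic_on UNIV"
  "airyU' holomorphic_on UNIV" "airyL holomorphic_on UNIV" "airyL' holomorphic_on UNIV"
  using airyAUL_deriv unfolding holomorphic_on_open[OF open_UNIV] by blast+

lemma airy_connection: "airyU z - airyL z = airyA z" "airyU' z - airyL' z = airyA' z"
proof -
  have 1: "airyU z - airyL z = airyA z" for z
    using Airy_connection[of z] unfolding airyU_def airyL_def airyA_def by algebra
  then show "airyU z - airyL z = airyA z" .
  have "((\<lambda>z. airyU z - airyL z) has_field_derivative airyU' z - airyL' z) (at z)"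
    by (intro DERIV_diff airyAUL_deriv)
  then show "airyU' z - airyL' z = airyA' z"
    using DERIV_unique[OF airyAUL_deriv(1)[of z]] by (simp add: 1)
qed

text \<open>The two asymptotic normal forms: with \<open>v = \<eta>\<^sup>2\<close>, a column \<open>(f, f')\<close> of the first kind decays like
  \<open>exp (- 2/3 v powr (3/2))\<close>, one of the second kind grows like \<open>exp (2/3 v powr (3/2))\<close>.\<close>

definition airy_form :: "real \<Rightarrow> real \<Rightarrow> complex \<Rightarrow> complex \<Rightarrow> complex \<Rightarrow> bool" where
  "airy_form C \<sigma> \<eta> f f' \<longleftrightarrow> (\<exists>r r'. norm r \<le> C / norm \<eta> ^ 3 \<and> norm r' \<le> C / norm \<eta> ^ 3 \<and>
     f = cis (\<sigma> * pi / 4) / sqrt 2 * exp (of_real (\<sigma> * (2/3)) * \<eta> ^ 3) / csqrt \<eta> * (1 + r) \<and>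
     f' = of_real \<sigma> * cis (\<sigma> * pi / 4) / sqrt 2 * exp (of_real (\<sigma> * (2/3)) * \<eta> ^ 3) * csqrt \<eta> * (1 + r'))"

lemma csqrt_bounds:
  assumes "Re \<eta> > 0"
  shows "\<bar>Im (csqrt \<eta>)\<bar> < Re (csqrt \<eta>)" "Im \<eta> \<ge> 0 \<Longrightarrow> Im (csqrt \<eta>) \<ge> 0" "Im \<eta> \<le> 0 \<Longrightarrow> Im (csqrt \<eta>) \<le> 0"
proof -
  define s where "s = csqrt \<eta>"
  have sq: "s\<^sup>2 = \<eta>" by (simp add: s_def)
  have re: "Re s > 0"
  proof -
    have "Re s \<noteq> 0"
    proof
      assume "Re s = 0"
      then have "Re (s\<^sup>2) = - ((Im s)\<^sup>2)" by (simp add: Re_power2)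
      then show False using assms unfolding sq by (smt (verit) zero_le_power2)
    qed
    then show ?thesis using csqrt_principal[of \<eta>] unfolding s_def[symmetric] by blast
  qed
  have "(Re s)\<^sup>2 - (Im s)\<^sup>2 > 0" using assms by (simp add: sq[symmetric] Re_power2)
  then have "\<bar>Im s\<bar>\<^sup>2 < (Re s)\<^sup>2" by simp
  then show "\<bar>Im (csqrt \<eta>)\<bar> < Re (csqrt \<eta>)" using re unfolding s_def[symmetric] by (rule power_less_imp_less_base[OF _ less_imp_le])
  have "Im \<eta> = 2 * Re s * Im s" by (simp add: sq[symmetric] Im_power2)
  then show "Im \<eta> \<ge> 0 \<Longrightarrow> Im (csqrt \<eta>) \<ge> 0" "Im \<eta> \<le> 0 \<Longrightarrow> Im (csqrt \<eta>) \<le> 0"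
    using re unfolding s_def[symmetric] by (auto simp: zero_le_mult_iff mult_le_0_iff)
qed

lemma cis_sixth: "cis (pi / 6) = Complex (sqrt 3 / 2) (1 / 2)" "cis (- pi / 6) = Complex (sqrt 3 / 2) (- 1 / 2)"
  "cis (pi / 3) = Complex (1 / 2) (sqrt 3 / 2)" "cis (- pi / 3) = Complex (1 / 2) (- sqrt 3 / 2)"
  "cis (2 * pi / 3) = Complex (- 1 / 2) (sqrt 3 / 2)" "cis (- (2 * pi / 3)) = Complex (- 1 / 2) (- sqrt 3 / 2)"
  by (auto simp: complex_eq_iff cos_30 sin_30 cos_60 sin_60 cos_120 sin_120)

text \<open>The principal root follows a rotation as long as the rotated root stays in the right
  half-plane. Here \<open>csqrt \<eta>\<close> lies within an angle pi/4 of the positive axis, so an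
  angle pi/6 is always safe, whereas pi/3 is safe only if it turns towards the axis.\<close>

lemma csqrt_rotate:
  assumes "Re \<eta> > 0"
  shows "csqrt (cis (- pi / 3) * \<eta>) = cis (- pi / 6) * csqrt \<eta>"
    and "csqrt (cis (pi / 3) * \<eta>) = cis (pi / 6) * csqrt \<eta>"
    and "Im \<eta> \<ge> 0 \<Longrightarrow> csqrt (cis (- (2 * pi / 3)) * \<eta>) = cis (- pi / 3) * csqrt \<eta>"
    and "Im \<eta> \<le> 0 \<Longrightarrow> csqrt (cis (2 * pi / 3) * \<eta>) = cis (pi / 3) * csqrt \<eta>"
proof -
  define x y where "x = Re (csqrt \<eta>)" and "y = Im (csqrt \<eta>)"
  note b = csqrt_bounds[OF assms, folded x_def y_def]
  have s3: "1 < sqrt (3::real)" by (simp add: real_less_rsqrt)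
  have xs: "x < sqrt 3 * x" using s3 b(1) by (auto simp: mult_less_cancel_right1)
  have c: "(cis t * csqrt \<eta>)\<^sup>2 = cis (2 * t) * \<eta>" for t
    by (simp add: power_mult_distrib Complex.DeMoivre)
  have uniq: "csqrt (cis (2 * t) * \<eta>) = cis t * csqrt \<eta>" if "Re (cis t * csqrt \<eta>) > 0" for t
    using that by (intro csqrt_unique c) auto
  have R: "Re (Complex p q * csqrt \<eta>) = p * x - q * y" for p q by (simp add: x_def y_def del: csqrt.simps)
  have "\<bar>y\<bar> < sqrt 3 * x" using b(1) xs by linarith
  then have "Re (cis (- pi / 6) * csqrt \<eta>) > 0" "Re (cis (pi / 6) * csqrt \<eta>) > 0"
    unfolding cis_sixth R by auto
  then show "csqrt (cis (- pi / 3) * \<eta>) = cis (- pi / 6) * csqrt \<eta>" "csqrt (cis (pi / 3) * \<eta>) = cis (pi / 6) * csqrt \<eta>"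
    using uniq[of "- pi / 6"] uniq[of "pi / 6"] by (simp_all del: csqrt.simps)
  show "csqrt (cis (- (2 * pi / 3)) * \<eta>) = cis (- pi / 3) * csqrt \<eta>" if "Im \<eta> \<ge> 0"
  proof -
    have "sqrt 3 * y \<ge> 0" using b(2)[OF that] by simp
    then have "Re (cis (- pi / 3) * csqrt \<eta>) > 0" unfolding cis_sixth R using b(1) by auto
    then show ?thesis using uniq[of "- pi / 3"] by (simp del: csqrt.simps)
  qed
  show "csqrt (cis (2 * pi / 3) * \<eta>) = cis (pi / 3) * csqrt \<eta>" if "Im \<eta> \<le> 0"
  proof -
    have "sqrt 3 * y \<le> 0" using b(3)[OF that] by (simp add: mult_le_0_iff)
    then have "Re (cis (pi / 3) * csqrt \<eta>) > 0" unfolding cis_sixth R using b(1) by auto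
    then show ?thesis using uniq[of "pi / 3"] by (simp del: csqrt.simps)
  qed
qed

lemma Re_rotate_bound:
  assumes "Re \<eta> > 0"
  shows "Im \<eta> \<ge> 0 \<Longrightarrow> norm \<eta> / 4 \<le> Re (cis (- pi / 3) * \<eta>)"
    and "Im \<eta> \<le> 0 \<Longrightarrow> norm \<eta> / 4 \<le> Re (cis (pi / 3) * \<eta>)"
proof -
  have s3: "1 \<le> sqrt (3::real)" by simp
  have n: "norm \<eta> \<le> \<bar>Re \<eta>\<bar> + \<bar>Im \<eta>\<bar>" by (rule cmod_le)
  show "norm \<eta> / 4 \<le> Re (cis (- pi / 3) * \<eta>)" if "Im \<eta> \<ge> 0"
    using mult_right_mono[OF s3 that] n assms that unfolding cis_sixth by (simp add: mult.commute)
  show "norm \<eta> / 4 \<le> Re (cis (pi / 3) * \<eta>)" if "Im \<eta> \<le> 0"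
    using mult_right_mono_neg[OF s3 that] n assms that unfolding cis_sixth by (simp add: mult.commute)
qed

text \<open>One expansion serves all cases. Turning the root \<open>\<eta>\<close> by 0, pi/3 or 2
  pi/3 in either direction rotates the Airy argument by a power of \<open>omega3\<close> and changes
  \<open>\<eta> ^ 3\<close> by a sign only, which is \<open>- \<sigma>\<close>. The constant 1/4 is
  the common margin of the sectors.\<close>

lemma airy_forms:
  "\<exists>C\<ge>0. \<forall>\<eta>. Re \<eta> > 0 \<longrightarrow>
     (norm \<eta> / 4 \<le> Re \<eta> \<longrightarrow> airy_form C (-1) \<eta> (airyA (\<eta>\<^sup>2)) (airyA' (\<eta>\<^sup>2))) \<and>
     (Im \<eta> \<ge> 0 \<longrightarrow> airy_form C 1 \<eta> (airyU (\<eta>\<^sup>2)) (airyU' (\<eta>\<^sup>2))) \<and>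
     (Im \<eta> \<le> 0 \<longrightarrow> airy_form C 1 \<eta> (airyL (\<eta>\<^sup>2)) (airyL' (\<eta>\<^sup>2))) \<and>
     (Im \<eta> \<ge> 0 \<longrightarrow> norm \<eta> / 4 \<le> Re (cis (- (2 * pi / 3)) * \<eta>) \<longrightarrow> airy_form C (-1) \<eta> (- airyL (\<eta>\<^sup>2)) (- airyL' (\<eta>\<^sup>2))) \<and>
     (Im \<eta> \<le> 0 \<longrightarrow> norm \<eta> / 4 \<le> Re (cis (2 * pi / 3) * \<eta>) \<longrightarrow> airy_form C (-1) \<eta> (airyU (\<eta>\<^sup>2)) (airyU' (\<eta>\<^sup>2)))"
proof -
  obtain C where C: "C \<ge> 0" "\<And>\<zeta>. \<zeta> \<noteq> 0 \<Longrightarrow> norm \<zeta> / 4 \<le> Re \<zeta> \<Longrightarrow> (\<exists>r r'. norm r \<le> C / norm \<zeta> ^ 3 \<and> norm r' \<le> C / norm \<zeta> ^ 3 \<and>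
     Airy (\<zeta>\<^sup>2) = exp (- (2/3) * \<zeta> ^ 3) / (2 * sqrt pi * csqrt \<zeta>) * (1 + r) \<and>
     Airy' (\<zeta>\<^sup>2) = - exp (- (2/3) * \<zeta> ^ 3) * csqrt \<zeta> / (2 * sqrt pi) * (1 + r'))"
    using Airy_asymptotics[of "1/4"] by auto
  have sp: "complex_of_real (sqrt pi) \<noteq> 0" by simp
  have s2: "complex_of_real (sqrt 2) * complex_of_real (sqrt 2) = 2" by (simp flip: of_real_mult)
  have s2': "complex_of_real (sqrt 2) * (complex_of_real (sqrt 2) * x) = 2 * x" for x
    by (simp only: mult.assoc[symmetric] s2)
  have K: "airy_norm = complex_of_real (sqrt 2) * complex_of_real (sqrt pi) * cis (- pi / 4)"
    by (simp add: airy_norm_def real_sqrt_mult)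
  text \<open>\<open>\<zeta> = cis \<phi> * \<eta>\<close> is the rotated square root; \<open>k\<close>, \<open>k'\<close> are the coefficients of the rotated solution.\<close>
  have gen: "airy_form C \<sigma> \<eta> (airy_norm * k * Airy (q * \<eta>\<^sup>2)) (airy_norm * k' * Airy' (q * \<eta>\<^sup>2))"
    if \<eta>: "\<eta> \<noteq> 0" and re: "norm \<eta> / 4 \<le> Re (cis \<phi> * \<eta>)"
      and cs: "csqrt (cis \<phi> * \<eta>) = cis (\<phi> / 2) * csqrt \<eta>" and q: "q = cis (2 * \<phi>)"
      and c3: "cis (3 * \<phi>) = of_real (- \<sigma>)" and k: "k * cis (- pi / 4 - \<phi> / 2) = cis (\<sigma> * pi / 4)"
      and k': "k' * cis (- pi / 4 + \<phi> / 2) = - of_real \<sigma> * cis (\<sigma> * pi / 4)" for \<eta> \<phi> \<sigma> k k' q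
  proof -
    define \<zeta> where "\<zeta> = cis \<phi> * \<eta>"
    have z: "\<zeta> \<noteq> 0" "norm \<zeta> = norm \<eta>" "\<zeta>\<^sup>2 = q * \<eta>\<^sup>2" "\<zeta> ^ 3 = of_real (- \<sigma>) * \<eta> ^ 3"
      using \<eta> by (auto simp: \<zeta>_def norm_mult power_mult_distrib Complex.DeMoivre q c3)
    have ce: "csqrt \<eta> \<noteq> 0" using \<eta> by simp
    obtain r r' where r: "norm r \<le> C / norm \<eta> ^ 3" "norm r' \<le> C / norm \<eta> ^ 3"
      "Airy (\<zeta>\<^sup>2) = exp (- (2/3) * \<zeta> ^ 3) / (2 * sqrt pi * csqrt \<zeta>) * (1 + r)"
      "Airy' (\<zeta>\<^sup>2) = - exp (- (2/3) * \<zeta> ^ 3) * csqrt \<zeta> / (2 * sqrt pi) * (1 + r')"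
      using C(2)[OF z(1)] re z(2) by (auto simp: \<zeta>_def)
    have ex: "- (2/3) * \<zeta> ^ 3 = of_real (\<sigma> * (2/3)) * \<eta> ^ 3" by (simp add: z(4))
    have ci: "cis (- pi / 4) / cis (\<phi> / 2) = cis (- pi / 4 - \<phi> / 2)" "cis (- pi / 4) * cis (\<phi> / 2) = cis (- pi / 4 + \<phi> / 2)"
      by (simp_all add: cis_divide cis_mult)
    have "airy_norm * k * Airy (q * \<eta>\<^sup>2) = (k * (cis (- pi / 4) / cis (\<phi> / 2))) / sqrt 2 * exp (of_real (\<sigma> * (2/3)) * \<eta> ^ 3) / csqrt \<eta> * (1 + r)"
      unfolding z(3)[symmetric] r(3) ex cs[folded \<zeta>_def] K using sp ce by (simp add: field_simps s2')
    moreover have "airy_norm * k' * Airy' (q * \<eta>\<^sup>2) = - (k' * (cis (- pi / 4) * cis (\<phi> / 2))) / sqrt 2 * exp (of_real (\<sigma> * (2/3)) * \<eta> ^ 3) * csqrt \<eta> * (1 + r')"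
      unfolding z(3)[symmetric] r(4) ex cs[folded \<zeta>_def] K using sp ce by (simp add: field_simps s2')
    ultimately show ?thesis
      unfolding airy_form_def ci k k' using r(1,2) by (intro exI[of _ r] exI[of _ r']) simp
  qed
  show ?thesis
  proof (intro exI[of _ C] conjI allI impI C(1))
    fix \<eta> :: complex assume re: "Re \<eta> > 0"
    then have \<eta>: "\<eta> \<noteq> 0" by auto
    have o1: "- (omega3\<^sup>2) = cis (pi / 3)" "- omega3 = cis (- (pi / 3))" "omega3 = cis (2 * pi / 3)" "omega3\<^sup>2 = cis (4 * pi / 3)"
      "omega3 = cis (2 * - (2 * pi / 3))" "omega3\<^sup>2 = cis (2 * - (pi / 3))"
    proof -
      have w2: "omega3\<^sup>2 = Complex (- 1 / 2) (- sqrt 3 / 2)" by (simp add: omega3_eq complex_eq_iff power2_eq_square)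
      show "- (omega3\<^sup>2) = cis (pi / 3)" unfolding w2 cis_sixth by (simp add: complex_eq_iff)
      show "- omega3 = cis (- (pi / 3))" using cis_sixth(4) by (simp add: omega3_eq complex_eq_iff)
      show "omega3 = cis (2 * pi / 3)" by (simp add: omega3_def)
      show "omega3\<^sup>2 = cis (4 * pi / 3)" by (simp add: omega3_def Complex.DeMoivre)
      have "cis (2 * - (2 * pi / 3)) = cis (2 * pi / 3 - 2 * pi)" by (rule arg_cong[of _ _ cis]) simp
      also have "\<dots> = cis (2 * pi / 3) / cis (2 * pi)" by (simp only: cis_divide)
      also have "\<dots> = omega3" by (simp add: omega3_def)
      finally show "omega3 = cis (2 * - (2 * pi / 3))" ..
      show "omega3\<^sup>2 = cis (2 * - (pi / 3))" unfolding w2 using cis_sixth(6) by simp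
    qed
    have pi': "- cis t = cis (t + pi)" "- cis t = cis (t - pi)" for t
      by (simp_all add: complex_eq_iff)
    show "airy_form C (-1) \<eta> (airyA (\<eta>\<^sup>2)) (airyA' (\<eta>\<^sup>2))" if "norm \<eta> / 4 \<le> Re \<eta>"
      using gen[of \<eta> 0 1 "-1" 1 1] \<eta> that by (simp add: airyA_def airyA'_def)
    show "airy_form C 1 \<eta> (airyU (\<eta>\<^sup>2)) (airyU' (\<eta>\<^sup>2))" if im: "Im \<eta> \<ge> 0"
    proof -
      have "norm \<eta> / 4 \<le> Re (cis (- pi / 3) * \<eta>)" using Re_rotate_bound[OF re] im by simp
      then have "airy_form C 1 \<eta> (airy_norm * - (omega3\<^sup>2) * Airy (omega3\<^sup>2 * \<eta>\<^sup>2)) (airy_norm * - omega3 * Airy' (omega3\<^sup>2 * \<eta>\<^sup>2))"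
      proof (intro gen[where \<phi> = "- pi / 3"])
        show "csqrt (cis (- pi / 3) * \<eta>) = cis (- pi / 3 / 2) * csqrt \<eta>" using csqrt_rotate(1)[OF re] by simp
        show "- omega3 * cis (- pi / 4 + - pi / 3 / 2) = - of_real 1 * cis (1 * pi / 4)"
          unfolding o1(2) cis_mult by (simp add: pi'(2))
        show "- (omega3\<^sup>2) * cis (- pi / 4 - - pi / 3 / 2) = cis (1 * pi / 4)"
          unfolding o1(1) cis_mult by (rule arg_cong[of _ _ cis]) simp
      qed (use \<eta> o1(6) in \<open>auto simp: complex_eq_iff\<close>)
      then show ?thesis by (simp add: airyU_def airyU'_def)
    qed
    show "airy_form C 1 \<eta> (airyL (\<eta>\<^sup>2)) (airyL' (\<eta>\<^sup>2))" if im: "Im \<eta> \<le> 0"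
    proof -
      have "norm \<eta> / 4 \<le> Re (cis (pi / 3) * \<eta>)" using Re_rotate_bound[OF re] im by simp
      then have "airy_form C 1 \<eta> (airy_norm * omega3 * Airy (omega3 * \<eta>\<^sup>2)) (airy_norm * omega3\<^sup>2 * Airy' (omega3 * \<eta>\<^sup>2))"
      proof (intro gen[where \<phi> = "pi / 3"])
        show "csqrt (cis (pi / 3) * \<eta>) = cis (pi / 3 / 2) * csqrt \<eta>" using csqrt_rotate(2)[OF re] by simp
        show "omega3\<^sup>2 * cis (- pi / 4 + pi / 3 / 2) = - of_real 1 * cis (1 * pi / 4)"
          unfolding o1(4) cis_mult by (simp add: pi'(1))
        show "omega3 * cis (- pi / 4 - pi / 3 / 2) = cis (1 * pi / 4)"
          unfolding o1(3) cis_mult by (rule arg_cong[of _ _ cis]) simp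
      qed (use \<eta> o1(3) in \<open>auto simp: complex_eq_iff\<close>)
      then show ?thesis by (simp add: airyL_def airyL'_def)
    qed
    show "airy_form C (-1) \<eta> (- airyL (\<eta>\<^sup>2)) (- airyL' (\<eta>\<^sup>2))"
      if im: "Im \<eta> \<ge> 0" and rr: "norm \<eta> / 4 \<le> Re (cis (- (2 * pi / 3)) * \<eta>)"
    proof -
      have "airy_form C (-1) \<eta> (airy_norm * - omega3 * Airy (omega3 * \<eta>\<^sup>2)) (airy_norm * - (omega3\<^sup>2) * Airy' (omega3 * \<eta>\<^sup>2))"
      proof (intro gen[where \<phi> = "- (2 * pi / 3)"] rr)
        show "csqrt (cis (- (2 * pi / 3)) * \<eta>) = cis (- (2 * pi / 3) / 2) * csqrt \<eta>" using csqrt_rotate(3)[OF re im] by simp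
        show "- (omega3\<^sup>2) * cis (- pi / 4 + - (2 * pi / 3) / 2) = - of_real (- 1) * cis (- 1 * pi / 4)"
          unfolding o1(1) cis_mult by simp
        show "- omega3 * cis (- pi / 4 - - (2 * pi / 3) / 2) = cis (- 1 * pi / 4)"
          unfolding o1(2) cis_mult by (rule arg_cong[of _ _ cis]) simp
      qed (use \<eta> o1(5) in \<open>auto simp: complex_eq_iff\<close>)
      then show ?thesis by (simp add: airyL_def airyL'_def)
    qed
    show "airy_form C (-1) \<eta> (airyU (\<eta>\<^sup>2)) (airyU' (\<eta>\<^sup>2))"
      if im: "Im \<eta> \<le> 0" and rr: "norm \<eta> / 4 \<le> Re (cis (2 * pi / 3) * \<eta>)"
    proof -
      have "airy_form C (-1) \<eta> (airy_norm * - (omega3\<^sup>2) * Airy (omega3\<^sup>2 * \<eta>\<^sup>2)) (airy_norm * - omega3 * Airy' (omega3\<^sup>2 * \<eta>\<^sup>2))"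
      proof (intro gen[where \<phi> = "2 * pi / 3"] rr)
        show "csqrt (cis (2 * pi / 3) * \<eta>) = cis (2 * pi / 3 / 2) * csqrt \<eta>" using csqrt_rotate(4)[OF re im] by simp
        show "- omega3 * cis (- pi / 4 + 2 * pi / 3 / 2) = - of_real (- 1) * cis (- 1 * pi / 4)"
          unfolding o1(2) cis_mult by simp
        show "- (omega3\<^sup>2) * cis (- pi / 4 - 2 * pi / 3 / 2) = cis (- 1 * pi / 4)"
          unfolding o1(1) cis_mult by (rule arg_cong[of _ _ cis]) simp
      qed (use \<eta> o1(4) in \<open>auto simp: complex_eq_iff\<close>)
      then show ?thesis by (simp add: airyU_def airyU'_def)
    qed
  qed
qed

text \<open>The Airy equation has no first-order term, so the Wronskian is constant. Its value is
  read off at the squares of the positive integers, where the exponentials and fourth roots of the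
  two forms cancel.\<close>

lemma airy_wronskian: "airyA z * airyU' z - airyA' z * airyU z = 1"
proof -
  define W where "W = (\<lambda>z. airyA z * airyU' z - airyA' z * airyU z)"
  have d: "(W has_field_derivative 0) (at z)" for z
  proof -
    have "(W has_field_derivative (airyA' z * airyU' z + (z * airyU z) * airyA z) - ((z * airyA z) * airyU z + airyU' z * airyA' z)) (at z)"
      unfolding W_def by (intro DERIV_diff DERIV_mult airyAUL_deriv)
    then show ?thesis by (simp add: algebra_simps)
  qed
  have c: "W z = W w" for z w
    using has_field_derivative_zero_constant[of UNIV W] d by (metis UNIV_I convex_UNIV has_field_derivative_at_within)
  obtain C where C: "C \<ge> 0" "\<And>\<eta>. Re \<eta> > 0 \<Longrightarrow>
     (norm \<eta> / 4 \<le> Re \<eta> \<longrightarrow> airy_form C (-1) \<eta> (airyA (\<eta>\<^sup>2)) (airyA' (\<eta>\<^sup>2))) \<and>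
     (Im \<eta> \<ge> 0 \<longrightarrow> airy_form C 1 \<eta> (airyU (\<eta>\<^sup>2)) (airyU' (\<eta>\<^sup>2)))"
    using airy_forms by blast
  define X where "X = (\<lambda>n. complex_of_real (real (Suc n)))"
  have "\<exists>r r' s s'. norm r \<le> C / real (Suc n) ^ 3 \<and> norm r' \<le> C / real (Suc n) ^ 3 \<and> norm s \<le> C / real (Suc n) ^ 3 \<and> norm s' \<le> C / real (Suc n) ^ 3 \<and>
     W ((X n)\<^sup>2) = ((1 + r) * (1 + s') + (1 + r') * (1 + s)) / 2" for n
  proof -
    have X: "norm (X n) = real (Suc n)" "Re (X n) = real (Suc n)" "Im (X n) = 0" by (simp_all add: X_def del: of_nat_Suc)
    then have re: "Re (X n) > 0" by simp
    define e where "e = exp (of_real (2/3) * X n ^ 3)"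
    define q where "q = csqrt (X n)"
    have q: "q \<noteq> 0" and e: "e \<noteq> 0" using re by (auto simp: q_def e_def)
    have e': "exp (of_real (- 1 * (2/3)) * X n ^ 3) = 1 / e" "exp (of_real (1 * (2/3)) * X n ^ 3) = e"
      by (simp_all add: e_def exp_minus inverse_eq_divide)
    have s2: "complex_of_real (sqrt 2) * complex_of_real (sqrt 2) = 2" by (simp flip: of_real_mult)
    have cc: "cis (- pi / 4) * cis (pi / 4) = 1" by (simp add: cis_mult)
    have "airy_form C (-1) (X n) (airyA ((X n)\<^sup>2)) (airyA' ((X n)\<^sup>2))" using C(2)[OF re] X by simp
    from this[unfolded airy_form_def e', folded q_def]
    obtain r r' where r: "norm r \<le> C / norm (X n) ^ 3" "norm r' \<le> C / norm (X n) ^ 3"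
      "airyA ((X n)\<^sup>2) = cis (- 1 * pi / 4) / sqrt 2 * (1 / e) / q * (1 + r)" "airyA' ((X n)\<^sup>2) = of_real (- 1) * cis (- 1 * pi / 4) / sqrt 2 * (1 / e) * q * (1 + r')"
      by blast
    have "airy_form C 1 (X n) (airyU ((X n)\<^sup>2)) (airyU' ((X n)\<^sup>2))" using C(2)[OF re] X by simp
    from this[unfolded airy_form_def e', folded q_def]
    obtain s s' where s: "norm s \<le> C / norm (X n) ^ 3" "norm s' \<le> C / norm (X n) ^ 3"
      "airyU ((X n)\<^sup>2) = cis (1 * pi / 4) / sqrt 2 * e / q * (1 + s)" "airyU' ((X n)\<^sup>2) = of_real 1 * cis (1 * pi / 4) / sqrt 2 * e * q * (1 + s')"
      by blast
    have "W ((X n)\<^sup>2) = (cis (- pi / 4) * cis (pi / 4)) * (1 / (complex_of_real (sqrt 2) * complex_of_real (sqrt 2))) * ((1 + r) * (1 + s') + (1 + r') * (1 + s))"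
    proof -
      define t where "t = complex_of_real (sqrt 2)"
      have "t \<noteq> 0" by (simp add: t_def)
      then show ?thesis
        unfolding W_def r(3,4) s(3,4) t_def[symmetric] using q e by (simp add: field_simps)
    qed
    then have "W ((X n)\<^sup>2) = ((1 + r) * (1 + s') + (1 + r') * (1 + s)) / 2" unfolding cc by (simp add: s2)
    then show ?thesis using r(1,2) s(1,2) unfolding X(1) by blast
  qed
  then obtain r r' s s' where R: "\<And>n. norm (r n) \<le> C / real (Suc n) ^ 3" "\<And>n. norm (r' n) \<le> C / real (Suc n) ^ 3"
    "\<And>n. norm (s n) \<le> C / real (Suc n) ^ 3" "\<And>n. norm (s' n) \<le> C / real (Suc n) ^ 3"
    "\<And>n. W ((X n)\<^sup>2) = ((1 + r n) * (1 + s' n) + (1 + r' n) * (1 + s n)) / 2"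
    by metis
  have z: "(\<lambda>n. C / real (Suc n) ^ 3) \<longlonglongrightarrow> 0" by real_asymp
  have lim: "f \<longlonglongrightarrow> 0" if "\<And>n. norm (f n) \<le> C / real (Suc n) ^ 3" for f :: "nat \<Rightarrow> complex"
    by (rule Lim_null_comparison[OF _ z]) (use that in auto)
  have "(\<lambda>n. ((1 + r n) * (1 + s' n) + (1 + r' n) * (1 + s n)) / 2) \<longlonglongrightarrow> ((1 + 0) * (1 + 0) + (1 + 0) * (1 + 0)) / 2"
    by (intro tendsto_intros lim R) auto
  moreover have "(\<lambda>n. ((1 + r n) * (1 + s' n) + (1 + r' n) * (1 + s n)) / 2) = (\<lambda>n. W z)"
    using R(5) c by metis
  ultimately have "(\<lambda>n::nat. W z) \<longlonglongrightarrow> 1" by simp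
  then have "W z = 1" by (simp add: LIMSEQ_const_iff)
  then show ?thesis by (simp add: W_def)
qed

section \<open>Matching with the normalization at infinity\<close>

lemma norm_diff_mono:
  fixes a b :: "'a::real_normed_vector"
  shows "norm a \<le> A \<Longrightarrow> norm b \<le> B \<Longrightarrow> norm (a - b) \<le> A + B"
  by (rule order_trans[OF norm_triangle_ineq4 add_mono])

lemma norm_exp_minus_taylor:
  fixes E :: complex
  assumes "norm E \<le> 1"
  shows "norm (exp E) \<le> 3" "norm (exp E - exp (- E) - 2 * E) \<le> 3 * norm E ^ 3" "norm (exp E + exp (- E) - 2) \<le> 4 * norm E ^ 2"
proof -
  have e3: "exp 1 \<le> (3::real)" using exp_le by simp
  have "norm (exp E) \<le> exp (norm E)" by (rule norm_exp)
  also have "\<dots> \<le> exp 1" using assms by simp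
  finally show "norm (exp E) \<le> 3" using e3 by linarith
  have t: "norm (exp x - (1 + x + x\<^sup>2 / 2)) \<le> 3 / 2 * norm x ^ 3" if "norm x \<le> 1" for x :: complex
  proof -
    have "norm (exp x - (\<Sum>i\<le>2. x ^ i / fact i)) \<le> exp \<bar>Re x\<bar> * norm x ^ Suc 2 / fact 2" by (rule Taylor_exp)
    also have "\<dots> = exp \<bar>Re x\<bar> * norm x ^ 3 / 2" by (simp add: eval_nat_numeral)
    also have "\<dots> \<le> exp 1 * norm x ^ 3 / 2"
      using that abs_Re_le_cmod[of x] by (intro divide_right_mono mult_mono) auto
    also have "\<dots> \<le> 3 / 2 * norm x ^ 3" using e3 by (simp add: mult_right_mono)
    finally show ?thesis by (simp add: numeral_2_eq_2)
  qed
  note p = t[OF assms]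
  have q: "norm (exp (- E) - (1 + (- E) + (- E)\<^sup>2 / 2)) \<le> 3 / 2 * norm E ^ 3"
    using t[of "- E"] assms by (simp only: norm_minus_cancel)
  have "exp E - exp (- E) - 2 * E = (exp E - (1 + E + E\<^sup>2 / 2)) - (exp (- E) - (1 + (- E) + (- E)\<^sup>2 / 2))" by simp
  also have "norm \<dots> \<le> 3 / 2 * norm E ^ 3 + 3 / 2 * norm E ^ 3"
    by (rule norm_diff_mono[OF p q])
  finally show "norm (exp E - exp (- E) - 2 * E) \<le> 3 * norm E ^ 3" by simp
  have "exp E + exp (- E) - 2 = E\<^sup>2 + ((exp E - (1 + E + E\<^sup>2 / 2)) + (exp (- E) - (1 + (- E) + (- E)\<^sup>2 / 2)))" by simp
  also have "norm \<dots> \<le> norm E ^ 2 + (3 / 2 * norm E ^ 3 + 3 / 2 * norm E ^ 3)"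
    by (rule norm_triangle_mono[OF _ norm_triangle_mono[OF p q]]) (simp add: norm_power)
  also have "\<dots> \<le> 4 * norm E ^ 2"
    using power_decreasing[of 2 3 "norm E"] assms by simp
  finally show "norm (exp E + exp (- E) - 2) \<le> 4 * norm E ^ 2" .
qed

text \<open>Here \<open>w = z powr (1/2)\<close>, \<open>\<eta> = (z + \<beta>) powr (1/2)\<close>, \<open>m\<close> and \<open>c\<close> are their square roots, and
  \<open>E\<close> is the difference of the phases, which equals
  \<open>(\<eta> - w)\<^sup>2 * (2 * \<eta> + w) / 3 = \<beta>\<^sup>2 / (4 * w) + O (1 / w ^ 3)\<close>. The term \<open>\<beta>\<^sup>2 / 4\<close> in the
  lower left entry is the reason for the triangular prefactor of the solution.\<close>

lemma matching_core:
  fixes w \<eta> m c r r' s s' E :: complex and \<beta> C W b K :: real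
  assumes \<eta>: "\<eta>\<^sup>2 = w\<^sup>2 + of_real \<beta>" and m: "m\<^sup>2 = w" and c: "c\<^sup>2 = \<eta>"
    and \<eta>w: "W \<le> norm (\<eta> + w)" and cm: "norm m \<le> norm (c + m)"
    and W: "W = norm w" "1 \<le> W" "4 * b \<le> W" "2 * b\<^sup>2 \<le> W" and b: "b = \<bar>\<beta>\<bar>" and C: "C \<ge> 0"
    and err: "norm r \<le> C / norm \<eta> ^ 3" "norm r' \<le> C / norm \<eta> ^ 3" "norm s \<le> C / norm \<eta> ^ 3" "norm s' \<le> C / norm \<eta> ^ 3"
    and E: "E = 2/3 * \<eta> ^ 3 - 2/3 * w ^ 3 - of_real \<beta> * w"
    and K: "K = 2 * b + 16 * b ^ 4 + 48 * C + 4 * b\<^sup>2 + 24 * b ^ 6 + 3 * b ^ 3"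
  shows "norm (m / c * (exp (- E) * (1 + r) + exp E * (1 + s)) / 2 - 1) \<le> K / W\<^sup>2"
    and "norm ((exp E * (1 + s) - exp (- E) * (1 + r)) / (2 * m * c)) \<le> K / W\<^sup>2"
    and "norm (m * c * (exp E * (1 + s') - exp (- E) * (1 + r')) / 2 - of_real (\<beta>\<^sup>2 / 4)) \<le> K / W\<^sup>2"
    and "norm (c / m * (exp (- E) * (1 + r') + exp E * (1 + s')) / 2 - 1) \<le> K / W\<^sup>2"
proof -
  have b0: "b \<ge> 0" using b by simp
  have W0: "W > 0" using W(2) by linarith
  have w0: "w \<noteq> 0" using W0 W(1) by (metis norm_zero less_irrefl)
  define d where "d = 1 / W"
  have d: "d > 0" "d \<le> 1" "W * d = 1" using W0 W(2) by (auto simp: d_def divide_le_eq)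
  have bd: "b * d \<le> 1 / 4" using W(3) W0 by (simp add: d_def field_simps)
  have nw: "(\<eta> - w) * (\<eta> + w) = of_real \<beta>" using \<eta> by algebra
  have "norm (\<eta> - w) * W \<le> norm (\<eta> - w) * norm (\<eta> + w)" using \<eta>w by (intro mult_left_mono) auto
  also have "\<dots> = b" using arg_cong[OF nw, of norm] by (simp add: norm_mult b)
  finally have 1: "norm (\<eta> - w) \<le> b * d" using W0 by (simp add: d_def field_simps)
  have nW: "W / 2 \<le> norm \<eta>" "norm \<eta> \<le> 2 * W"
    using norm_triangle_ineq2[of w \<eta>] norm_triangle_ineq2[of \<eta> w] 1 bd W by (simp_all add: norm_minus_commute)
  have \<eta>0: "\<eta> \<noteq> 0" using nW W by auto
  have c0: "c \<noteq> 0" and m0: "m \<noteq> 0" using c m \<eta>0 w0 by auto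
  \<comment> \<open>\<open>\<eta>w\<close> and \<open>cm\<close> express that compatible branches
    were chosen: the sums of roots do not cancel, so differences of squares control differences of
    roots. The bound on \<open>\<eta> - w\<close> came about in the same way.\<close>
  have "(c - m) * (c + m) = \<eta> - w" unfolding c[symmetric] m[symmetric] by (simp add: algebra_simps power2_eq_square)
  then have "norm (c - m) * norm (c + m) \<le> b * d" using 1 by (metis norm_mult)
  then have "norm (c - m) * norm m \<le> b * d"
    using mult_left_mono[OF cm, of "norm (c - m)"] by simp
  then have cmm: "norm ((c - m) * m) \<le> b * d" by (simp add: norm_mult)
  have e1: "norm (c / m - 1) \<le> b * d\<^sup>2"
  proof -
    have "c / m - 1 = (c - m) * m / w" using m0 m[symmetric] by (simp add: field_simps power2_eq_square)
    then have "norm (c / m - 1) = norm ((c - m) * m) * d" using W by (simp add: norm_divide d_def)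
    also have "\<dots> \<le> b * d * d" using cmm d by (intro mult_right_mono) auto
    finally show ?thesis by (simp add: power2_eq_square)
  qed
  have bdd: "b * d\<^sup>2 \<le> 1 / 4" using mult_mono[OF bd d(2)] b0 d(1) by (simp add: power2_eq_square mult.assoc)
  have n1: "1 / 2 \<le> norm (c / m)" "norm (c / m) \<le> 2"
    using norm_triangle_ineq2[of 1 "c / m"] norm_triangle_ineq2[of "c / m" 1] e1 bdd by (simp_all add: norm_minus_commute)
  have n2: "norm (m / c) \<le> 2" using n1(1) c0 m0 by (simp add: norm_divide field_simps)
  have e2: "norm (m / c - 1) \<le> 2 * b * d\<^sup>2"
  proof -
    have "m / c - 1 = - (m / c) * (c / m - 1)" using c0 m0 by (simp add: field_simps)
    then have "norm (m / c - 1) = norm (m / c) * norm (c / m - 1)" by (simp only: norm_mult norm_minus_cancel)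
    also have "\<dots> \<le> 2 * (b * d\<^sup>2)" using n2 e1 by (intro mult_mono) auto
    finally show ?thesis by simp
  qed
  have mcw: "norm (m * c - w) \<le> b * d"
    using cmm m by (simp add: algebra_simps power2_eq_square)
  have mc: "norm (m * c) \<le> 2 * W" "W / 2 \<le> norm (m * c)"
    using norm_triangle_ineq2[of w "m * c"] norm_triangle_ineq2[of "m * c" w] mcw bd W by (simp_all add: norm_minus_commute)
  \<comment> \<open>Eliminating \<open>\<beta>\<close> exposes a double zero at
    \<open>\<eta> = w\<close>. The three terms of \<open>E\<close> are as large as
    \<open>W ^ 3\<close>, yet \<open>E\<close> itself is of order \<open>1 / W\<close>.\<close>
  have E1: "E = (\<eta> - w)\<^sup>2 * (2 * \<eta> + w) / 3"
  proof -
    have bb: "of_real \<beta> = \<eta>\<^sup>2 - w\<^sup>2" using \<eta> by simp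
    show ?thesis unfolding E bb by (simp add: field_simps power2_eq_square power3_eq_cube)
  qed
  have "norm E \<le> (b * d)\<^sup>2 * (6 * W) / 3"
  proof -
    have "norm (2 * \<eta> + w) \<le> 2 * norm \<eta> + norm w" using norm_triangle_ineq[of "2 * \<eta>" w] by (simp add: norm_mult)
    also have "\<dots> \<le> 6 * W" using nW W by simp
    finally show ?thesis
      unfolding E1 norm_divide norm_mult norm_power using 1 by (intro divide_mono mult_mono power_mono) auto
  qed
  also have "\<dots> = 2 * b\<^sup>2 * d * (W * d)" by (simp add: power2_eq_square)
  finally have nE: "norm E \<le> 2 * b\<^sup>2 * d" using d by simp
  have nE1: "norm E \<le> 1" using nE mult_right_mono[OF W(4), of d] d by linarith
  have E2: "norm (w * E - of_real (\<beta>\<^sup>2 / 4)) \<le> 3 * b ^ 3 * d\<^sup>2"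
  proof -
    have sw: "\<eta> + w \<noteq> 0" using \<eta>w W by auto
    have "\<eta> - w = of_real \<beta> / (\<eta> + w)" using nw sw by (simp add: field_simps)
    then have E3: "E = of_real (\<beta>\<^sup>2) * (2 * \<eta> + w) / (3 * (\<eta> + w)\<^sup>2)"
      unfolding E1 using sw by (simp add: power_divide)
    \<comment> \<open>The numerator has the further zero \<open>\<eta> = w\<close>, so that the
      deviation of \<open>w * E\<close> from its limit is of order \<open>1 / W\<^sup>2\<close>, as
      the other errors are.\<close>
    have "w * E - of_real (\<beta>\<^sup>2 / 4) = of_real (\<beta>\<^sup>2) * ((w - \<eta>) * (w + 3 * \<eta>)) / (12 * (\<eta> + w)\<^sup>2)"
    proof -
      define S B where "S = (\<eta> + w)\<^sup>2" and "B = complex_of_real (\<beta>\<^sup>2)"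
      have S: "S \<noteq> 0" using sw by (simp add: S_def)
      have "w * E - of_real (\<beta>\<^sup>2 / 4) = w * (B * (2 * \<eta> + w) / (3 * S)) - B / 4"
        unfolding E3 S_def B_def by simp
      also have "\<dots> = (4 * w * (B * (2 * \<eta> + w)) - 3 * S * B) / (12 * S)"
        using S by (simp add: field_simps)
      also have "4 * w * (B * (2 * \<eta> + w)) - 3 * S * B = B * ((w - \<eta>) * (w + 3 * \<eta>))"
        unfolding S_def by (simp add: algebra_simps power2_eq_square)
      finally show ?thesis by (simp only: S_def B_def)
    qed
    also have "norm \<dots> \<le> b\<^sup>2 * (b * d * (7 * W)) / (12 * W\<^sup>2)"
    proof -
      have "norm (w + 3 * \<eta>) \<le> norm w + 3 * norm \<eta>" using norm_triangle_ineq[of w "3 * \<eta>"] by (simp add: norm_mult)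
      also have "\<dots> \<le> 7 * W" using nW W by simp
      finally have 7: "norm (w + 3 * \<eta>) \<le> 7 * W" .
      have "norm (of_real (\<beta>\<^sup>2) * ((w - \<eta>) * (w + 3 * \<eta>))) \<le> b\<^sup>2 * (b * d * (7 * W))"
      proof -
        have nb: "norm (complex_of_real (\<beta>\<^sup>2)) = b\<^sup>2" unfolding norm_of_real b by simp
        show ?thesis unfolding norm_mult nb norm_minus_commute[of w \<eta>] using 1 7 b0 d by (intro mult_mono) auto
      qed
      moreover have "12 * W\<^sup>2 \<le> norm (12 * (\<eta> + w)\<^sup>2)"
        unfolding norm_mult norm_power using \<eta>w W0 by (auto intro!: power_mono)
      ultimately show ?thesis unfolding norm_divide using W0 b0 d by (intro frac_le) auto
    qed
    also have "\<dots> = 7 / 12 * (b ^ 3 * d\<^sup>2)" using W0 by (simp add: d_def power2_eq_square power3_eq_cube field_simps)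
    also have "\<dots> \<le> 3 * (b ^ 3 * d\<^sup>2)" using b0 by (intro mult_right_mono) auto
    finally show ?thesis by simp
  qed
  note T = norm_exp_minus_taylor[OF nE1]
  have Tm: "norm (exp (- E)) \<le> 3" using norm_exp_minus_taylor(1)[of "- E"] nE1 by simp
  have rr: "norm x \<le> 8 * C * d ^ 3" if "norm x \<le> C / norm \<eta> ^ 3" for x :: complex
  proof -
    have "C / norm \<eta> ^ 3 \<le> C / (W / 2) ^ 3" using nW W0 C by (intro divide_left_mono power_mono mult_pos_pos zero_less_power) auto
    also have "\<dots> = 8 * C * d ^ 3" by (simp add: d_def power_divide)
    finally show ?thesis using that by linarith
  qed
  have er: "norm (exp (- E) * x) \<le> 24 * C * d ^ 3" "norm (exp E * x) \<le> 24 * C * d ^ 3" if "norm x \<le> C / norm \<eta> ^ 3" for x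
  proof -
    have "norm (exp (- E) * x) \<le> 3 * (8 * C * d ^ 3)" "norm (exp E * x) \<le> 3 * (8 * C * d ^ 3)"
      unfolding norm_mult using Tm T(1) rr[OF that] by (intro mult_mono; simp)+
    then show "norm (exp (- E) * x) \<le> 24 * C * d ^ 3" "norm (exp E * x) \<le> 24 * C * d ^ 3" by simp_all
  qed
  have d32: "d ^ 3 \<le> d\<^sup>2" "d ^ 3 \<le> d" using d by (auto intro: power_decreasing power_le_one[of d 2] simp: power3_eq_cube power2_eq_square mult_le_one mult_left_le)
  have cosh: "norm (exp E + exp (- E) - 2) \<le> 16 * b ^ 4 * d\<^sup>2"
  proof -
    have "norm E ^ 2 \<le> (2 * b\<^sup>2 * d)\<^sup>2" using nE by (intro power_mono) auto
    also have "\<dots> = 4 * (b ^ 4 * d\<^sup>2)" by (simp add: power_mult_distrib flip: power_mult)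
    finally show ?thesis using T(3) by simp
  qed
  have sinh: "norm (exp E - exp (- E) - 2 * E) \<le> 24 * b ^ 6 * d ^ 3"
  proof -
    have "norm E ^ 3 \<le> (2 * b\<^sup>2 * d) ^ 3" using nE by (intro power_mono) auto
    also have "\<dots> = 8 * b ^ 6 * d ^ 3" by (simp add: power_mult_distrib flip: power_mult)
    finally show ?thesis using T(2) by simp
  qed
  have pair: "norm (p * (exp (- E) * (1 + x) + exp E * (1 + y)) / 2 - 1) \<le> K * d\<^sup>2"
    if p: "norm p \<le> 2" "norm (p - 1) \<le> 2 * b * d\<^sup>2" and x: "norm x \<le> C / norm \<eta> ^ 3" and y: "norm y \<le> C / norm \<eta> ^ 3" for p x y
  proof -
    have "p * (exp (- E) * (1 + x) + exp E * (1 + y)) / 2 - 1 = (p - 1) + p * ((exp E + exp (- E) - 2) + (exp (- E) * x + exp E * y)) / 2"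
      by (simp add: field_simps)
    also have "norm \<dots> \<le> 2 * b * d\<^sup>2 + 2 * (16 * b ^ 4 * d\<^sup>2 + (24 * C * d ^ 3 + 24 * C * d ^ 3)) / 2"
    proof (rule norm_triangle_mono[OF p(2)])
      show "norm (p * ((exp E + exp (- E) - 2) + (exp (- E) * x + exp E * y)) / 2) \<le> 2 * (16 * b ^ 4 * d\<^sup>2 + (24 * C * d ^ 3 + 24 * C * d ^ 3)) / 2"
        using mult_mono[OF p(1) norm_triangle_mono[OF cosh norm_triangle_mono[OF er(1)[OF x] er(2)[OF y]]]]
        unfolding norm_divide norm_mult[of p] by simp
    qed
    also have "\<dots> \<le> 2 * b * d\<^sup>2 + (16 * b ^ 4 * d\<^sup>2 + 48 * C * d\<^sup>2)"
      using mult_left_mono[OF d32(1), of "48 * C"] C by simp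
    also have "\<dots> = (2 * b + 16 * b ^ 4 + 48 * C) * d\<^sup>2" by (simp add: algebra_simps)
    also have "\<dots> \<le> K * d\<^sup>2" using b0 by (intro mult_right_mono) (auto simp: K)
    finally show ?thesis .
  qed
  have Kd: "K * d\<^sup>2 = K / W\<^sup>2" by (simp add: d_def power_divide)
  show "norm (m / c * (exp (- E) * (1 + r) + exp E * (1 + s)) / 2 - 1) \<le> K / W\<^sup>2"
    unfolding Kd[symmetric] by (rule pair[OF n2 e2 err(1,3)])
  have "b * d\<^sup>2 \<le> 2 * b * d\<^sup>2" using b0 by (simp add: mult_right_mono)
  then show "norm (c / m * (exp (- E) * (1 + r') + exp E * (1 + s')) / 2 - 1) \<le> K / W\<^sup>2"
    unfolding Kd[symmetric] by (intro pair[OF n1(2) order_trans[OF e1] err(2,4)])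
  show "norm ((exp E * (1 + s) - exp (- E) * (1 + r)) / (2 * m * c)) \<le> K / W\<^sup>2"
  proof -
    have "exp E * (1 + s) - exp (- E) * (1 + r) = (exp E - exp (- E) - 2 * E) + (2 * E + (exp E * s - exp (- E) * r))"
      by (simp add: algebra_simps)
    also have "norm \<dots> \<le> 24 * b ^ 6 * d ^ 3 + (2 * (2 * b\<^sup>2 * d) + (24 * C * d ^ 3 + 24 * C * d ^ 3))"
      by (intro norm_triangle_mono norm_diff_mono sinh er err) (use nE in \<open>auto simp: norm_mult mult.commute\<close>)
    also have "\<dots> \<le> 24 * b ^ 6 * d + (4 * b\<^sup>2 * d + 48 * C * d)"
      using mult_left_mono[OF d32(2), of "24 * b ^ 6"] mult_left_mono[OF d32(2), of "48 * C"] C b0 by simp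
    also have "\<dots> = (24 * b ^ 6 + 4 * b\<^sup>2 + 48 * C) * d" by (simp add: algebra_simps)
    also have "\<dots> \<le> K * d" using b0 d by (intro mult_right_mono) (auto simp: K)
    finally have n: "norm (exp E * (1 + s) - exp (- E) * (1 + r)) \<le> K * d" .
    have "norm ((exp E * (1 + s) - exp (- E) * (1 + r)) / (2 * m * c)) = norm (exp E * (1 + s) - exp (- E) * (1 + r)) / (2 * norm (m * c))"
      by (simp add: norm_divide norm_mult)
    also have "\<dots> \<le> K * d / (2 * (W / 2))"
      using n mc(2) W0 by (intro frac_le) (auto intro: order_trans[OF norm_ge_zero])
    finally show ?thesis by (simp add: d_def power2_eq_square)
  qed
  show "norm (m * c * (exp E * (1 + s') - exp (- E) * (1 + r')) / 2 - of_real (\<beta>\<^sup>2 / 4)) \<le> K / W\<^sup>2"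
  proof -
    have "m * c * (exp E * (1 + s') - exp (- E) * (1 + r')) / 2 - of_real (\<beta>\<^sup>2 / 4)
       = m * c / 2 * ((exp E - exp (- E) - 2 * E) + (exp E * s' - exp (- E) * r')) + ((m * c - w) * E + (w * E - of_real (\<beta>\<^sup>2 / 4)))"
      by (simp add: field_simps)
    also have "norm \<dots> \<le> W * (24 * b ^ 6 * d ^ 3 + (24 * C * d ^ 3 + 24 * C * d ^ 3)) + (b * d * (2 * b\<^sup>2 * d) + 3 * b ^ 3 * d\<^sup>2)"
    proof (intro norm_triangle_mono E2)
      show "norm (m * c / 2 * ((exp E - exp (- E) - 2 * E) + (exp E * s' - exp (- E) * r'))) \<le> W * (24 * b ^ 6 * d ^ 3 + (24 * C * d ^ 3 + 24 * C * d ^ 3))"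
        unfolding norm_mult[of "m * c / 2"]
        using mc(1) W0 norm_triangle_mono[OF sinh norm_diff_mono[OF er(2)[OF err(4)] er(1)[OF err(2)]]]
        by (intro mult_mono) (auto simp: norm_mult norm_divide)
      show "norm ((m * c - w) * E) \<le> b * d * (2 * b\<^sup>2 * d)"
        unfolding norm_mult using mcw nE b0 d by (intro mult_mono) auto
    qed
    also have "\<dots> = (W * d) * (24 * b ^ 6 + 48 * C) * d\<^sup>2 + 2 * b ^ 3 * d\<^sup>2 + 3 * b ^ 3 * d\<^sup>2"
      by (simp add: algebra_simps power2_eq_square power3_eq_cube)
    also have "\<dots> = (24 * b ^ 6 + 48 * C + 5 * b ^ 3) * d\<^sup>2" unfolding d(3) by (simp add: algebra_simps)
    also have "\<dots> \<le> K * d\<^sup>2"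
    proof (intro mult_right_mono)
      \<comment> \<open>The estimate needs \<open>5 * b ^ 3\<close> while \<open>K\<close> contains
        only \<open>3 * b ^ 3\<close>; the missing part is paid by the terms with
        \<open>b\<^sup>2\<close> and \<open>b ^ 4\<close>.\<close>
      have "2 * b ^ 3 \<le> 4 * b\<^sup>2 + 16 * b ^ 4"
      proof -
        have "0 \<le> b\<^sup>2 * (4 * b - 1 / 4)\<^sup>2" by simp
        also have "\<dots> = 16 * b ^ 4 - 2 * b ^ 3 + b\<^sup>2 / 16" by (simp add: power2_eq_square algebra_simps eval_nat_numeral)
        finally show ?thesis using zero_le_power2[of b] by linarith
      qed
      then show "24 * b ^ 6 + 48 * C + 5 * b ^ 3 \<le> K" using b0 C by (simp add: K)
    qed simp
    finally show ?thesis unfolding Kd .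
  qed
qed

section \<open>Principal roots and the matching of Airy columns\<close>

lemma csqrt_eq_cis: "z \<noteq> 0 \<Longrightarrow> csqrt z = of_real (sqrt (norm z)) * cis (Arg z / 2)"
proof -
  assume z: "z \<noteq> 0"
  have "csqrt z = exp (of_real (ln (norm z) / 2) + \<i> * of_real (Arg z / 2))"
    using z by (simp add: csqrt_exp_Ln Ln_Arg add_divide_distrib)
  also have "\<dots> = of_real (exp (ln (norm z) / 2)) * cis (Arg z / 2)"
    unfolding exp_add cis_conv_exp exp_of_real ..
  also have "exp (ln (norm z) / 2) = sqrt (norm z)"
    using z by (simp add: exp_ln_iff ln_sqrt[symmetric])
  finally show ?thesis .
qed

lemma powr_csqrt:
  assumes "z \<noteq> 0"
  shows "z powr (1 / 2) = csqrt z" "z powr (3 / 2) = csqrt z ^ 3" "z powr (1 / 4) = csqrt (csqrt z)" "z powr (- 1 / 4) = 1 / csqrt (csqrt z)"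
proof -
  have w: "csqrt z = exp (Ln z / 2)" using assms by (rule csqrt_exp_Ln)
  have Lw: "Ln (csqrt z) = Ln z / 2"
    unfolding w using mpi_less_Im_Ln[OF assms] Im_Ln_le_pi[OF assms] by (intro Ln_exp) auto
  have "csqrt z \<noteq> 0" using assms by simp
  then have "csqrt (csqrt z) = exp (Ln (csqrt z) / 2)" by (rule csqrt_exp_Ln)
  then have c: "csqrt (csqrt z) = exp (Ln z / 4)" by (simp add: Lw)
  show "z powr (1 / 2) = csqrt z" using assms by (simp add: w powr_def)
  show "z powr (1 / 4) = csqrt (csqrt z)" "z powr (- 1 / 4) = 1 / csqrt (csqrt z)"
    using assms unfolding c by (simp_all add: powr_def exp_minus inverse_eq_divide)
  have "exp (Ln z / 2) ^ 3 = exp (of_nat 3 * (Ln z / 2))" by (rule exp_of_nat_mult[symmetric])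
  then show "z powr (3 / 2) = csqrt z ^ 3" using assms unfolding w by (simp add: powr_def)
qed

lemma csqrt_right_half:
  assumes "Im z \<noteq> 0"
  shows "Re (csqrt z) > 0" "Im z > 0 \<Longrightarrow> Im (csqrt z) > 0" "Im z < 0 \<Longrightarrow> Im (csqrt z) < 0"
proof -
  have e: "Im z = 2 * Re (csqrt z) * Im (csqrt z)"
    using arg_cong[OF power2_csqrt[of z], of Im] unfolding Im_power2 by simp
  then have "Re (csqrt z) \<noteq> 0" using assms by auto
  then show r: "Re (csqrt z) > 0" using csqrt_principal[of z] by blast
  have r2: "2 * Re (csqrt z) > 0" using r by linarith
  show "Im (csqrt z) > 0" if "Im z > 0"
  proof (rule zero_less_mult_pos[OF _ r2])
    show "0 < 2 * Re (csqrt z) * Im (csqrt z)" using e that by linarith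
  qed
  show "Im (csqrt z) < 0" if "Im z < 0"
  proof -
    have "0 < - Im (csqrt z)"
    proof (rule zero_less_mult_pos[OF _ r2])
      show "0 < 2 * Re (csqrt z) * - Im (csqrt z)" using e that by linarith
    qed
    then show ?thesis by linarith
  qed
qed

lemma norm_le_norm_add:
  assumes "Re a > 0" "Re b > 0" "Im a * Im b \<ge> 0"
  shows "norm b \<le> norm (a + b)"
proof -
  have "(norm b)\<^sup>2 \<le> (norm (a + b))\<^sup>2"
    using assms mult_pos_pos[OF assms(1,2)] unfolding cmod_power2
    by (simp add: power2_eq_square algebra_simps)
  then show ?thesis by (rule power2_le_imp_le) simp
qed

definition mfrak_inv_row :: "complex \<Rightarrow> complex \<Rightarrow> complex \<Rightarrow> complex \<times> complex" where
  "mfrak_inv_row z a b = (let m = csqrt (csqrt z) in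
     (m / sqrt 2 * (a * cis (pi / 4) + b * cis (- pi / 4)), (b * cis (- pi / 4) - a * cis (pi / 4)) / (sqrt 2 * m)))"

definition rh_theta :: "real \<Rightarrow> complex \<Rightarrow> complex" where
  "rh_theta \<beta> z = 2 / 3 * z powr (3 / 2) + of_real \<beta> * z powr (1 / 2)"

text \<open>The columns enter through \<open>airy_form\<close> alone, so one statement covers every
  sector, whichever rotated Airy function represents them there. Since \<open>W\<close> is the root
  of \<open>norm z\<close>, the errors \<open>K / W\<^sup>2\<close> of the core estimate are of the
  required order \<open>1 / z\<close>.\<close>

lemma airy_matching:
  fixes \<beta> C :: real
  assumes C: "C \<ge> 0"
  shows "\<exists>K\<ge>0. \<exists>R\<ge>1. \<forall>z f f' h h'. Im z \<noteq> 0 \<longrightarrow> norm z \<ge> R \<longrightarrow>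
     airy_form C (-1) (csqrt (z + of_real \<beta>)) f f' \<longrightarrow> airy_form C 1 (csqrt (z + of_real \<beta>)) h h' \<longrightarrow>
     (let t = exp (rh_theta \<beta> z); T1 = mfrak_inv_row z (f * t) (h / t); T2 = mfrak_inv_row z (f' * t) (h' / t) in
       norm (fst T1 - 1) \<le> K / norm z \<and> norm (snd T1) \<le> K / norm z \<and>
       norm (fst T2 - of_real (\<beta>\<^sup>2 / 4)) \<le> K / norm z \<and> norm (snd T2 - 1) \<le> K / norm z)"
proof -
  define b where "b = \<bar>\<beta>\<bar>"
  define K where "K = 2 * b + 16 * b ^ 4 + 48 * C + 4 * b\<^sup>2 + 24 * b ^ 6 + 3 * b ^ 3"
  have K0: "K \<ge> 0" using C by (simp add: K_def b_def)
  \<comment> \<open>The core estimate wants \<open>W\<close> above 1, \<open>4 * b\<close> and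
    \<open>2 * b\<^sup>2\<close>; their sum is squared because \<open>W\<close> is the root of
    \<open>norm z\<close>.\<close>
  define R where "R = (1 + 4 * b + 2 * b\<^sup>2)\<^sup>2"
  have R1: "R \<ge> 1" unfolding R_def b_def by (intro one_le_power) simp
  show ?thesis
  proof (rule exI[of _ K], rule conjI[OF K0], rule exI[of _ R], rule conjI[OF R1], intro allI impI)
    fix z f f' h h' assume z: "Im z \<noteq> 0" "norm z \<ge> R"
      and F: "airy_form C (-1) (csqrt (z + of_real \<beta>)) f f'" and H: "airy_form C 1 (csqrt (z + of_real \<beta>)) h h'"
    define \<eta> where "\<eta> = csqrt (z + of_real \<beta>)"
    define w where "w = csqrt z"
    define m where "m = csqrt w"
    define c where "c = csqrt \<eta>"
    define W where "W = norm w"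
    define E where "E = 2/3 * \<eta> ^ 3 - 2/3 * w ^ 3 - of_real \<beta> * w"
    have z0: "z \<noteq> 0" using z(1) by auto
    have zb: "Im (z + of_real \<beta>) \<noteq> 0" using z by simp
    note wr = csqrt_right_half[OF z(1), folded w_def] and er = csqrt_right_half[OF zb, folded \<eta>_def]
    have W2: "W\<^sup>2 = norm z" by (simp add: W_def w_def norm_power[symmetric])
    have "(1 + 4 * b + 2 * b\<^sup>2)\<^sup>2 \<le> W\<^sup>2" using z(2) by (simp add: W2 R_def)
    then have "1 + 4 * b + 2 * b\<^sup>2 \<le> W" by (rule power2_le_imp_le) (simp add: W_def)
    then have W: "1 \<le> W" "4 * b \<le> W" "2 * b\<^sup>2 \<le> W" using zero_le_power2[of b] abs_ge_zero[of \<beta>, folded b_def] by linarith+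
    have ew: "Im \<eta> * Im w \<ge> 0"
      using wr(2,3) er(2,3) z(1) by (cases "Im z > 0") (auto simp: zero_le_mult_iff)
    have \<eta>w: "W \<le> norm (\<eta> + w)" unfolding W_def by (rule norm_le_norm_add[OF er(1) wr(1) ew])
    have cr: "Re c > 0" "Re m > 0"
      unfolding c_def m_def using csqrt_bounds(1)[OF er(1)] csqrt_bounds(1)[OF wr(1)] by linarith+
    have "Im c * Im m \<ge> 0"
    proof (cases "Im z > 0")
      case True
      then show ?thesis unfolding c_def m_def using wr er csqrt_bounds(2)[OF er(1)] csqrt_bounds(2)[OF wr(1)] by (intro mult_nonneg_nonneg) auto
    next
      case False
      then have "Im z < 0" using z(1) by simp
      then show ?thesis unfolding c_def m_def using wr er csqrt_bounds(3)[OF er(1)] csqrt_bounds(3)[OF wr(1)] by (intro mult_nonpos_nonpos) auto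
    qed
    then have cm: "norm m \<le> norm (c + m)" by (rule norm_le_norm_add[OF cr])
    have sq: "\<eta>\<^sup>2 = w\<^sup>2 + of_real \<beta>" "m\<^sup>2 = w" "c\<^sup>2 = \<eta>" by (simp_all add: \<eta>_def w_def m_def c_def)
    have c0: "c \<noteq> 0" and m0: "m \<noteq> 0" using cr by auto
    define t where "t = exp (rh_theta \<beta> z)"
    have th: "rh_theta \<beta> z = 2/3 * w ^ 3 + of_real \<beta> * w" by (simp add: rh_theta_def powr_csqrt[OF z0] w_def)
    have t1: "exp (of_real (- 1 * (2/3)) * \<eta> ^ 3) * t = exp (- E)"
      unfolding t_def th exp_add[symmetric] E_def by (rule arg_cong[of _ _ exp]) simp
    have t2: "exp (of_real (1 * (2/3)) * \<eta> ^ 3) / t = exp E"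
      unfolding t_def th exp_diff[symmetric] E_def by (rule arg_cong[of _ _ exp]) simp
    have ft: "f * t = cis (- 1 * pi / 4) / sqrt 2 * exp (- E) / c * (1 + r)" if "f = cis (- 1 * pi / 4) / sqrt 2 * exp (of_real (- 1 * (2/3)) * \<eta> ^ 3) / c * (1 + r)" for r
      unfolding that t1[symmetric] by simp
    have ft': "f' * t = - cis (- 1 * pi / 4) / sqrt 2 * exp (- E) * c * (1 + r')" if "f' = of_real (- 1) * cis (- 1 * pi / 4) / sqrt 2 * exp (of_real (- 1 * (2/3)) * \<eta> ^ 3) * c * (1 + r')" for r'
      unfolding that t1[symmetric] by simp
    have ht: "h / t = cis (1 * pi / 4) / sqrt 2 * exp E / c * (1 + s)" if "h = cis (1 * pi / 4) / sqrt 2 * exp (of_real (1 * (2/3)) * \<eta> ^ 3) / c * (1 + s)" for s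
      unfolding that t2[symmetric] by simp
    have ht': "h' / t = cis (1 * pi / 4) / sqrt 2 * exp E * c * (1 + s')" if "h' = of_real 1 * cis (1 * pi / 4) / sqrt 2 * exp (of_real (1 * (2/3)) * \<eta> ^ 3) * c * (1 + s')" for s'
      unfolding that t2[symmetric] by simp
    from F[unfolded airy_form_def, folded \<eta>_def, folded c_def] obtain r r' where r: "norm r \<le> C / norm \<eta> ^ 3" "norm r' \<le> C / norm \<eta> ^ 3"
      "f * t = cis (- 1 * pi / 4) / sqrt 2 * exp (- E) / c * (1 + r)" "f' * t = - cis (- 1 * pi / 4) / sqrt 2 * exp (- E) * c * (1 + r')"
      using ft ft' by blast
    from H[unfolded airy_form_def, folded \<eta>_def, folded c_def] obtain s s' where s: "norm s \<le> C / norm \<eta> ^ 3" "norm s' \<le> C / norm \<eta> ^ 3"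
      "h / t = cis (1 * pi / 4) / sqrt 2 * exp E / c * (1 + s)" "h' / t = cis (1 * pi / 4) / sqrt 2 * exp E * c * (1 + s')"
      using ht ht' by blast
    note core = matching_core[OF sq \<eta>w cm W_def W b_def C r(1,2) s(1,2) E_def K_def, unfolded W2]
    define q where "q = complex_of_real (sqrt 2)"
    have q: "q \<noteq> 0" "q * q = 2" by (simp_all add: q_def flip: of_real_mult)
    define e where "e = cis (pi / 4)"
    have e: "e \<noteq> 0" "cis (- 1 * pi / 4) = 1 / e" "cis (- pi / 4) = 1 / e" "cis (1 * pi / 4) = e"
      by (simp_all add: e_def cis_divide[symmetric] flip: cis_inverse inverse_eq_divide)
    have T11: "m / q * (f * t * e + h / t * (1 / e)) = m / c * (exp (- E) * (1 + r) + exp E * (1 + s)) / 2" (is "?L = _")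
    proof -
      have "?L = m / c * (exp (- E) * (1 + r) + exp E * (1 + s)) / (q * q)"
        unfolding r(3) s(3) e(2,4) q_def[symmetric] using q(1) e(1) c0 m0 by (simp add: field_simps)
      then show ?thesis by (simp only: q(2))
    qed
    have T12: "(h / t * (1 / e) - f * t * e) / (q * m) = (exp E * (1 + s) - exp (- E) * (1 + r)) / (2 * m * c)" (is "?L = _")
    proof -
      have "?L = (exp E * (1 + s) - exp (- E) * (1 + r)) / ((q * q) * m * c)"
        unfolding r(3) s(3) e(2,4) q_def[symmetric] using q(1) e(1) c0 m0 by (simp add: field_simps)
      then show ?thesis by (simp only: q(2))
    qed
    have T21: "m / q * (f' * t * e + h' / t * (1 / e)) = m * c * (exp E * (1 + s') - exp (- E) * (1 + r')) / 2" (is "?L = _")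
    proof -
      have "?L = m * c * (exp E * (1 + s') - exp (- E) * (1 + r')) / (q * q)"
        unfolding r(4) s(4) e(2,4) q_def[symmetric] using q(1) e(1) c0 m0 by (simp add: field_simps)
      then show ?thesis by (simp only: q(2))
    qed
    have T22: "(h' / t * (1 / e) - f' * t * e) / (q * m) = c / m * (exp (- E) * (1 + r') + exp E * (1 + s')) / 2" (is "?L = _")
    proof -
      have "?L = c / m * (exp (- E) * (1 + r') + exp E * (1 + s')) / (q * q)"
        unfolding r(4) s(4) e(2,4) q_def[symmetric] using q(1) e(1) c0 m0 by (simp add: field_simps)
      then show ?thesis by (simp only: q(2))
    qed
    show "let t = exp (rh_theta \<beta> z); T1 = mfrak_inv_row z (f * t) (h / t); T2 = mfrak_inv_row z (f' * t) (h' / t) in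
       norm (fst T1 - 1) \<le> K / norm z \<and> norm (snd T1) \<le> K / norm z \<and>
       norm (fst T2 - of_real (\<beta>\<^sup>2 / 4)) \<le> K / norm z \<and> norm (snd T2 - 1) \<le> K / norm z"
      unfolding Let_def t_def[symmetric] mfrak_inv_row_def fst_conv snd_conv w_def[symmetric] m_def[symmetric] q_def[symmetric] e_def[symmetric] e(3) T11 T12 T21 T22
      using core by blast
  qed
qed

section \<open>The model solution\<close>

definition rh_q :: "real \<Rightarrow> (complex \<Rightarrow> complex) \<Rightarrow> (complex \<Rightarrow> complex) \<Rightarrow> complex \<Rightarrow> complex" where
  "rh_q \<gamma> g y z = g z + y z * Ln (z - of_real \<gamma>) / (2 * of_real pi * \<i>)"

text \<open>The multiple of the second column that is added to the first when the lenses are opened.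
  The signs turn \<open>airyA\<close> into \<open>airyA - airyU = - airyL\<close> above the upper
  ray and into \<open>airyA + airyL = airyU\<close> below the lower one, the functions with the
  first asymptotic form there.\<close>

definition lens :: "complex \<Rightarrow> complex" where
  "lens z = (if 2 / 3 * pi < Arg z then - 1 else if Arg z < - (2 / 3 * pi) then 1 else 0)"

lemma airy_norm_square: "airy_norm * airy_norm = - (2 * of_real pi * \<i>)" "airy_norm \<noteq> 0"
proof -
  have "airy_norm * airy_norm = (of_real (sqrt (2 * pi)) * of_real (sqrt (2 * pi))) * (cis (- pi / 4) * cis (- pi / 4))"
    by (simp add: airy_norm_def)
  also have "of_real (sqrt (2 * pi)) * of_real (sqrt (2 * pi)) = complex_of_real (2 * pi)"
    by (simp flip: of_real_mult)
  also have "cis (- pi / 4) * cis (- pi / 4) = - \<i>" by (simp add: cis_mult complex_eq_iff)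
  finally show "airy_norm * airy_norm = - (2 * of_real pi * \<i>)" by simp
  show "airy_norm \<noteq> 0" by (simp add: airy_norm_def)
qed

lemma Ln_reflect:
  assumes "Im z \<noteq> 0"
  shows "Im z > 0 \<Longrightarrow> Ln (- z) = Ln z - \<i> * of_real pi" "Im z < 0 \<Longrightarrow> Ln (- z) = Ln z + \<i> * of_real pi"
proof -
  have "z \<noteq> 0" using assms by auto
  then show "Im z > 0 \<Longrightarrow> Ln (- z) = Ln z - \<i> * of_real pi" "Im z < 0 \<Longrightarrow> Ln (- z) = Ln z + \<i> * of_real pi"
    using Ln_minus[of z] by auto
qed

text \<open>The row \<open>(x1, x2) = (d1 + u * Airy' * l, d2 - u * Airy * l)\<close>, with \<open>l = Ln (a - v)\<close>, applied
  to the second column: the jump of the logarithm cancels against the one of the column.\<close>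

lemma row_second_column:
  fixes v :: complex and a :: real
  assumes u: "d1 * Airy v + d2 * Airy' v = u" and im: "Im v \<noteq> 0"
  defines "l \<equiv> Ln (of_real a - v)"
  defines "q \<equiv> (d1 * airyU v + d2 * airyU' v - airy_norm * u / 2) + airy_norm * u * Ln (v - of_real a) / (2 * of_real pi * \<i>)"
  shows "Im v > 0 \<Longrightarrow> q = (d1 + u * Airy' v * l) * airyU v + (d2 - u * Airy v * l) * airyU' v"
    and "Im v < 0 \<Longrightarrow> q = (d1 + u * Airy' v * l) * airyL v + (d2 - u * Airy v * l) * airyL' v"
    and "airy_norm * u = (d1 + u * Airy' v * l) * airyA v + (d2 - u * Airy v * l) * airyA' v"
proof -
  define k where "k = airy_norm"
  define p where "p = complex_of_real pi"
  have k: "k * k = - (2 * p * \<i>)" "k \<noteq> 0" using airy_norm_square by (simp_all add: k_def p_def)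
  have p0: "p \<noteq> 0" by (simp add: p_def)
  have W: "k * (Airy v * airyU' v - Airy' v * airyU v) = 1"
    using airy_wronskian[of v] by (simp add: airyA_def airyA'_def k_def algebra_simps)
  have conn: "airyU v = airyL v + k * Airy v" "airyU' v = airyL' v + k * Airy' v"
    using airy_connection[of v] by (simp_all add: airyA_def airyA'_def k_def algebra_simps)
  have W': "k * (Airy v * airyL' v - Airy' v * airyL v) = 1"
    using W unfolding conn by (simp add: algebra_simps)
  \<comment> \<open>Because \<open>k * k\<close> is minus \<open>2 * p * \<i>\<close>, the factor of
    the logarithm becomes \<open>- 1 / k\<close>, the one produced by the Wronskian relation
    \<open>W\<close>.\<close>
  have kq: "k / (2 * p * \<i>) = - 1 / k"
    using k p0 by (simp add: divide_simps)
  have kp: "\<i> * p / k = - k / 2"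
    using k p0 by (simp add: divide_simps)
  have lm: "of_real a - v = - (v - of_real a)" by simp
  define n where "n = Ln (v - of_real a)"
  have q: "q = (d1 * airyU v + d2 * airyU' v - k * u / 2) - u * n / k"
  proof -
    have "airy_norm * u * n / (2 * of_real pi * \<i>) = (k / (2 * p * \<i>)) * u * n" by (simp add: k_def p_def)
    then show ?thesis unfolding q_def n_def[symmetric] kq by (simp add: k_def)
  qed
  show "airy_norm * u = (d1 + u * Airy' v * l) * airyA v + (d2 - u * Airy v * l) * airyA' v"
    unfolding airyA_def airyA'_def u[symmetric] by (simp add: algebra_simps)
  show "q = (d1 + u * Airy' v * l) * airyU v + (d2 - u * Airy v * l) * airyU' v" if "Im v > 0"
  proof -
    have l: "l = n - \<i> * p" unfolding l_def lm n_def p_def using Ln_reflect(1)[of "v - of_real a"] that by simp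
    have "(d1 + u * Airy' v * l) * airyU v + (d2 - u * Airy v * l) * airyU' v
       = d1 * airyU v + d2 * airyU' v - u * l * (k * (Airy v * airyU' v - Airy' v * airyU v)) / k"
      using k(2) by (simp add: field_simps)
    also have "\<dots> = d1 * airyU v + d2 * airyU' v - u * n / k + u * (\<i> * p / k)" unfolding W l by (simp add: algebra_simps add_divide_distrib diff_divide_distrib)
    finally show ?thesis unfolding q kp by (simp add: algebra_simps)
  qed
  show "q = (d1 + u * Airy' v * l) * airyL v + (d2 - u * Airy v * l) * airyL' v" if "Im v < 0"
  proof -
    have l: "l = n + \<i> * p" unfolding l_def lm n_def p_def using Ln_reflect(2)[of "v - of_real a"] that by simp
    have "(d1 + u * Airy' v * l) * airyL v + (d2 - u * Airy v * l) * airyL' v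
       = d1 * airyL v + d2 * airyL' v - u * l * (k * (Airy v * airyL' v - Airy' v * airyL v)) / k"
      using k(2) by (simp add: field_simps)
    also have "\<dots> = d1 * airyL v + d2 * airyL' v - u * n / k - u * (\<i> * p / k)" unfolding W' l by (simp add: algebra_simps add_divide_distrib diff_divide_distrib)
    finally have R: "(d1 + u * Airy' v * l) * airyL v + (d2 - u * Airy v * l) * airyL' v = d1 * airyL v + d2 * airyL' v - u * n / k + k * u / 2"
      unfolding kp by (simp add: algebra_simps)
    have "d1 * airyU v + d2 * airyU' v = d1 * airyL v + d2 * airyL' v + k * u"
      unfolding conn u[symmetric] by (simp add: algebra_simps)
    then show ?thesis unfolding q R by (simp add: algebra_simps)
  qed
qed

text \<open>Without the shift the root has argument \<open>Arg z / 2\<close>, and the cosine of an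
  angle up to pi/3 is at least 1/2. Shifting by \<open>\<beta>\<close> moves the root by at most
  \<open>W / 20\<close>, which leaves 9/20 of \<open>W\<close> against a quarter of 21/20.\<close>

lemma Re_rotated_root:
  fixes \<beta> :: real
  assumes im: "Im z \<noteq> 0" and R: "1 \<le> norm z" "20 * \<bar>\<beta>\<bar> \<le> norm z" and \<phi>: "\<bar>\<phi> + Arg z / 2\<bar> \<le> pi / 3"
  shows "norm (csqrt (z + of_real \<beta>)) / 4 \<le> Re (cis \<phi> * csqrt (z + of_real \<beta>))"
proof -
  define \<eta> where "\<eta> = csqrt (z + of_real \<beta>)"
  define w where "w = csqrt z"
  define W where "W = norm w"
  have z0: "z \<noteq> 0" using im by auto
  have zb: "Im (z + of_real \<beta>) \<noteq> 0" using im by simp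
  note wr = csqrt_right_half[OF im, folded w_def] and er = csqrt_right_half[OF zb, folded \<eta>_def]
  have W2: "W\<^sup>2 = norm z" by (simp add: W_def w_def norm_power[symmetric])
  have W0: "W > 0" using z0 by (simp add: W_def w_def)
  have ew: "Im \<eta> * Im w \<ge> 0"
    using wr(2,3) er(2,3) im by (cases "Im z > 0") (auto simp: zero_le_mult_iff)
  have \<eta>w: "W \<le> norm (\<eta> + w)" unfolding W_def by (rule norm_le_norm_add[OF er(1) wr(1) ew])
  have "(\<eta> - w) * (\<eta> + w) = \<eta>\<^sup>2 - w\<^sup>2" by (simp add: algebra_simps power2_eq_square)
  also have "\<dots> = of_real \<beta>" by (simp add: \<eta>_def w_def)
  finally have "norm (\<eta> - w) * norm (\<eta> + w) = \<bar>\<beta>\<bar>" by (metis norm_mult norm_of_real)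
  then have "norm (\<eta> - w) * W \<le> \<bar>\<beta>\<bar>" using mult_left_mono[OF \<eta>w, of "norm (\<eta> - w)"] by simp
  also have "\<dots> \<le> (W / 20) * W" using R(2) by (simp add: W2[symmetric] power2_eq_square)
  finally have d: "norm (\<eta> - w) \<le> W / 20" using W0 by (simp add: mult_le_cancel_right)
  have "w = of_real W * cis (Arg z / 2)"
  proof -
    have "W = sqrt (norm z)" using W2 W0 by (metis less_imp_le real_sqrt_unique)
    then show ?thesis unfolding w_def using csqrt_eq_cis[OF z0] by simp
  qed
  then have "cis \<phi> * w = of_real W * cis (\<phi> + Arg z / 2)" by (simp add: cis_mult[symmetric])
  then have Rw: "Re (cis \<phi> * w) = W * cos (\<phi> + Arg z / 2)" by simp
  have "cos (pi / 3) \<le> cos \<bar>\<phi> + Arg z / 2\<bar>"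
    using \<phi> pi_gt_zero by (intro cos_monotone_0_pi_le) auto
  then have "1 / 2 \<le> cos (\<phi> + Arg z / 2)" by (simp add: cos_60)
  then have 1: "W / 2 \<le> Re (cis \<phi> * w)" using W0 mult_left_mono[of "1/2" "cos (\<phi> + Arg z / 2)" W] unfolding Rw by simp
  have "Re (cis \<phi> * \<eta>) = Re (cis \<phi> * w) + Re (cis \<phi> * (\<eta> - w))" by (simp add: algebra_simps)
  moreover have "\<bar>Re (cis \<phi> * (\<eta> - w))\<bar> \<le> W / 20"
    using abs_Re_le_cmod[of "cis \<phi> * (\<eta> - w)"] d by (simp only: norm_mult norm_cis)
  ultimately have "W / 2 - W / 20 \<le> Re (cis \<phi> * \<eta>)" using 1 by linarith
  moreover have "norm \<eta> \<le> W + W / 20"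
    using norm_triangle_ineq2[of \<eta> w] d by (simp add: W_def)
  ultimately show ?thesis unfolding \<eta>_def[symmetric] using W0 by linarith
qed

lemma mfrak_inv_row_linear:
  "fst (mfrak_inv_row z (x1 * a1 + x2 * a2) (x1 * b1 + x2 * b2)) = x1 * fst (mfrak_inv_row z a1 b1) + x2 * fst (mfrak_inv_row z a2 b2)"
  "snd (mfrak_inv_row z (x1 * a1 + x2 * a2) (x1 * b1 + x2 * b2)) = x1 * snd (mfrak_inv_row z a1 b1) + x2 * snd (mfrak_inv_row z a2 b2)"
  by (simp_all add: mfrak_inv_row_def Let_def algebra_simps add_divide_distrib diff_divide_distrib)

text \<open>The \<open>x\<close> entries are the errors of the Cauchy integral rows and the
  \<open>t\<close> entries those of the Airy matching, whose lower left entry tends to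
  \<open>D\<close>. Subtracting \<open>D\<close> times the first row from the second is the
  triangular prefactor; it removes this constant.\<close>

lemma error_product:
  fixes x11 x12 x21 x22 t11 t12 t21 t22 D :: complex and X K \<epsilon> :: real
  assumes x: "norm x11 \<le> X * \<epsilon>" "norm x12 \<le> X * \<epsilon>" "norm x21 \<le> X * \<epsilon>" "norm x22 \<le> X * \<epsilon>"
    and t: "norm t11 \<le> K * \<epsilon>" "norm t12 \<le> K * \<epsilon>" "norm t21 \<le> K * \<epsilon>" "norm t22 \<le> K * \<epsilon>"
    and \<epsilon>: "0 \<le> \<epsilon>" "\<epsilon> \<le> 1" and X: "X \<ge> 0" and K: "K \<ge> 0"
  defines "B \<equiv> (1 + norm D) * (2 * K + 3 * X * (1 + K) + X * (norm D + K) + X * K)"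
  shows "norm ((1 + x11) * (1 + t11) + x12 * (D + t21) - 1) \<le> B * \<epsilon>" (is ?a)
    and "norm ((1 + x11) * t12 + x12 * (1 + t22)) \<le> B * \<epsilon>" (is ?b)
    and "norm ((x21 * (1 + t11) + (1 + x22) * (D + t21)) - D * ((1 + x11) * (1 + t11) + x12 * (D + t21))) \<le> B * \<epsilon>" (is ?c)
    and "norm ((x21 * t12 + (1 + x22) * (1 + t22)) - D * ((1 + x11) * t12 + x12 * (1 + t22)) - 1) \<le> B * \<epsilon>" (is ?d)
proof -
  have m: "norm (x * (1 + t)) \<le> X * (1 + K) * \<epsilon>" if "norm x \<le> X * \<epsilon>" "norm t \<le> K * \<epsilon>" for x t :: complex
  proof -
    have "norm (1 + t) \<le> 1 + K" using norm_triangle_ineq[of 1 t] that(2) mult_left_le[OF \<epsilon>(2) K] by simp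
    then have "norm (x * (1 + t)) \<le> (X * \<epsilon>) * (1 + K)" unfolding norm_mult using that X \<epsilon> by (intro mult_mono) auto
    then show ?thesis by (simp add: ac_simps)
  qed
  have mD: "norm (x * (D + t)) \<le> X * (norm D + K) * \<epsilon>" if "norm x \<le> X * \<epsilon>" "norm t \<le> K * \<epsilon>" for x t :: complex
  proof -
    have "norm (D + t) \<le> norm D + K" using norm_triangle_ineq[of D t] that(2) mult_left_le[OF \<epsilon>(2) K] by linarith
    then have "norm (x * (D + t)) \<le> (X * \<epsilon>) * (norm D + K)" unfolding norm_mult using that X \<epsilon> by (intro mult_mono) auto
    then show ?thesis by (simp add: ac_simps)
  qed
  have mt: "norm (x * t) \<le> X * K * \<epsilon>" if "norm x \<le> X * \<epsilon>" "norm t \<le> K * \<epsilon>" for x t :: complex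
  proof -
    have "norm t \<le> K" using that(2) mult_left_le[OF \<epsilon>(2) K] by linarith
    then have "norm (x * t) \<le> (X * \<epsilon>) * K" unfolding norm_mult using that X \<epsilon> by (intro mult_mono) auto
    then show ?thesis by (simp add: ac_simps)
  qed
  define A1 where "A1 = (K + X * (1 + K) + X * (norm D + K)) * \<epsilon>"
  define A2 where "A2 = (K + X * K + X * (1 + K)) * \<epsilon>"
  have XK: "X * (1 + K) \<ge> 0" "X * (norm D + K) \<ge> 0" "X * K \<ge> 0" using X K by auto
  have A: "A1 \<ge> 0" "A2 \<ge> 0" using XK K \<epsilon> by (auto simp: A1_def A2_def)
  have BA: "B * \<epsilon> = (1 + norm D) * (A1 + A2 + X * (1 + K) * \<epsilon>)"
    by (simp add: B_def A1_def A2_def algebra_simps)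
  have le: "(1 + norm D) * A1 \<le> B * \<epsilon>" "(1 + norm D) * A2 \<le> B * \<epsilon>"
    unfolding BA using A XK \<epsilon> by (intro mult_left_mono; simp)+
  have le': "A1 \<le> (1 + norm D) * A1" "A2 \<le> (1 + norm D) * A2" using A by (simp_all add: algebra_simps)
  have "(1 + x11) * (1 + t11) + x12 * (D + t21) - 1 = t11 + (x11 * (1 + t11) + x12 * (D + t21))" by (simp add: algebra_simps)
  also have "norm \<dots> \<le> K * \<epsilon> + (X * (1 + K) * \<epsilon> + X * (norm D + K) * \<epsilon>)"
    by (intro norm_triangle_mono m mD x t)
  also have "\<dots> = A1" by (simp add: A1_def algebra_simps)
  finally have a: "norm ((1 + x11) * (1 + t11) + x12 * (D + t21) - 1) \<le> A1" .
  then show ?a using le le' by linarith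
  have "(1 + x11) * t12 + x12 * (1 + t22) = t12 + (x11 * t12 + x12 * (1 + t22))" by (simp add: algebra_simps)
  also have "norm \<dots> \<le> K * \<epsilon> + (X * K * \<epsilon> + X * (1 + K) * \<epsilon>)"
    by (intro norm_triangle_mono m mt x t)
  also have "\<dots> = A2" by (simp add: A2_def algebra_simps)
  finally have b: "norm ((1 + x11) * t12 + x12 * (1 + t22)) \<le> A2" .
  then show ?b using le le' by linarith
  have "(x21 * (1 + t11) + (1 + x22) * (D + t21)) - D * ((1 + x11) * (1 + t11) + x12 * (D + t21))
     = (t21 + (x21 * (1 + t11) + x22 * (D + t21))) - D * ((1 + x11) * (1 + t11) + x12 * (D + t21) - 1)"
    by (simp add: algebra_simps)
  also have "norm \<dots> \<le> (K * \<epsilon> + (X * (1 + K) * \<epsilon> + X * (norm D + K) * \<epsilon>)) + norm D * A1"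
    using a by (intro norm_diff_mono norm_triangle_mono m mD x t) (simp add: norm_mult mult_left_mono)
  also have "\<dots> = (1 + norm D) * A1" by (simp add: A1_def algebra_simps)
  finally show ?c using le by linarith
  have "(x21 * t12 + (1 + x22) * (1 + t22)) - D * ((1 + x11) * t12 + x12 * (1 + t22)) - 1
     = (t22 + (x21 * t12 + x22 * (1 + t22))) - D * ((1 + x11) * t12 + x12 * (1 + t22))"
    by (simp add: algebra_simps)
  also have "norm \<dots> \<le> (K * \<epsilon> + (X * K * \<epsilon> + X * (1 + K) * \<epsilon>)) + norm D * A2"
    using b by (intro norm_diff_mono norm_triangle_mono m mt x t) (simp add: norm_mult mult_left_mono)
  also have "\<dots> = (1 + norm D) * A2" by (simp add: A2_def algebra_simps)
  finally show ?d using le by linarith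
qed

theorem model_solution:
  fixes \<beta> \<gamma> :: real
  shows "\<exists>y1 y2 g1 g2 K R. y1 holomorphic_on UNIV \<and> y2 holomorphic_on UNIV \<and> g1 holomorphic_on UNIV \<and> g2 holomorphic_on UNIV \<and>
    (\<forall>z. Im z \<noteq> 0 \<longrightarrow> Arg z \<noteq> 2 / 3 * pi \<longrightarrow> Arg z \<noteq> - (2 / 3 * pi) \<longrightarrow> R \<le> norm z \<longrightarrow>
      (let t = exp (rh_theta \<beta> z); q1 = rh_q \<gamma> g1 y1 z; q2 = rh_q \<gamma> g2 y2 z;
         T1 = mfrak_inv_row z ((y1 z + lens z * q1) * t) (q1 / t);
         T2 = mfrak_inv_row z ((y2 z + lens z * q2) * t) (q2 / t) in
       norm (fst T1 - 1) \<le> K / norm z \<and> norm (snd T1) \<le> K / norm z \<and>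
       norm (fst T2) \<le> K / norm z \<and> norm (snd T2 - 1) \<le> K / norm z))"
proof -
  \<comment> \<open>In the variable \<open>z + of_real \<beta>\<close> of the Airy functions the
    branch point \<open>\<gamma>\<close> sits at this \<open>a\<close>.\<close>
  define a where "a = \<beta> + \<gamma>"
  define D where "D = complex_of_real (\<beta>\<^sup>2 / 4)"
  obtain u1 d11 d12 C1 R1 where r1: "u1 holomorphic_on UNIV" "d11 holomorphic_on UNIV" "d12 holomorphic_on UNIV"
    "\<And>z. d11 z * Airy z + d12 z * Airy' z = u1 z"
    "\<And>z. z \<notin> of_real ` {a..} \<Longrightarrow> R1 \<le> norm z \<Longrightarrow>
       norm (d11 z + u1 z * Airy' z * Ln (of_real a - z) - 1) \<le> C1 / norm z \<and>
       norm (d12 z - u1 z * Airy z * Ln (of_real a - z) - 0) \<le> C1 / norm z"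
    using airy_row[of a 1 0] unfolding of_real_0 of_real_1 by blast
  obtain u2 d21 d22 C2 R2 where r2: "u2 holomorphic_on UNIV" "d21 holomorphic_on UNIV" "d22 holomorphic_on UNIV"
    "\<And>z. d21 z * Airy z + d22 z * Airy' z = u2 z"
    "\<And>z. z \<notin> of_real ` {a..} \<Longrightarrow> R2 \<le> norm z \<Longrightarrow>
       norm (d21 z + u2 z * Airy' z * Ln (of_real a - z) - 0) \<le> C2 / norm z \<and>
       norm (d22 z - u2 z * Airy z * Ln (of_real a - z) - 1) \<le> C2 / norm z"
    using airy_row[of a 0 1] unfolding of_real_0 of_real_1 by blast
  obtain C where C: "C \<ge> 0" and forms: "\<And>\<eta>. Re \<eta> > 0 \<Longrightarrow>
     (norm \<eta> / 4 \<le> Re \<eta> \<longrightarrow> airy_form C (-1) \<eta> (airyA (\<eta>\<^sup>2)) (airyA' (\<eta>\<^sup>2))) \<and>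
     (Im \<eta> \<ge> 0 \<longrightarrow> airy_form C 1 \<eta> (airyU (\<eta>\<^sup>2)) (airyU' (\<eta>\<^sup>2))) \<and>
     (Im \<eta> \<le> 0 \<longrightarrow> airy_form C 1 \<eta> (airyL (\<eta>\<^sup>2)) (airyL' (\<eta>\<^sup>2))) \<and>
     (Im \<eta> \<ge> 0 \<longrightarrow> norm \<eta> / 4 \<le> Re (cis (- (2 * pi / 3)) * \<eta>) \<longrightarrow> airy_form C (-1) \<eta> (- airyL (\<eta>\<^sup>2)) (- airyL' (\<eta>\<^sup>2))) \<and>
     (Im \<eta> \<le> 0 \<longrightarrow> norm \<eta> / 4 \<le> Re (cis (2 * pi / 3) * \<eta>) \<longrightarrow> airy_form C (-1) \<eta> (airyU (\<eta>\<^sup>2)) (airyU' (\<eta>\<^sup>2)))"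
    using airy_forms by blast
  obtain K R0 where K: "K \<ge> 0" "R0 \<ge> 1" and match: "\<And>z f f' h h'. Im z \<noteq> 0 \<Longrightarrow> norm z \<ge> R0 \<Longrightarrow>
     airy_form C (-1) (csqrt (z + of_real \<beta>)) f f' \<Longrightarrow> airy_form C 1 (csqrt (z + of_real \<beta>)) h h' \<Longrightarrow>
     (let t = exp (rh_theta \<beta> z); T1 = mfrak_inv_row z (f * t) (h / t); T2 = mfrak_inv_row z (f' * t) (h' / t) in
       norm (fst T1 - 1) \<le> K / norm z \<and> norm (snd T1) \<le> K / norm z \<and>
       norm (fst T2 - of_real (\<beta>\<^sup>2 / 4)) \<le> K / norm z \<and> norm (snd T2 - 1) \<le> K / norm z)"
    using airy_matching[OF C, of \<beta>] by blast
  define sh where "sh = (\<lambda>z::complex. z + of_real \<beta>)"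
  have sh_hol: "(\<lambda>z. F (sh z)) holomorphic_on UNIV" if "F holomorphic_on UNIV" for F
  proof -
    have "sh holomorphic_on UNIV" unfolding sh_def by (intro holomorphic_intros)
    from holomorphic_on_compose_gen[OF this that] show ?thesis by (simp add: comp_def)
  qed
  define y1 where "y1 = (\<lambda>z. airy_norm * u1 (sh z))"
  define p2 where "p2 = (\<lambda>z. airy_norm * u2 (sh z))"
  define g1 where "g1 = (\<lambda>z. d11 (sh z) * airyU (sh z) + d12 (sh z) * airyU' (sh z) - airy_norm * u1 (sh z) / 2)"
  define h2 where "h2 = (\<lambda>z. d21 (sh z) * airyU (sh z) + d22 (sh z) * airyU' (sh z) - airy_norm * u2 (sh z) / 2)"
  \<comment> \<open>The constant prefactor acts on entire functions, so the corrected row keeps the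
    structure of an entire pair \<open>(y2, g2)\<close>.\<close>
  define y2 where "y2 = (\<lambda>z. p2 z - D * y1 z)"
  define g2 where "g2 = (\<lambda>z. h2 z - D * g1 z)"
  have hol: "y1 holomorphic_on UNIV" "y2 holomorphic_on UNIV" "g1 holomorphic_on UNIV" "g2 holomorphic_on UNIV"
    unfolding y1_def y2_def g1_def g2_def p2_def h2_def
    by (intro holomorphic_intros sh_hol r1 r2 airyAUL_holomorphic; simp)+
  define X where "X = 2 * (\<bar>C1\<bar> + \<bar>C2\<bar>)"
  define B where "B = (1 + norm D) * (2 * K + 3 * X * (1 + K) + X * (norm D + K) + X * K)"
  \<comment> \<open>\<open>20 * \<bar>\<beta>\<bar>\<close> is the threshold of
    \<open>Re_rotated_root\<close>. The summand \<open>\<bar>\<beta>\<bar>\<close> beside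
    \<open>R1\<close> and \<open>R2\<close> is the loss in passing from \<open>norm z\<close> to the
    norm of the shifted point.\<close>
  define R where "R = max (max R0 (20 * \<bar>\<beta>\<bar>)) (max R1 R2 + \<bar>\<beta>\<bar>)"
  have main: "let t = exp (rh_theta \<beta> z); q1 = rh_q \<gamma> g1 y1 z; q2 = rh_q \<gamma> g2 y2 z;
         T1 = mfrak_inv_row z ((y1 z + lens z * q1) * t) (q1 / t);
         T2 = mfrak_inv_row z ((y2 z + lens z * q2) * t) (q2 / t) in
       norm (fst T1 - 1) \<le> B / norm z \<and> norm (snd T1) \<le> B / norm z \<and>
       norm (fst T2) \<le> B / norm z \<and> norm (snd T2 - 1) \<le> B / norm z"
    if im: "Im z \<noteq> 0" and arg: "Arg z \<noteq> 2 / 3 * pi" "Arg z \<noteq> - (2 / 3 * pi)" and zR: "R \<le> norm z" for z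
  proof -
    have z0: "z \<noteq> 0" using im by auto
    have zR': "R0 \<le> norm z" "1 \<le> norm z" "20 * \<bar>\<beta>\<bar> \<le> norm z" "R1 + \<bar>\<beta>\<bar> \<le> norm z" "R2 + \<bar>\<beta>\<bar> \<le> norm z"
      using zR K(2) by (auto simp: R_def)
    define v where "v = sh z"
    define \<eta> where "\<eta> = csqrt (z + of_real \<beta>)"
    have v: "v = z + of_real \<beta>" "Im v = Im z" "\<eta>\<^sup>2 = v" by (auto simp: v_def sh_def \<eta>_def)
    have imv: "Im v \<noteq> 0" using im v by simp
    have vray: "v \<notin> of_real ` {a..}" using imv by auto
    have nv: "norm z - \<bar>\<beta>\<bar> \<le> norm v"
      using norm_triangle_ineq2[of z "- of_real \<beta>"] by (simp add: v(1))
    have nv2: "norm z / 2 \<le> norm v" using nv zR' by linarith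
    define \<epsilon> where "\<epsilon> = 1 / norm z"
    have \<epsilon>: "0 \<le> \<epsilon>" "\<epsilon> \<le> 1" using zR'(2) by (auto simp: \<epsilon>_def divide_le_eq)
    have Cv: "x \<le> X * \<epsilon>" if "x \<le> c / norm v" "\<bar>c\<bar> \<le> \<bar>C1\<bar> + \<bar>C2\<bar>" for x c :: real
    proof -
      have "c / norm v \<le> \<bar>c\<bar> / (norm z / 2)" using nv2 z0 by (intro frac_le) auto
      also have "\<dots> \<le> (\<bar>C1\<bar> + \<bar>C2\<bar>) / (norm z / 2)" using that(2) by (intro divide_right_mono) auto
      also have "\<dots> = X * \<epsilon>" by (simp add: X_def \<epsilon>_def)
      finally show ?thesis using that(1) by simp
    qed
    define l where "l = Ln (of_real a - v)"
    define x11 where "x11 = d11 v + u1 v * Airy' v * l - 1"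
    define x12 where "x12 = d12 v - u1 v * Airy v * l"
    define x21 where "x21 = d21 v + u2 v * Airy' v * l"
    define x22 where "x22 = d22 v - u2 v * Airy v * l - 1"
    have R12: "R1 \<le> norm v" "R2 \<le> norm v" using nv zR' by linarith+
    have x: "norm x11 \<le> X * \<epsilon>" "norm x12 \<le> X * \<epsilon>" "norm x21 \<le> X * \<epsilon>" "norm x22 \<le> X * \<epsilon>"
      using r1(5)[OF vray R12(1)] r2(5)[OF vray R12(2)]
      by (auto intro!: Cv simp: x11_def x12_def x21_def x22_def l_def)
    have qv: "Ln (v - of_real a) = Ln (z - of_real \<gamma>)" by (simp add: v a_def)
    note c1 = row_second_column[OF r1(4) imv, of a] and c2 = row_second_column[OF r2(4) imv, of a]
    define q1 where "q1 = rh_q \<gamma> g1 y1 z"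
    define q2 where "q2 = rh_q \<gamma> h2 p2 z"
    have q1: "q1 = d11 v * airyU v + d12 v * airyU' v - airy_norm * u1 v / 2 + airy_norm * u1 v * Ln (v - of_real a) / (2 * of_real pi * \<i>)"
      by (simp add: q1_def rh_q_def g1_def y1_def v_def[symmetric] qv)
    have q2: "q2 = d21 v * airyU v + d22 v * airyU' v - airy_norm * u2 v / 2 + airy_norm * u2 v * Ln (v - of_real a) / (2 * of_real pi * \<i>)"
      by (simp add: q2_def rh_q_def h2_def p2_def v_def[symmetric] qv)
    have yA: "y1 z = (1 + x11) * airyA v + x12 * airyA' v" "p2 z = x21 * airyA v + (1 + x22) * airyA' v"
      using c1(3) c2(3) by (simp_all add: y1_def p2_def v_def[symmetric] x11_def x12_def x21_def x22_def l_def)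
    have qU: "q1 = (1 + x11) * airyU v + x12 * airyU' v" "q2 = x21 * airyU v + (1 + x22) * airyU' v" if "Im z > 0"
      using c1(1) c2(1) that v(2) unfolding q1 q2 by (simp_all add: x11_def x12_def x21_def x22_def l_def)
    have qL: "q1 = (1 + x11) * airyL v + x12 * airyL' v" "q2 = x21 * airyL v + (1 + x22) * airyL' v" if "Im z < 0"
      using c1(2) c2(2) that v(2) unfolding q1 q2 by (simp_all add: x11_def x12_def x21_def x22_def l_def)
    have zb: "Im (z + of_real \<beta>) \<noteq> 0" using im by simp
    note er = csqrt_right_half[OF zb, folded \<eta>_def]
    note fm = forms[OF er(1), unfolded v(3)]
    have rot: "norm \<eta> / 4 \<le> Re (cis \<phi> * \<eta>)" if "\<bar>\<phi> + Arg z / 2\<bar> \<le> pi / 3" for \<phi>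
      unfolding \<eta>_def by (rule Re_rotated_root[OF im zR'(2,3) that])
    have conn: "airyA v = airyU v - airyL v" "airyA' v = airyU' v - airyL' v" using airy_connection by metis+
    \<comment> \<open>In each of the four sectors the columns, lenses opened, are one fixed matrix
      close to the identity times a pair of Airy columns in normal form. The pairs, from the upper
      side of the negative axis to the lower, are (- L, U), (A, U), (A, L) and (U, L).\<close>
    have "\<exists>f f' h h'. airy_form C (-1) \<eta> f f' \<and> airy_form C 1 \<eta> h h' \<and>
        y1 z + lens z * q1 = (1 + x11) * f + x12 * f' \<and> q1 = (1 + x11) * h + x12 * h' \<and>
        p2 z + lens z * q2 = x21 * f + (1 + x22) * f' \<and> q2 = x21 * h + (1 + x22) * h'"
    proof (cases "Im z > 0")
      case True
      have Az: "0 < Arg z" "Arg z \<le> pi" using Arg_bounded[of z] True Arg_lt_pi[of z] by auto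
      have im\<eta>: "Im \<eta> \<ge> 0" using er True by simp
      have hU: "airy_form C 1 \<eta> (airyU v) (airyU' v)" using fm im\<eta> by blast
      show ?thesis
      proof (cases "2 / 3 * pi < Arg z")
        case lensT: True
        have "norm \<eta> / 4 \<le> Re (cis (- (2 * pi / 3)) * \<eta>)" using lensT Az by (intro rot) (auto simp: abs_le_iff)
        then have "airy_form C (-1) \<eta> (- airyL v) (- airyL' v)" using fm im\<eta> by blast
        with hU show ?thesis
          using qU[OF True] yA lensT by (intro exI[of _ "- airyL v"] exI[of _ "- airyL' v"] exI[of _ "airyU v"] exI[of _ "airyU' v"])
            (simp add: lens_def conn algebra_simps)
      next
        case False
        have "norm \<eta> / 4 \<le> Re (cis 0 * \<eta>)" using False Az by (intro rot) auto
        then have "airy_form C (-1) \<eta> (airyA v) (airyA' v)" using fm by simp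
        with hU show ?thesis
          using qU[OF True] yA False Az by (intro exI[of _ "airyA v"] exI[of _ "airyA' v"] exI[of _ "airyU v"] exI[of _ "airyU' v"])
            (simp add: lens_def)
      qed
    next
      case False
      then have neg: "Im z < 0" using im by simp
      have Az: "Arg z < 0" "- pi < Arg z" using Arg_bounded[of z] neg Arg_less_0[of z] by auto
      have im\<eta>: "Im \<eta> \<le> 0" using er neg by simp
      have hL: "airy_form C 1 \<eta> (airyL v) (airyL' v)" using fm im\<eta> by blast
      show ?thesis
      proof (cases "Arg z < - (2 / 3 * pi)")
        case lensT: True
        have "norm \<eta> / 4 \<le> Re (cis (2 * pi / 3) * \<eta>)" using lensT Az by (intro rot) (auto simp: abs_le_iff)
        then have "airy_form C (-1) \<eta> (airyU v) (airyU' v)" using fm im\<eta> by blast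
        with hL show ?thesis
          using qL[OF neg] yA lensT Az pi_gt_zero by (intro exI[of _ "airyU v"] exI[of _ "airyU' v"] exI[of _ "airyL v"] exI[of _ "airyL' v"])
            (simp add: lens_def conn algebra_simps)
      next
        case nlens: False
        have "norm \<eta> / 4 \<le> Re (cis 0 * \<eta>)" using nlens Az by (intro rot) auto
        then have "airy_form C (-1) \<eta> (airyA v) (airyA' v)" using fm by simp
        with hL show ?thesis
          using qL[OF neg] yA nlens Az pi_gt_zero by (intro exI[of _ "airyA v"] exI[of _ "airyA' v"] exI[of _ "airyL v"] exI[of _ "airyL' v"])
            (simp add: lens_def)
      qed
    qed
    then obtain f f' h h' where F: "airy_form C (-1) \<eta> f f'" "airy_form C 1 \<eta> h h'"
      and N: "y1 z + lens z * q1 = (1 + x11) * f + x12 * f'" "q1 = (1 + x11) * h + x12 * h'"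
        "p2 z + lens z * q2 = x21 * f + (1 + x22) * f'" "q2 = x21 * h + (1 + x22) * h'" by blast
    define t where "t = exp (rh_theta \<beta> z)"
    define S1 where "S1 = mfrak_inv_row z (f * t) (h / t)"
    define S2 where "S2 = mfrak_inv_row z (f' * t) (h' / t)"
    have S: "norm (fst S1 - 1) \<le> K * \<epsilon>" "norm (snd S1) \<le> K * \<epsilon>" "norm (fst S2 - D) \<le> K * \<epsilon>" "norm (snd S2 - 1) \<le> K * \<epsilon>"
      using match[OF im zR'(1) F[unfolded \<eta>_def]] by (simp_all add: Let_def t_def S1_def S2_def D_def \<epsilon>_def)
    have X0: "X \<ge> 0" by (simp add: X_def)
    note ep = error_product[where D = D, OF x S(1) S(2) S(3) S(4) \<epsilon> X0 K(1), folded B_def]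
    have row1: "fst (mfrak_inv_row z ((y1 z + lens z * q1) * t) (q1 / t)) = (1 + x11) * fst S1 + x12 * fst S2"
      "snd (mfrak_inv_row z ((y1 z + lens z * q1) * t) (q1 / t)) = (1 + x11) * snd S1 + x12 * snd S2"
    proof -
      have e: "(y1 z + lens z * q1) * t = (1 + x11) * (f * t) + x12 * (f' * t)" "q1 / t = (1 + x11) * (h / t) + x12 * (h' / t)"
        unfolding N(1) by (simp add: algebra_simps, subst N(2), simp add: add_divide_distrib)
      show "fst (mfrak_inv_row z ((y1 z + lens z * q1) * t) (q1 / t)) = (1 + x11) * fst S1 + x12 * fst S2"
        "snd (mfrak_inv_row z ((y1 z + lens z * q1) * t) (q1 / t)) = (1 + x11) * snd S1 + x12 * snd S2"
        unfolding e mfrak_inv_row_linear S1_def S2_def by simp_all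
    qed
    have row2: "fst (mfrak_inv_row z ((p2 z + lens z * q2) * t) (q2 / t)) = x21 * fst S1 + (1 + x22) * fst S2"
      "snd (mfrak_inv_row z ((p2 z + lens z * q2) * t) (q2 / t)) = x21 * snd S1 + (1 + x22) * snd S2"
    proof -
      have e: "(p2 z + lens z * q2) * t = x21 * (f * t) + (1 + x22) * (f' * t)" "q2 / t = x21 * (h / t) + (1 + x22) * (h' / t)"
        unfolding N(3) by (simp add: algebra_simps, subst N(4), simp add: add_divide_distrib)
      show "fst (mfrak_inv_row z ((p2 z + lens z * q2) * t) (q2 / t)) = x21 * fst S1 + (1 + x22) * fst S2"
        "snd (mfrak_inv_row z ((p2 z + lens z * q2) * t) (q2 / t)) = x21 * snd S1 + (1 + x22) * snd S2"
        unfolding e mfrak_inv_row_linear S1_def S2_def by simp_all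
    qed
    define Q2 where "Q2 = rh_q \<gamma> g2 y2 z"
    have Q2: "Q2 = q2 - D * q1"
      by (simp add: Q2_def q2_def q1_def rh_q_def g2_def y2_def algebra_simps diff_divide_distrib)
    have e2: "(y2 z + lens z * Q2) * t = 1 * ((p2 z + lens z * q2) * t) + (- D) * ((y1 z + lens z * q1) * t)"
      "Q2 / t = 1 * (q2 / t) + (- D) * (q1 / t)"
      by (simp_all add: Q2 y2_def algebra_simps diff_divide_distrib)
    have tot2: "fst (mfrak_inv_row z ((y2 z + lens z * Q2) * t) (Q2 / t)) = (x21 * fst S1 + (1 + x22) * fst S2) - D * ((1 + x11) * fst S1 + x12 * fst S2)"
      "snd (mfrak_inv_row z ((y2 z + lens z * Q2) * t) (Q2 / t)) = (x21 * snd S1 + (1 + x22) * snd S2) - D * ((1 + x11) * snd S1 + x12 * snd S2)"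
      unfolding e2 mfrak_inv_row_linear row1 row2 by simp_all
    have B\<epsilon>: "B / norm z = B * \<epsilon>" by (simp add: \<epsilon>_def)
    show ?thesis
      unfolding Let_def t_def[symmetric] q1_def[symmetric] Q2_def[symmetric] row1 tot2 B\<epsilon>
      using ep by simp
  qed
  then show ?thesis using hol by blast
qed

section \<open>Existence\<close>

lemma mat2_nth [simp]:
  "mat2 a b c d $ 1 $ 1 = a" "mat2 a b c d $ 1 $ 2 = b" "mat2 a b c d $ 2 $ 1 = c" "mat2 a b c d $ 2 $ 2 = d"
  by (simp_all add: mat2_def)

lemma matrix_mult_mat2_nth [simp]:
  fixes A :: cmat2
  shows "(A ** mat2 a b c d) $ i $ 1 = A $ i $ 1 * a + A $ i $ 2 * c"
    and "(A ** mat2 a b c d) $ i $ 2 = A $ i $ 1 * b + A $ i $ 2 * d"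
  by (simp_all add: matrix_matrix_mult_def sum_2)

lemma cmat2_eqI:
  fixes A B :: cmat2
  assumes "\<And>i. A $ i $ 1 = B $ i $ 1" "\<And>i. A $ i $ 2 = B $ i $ 2"
  shows "A = B"
  using assms by (simp add: vec_eq_iff forall_2)

lemma cmat2_tendstoI:
  fixes F :: "'a \<Rightarrow> cmat2"
  assumes "\<And>i j. ((\<lambda>x. F x $ i $ j) \<longlongrightarrow> A $ i $ j) net"
  shows "(F \<longlongrightarrow> A) net"
  by (intro vec_tendstoI assms)

lemma mfrak_eq:
  fixes z m :: complex
  assumes "z \<noteq> 0"
  defines "m \<equiv> csqrt (csqrt z)"
  shows "mfrak z = mat2 (cis (- pi / 4) / (sqrt 2 * m)) (cis (pi / 4) / (sqrt 2 * m))
                        (- (m * cis (- pi / 4) / sqrt 2)) (m * cis (pi / 4) / sqrt 2)"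
proof -
  have e: "exp (- (complex_of_real pi * \<i> / 4)) = cis (- pi / 4)" "exp (complex_of_real pi * \<i> / 4) = cis (pi / 4)"
    by (simp_all add: cis_conv_exp mult.commute)
  have p: "z powr (- 1 / 4) = 1 / m" "z powr (- (- 1 / 4)) = m"
    using powr_csqrt[OF assms(1)] by (simp_all add: m_def)
  show ?thesis
    unfolding mfrak_def zpow_sigma3_def exp_sigma3_def p minus_minus e
    by (rule cmat2_eqI) (simp_all add: exhaust_2 matrix_matrix_mult_def sum_2 mat2_def vector_def field_simps)
qed

lemma mfrak_inv_row_mfrak:
  fixes A :: cmat2 and i :: 2
  assumes z: "z \<noteq> 0" and m: "(A $ i $ 1, A $ i $ 2) = mfrak_inv_row z a b"
  shows "(A ** mfrak z) $ i $ 1 = a" "(A ** mfrak z) $ i $ 2 = b"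
proof -
  define m where "m = csqrt (csqrt z)"
  define c where "c = cis (pi / 4)"
  define d where "d = cis (- pi / 4)"
  define s where "s = complex_of_real (sqrt 2)"
  have cd: "c * d = 1" by (simp add: c_def d_def cis_mult)
  have s2: "s * s = 2" by (simp add: s_def flip: of_real_mult)
  have m0: "m \<noteq> 0" using z by (simp add: m_def)
  have s0: "s \<noteq> 0" by (simp add: s_def)
  have A: "A $ i $ 1 = m / s * (a * c + b * d)" "A $ i $ 2 = (b * d - a * c) / (s * m)"
    using m by (simp_all add: mfrak_inv_row_def Let_def m_def c_def d_def s_def)
  have "(A ** mfrak z) $ i $ 1 = m / s * (a * c + b * d) * (d / (s * m)) + (b * d - a * c) / (s * m) * (- (m * d / s))"
    unfolding mfrak_eq[OF z] matrix_mult_mat2_nth A m_def c_def d_def s_def ..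
  also have "\<dots> = 2 * a * (c * d) / (s * s)" using m0 s0 by (simp add: field_simps)
  finally show "(A ** mfrak z) $ i $ 1 = a" by (simp add: cd s2)
  have "(A ** mfrak z) $ i $ 2 = m / s * (a * c + b * d) * (c / (s * m)) + (b * d - a * c) / (s * m) * (m * c / s)"
    unfolding mfrak_eq[OF z] matrix_mult_mat2_nth A m_def c_def d_def s_def ..
  also have "\<dots> = 2 * b * (c * d) / (s * s)" using m0 s0 by (simp add: field_simps)
  finally show "(A ** mfrak z) $ i $ 2 = b" by (simp add: cd s2)
qed

lemma rh_theta_csqrt: "rh_theta \<beta> z = 2 / 3 * csqrt z ^ 3 + of_real \<beta> * csqrt z"
  by (cases "z = 0") (simp_all add: rh_theta_def powr_csqrt)

lemma csqrt_reflect: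
  "Im z > 0 \<Longrightarrow> csqrt z = \<i> * csqrt (- z)" "Im z < 0 \<Longrightarrow> csqrt z = - (\<i> * csqrt (- z))"
proof -
  show "Im z > 0 \<Longrightarrow> csqrt z = \<i> * csqrt (- z)" using csqrt_minus[of "- z"] by simp
  assume "Im z < 0"
  then have "csqrt (- z) = \<i> * csqrt z" by (intro csqrt_minus) simp
  then show "csqrt z = - (\<i> * csqrt (- z))" by (simp add: mult.assoc[symmetric])
qed

section \<open>The contour and its two sides\<close>

definition rh_contour :: "real \<Rightarrow> complex set" where
  "rh_contour \<gamma> = {z. Im z = 0 \<and> Re z \<le> \<gamma>} \<union> ray (2 / 3 * pi) \<union> ray (- (2 / 3 * pi))"

lemma of_real_image_eq: "complex_of_real ` {r. P r} = {z. Im z = 0 \<and> P (Re z)}"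
  by (auto simp: complex_eq_iff image_iff)

lemma Sigma_left_eq: "Sigma_left \<alpha> = rh_contour 0"
  by (auto simp: Sigma_left_def contour_def arcs_left_def rh_contour_def lessThan_def of_real_image_eq complex_eq_iff)

lemma Sigma_right_eq: "\<alpha> > 0 \<Longrightarrow> Sigma_right \<alpha> = rh_contour \<alpha>"
  by (auto simp: Sigma_right_def contour_def arcs_right_def rh_contour_def lessThan_def greaterThanLessThan_def greaterThan_def
      of_real_image_eq complex_eq_iff Int_def)

lemma Im_ray: "z \<in> ray (2 / 3 * pi) \<Longrightarrow> Im z > 0" "z \<in> ray (- (2 / 3 * pi)) \<Longrightarrow> Im z < 0"
  unfolding ray_def Arg_lt_pi[symmetric] Arg_neg_iff[symmetric] mem_Collect_eq
  using pi_gt_zero by linarith+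

lemma Im_mult_cis_uminus: "Im (z * cis (- \<phi>)) = norm z * sin (Arg z - \<phi>)"
proof (cases "z = 0")
  case False
  have "z = of_real (norm z) * cis (Arg z)" using Arg_eq[OF False] by (simp add: cis_conv_exp)
  then have "z * cis (- \<phi>) = of_real (norm z) * (cis (Arg z) * cis (- \<phi>))" by (metis mult.assoc)
  also have "\<dots> = of_real (norm z) * cis (Arg z - \<phi>)" by (simp add: cis_mult)
  finally have "z * cis (- \<phi>) = of_real (norm z) * cis (Arg z - \<phi>)" .
  then show ?thesis by simp
qed simp

lemma sin_sign:
  assumes "\<bar>x\<bar> < pi"
  shows "sin x < 0 \<longleftrightarrow> x < 0" "sin x > 0 \<longleftrightarrow> x > 0"
proof -
  consider "x < 0" | "x = 0" | "x > 0" by linarith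
  then have "(sin x < 0 \<longleftrightarrow> x < 0) \<and> (sin x > 0 \<longleftrightarrow> x > 0)"
  proof cases
    case 1
    then have "sin (- x) > 0" using assms by (intro sin_gt_zero) auto
    with 1 show ?thesis by simp
  next
    case 3
    then have "sin x > 0" using assms by (intro sin_gt_zero) auto
    with 3 show ?thesis by simp
  qed simp
  then show "sin x < 0 \<longleftrightarrow> x < 0" "sin x > 0 \<longleftrightarrow> x > 0" by blast+
qed

text \<open>The rays run towards 0, in direction \<open>- cis \<phi>\<close>, so their left side is
  the one of smaller argument. The bound on \<open>Arg w - \<phi>\<close> keeps the sine from
  changing sign a second time.\<close>

lemma ray_sides_iff:
  assumes z: "z \<in> ray \<phi>" and w: "\<bar>Arg w - \<phi>\<bar> < pi" "w \<noteq> 0"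
  shows "w \<in> left_side (- cis \<phi>) z \<longleftrightarrow> Arg w < \<phi>" "w \<in> right_side (- cis \<phi>) z \<longleftrightarrow> Arg w > \<phi>"
proof -
  have "(w - z) / (- cis \<phi>) = z * cis (- \<phi>) - w * cis (- \<phi>)"
    by (simp add: divide_inverse cis_inverse algebra_simps)
  moreover have "Im (z * cis (- \<phi>)) = 0" using z unfolding Im_mult_cis_uminus by (simp add: ray_def)
  ultimately have "Im ((w - z) / (- cis \<phi>)) = - (norm w * sin (Arg w - \<phi>))"
    by (simp only: minus_complex.simps(2) Im_mult_cis_uminus)
  then show "w \<in> left_side (- cis \<phi>) z \<longleftrightarrow> Arg w < \<phi>" "w \<in> right_side (- cis \<phi>) z \<longleftrightarrow> Arg w > \<phi>"
    using sin_sign[OF w(1)] w(2) by (simp_all add: left_side_def right_side_def mult_less_0_iff zero_less_mult_iff)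
qed

lemma side_one_iff: "Im z = 0 \<Longrightarrow> w \<in> left_side 1 z \<longleftrightarrow> Im w > 0" "Im z = 0 \<Longrightarrow> w \<in> right_side 1 z \<longleftrightarrow> Im w < 0"
  by (simp_all add: left_side_def right_side_def)

text \<open>\<open>Mp\<close> and \<open>Mm\<close> are continuous across the arc and coincide with
  \<open>M\<close> on one side each. Boundary values are then ordinary function values, and the jump
  is an identity at points of the arc.\<close>

lemma satisfies_jumpI:
  fixes M Mp Mm :: "complex \<Rightarrow> cmat2"
  assumes "\<And>z. z \<in> S \<Longrightarrow> isCont Mp z" "\<And>z. z \<in> S \<Longrightarrow> isCont Mm z"
    and "\<And>z. z \<in> S \<Longrightarrow> \<forall>\<^sub>F w in nhds z. w \<in> left_side t z \<longrightarrow> M w = Mp w"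
    and "\<And>z. z \<in> S \<Longrightarrow> \<forall>\<^sub>F w in nhds z. w \<in> right_side t z \<longrightarrow> M w = Mm w"
    and "\<And>z. z \<in> S \<Longrightarrow> Mp z = Mm z ** J z"
  shows "satisfies_jump M (S, t, J)"
proof -
  have lim: "(M \<longlongrightarrow> F z) (at z within A)" if c: "isCont F z" and e: "\<forall>\<^sub>F w in nhds z. w \<in> A \<longrightarrow> M w = F w" for F A z
  proof -
    have "(F \<longlongrightarrow> F z) (at z within A)" using c unfolding isCont_def by (rule tendsto_within_subset) simp
    moreover have "\<forall>\<^sub>F w in at z within A. F w = M w"
      using e by (simp add: eventually_at_filter) (auto elim: eventually_mono)
    ultimately show ?thesis by (rule Lim_transform_eventually)
  qed
  show ?thesis
    unfolding satisfies_jump_def prod.case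
    by (rule exI[of _ Mp], rule exI[of _ Mm]) (intro conjI ballI continuous_at_imp_continuous_on lim[where F = Mp] lim[where F = Mm] assms; assumption)
qed

lemma eventually_Arg_less: "z \<notin> \<real>\<^sub>\<le>\<^sub>0 \<Longrightarrow> Arg z < c \<Longrightarrow> \<forall>\<^sub>F w in nhds z. Arg w < c"
  using continuous_at_Arg[of z] unfolding isCont_def tendsto_at_iff_tendsto_nhds by (rule order_tendstoD)

lemma eventually_Arg_greater: "z \<notin> \<real>\<^sub>\<le>\<^sub>0 \<Longrightarrow> c < Arg z \<Longrightarrow> \<forall>\<^sub>F w in nhds z. c < Arg w"
  using continuous_at_Arg[of z] unfolding isCont_def tendsto_at_iff_tendsto_nhds by (rule order_tendstoD)

lemma lens_locally_constant:
  assumes "z \<notin> rh_contour \<gamma>" "0 \<le> \<gamma>"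
  shows "\<forall>\<^sub>F w in nhds z. lens w = lens z"
proof -
  have z: "z \<notin> \<real>\<^sub>\<le>\<^sub>0" "Arg z \<noteq> 2 / 3 * pi" "Arg z \<noteq> - (2 / 3 * pi)"
    using assms by (auto simp: rh_contour_def ray_def complex_nonpos_Reals_iff)
  have pos: "\<not> (x > 2 / 3 * pi \<and> x < - (2 / 3 * pi))" for x using pi_gt_zero by linarith
  consider "Arg z < - (2 / 3 * pi)" | "- (2 / 3 * pi) < Arg z" "Arg z < 2 / 3 * pi" | "2 / 3 * pi < Arg z"
    using z by linarith
  then show ?thesis
  proof cases
    case 1
    show ?thesis using eventually_Arg_less[OF z(1) 1] by (rule eventually_mono) (use 1 pos in \<open>auto simp: lens_def\<close>)
  next
    case 2
    show ?thesis using eventually_Arg_less[OF z(1) 2(2)] eventually_Arg_greater[OF z(1) 2(1)]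
      by eventually_elim (use 2 in \<open>auto simp: lens_def\<close>)
  next
    case 3
    show ?thesis using eventually_Arg_greater[OF z(1) 3] by (rule eventually_mono) (use 3 in \<open>auto simp: lens_def\<close>)
  qed
qed

text \<open>The rows are indexed by the type \<open>2\<close>, so that jumps and singularities are
  treated for both at once. The expansion is required only off the real axis and the rays; the
  half-line beyond \<open>\<gamma>\<close>, which is not on the contour, is recovered by
  continuity.\<close>

locale rh_model =
  fixes \<beta> \<gamma> K R :: real and y g :: "2 \<Rightarrow> complex \<Rightarrow> complex"
  assumes \<gamma>: "\<gamma> \<ge> 0"
    and holo: "\<And>i. y i holomorphic_on UNIV" "\<And>i. g i holomorphic_on UNIV"
    and asymp: "\<And>z i. Im z \<noteq> 0 \<Longrightarrow> Arg z \<noteq> 2 / 3 * pi \<Longrightarrow> Arg z \<noteq> - (2 / 3 * pi) \<Longrightarrow> R \<le> norm z \<Longrightarrow>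
      (let t = exp (rh_theta \<beta> z); q = rh_q \<gamma> (g i) (y i) z; T = mfrak_inv_row z ((y i z + lens z * q) * t) (q / t) in
       norm (fst T - (mat 1 :: cmat2) $ i $ 1) \<le> K / norm z \<and> norm (snd T - (mat 1 :: cmat2) $ i $ 2) \<le> K / norm z)"
begin

text \<open>The lens factor \<open>l\<close>, the logarithm \<open>L\<close> and the square root \<open>w\<close> are separate arguments: the
  boundary values on the two sides of the contour differ only in these.\<close>

definition branch :: "complex \<Rightarrow> complex \<Rightarrow> complex \<Rightarrow> complex \<Rightarrow> cmat2" where
  "branch l L w z = (\<chi> i. let q = g i z + y i z * L / (2 * of_real pi * \<i>); t = exp (2 / 3 * w ^ 3 + of_real \<beta> * w)
     in vector [(y i z + l * q) * t, q / t])"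

definition sol :: "complex \<Rightarrow> cmat2" where
  "sol z = branch (lens z) (Ln (z - of_real \<gamma>)) (csqrt z) z"

lemma branch_nth:
  "branch l L w z $ i $ 1 = (y i z + l * (g i z + y i z * L / (2 * of_real pi * \<i>))) * exp (2 / 3 * w ^ 3 + of_real \<beta> * w)"
  "branch l L w z $ i $ 2 = (g i z + y i z * L / (2 * of_real pi * \<i>)) * exp (- (2 / 3 * w ^ 3 + of_real \<beta> * w))"
  by (simp_all only: branch_def Let_def vec_lambda_beta vector_2 exp_minus divide_inverse)

lemma sol_nth:
  "sol z $ i $ 1 = (y i z + lens z * rh_q \<gamma> (g i) (y i) z) * exp (rh_theta \<beta> z)"
  "sol z $ i $ 2 = rh_q \<gamma> (g i) (y i) z / exp (rh_theta \<beta> z)"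
  by (simp_all only: sol_def branch_nth rh_q_def rh_theta_csqrt exp_minus divide_inverse)

lemma isCont_entire: "isCont (y i) z" "isCont (g i) z"
  using holo by (metis DERIV_isCont UNIV_I holomorphic_derivI open_UNIV)+

lemma isCont_branch:
  assumes "isCont L z" "isCont w z"
  shows "isCont (\<lambda>z. branch l (L z) (w z) z) z"
  unfolding isCont_def
proof (rule cmat2_tendstoI)
  fix i j :: 2
  have "isCont (\<lambda>z. branch l (L z) (w z) z $ i $ 1) z" "isCont (\<lambda>z. branch l (L z) (w z) z $ i $ 2) z"
    unfolding branch_nth divide_inverse
    by (intro isCont_add isCont_mult isCont_minus isCont_power isCont_exp' continuous_const assms isCont_entire)+
  then show "((\<lambda>z. branch l (L z) (w z) z $ i $ j) \<longlongrightarrow> branch l (L z) (w z) z $ i $ j) (at z)"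
    using exhaust_2[of j] by (elim disjE) (simp_all only: isCont_def)
qed

section \<open>The jump relations\<close>

lemma jump_lower: "branch (l + 1) L w z = branch l L w z ** mat2 1 0 (exp (2 * (2 / 3 * w ^ 3 + of_real \<beta> * w))) 1"
proof (rule cmat2_eqI)
  fix i :: 2
  define t where "t = 2 / 3 * w ^ 3 + of_real \<beta> * w"
  define q where "q = g i z + y i z * L / (2 * of_real pi * \<i>)"
  have e: "exp t = exp (- t) * exp (2 * t)" by (simp add: exp_add[symmetric])
  show "branch (l + 1) L w z $ i $ 1 = (branch l L w z ** mat2 1 0 (exp (2 * (2 / 3 * w ^ 3 + of_real \<beta> * w))) 1) $ i $ 1"
    unfolding matrix_mult_mat2_nth branch_nth t_def[symmetric] q_def[symmetric] e by (simp add: ring_distribs ac_simps)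
  show "branch (l + 1) L w z $ i $ 2 = (branch l L w z ** mat2 1 0 (exp (2 * (2 / 3 * w ^ 3 + of_real \<beta> * w))) 1) $ i $ 2"
    unfolding matrix_mult_mat2_nth branch_nth by simp
qed

text \<open>Between the two sides the logarithm changes by \<open>2 * of_real pi * \<i>\<close>,
  hence \<open>q\<close> by \<open>y i z\<close>, which is the first column without its
  exponential.\<close>

lemma jump_upper:
  "branch 0 (L + of_real pi * \<i>) w z = branch 0 (L - of_real pi * \<i>) w z ** mat2 1 (exp (- (2 * (2 / 3 * w ^ 3 + of_real \<beta> * w)))) 0 1"
proof (rule cmat2_eqI)
  fix i :: 2
  define t where "t = 2 / 3 * w ^ 3 + of_real \<beta> * w"
  define q where "q = g i z + y i z * (L - of_real pi * \<i>) / (2 * of_real pi * \<i>)"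
  have q: "g i z + y i z * (L + of_real pi * \<i>) / (2 * of_real pi * \<i>) = q + y i z"
    by (simp add: q_def field_simps)
  have e: "exp (- t) = exp t * exp (- (2 * t))" by (simp add: exp_add[symmetric])
  show "branch 0 (L + of_real pi * \<i>) w z $ i $ 2 = (branch 0 (L - of_real pi * \<i>) w z ** mat2 1 (exp (- (2 * (2 / 3 * w ^ 3 + of_real \<beta> * w)))) 0 1) $ i $ 2"
    unfolding matrix_mult_mat2_nth branch_nth t_def[symmetric] q q_def[symmetric] e by (simp add: ring_distribs ac_simps)
  show "branch 0 (L + of_real pi * \<i>) w z $ i $ 1 = (branch 0 (L - of_real pi * \<i>) w z ** mat2 1 (exp (- (2 * (2 / 3 * w ^ 3 + of_real \<beta> * w)))) 0 1) $ i $ 1"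
    unfolding matrix_mult_mat2_nth branch_nth by simp
qed

text \<open>Write \<open>q\<close> for the value on the right. The logarithm makes the left value
  \<open>q + y\<close>, so the left first column is \<open>y - (q + y) = - q\<close>, and the left
  second column \<open>y + q\<close> is the first one on the right. The exponentials fit because the
  root changes sign.\<close>

lemma jump_swap:
  "branch (- 1) (L + of_real pi * \<i>) (\<i> * w) z = branch 1 (L - of_real pi * \<i>) (- (\<i> * w)) z ** mat2 0 1 (- 1) 0"
proof (rule cmat2_eqI)
  fix i :: 2
  define t where "t = 2 / 3 * (\<i> * w) ^ 3 + of_real \<beta> * (\<i> * w)"
  define q where "q = g i z + y i z * (L - of_real pi * \<i>) / (2 * of_real pi * \<i>)"
  have q: "g i z + y i z * (L + of_real pi * \<i>) / (2 * of_real pi * \<i>) = q + y i z"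
    by (simp add: q_def field_simps)
  have t: "2 / 3 * (- (\<i> * w)) ^ 3 + of_real \<beta> * - (\<i> * w) = - t" by (simp add: t_def power3_eq_cube)
  show "branch (- 1) (L + of_real pi * \<i>) (\<i> * w) z $ i $ 1 = (branch 1 (L - of_real pi * \<i>) (- (\<i> * w)) z ** mat2 0 1 (- 1) 0) $ i $ 1"
    "branch (- 1) (L + of_real pi * \<i>) (\<i> * w) z $ i $ 2 = (branch 1 (L - of_real pi * \<i>) (- (\<i> * w)) z ** mat2 0 1 (- 1) 0) $ i $ 2"
    unfolding matrix_mult_mat2_nth branch_nth t t_def[symmetric] q q_def[symmetric] minus_minus by (simp_all add: ring_distribs)
qed

lemma Ln_sides:
  "Im w > 0 \<Longrightarrow> Ln (w - of_real \<gamma>) = Ln (of_real \<gamma> - w) + of_real pi * \<i>"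
  "Im w < 0 \<Longrightarrow> Ln (w - of_real \<gamma>) = Ln (of_real \<gamma> - w) - of_real pi * \<i>"
  using Ln_reflect[of "w - of_real \<gamma>"] by (simp_all add: mult.commute)

lemma jump_segment: "satisfies_jump sol (of_real ` {0<..<\<gamma>}, 1, \<lambda>z. mat2 1 (exp (- (2 * rh_theta \<beta> z))) 0 1)"
proof (rule satisfies_jumpI[where Mp = "\<lambda>z. branch 0 (Ln (of_real \<gamma> - z) + of_real pi * \<i>) (csqrt z) z"
      and Mm = "\<lambda>z. branch 0 (Ln (of_real \<gamma> - z) - of_real pi * \<i>) (csqrt z) z"])
  fix z :: complex assume "z \<in> of_real ` {0<..<\<gamma>}"
  then have z: "Im z = 0" "0 < Re z" "Re z < \<gamma>" by auto
  have nn: "z \<notin> \<real>\<^sub>\<le>\<^sub>0" "of_real \<gamma> - z \<notin> \<real>\<^sub>\<le>\<^sub>0" using z by (auto simp: complex_nonpos_Reals_iff)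
  have L: "isCont (\<lambda>z. Ln (of_real \<gamma> - z)) z"
    using nn by (intro isCont_Ln' continuous_intros)
  have S: "isCont csqrt z" using nn by (intro continuous_at_csqrt) auto
  show "isCont (\<lambda>z. branch 0 (Ln (of_real \<gamma> - z) + of_real pi * \<i>) (csqrt z) z) z"
    "isCont (\<lambda>z. branch 0 (Ln (of_real \<gamma> - z) - of_real pi * \<i>) (csqrt z) z) z"
    by (intro isCont_branch isCont_add isCont_diff L S continuous_const)+
  have "Arg z = 0" using z by (simp add: Arg_eq_0 complex_is_Real_iff)
  then have "\<forall>\<^sub>F w in nhds z. Arg w < 2 / 3 * pi \<and> - (2 / 3 * pi) < Arg w"
    using nn(1) by (intro eventually_conj eventually_Arg_less eventually_Arg_greater) auto
  then have lens: "\<forall>\<^sub>F w in nhds z. lens w = 0" by (rule eventually_mono) (auto simp: lens_def)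
  show "\<forall>\<^sub>F w in nhds z. w \<in> left_side 1 z \<longrightarrow> sol w = branch 0 (Ln (of_real \<gamma> - w) + of_real pi * \<i>) (csqrt w) w"
    "\<forall>\<^sub>F w in nhds z. w \<in> right_side 1 z \<longrightarrow> sol w = branch 0 (Ln (of_real \<gamma> - w) - of_real pi * \<i>) (csqrt w) w"
    by (rule eventually_mono[OF lens]; simp add: side_one_iff[OF z(1)] sol_def Ln_sides del: csqrt.simps)+
  show "branch 0 (Ln (of_real \<gamma> - z) + of_real pi * \<i>) (csqrt z) z =
     branch 0 (Ln (of_real \<gamma> - z) - of_real pi * \<i>) (csqrt z) z ** mat2 1 (exp (- (2 * rh_theta \<beta> z))) 0 1"
    unfolding rh_theta_csqrt by (rule jump_upper)
qed

text \<open>On the negative axis both principal branches break. They are rewritten through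
  \<open>Ln (of_real \<gamma> - z)\<close> and \<open>csqrt (- z)\<close>, which are continuous
  there; all discontinuity then sits in explicit constants and in the sign of the root.\<close>

lemma jump_negative: "satisfies_jump sol (of_real ` {..<0::real}, 1, \<lambda>z. mat2 0 1 (- 1) 0)"
proof (rule satisfies_jumpI[where Mp = "\<lambda>z. branch (- 1) (Ln (of_real \<gamma> - z) + of_real pi * \<i>) (\<i> * csqrt (- z)) z"
      and Mm = "\<lambda>z. branch 1 (Ln (of_real \<gamma> - z) - of_real pi * \<i>) (- (\<i> * csqrt (- z))) z"])
  fix z :: complex assume "z \<in> of_real ` {..<0::real}"
  then have z: "Im z = 0" "Re z < 0" by auto
  have nn: "- z \<notin> \<real>\<^sub>\<le>\<^sub>0" "of_real \<gamma> - z \<notin> \<real>\<^sub>\<le>\<^sub>0" using z \<gamma> by (auto simp: complex_nonpos_Reals_iff)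
  have L: "isCont (\<lambda>z. Ln (of_real \<gamma> - z)) z"
    using nn by (intro isCont_Ln' continuous_intros)
  have S: "isCont (\<lambda>z. csqrt (- z)) z"
    using nn by (intro isCont_o2[of z uminus csqrt] continuous_at_csqrt continuous_intros) auto
  show "isCont (\<lambda>z. branch (- 1) (Ln (of_real \<gamma> - z) + of_real pi * \<i>) (\<i> * csqrt (- z)) z) z"
    "isCont (\<lambda>z. branch 1 (Ln (of_real \<gamma> - z) - of_real pi * \<i>) (- (\<i> * csqrt (- z))) z) z"
    by (intro isCont_branch isCont_add isCont_diff isCont_minus isCont_mult L S continuous_const)+
  have "Arg (- z) = 0" using z by (simp add: Arg_eq_0 complex_is_Real_iff)
  then have A: "\<forall>\<^sub>F w in nhds (- z). - (pi / 3) < Arg w \<and> Arg w < pi / 3"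
    using nn(1) by (intro eventually_conj eventually_Arg_less eventually_Arg_greater) auto
  have "filterlim uminus (nhds (- z)) (nhds z)" by (intro tendsto_intros filterlim_ident)
  from eventually_compose_filterlim[OF A this]
  have near: "\<forall>\<^sub>F w in nhds z. - (pi / 3) < Arg (- w) \<and> Arg (- w) < pi / 3" by simp
  have lens: "\<forall>\<^sub>F w in nhds z. (Im w > 0 \<longrightarrow> lens w = - 1) \<and> (Im w < 0 \<longrightarrow> lens w = 1)"
    using near
  proof eventually_elim
    case (elim w)
    have "Arg (- w) = Arg w - pi" if "Im w > 0" using that Arg_minus[of w] Arg_pos_iff[of w] by (cases "w = 0") auto
    moreover have "Arg (- w) = Arg w + pi" if "Im w < 0" using that Arg_minus[of w] Arg_neg_iff[of w] by (cases "w = 0") auto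
    ultimately show ?case using elim pi_gt_zero by (auto simp: lens_def)
  qed
  show "\<forall>\<^sub>F w in nhds z. w \<in> left_side 1 z \<longrightarrow> sol w = branch (- 1) (Ln (of_real \<gamma> - w) + of_real pi * \<i>) (\<i> * csqrt (- w)) w"
    "\<forall>\<^sub>F w in nhds z. w \<in> right_side 1 z \<longrightarrow> sol w = branch 1 (Ln (of_real \<gamma> - w) - of_real pi * \<i>) (- (\<i> * csqrt (- w))) w"
    by (rule eventually_mono[OF lens], subst side_one_iff[OF z(1)], subst sol_def, rule impI, subst csqrt_reflect, assumption, simp add: Ln_sides del: csqrt.simps)+
  show "branch (- 1) (Ln (of_real \<gamma> - z) + of_real pi * \<i>) (\<i> * csqrt (- z)) z =
     branch 1 (Ln (of_real \<gamma> - z) - of_real pi * \<i>) (- (\<i> * csqrt (- z))) z ** mat2 0 1 (- 1) 0"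
    by (rule jump_swap)
qed

text \<open>Neither the logarithm nor the root is cut on a ray off the real axis. Only the lens
  factor changes, rising by 1 from the right side to the left.\<close>

lemma jump_ray:
  assumes \<phi>: "\<phi> \<noteq> 0" "\<bar>\<phi>\<bar> < pi"
    and lens: "\<And>z. z \<in> ray \<phi> \<Longrightarrow> \<forall>\<^sub>F w in nhds z. (Arg w < \<phi> \<longrightarrow> lens w = l + 1) \<and> (\<phi> < Arg w \<longrightarrow> lens w = l)"
  shows "satisfies_jump sol (ray \<phi>, - cis \<phi>, \<lambda>z. mat2 1 0 (exp (2 * rh_theta \<beta> z)) 1)"
proof (rule satisfies_jumpI[where Mp = "\<lambda>z. branch (l + 1) (Ln (z - of_real \<gamma>)) (csqrt z) z"
      and Mm = "\<lambda>z. branch l (Ln (z - of_real \<gamma>)) (csqrt z) z"])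
  fix z assume z: "z \<in> ray \<phi>"
  have A: "Arg z = \<phi>" "z \<noteq> 0" using z by (auto simp: ray_def)
  have im: "Im z \<noteq> 0"
  proof
    assume "Im z = 0"
    then have "Arg z = 0 \<or> Arg z = pi" by (cases "Re z < 0") (auto simp: Arg_eq_0 Arg_eq_pi complex_is_Real_iff)
    then show False using A \<phi> by auto
  qed
  have nn: "z \<notin> \<real>\<^sub>\<le>\<^sub>0" "z - of_real \<gamma> \<notin> \<real>\<^sub>\<le>\<^sub>0" using im by (auto simp: complex_nonpos_Reals_iff)
  have L: "isCont (\<lambda>z. Ln (z - of_real \<gamma>)) z"
    using nn by (intro isCont_Ln' continuous_intros)
  have S: "isCont csqrt z" using nn by (intro continuous_at_csqrt) auto
  show "isCont (\<lambda>z. branch (l + 1) (Ln (z - of_real \<gamma>)) (csqrt z) z) z"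
    "isCont (\<lambda>z. branch l (Ln (z - of_real \<gamma>)) (csqrt z) z) z"
    by (intro isCont_branch L S)+
  have "\<forall>\<^sub>F w in nhds z. Arg w < \<phi> + pi \<and> \<phi> - pi < Arg w"
    using nn(1) A by (intro eventually_conj eventually_Arg_less eventually_Arg_greater) auto
  moreover have "\<forall>\<^sub>F w in nhds z. w \<noteq> 0" using A(2) by (rule t1_space_nhds)
  ultimately have side: "\<forall>\<^sub>F w in nhds z. (w \<in> left_side (- cis \<phi>) z \<longleftrightarrow> Arg w < \<phi>) \<and> (w \<in> right_side (- cis \<phi>) z \<longleftrightarrow> \<phi> < Arg w)"
    by eventually_elim (intro conjI ray_sides_iff[OF z]; auto)
  show "\<forall>\<^sub>F w in nhds z. w \<in> left_side (- cis \<phi>) z \<longrightarrow> sol w = branch (l + 1) (Ln (w - of_real \<gamma>)) (csqrt w) w"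
    "\<forall>\<^sub>F w in nhds z. w \<in> right_side (- cis \<phi>) z \<longrightarrow> sol w = branch l (Ln (w - of_real \<gamma>)) (csqrt w) w"
    by (rule eventually_mono[OF eventually_conj[OF side lens[OF z]]]; simp add: sol_def del: csqrt.simps)+
  show "branch (l + 1) (Ln (z - of_real \<gamma>)) (csqrt z) z = branch l (Ln (z - of_real \<gamma>)) (csqrt z) z ** mat2 1 0 (exp (2 * rh_theta \<beta> z)) 1"
    unfolding rh_theta_csqrt by (rule jump_lower)
qed

lemma jump_rays:
  "satisfies_jump sol (ray (2 / 3 * pi), - cis (2 / 3 * pi), \<lambda>z. mat2 1 0 (exp (2 * rh_theta \<beta> z)) 1)"
  "satisfies_jump sol (ray (- (2 / 3 * pi)), - cis (- (2 / 3 * pi)), \<lambda>z. mat2 1 0 (exp (2 * rh_theta \<beta> z)) 1)"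
proof -
  have nn: "z \<notin> \<real>\<^sub>\<le>\<^sub>0" if "z \<in> ray (2 / 3 * pi) \<or> z \<in> ray (- (2 / 3 * pi))" for z
    using that Im_ray[of z] by (auto simp: complex_nonpos_Reals_iff)
  show "satisfies_jump sol (ray (2 / 3 * pi), - cis (2 / 3 * pi), \<lambda>z. mat2 1 0 (exp (2 * rh_theta \<beta> z)) 1)"
  proof (rule jump_ray[where l = "- 1"])
    fix z assume z: "z \<in> ray (2 / 3 * pi)"
    have "\<forall>\<^sub>F w in nhds z. 0 < Arg w" using nn[of z] z Im_ray(1)[OF z] by (intro eventually_Arg_greater) (auto simp: Arg_pos_iff)
    then show "\<forall>\<^sub>F w in nhds z. (Arg w < 2 / 3 * pi \<longrightarrow> lens w = - 1 + 1) \<and> (2 / 3 * pi < Arg w \<longrightarrow> lens w = - 1)"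
      using pi_gt_zero by (auto elim!: eventually_mono simp: lens_def)
  qed (use pi_gt_zero in auto)
  show "satisfies_jump sol (ray (- (2 / 3 * pi)), - cis (- (2 / 3 * pi)), \<lambda>z. mat2 1 0 (exp (2 * rh_theta \<beta> z)) 1)"
  proof (rule jump_ray[where l = 0])
    fix z assume z: "z \<in> ray (- (2 / 3 * pi))"
    have "\<forall>\<^sub>F w in nhds z. Arg w < 0" using nn[of z] z Im_ray(2)[OF z] by (intro eventually_Arg_less) (auto simp: Arg_neg_iff)
    then show "\<forall>\<^sub>F w in nhds z. (Arg w < - (2 / 3 * pi) \<longrightarrow> lens w = 0 + 1) \<and> (- (2 / 3 * pi) < Arg w \<longrightarrow> lens w = 0)"
      by (auto elim!: eventually_mono simp: lens_def) (use pi_gt_zero in linarith)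
  qed (use pi_gt_zero in auto)
qed

lemma sol_analytic: "(\<lambda>z. sol z $ i $ j) analytic_on - rh_contour \<gamma>"
  unfolding analytic_on_analytic_at[of _ "- rh_contour \<gamma>"]
proof
  fix z assume "z \<in> - rh_contour \<gamma>"
  then have z: "z \<notin> rh_contour \<gamma>" by simp
  obtain S where S: "open S" "z \<in> S" "\<And>w. w \<in> S \<Longrightarrow> lens w = lens z"
    using lens_locally_constant[OF z \<gamma>] unfolding eventually_nhds by blast
  define T where "T = S \<inter> - {w. Im w = 0 \<and> Re w \<le> \<gamma>}"
  have "closed {w. Im w = 0 \<and> Re w \<le> \<gamma>}"
    by (intro closed_Collect_conj closed_Collect_eq closed_Collect_le continuous_intros)
  then have "open T" unfolding T_def using S(1) by (intro open_Int) auto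
  have zT: "z \<in> T" using z S(2) by (auto simp: T_def rh_contour_def)
  have nn: "w \<notin> \<real>\<^sub>\<le>\<^sub>0" "w - of_real \<gamma> \<notin> \<real>\<^sub>\<le>\<^sub>0" if "w \<in> T" for w
    using that \<gamma> by (auto simp: T_def complex_nonpos_Reals_iff)
  have yg: "y i holomorphic_on T" "g i holomorphic_on T" using holo holomorphic_on_subset by blast+
  have 1: "(\<lambda>w. branch (lens z) (Ln (w - of_real \<gamma>)) (csqrt w) w $ i $ 1) holomorphic_on T"
    unfolding branch_nth by (intro holomorphic_intros yg nn) auto
  have 2: "(\<lambda>w. branch (lens z) (Ln (w - of_real \<gamma>)) (csqrt w) w $ i $ 2) holomorphic_on T"
    unfolding branch_nth by (intro holomorphic_intros yg nn) auto
  have "(\<lambda>w. branch (lens z) (Ln (w - of_real \<gamma>)) (csqrt w) w $ i $ j) holomorphic_on T"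
    using 1 2 exhaust_2[of j] by (elim disjE) simp_all
  then have "(\<lambda>w. sol w $ i $ j) holomorphic_on T"
    by (rule holomorphic_transform) (simp add: sol_def S(3) T_def del: csqrt.simps)
  with \<open>open T\<close> zT show "(\<lambda>w. sol w $ i $ j) analytic_on {z}" unfolding analytic_at by blast
qed

section \<open>Behaviour at infinity and at the endpoints\<close>

lemma sol_normalized: "normalized_at_infinity (rh_contour \<gamma>) sol"
proof -
  define T where "T = (\<lambda>i z. mfrak_inv_row z (sol z $ i $ 1) (sol z $ i $ 2))"
  define E :: "complex \<Rightarrow> cmat2" where "E = (\<lambda>z. \<chi> i. vector [fst (T i z) - (mat 1 :: cmat2) $ i $ 1, snd (T i z) - (mat 1 :: cmat2) $ i $ 2])"
  have E_nth: "E z $ i $ 1 = fst (T i z) - (mat 1 :: cmat2) $ i $ 1" "E z $ i $ 2 = snd (T i z) - (mat 1 :: cmat2) $ i $ 2" for z i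
    by (simp_all add: E_def)
  have eq: "sol z = (mat 1 + E z) ** mfrak z" if "z \<noteq> 0" for z
  proof -
    have "((mat 1 + E z) $ i $ 1, (mat 1 + E z) $ i $ 2) = mfrak_inv_row z (sol z $ i $ 1) (sol z $ i $ 2)" for i
      by (simp add: E_nth T_def)
    from mfrak_inv_row_mfrak[OF that this] show ?thesis by (intro cmat2_eqI) simp_all
  qed
  have off: "norm (E z $ i $ j) \<le> K / norm z"
    if "Im z \<noteq> 0" "Arg z \<noteq> 2 / 3 * pi" "Arg z \<noteq> - (2 / 3 * pi)" "R \<le> norm z" for z i j
    using asymp[OF that, of i] exhaust_2[of j]
    by (auto simp: E_nth T_def sol_nth Let_def)
  \<comment> \<open>On the real half-line beyond \<open>\<gamma>\<close> the entries are continuous.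
    A strict violation of the bound would persist in a neighbourhood, which contains points off the
    real axis, where the bound is known.\<close>
  have bound: "norm (E z $ i $ j) \<le> K / norm z" if z: "z \<notin> rh_contour \<gamma>" and R: "R < norm z" for z i j
  proof (cases "Im z = 0")
    case False
    then have "z \<noteq> 0" by auto
    with False show ?thesis using z R by (intro off) (auto simp: rh_contour_def ray_def)
  next
    case True
    then have Re: "Re z > \<gamma>" using z by (auto simp: rh_contour_def)
    have nn: "z \<notin> \<real>\<^sub>\<le>\<^sub>0" and z0: "z \<noteq> 0" using Re \<gamma> by (auto simp: complex_nonpos_Reals_iff)
    have cs: "csqrt z \<notin> \<real>\<^sub>\<le>\<^sub>0" using csqrt_of_real_nonneg[OF True] Re \<gamma> by (auto simp: complex_nonpos_Reals_iff simp del: csqrt.simps)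
    have cc: "isCont (\<lambda>w. csqrt (csqrt w)) z" by (intro isCont_csqrt' continuous_at_csqrt nn cs)
    have sc: "isCont (\<lambda>w. sol w $ i $ k) z" for i k
      using sol_analytic[of i k] z by (meson ComplI analytic_at_imp_isCont analytic_on_analytic_at)
    have "isCont (\<lambda>w. E w $ i $ 1) z" "isCont (\<lambda>w. E w $ i $ 2) z"
      unfolding E_nth T_def mfrak_inv_row_def Let_def fst_conv snd_conv
      by (intro isCont_add isCont_diff isCont_mult isCont_divide continuous_const cc sc; use z0 in simp)+
    then have "isCont (\<lambda>w. E w $ i $ j) z" using exhaust_2[of j] by (elim disjE) simp_all
    then have c: "isCont (\<lambda>w. norm (E w $ i $ j) - K / norm w) z"
      using z0 by (intro isCont_diff isCont_divide isCont_norm continuous_const continuous_ident) auto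
    show ?thesis
    proof (rule ccontr)
      assume "\<not> ?thesis"
      then have pos: "0 < norm (E z $ i $ j) - K / norm z" by simp
      have "((\<lambda>w. norm (E w $ i $ j) - K / norm w) \<longlongrightarrow> norm (E z $ i $ j) - K / norm z) (nhds z)"
        using c tendsto_at_iff_tendsto_nhds[of "\<lambda>w. norm (E w $ i $ j) - K / norm w" z] unfolding isCont_def by simp
      from order_tendstoD(1)[OF this pos] have 1: "\<forall>\<^sub>F w in nhds z. K / norm w < norm (E w $ i $ j)" by simp
      have "(norm \<longlongrightarrow> norm z) (nhds z)" by (intro tendsto_intros filterlim_ident)
      from order_tendstoD(1)[OF this R] have 2: "\<forall>\<^sub>F w in nhds z. R < norm w" .
      have "Arg z = 0" using True Re \<gamma> by (simp add: Arg_eq_0 complex_is_Real_iff)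
      then have 3: "\<forall>\<^sub>F w in nhds z. Arg w < 2 / 3 * pi \<and> - (2 / 3 * pi) < Arg w"
        using nn by (intro eventually_conj eventually_Arg_less eventually_Arg_greater) auto
      have "\<forall>\<^sub>F w in nhds z. Im w = 0"
        using 1 2 3
      proof eventually_elim
        case (elim w)
        show ?case using off[of w i j] elim by (cases "Im w = 0") auto
      qed
      then obtain d where d: "d > 0" "\<And>w. dist w z < d \<Longrightarrow> Im w = 0" unfolding eventually_nhds_metric by blast
      have "dist (z + \<i> * of_real (d / 2)) z < d" using d(1) by (simp add: dist_norm norm_mult)
      from d(2)[OF this] True d(1) show False by simp
    qed
  qed
  have ev: "\<forall>\<^sub>F z in inf at_infinity (principal (- rh_contour \<gamma>)). max R 0 < norm z \<and> z \<notin> rh_contour \<gamma>"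
    unfolding eventually_inf_principal by (rule eventually_mono[OF eventually_at_infinityI[of "max R 0 + 1"]]) auto
  show ?thesis
    unfolding normalized_at_infinity_def
  proof (intro exI[of _ E] conjI allI)
    fix i j
    show "(\<lambda>z. E z $ i $ j) \<in> O[inf at_infinity (principal (- rh_contour \<gamma>))](\<lambda>z. 1 / z)"
      by (rule bigoI[of _ K]) (use ev in eventually_elim, use bound in \<open>auto simp: norm_divide\<close>)
    show "\<forall>\<^sub>F z in inf at_infinity (principal (- rh_contour \<gamma>)). sol z = (mat 1 + E z) ** mfrak z"
      using ev by eventually_elim (use eq in auto)
  qed
qed

lemma sol_log_singularity:
  assumes e: "e = 0 \<or> e = of_real \<gamma>"
  shows "log_singularity (rh_contour \<gamma>) sol e"
proof -
  define \<rho> where "\<rho> = norm e + 1"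
  have near: "\<forall>\<^sub>F z in at e. norm z \<le> \<rho>"
  proof -
    have "\<forall>\<^sub>F z in at e. dist z e < 1" unfolding eventually_at by (intro exI[of _ 1]) simp
    then show ?thesis
    proof eventually_elim
      case (elim z)
      then show ?case unfolding \<rho>_def dist_norm using norm_triangle_ineq2[of z e] by linarith
    qed
  qed
  have "\<exists>B\<ge>0. \<forall>i. \<forall>z. norm z \<le> \<rho> \<longrightarrow> norm (y i z) \<le> B \<and> norm (g i z) \<le> B"
  proof -
    have "\<exists>B. \<forall>z\<in>cball 0 \<rho>. norm (f z) \<le> B" if "f holomorphic_on UNIV" for f :: "complex \<Rightarrow> complex"
    proof -
      have "compact (f ` cball 0 \<rho>)"
        using that by (intro compact_continuous_image) (auto intro: holomorphic_on_imp_continuous_on holomorphic_on_subset)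
      then show ?thesis using compact_imp_bounded bounded_iff by (metis imageI)
    qed
    from this[OF holo(1)] this[OF holo(2)]
    have "\<forall>i. \<exists>B. \<forall>z\<in>cball 0 \<rho>. norm (y i z) \<le> B" "\<forall>i. \<exists>B. \<forall>z\<in>cball 0 \<rho>. norm (g i z) \<le> B" by blast+
    then obtain b c where "\<forall>i. \<forall>z\<in>cball 0 \<rho>. norm (y i z) \<le> b i" "\<forall>i. \<forall>z\<in>cball 0 \<rho>. norm (g i z) \<le> c i"
      unfolding choice_iff by blast
    then have bc: "norm (y i z) \<le> \<bar>b i\<bar> + \<bar>c i\<bar>" "norm (g i z) \<le> \<bar>b i\<bar> + \<bar>c i\<bar>" if "norm z \<le> \<rho>" for i z
      using that by (smt (verit) mem_cball_0)+
    define B where "B = (\<Sum>i\<in>UNIV. \<bar>b i\<bar> + \<bar>c i\<bar>)"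
    have "\<bar>b i\<bar> + \<bar>c i\<bar> \<le> B" for i unfolding B_def by (rule member_le_sum) auto
    with bc have "norm z \<le> \<rho> \<Longrightarrow> norm (y i z) \<le> B \<and> norm (g i z) \<le> B" for i z by (meson order_trans)
    moreover have "B \<ge> 0" unfolding B_def by (intro sum_nonneg) auto
    ultimately show ?thesis by blast
  qed
  then obtain B where B: "B \<ge> 0" "\<And>i z. norm z \<le> \<rho> \<Longrightarrow> norm (y i z) \<le> B \<and> norm (g i z) \<le> B" by blast
  define H where "H = exp (2 / 3 * \<rho> ^ 3 + \<bar>\<beta>\<bar> * \<rho>)"
  have \<rho>1: "\<rho> \<ge> 1" by (simp add: \<rho>_def)
  have theta: "norm (exp (rh_theta \<beta> z)) \<le> H" "norm (exp (- rh_theta \<beta> z)) \<le> H" if "norm z \<le> \<rho>" for z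
  proof -
    have "norm (csqrt z) \<le> \<rho>"
    proof (rule power2_le_imp_le)
      have "(norm (csqrt z))\<^sup>2 = norm z" by (simp flip: norm_power)
      also have "\<dots> \<le> \<rho>\<^sup>2" using that \<rho>1 self_le_power[of \<rho> 2] by linarith
      finally show "(norm (csqrt z))\<^sup>2 \<le> \<rho>\<^sup>2" .
    qed (use \<rho>1 in simp)
    then have "norm (2 / 3 * csqrt z ^ 3) \<le> 2 / 3 * \<rho> ^ 3" "norm (of_real \<beta> * csqrt z) \<le> \<bar>\<beta>\<bar> * \<rho>"
      by (auto simp: norm_mult norm_power simp del: csqrt.simps intro!: mult_left_mono power_mono)
    then have th: "norm (rh_theta \<beta> z) \<le> 2 / 3 * \<rho> ^ 3 + \<bar>\<beta>\<bar> * \<rho>"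
      unfolding rh_theta_csqrt by (rule norm_triangle_mono)
    show "norm (exp (rh_theta \<beta> z)) \<le> H" "norm (exp (- rh_theta \<beta> z)) \<le> H"
      unfolding H_def using norm_exp[of "rh_theta \<beta> z"] norm_exp[of "- rh_theta \<beta> z"] th
      by (smt (verit) exp_le_cancel_iff norm_minus_cancel)+
  qed
  have H0: "H \<ge> 0" by (simp add: H_def)
  define l where "l = (\<lambda>z. norm (Ln (z - of_real \<gamma>)))"
  have q: "norm (rh_q \<gamma> (g i) (y i) z) \<le> B * (1 + l z)" if "norm z \<le> \<rho>" for i z
  proof -
    have "norm (rh_q \<gamma> (g i) (y i) z) \<le> norm (g i z) + norm (y i z) * l z / (2 * pi)"
      unfolding rh_q_def by (rule order_trans[OF norm_triangle_ineq]) (simp add: norm_mult norm_divide l_def)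
    also have "\<dots> \<le> B + B * l z / 1"
      using B that pi_gt3 by (intro add_mono frac_le mult_right_mono) (auto simp: l_def)
    finally show ?thesis by (simp add: algebra_simps)
  qed
  have entry: "norm (sol z $ i $ j) \<le> 2 * B * H * (1 + l z)" if z: "norm z \<le> \<rho>" for i j z
  proof -
    have l0: "0 \<le> l z" by (simp add: l_def)
    have "norm (sol z $ i $ 2) \<le> B * (1 + l z) * H"
      unfolding sol_nth divide_inverse exp_minus[symmetric] norm_mult
      using q[OF z] theta[OF z] B(1) l0 by (intro mult_mono) auto
    moreover have "0 \<le> B * H * (1 + l z)" using B(1) H0 l0 by simp
    then have "B * (1 + l z) * H \<le> 2 * B * H * (1 + l z)" by (simp add: algebra_simps)
    ultimately have 2: "norm (sol z $ i $ 2) \<le> 2 * B * H * (1 + l z)" by linarith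
    have "norm (lens z) \<le> 1" by (simp add: lens_def)
    then have "norm (lens z * rh_q \<gamma> (g i) (y i) z) \<le> 1 * (B * (1 + l z))"
      unfolding norm_mult using q[OF z] by (intro mult_mono) auto
    then have "norm (y i z + lens z * rh_q \<gamma> (g i) (y i) z) \<le> B + 1 * (B * (1 + l z))"
      using B(2)[OF z] by (intro norm_triangle_mono) auto
    also have "\<dots> \<le> 2 * B * (1 + l z)" using B(1) l0 by (simp add: algebra_simps)
    finally have "norm (sol z $ i $ 1) \<le> 2 * B * (1 + l z) * H"
      unfolding sol_nth norm_mult using theta[OF z] B(1) l0 by (intro mult_mono) auto
    then have 1: "norm (sol z $ i $ 1) \<le> 2 * B * H * (1 + l z)" by (simp add: mult.commute mult.left_commute)
    show ?thesis using 1 2 exhaust_2[of j] by auto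
  qed
  have lim: "filterlim (\<lambda>z. ln (norm (z - c))) at_bot (at c)" for c :: complex
  proof -
    have "((\<lambda>z. norm (z - c)) \<longlongrightarrow> norm (c - c)) (at c)" by (intro tendsto_intros)
    then have "filterlim (\<lambda>z. norm (z - c)) (at_right 0) (at c)"
      unfolding filterlim_at by (auto simp: eventually_at_filter)
    from filterlim_compose[OF ln_at_0 this] show ?thesis .
  qed
  \<comment> \<open>Close to \<open>e\<close> the modulus of the comparison logarithm is at least 1,
    so constants can be absorbed into it.\<close>
  have big: "\<forall>\<^sub>F z in at e. ln (norm (z - e)) \<le> - 1" using lim[of e] by (simp add: filterlim_at_bot)
  have "\<exists>C\<ge>0. \<forall>\<^sub>F z in at e. l z \<le> C * \<bar>ln (norm (z - e))\<bar>"
  proof (cases "e = of_real \<gamma>")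
    case True
    have "\<forall>\<^sub>F z in at e. l z \<le> (1 + pi) * \<bar>ln (norm (z - e))\<bar>"
      using big eventually_neq_at_within[of e e UNIV]
    proof eventually_elim
      case (elim z)
      have "Ln (z - e) = of_real (ln (norm (z - e))) + \<i> * of_real (Arg (z - e))" using elim(2) by (intro Ln_Arg) auto
      then have "l z \<le> norm (complex_of_real (ln (norm (z - e)))) + norm (\<i> * complex_of_real (Arg (z - e)))"
        unfolding l_def True[symmetric] by (metis norm_triangle_ineq)
      also have "\<dots> \<le> \<bar>ln (norm (z - e))\<bar> + pi * 1" using Arg_bounded[of "z - e"] by (simp add: norm_mult abs_le_iff)
      also have "\<dots> \<le> \<bar>ln (norm (z - e))\<bar> + pi * \<bar>ln (norm (z - e))\<bar>" using elim(1) by (intro add_left_mono mult_left_mono) auto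
      finally show ?case by (simp add: algebra_simps)
    qed
    then show ?thesis by (intro exI[of _ "1 + pi"]) auto
  next
    case False
    then have g0: "\<gamma> > 0" "e = 0" using e \<gamma> by auto
    \<comment> \<open>At \<open>e = 0\<close> with \<open>\<gamma> > 0\<close> the logarithm in the
      solution is centred elsewhere and only bounded: its real part by
      \<open>\<bar>ln \<gamma>\<bar> + 1\<close> near 0, its imaginary part by
      \<open>pi\<close>.\<close>
    define C where "C = \<bar>ln \<gamma>\<bar> + 1 + pi"
    have "((\<lambda>z. \<bar>ln (norm (z - complex_of_real \<gamma>))\<bar>) \<longlongrightarrow> \<bar>ln (norm (0 - complex_of_real \<gamma>))\<bar>) (at 0)"
      using g0(1) by (intro tendsto_intros) auto
    then have "\<forall>\<^sub>F z in at 0. \<bar>ln (norm (z - complex_of_real \<gamma>))\<bar> < \<bar>ln \<gamma>\<bar> + 1"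
      using g0(1) by (intro order_tendstoD(2)) auto
    moreover have "\<forall>\<^sub>F z in at 0. z \<noteq> complex_of_real \<gamma>"
      using g0(1) eventually_neq_at_within[of "complex_of_real \<gamma>" 0 UNIV] by simp
    ultimately have "\<forall>\<^sub>F z in at 0. l z \<le> C"
    proof eventually_elim
      case (elim z)
      have "Ln (z - of_real \<gamma>) = of_real (ln (norm (z - of_real \<gamma>))) + \<i> * of_real (Arg (z - of_real \<gamma>))"
        using elim(2) by (intro Ln_Arg) auto
      then have "l z \<le> norm (complex_of_real (ln (norm (z - of_real \<gamma>)))) + norm (\<i> * complex_of_real (Arg (z - of_real \<gamma>)))"
        unfolding l_def by (metis norm_triangle_ineq)
      then show ?case using elim(1) Arg_bounded[of "z - of_real \<gamma>"] unfolding norm_mult norm_of_real norm_ii C_def by linarith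
    qed
    with big have "\<forall>\<^sub>F z in at e. l z \<le> C * \<bar>ln (norm (z - e))\<bar>"
      unfolding g0(2)
    proof eventually_elim
      case (elim z)
      have "C * 1 \<le> C * \<bar>ln (norm (z - 0))\<bar>" using elim(1) pi_gt_zero unfolding C_def by (intro mult_left_mono) auto
      then show ?case using elim(2) by simp
    qed
    then show ?thesis using pi_gt_zero by (intro exI[of _ C]) (simp add: C_def)
  qed
  then obtain C where C: "C \<ge> 0" "\<forall>\<^sub>F z in at e. l z \<le> C * \<bar>ln (norm (z - e))\<bar>" by blast
  have ev: "\<forall>\<^sub>F z in at e. norm (sol z $ i $ j) \<le> 2 * B * H * (1 + C) * norm (complex_of_real (ln (norm (z - e))))" for i j
    using C(2) big near
  proof eventually_elim
    case (elim z)
    have "norm (sol z $ i $ j) \<le> 2 * B * H * (1 + l z)" by (rule entry[OF elim(3)])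
    also have "\<dots> \<le> 2 * B * H * (\<bar>ln (norm (z - e))\<bar> + C * \<bar>ln (norm (z - e))\<bar>)"
      using elim(1,2) B(1) H0 by (intro mult_left_mono add_mono) auto
    finally show ?case by (simp add: algebra_simps)
  qed
  show ?thesis
    unfolding log_singularity_def
  proof (intro allI)
    fix i j
    show "(\<lambda>z. sol z $ i $ j) \<in> O[at e within - rh_contour \<gamma>](\<lambda>z. of_real (ln (norm (z - e))))"
      by (rule bigoI[of _ "2 * B * H * (1 + C)"]) (use filter_leD[OF at_le[OF subset_UNIV] ev] in simp)
  qed
qed

end

lemma rh_model_exists:
  assumes "\<gamma> \<ge> 0"
  shows "\<exists>K R y g. rh_model \<beta> \<gamma> K R y g"
proof -
  obtain y1 y2 g1 g2 K R where h: "y1 holomorphic_on UNIV" "y2 holomorphic_on UNIV" "g1 holomorphic_on UNIV" "g2 holomorphic_on UNIV"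
    and a: "\<And>z. Im z \<noteq> 0 \<Longrightarrow> Arg z \<noteq> 2 / 3 * pi \<Longrightarrow> Arg z \<noteq> - (2 / 3 * pi) \<Longrightarrow> R \<le> norm z \<Longrightarrow>
      (let t = exp (rh_theta \<beta> z); q1 = rh_q \<gamma> g1 y1 z; q2 = rh_q \<gamma> g2 y2 z;
         T1 = mfrak_inv_row z ((y1 z + lens z * q1) * t) (q1 / t);
         T2 = mfrak_inv_row z ((y2 z + lens z * q2) * t) (q2 / t) in
       norm (fst T1 - 1) \<le> K / norm z \<and> norm (snd T1) \<le> K / norm z \<and>
       norm (fst T2) \<le> K / norm z \<and> norm (snd T2 - 1) \<le> K / norm z)"
    using model_solution by metis
  have "rh_model \<beta> \<gamma> K R (\<lambda>i. if i = 1 then y1 else y2) (\<lambda>i. if i = 1 then g1 else g2)"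
  proof
    fix z and i :: 2
    assume "Im z \<noteq> 0" "Arg z \<noteq> 2 / 3 * pi" "Arg z \<noteq> - (2 / 3 * pi)" "R \<le> norm z"
    from a[OF this] show "let t = exp (rh_theta \<beta> z); q = rh_q \<gamma> (if i = 1 then g1 else g2) (if i = 1 then y1 else y2) z;
        T = mfrak_inv_row z (((if i = 1 then y1 else y2) z + lens z * q) * t) (q / t) in
       norm (fst T - (mat 1 :: cmat2) $ i $ 1) \<le> K / norm z \<and> norm (snd T - (mat 1 :: cmat2) $ i $ 2) \<le> K / norm z"
      using exhaust_2[of i] by (elim disjE) (simp_all add: Let_def mat_def)
  qed (use assms h in auto)
  then show ?thesis by blast
qed

theorem RHP_left_exists: "\<exists>M. RHP_left \<alpha> M"
proof -
  obtain K R y g where "rh_model \<alpha> 0 K R y g" using rh_model_exists[of 0 \<alpha>] by auto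
  then interpret rh_model \<alpha> 0 K R y g .
  have J: "exp (4 / 3 * z powr (3 / 2) + 2 * of_real \<alpha> * z powr (1 / 2)) = exp (2 * rh_theta \<alpha> z)" for z
    by (simp add: rh_theta_def algebra_simps)
  have "rh_solution (arcs_left \<alpha>) {0} sol"
    unfolding rh_solution_def Sigma_left_def[symmetric] Sigma_left_eq
    using sol_analytic sol_log_singularity sol_normalized jump_rays jump_negative unfolding arcs_left_def J by simp
  then show ?thesis unfolding RHP_left_def by blast
qed

theorem RHP_right_exists:
  assumes "\<alpha> > 0"
  shows "\<exists>M. RHP_right \<alpha> M"
proof -
  obtain K R y g where "rh_model 0 \<alpha> K R y g" using rh_model_exists[of \<alpha> 0] assms by auto
  then interpret rh_model 0 \<alpha> K R y g .
  have J: "exp (4 / 3 * z powr (3 / 2)) = exp (2 * rh_theta 0 z)" "exp (- (4 / 3) * z powr (3 / 2)) = exp (- (2 * rh_theta 0 z))" for z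
    by (simp_all add: rh_theta_def)
  have "rh_solution (arcs_right \<alpha>) {0, of_real \<alpha>} sol"
    unfolding rh_solution_def Sigma_right_def[symmetric] Sigma_right_eq[OF assms]
    using sol_analytic sol_log_singularity sol_normalized jump_rays jump_negative jump_segment unfolding arcs_right_def J by simp
  then show ?thesis unfolding RHP_right_def by blast
qed

section \<open>Uniqueness\<close>

text \<open>On the line itself \<open>f\<close> may take arbitrary values, so they are replaced by
  the common boundary value. The result is continuous because a point of the line is approached from
  either side or along the line, and a continuous function holomorphic off a line is holomorphic
  across it.\<close>

lemma holomorphic_paste_limits:
  fixes f F :: "complex \<Rightarrow> complex" and d :: complex and k :: real
  assumes U: "open U" and d: "d \<noteq> 0"
    and hol: "f holomorphic_on (U \<inter> {z. d \<bullet> z < k})" "f holomorphic_on (U \<inter> {z. k < d \<bullet> z})"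
    and F: "continuous_on (U \<inter> {z. d \<bullet> z = k}) F"
    and lim: "\<And>z. z \<in> U \<Longrightarrow> d \<bullet> z = k \<Longrightarrow> (f \<longlongrightarrow> F z) (at z within {w. d \<bullet> w < k})"
      "\<And>z. z \<in> U \<Longrightarrow> d \<bullet> z = k \<Longrightarrow> (f \<longlongrightarrow> F z) (at z within {w. k < d \<bullet> w})"
  shows "(\<lambda>z. if d \<bullet> z = k then F z else f z) holomorphic_on U"
proof (rule holomorphic_on_paste_across_line[OF U d, where k = k])
  let ?h = "\<lambda>z. if d \<bullet> z = k then F z else f z"
  have op: "open {z. d \<bullet> z < k}" "open {z. k < d \<bullet> z}" by (simp_all add: open_halfspace_lt open_halfspace_gt)
  show h1: "?h holomorphic_on (U \<inter> {z. d \<bullet> z < k})" by (rule holomorphic_transform[OF hol(1)]) auto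
  show h2: "?h holomorphic_on (U \<inter> {z. k < d \<bullet> z})" by (rule holomorphic_transform[OF hol(2)]) auto
  show "continuous_on U ?h"
    unfolding continuous_on_eq_continuous_at[OF U]
  proof
    fix z assume z: "z \<in> U"
    show "isCont ?h z"
    proof (cases "d \<bullet> z = k")
      case False
      then consider "d \<bullet> z < k" | "k < d \<bullet> z" by linarith
      then show ?thesis
      proof cases
        case 1
        then show ?thesis using holomorphic_on_imp_continuous_on[OF h1] continuous_on_eq_continuous_at[OF open_Int[OF U op(1)]] z by auto
      next
        case 2
        then show ?thesis using holomorphic_on_imp_continuous_on[OF h2] continuous_on_eq_continuous_at[OF open_Int[OF U op(2)]] z by auto
      qed
    next
      case True
      have "(?h \<longlongrightarrow> F z) (at z within {w. d \<bullet> w < k})"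
        by (rule Lim_transform_eventually[OF lim(1)[OF z True]]) (auto simp: eventually_at_filter)
      moreover have "(?h \<longlongrightarrow> F z) (at z within {w. k < d \<bullet> w})"
        by (rule Lim_transform_eventually[OF lim(2)[OF z True]]) (auto simp: eventually_at_filter)
      moreover have "(?h \<longlongrightarrow> F z) (at z within U \<inter> {w. d \<bullet> w = k})"
      proof (rule Lim_transform_eventually)
        show "(F \<longlongrightarrow> F z) (at z within U \<inter> {w. d \<bullet> w = k})" using F z True by (auto simp: continuous_on_def)
      qed (auto simp: eventually_at_filter)
      ultimately have "(?h \<longlongrightarrow> F z) (at z within ({w. d \<bullet> w < k} \<union> {w. k < d \<bullet> w} \<union> (U \<inter> {w. d \<bullet> w = k})))"
        by (intro Lim_Un)
      then have "(?h \<longlongrightarrow> F z) (at z within U)" by (rule tendsto_within_subset) auto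
      then show ?thesis using True at_within_open[OF z U] by (simp add: isCont_def)
    qed
  qed
qed

lemma at_within_complement_nontrivial:
  fixes z :: complex
  assumes "interior \<Gamma> = {}"
  shows "at z within - \<Gamma> \<noteq> bot"
proof -
  have "z islimpt - \<Gamma>"
  proof (rule ccontr)
    assume "\<not> z islimpt - \<Gamma>"
    then obtain T where T: "open T" "z \<in> T" "\<And>w. w \<in> - \<Gamma> \<Longrightarrow> w \<in> T \<Longrightarrow> w = z" unfolding islimpt_def by blast
    have "open (T - {z})" using T(1) by (intro open_Diff) auto
    moreover have "T - {z} \<subseteq> \<Gamma>" using T(3) by auto
    ultimately have "T \<subseteq> {z}" using assms interior_maximal[of "T - {z}" \<Gamma>] by blast
    then have "T = {z}" using T(2) by auto
    then show False using T(1) not_open_singleton by metis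
  qed
  then show ?thesis by (simp add: trivial_limit_within)
qed

text \<open>A set without interior has a dense complement, so each local extension is recovered as
  the limit of \<open>f\<close> along that complement. This limit refers to no particular extension
  and defines the global function.\<close>

lemma holomorphic_glue:
  fixes f :: "complex \<Rightarrow> complex"
  assumes U: "open U" and \<Gamma>: "interior \<Gamma> = {}"
    and loc: "\<And>z. z \<in> U \<Longrightarrow> \<exists>V h. open V \<and> z \<in> V \<and> h holomorphic_on V \<and> (\<forall>w\<in>V - \<Gamma>. h w = f w)"
  shows "\<exists>g. g holomorphic_on U \<and> (\<forall>z\<in>U - \<Gamma>. g z = f z)"
proof -
  define g where "g = (\<lambda>z. Lim (at z within - \<Gamma>) f)"
  have g: "g w = h w" if "open V" "h holomorphic_on V" "\<forall>w\<in>V - \<Gamma>. h w = f w" "w \<in> V" for V h w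
  proof -
    have "isCont h w" using that holomorphic_on_imp_continuous_on continuous_on_eq_continuous_at by blast
    then have "(h \<longlongrightarrow> h w) (at w within - \<Gamma>)" unfolding isCont_def by (rule tendsto_within_subset) simp
    moreover have "\<forall>\<^sub>F x in at w within - \<Gamma>. h x = f x"
      unfolding eventually_at_filter by (rule eventually_mono[OF eventually_nhds_in_open[OF that(1,4)]]) (use that(3) in auto)
    ultimately have "(f \<longlongrightarrow> h w) (at w within - \<Gamma>)" by (rule Lim_transform_eventually)
    then show ?thesis unfolding g_def by (intro tendsto_Lim at_within_complement_nontrivial \<Gamma>)
  qed
  have "g holomorphic_on U"
    unfolding holomorphic_on_def
  proof
    fix z assume "z \<in> U"
    from loc[OF this] obtain V h where V: "open V" "z \<in> V" "h holomorphic_on V" "\<forall>w\<in>V - \<Gamma>. h w = f w" by blast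
    have "g holomorphic_on V" by (rule holomorphic_transform[OF V(3)]) (use g[OF V(1,3,4)] in simp)
    then show "g field_differentiable at z within U"
      using V(1,2) by (meson field_differentiable_at_within holomorphic_on_imp_differentiable_at)
  qed
  moreover have "g z = f z" if "z \<in> U - \<Gamma>" for z
  proof -
    from loc[of z] that obtain V h where V: "open V" "z \<in> V" "h holomorphic_on V" "\<forall>w\<in>V - \<Gamma>. h w = f w" by blast
    then show ?thesis using g[OF V(1,3,4,2)] that by auto
  qed
  ultimately show ?thesis by blast
qed

text \<open>The points violating the condition form an open set contained in
  \<open>\<Gamma>\<close>, which is therefore empty.\<close>

lemma closed_condition_extends:
  fixes h :: "complex \<Rightarrow> 'a::topological_space"
  assumes U: "open U" and h: "continuous_on U h" and \<Gamma>: "interior \<Gamma> = {}" and T: "closed T"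
    and m: "\<And>z. z \<in> U - \<Gamma> \<Longrightarrow> h z \<in> T" and z: "z \<in> U"
  shows "h z \<in> T"
proof (rule ccontr)
  assume "h z \<notin> T"
  have "open (U \<inter> h -` (- T))" using T by (intro continuous_open_preimage h U) auto
  moreover have "U \<inter> h -` (- T) \<subseteq> \<Gamma>" using m by auto
  ultimately have "U \<inter> h -` (- T) = {}" using \<Gamma> interior_maximal by blast
  then show False using z \<open>h z \<notin> T\<close> by auto
qed

lemma remove_singularities:
  fixes f :: "complex \<Rightarrow> complex"
  assumes "finite E" "f holomorphic_on - E" "\<And>e. e \<in> E \<Longrightarrow> ((\<lambda>z. (z - e) * f z) \<longlongrightarrow> 0) (at e)"
  shows "\<exists>g. g holomorphic_on UNIV \<and> (\<forall>z\<in>- E. g z = f z)"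
  using assms
proof (induction E arbitrary: f rule: finite_induct)
  case empty
  then show ?case by auto
next
  case (insert e E)
  have o: "open (- E)" using insert.hyps(1) by (simp add: finite_imp_closed open_Compl)
  have e: "e \<in> interior (- E)" using insert.hyps(2) o by (simp add: interior_open)
  have "- E - {e} = - insert e E" by auto
  then have "f holomorphic_on (- E - {e})" using insert.prems(1) by simp
  from holomorphic_on_extend_lim[OF this e] insert.prems(2)[of e]
  obtain g where g: "g holomorphic_on - E" "\<forall>z\<in>- E - {e}. g z = f z" by auto
  have "((\<lambda>z. (z - x) * g z) \<longlongrightarrow> 0) (at x)" if "x \<in> E" for x
  proof (rule Lim_transform_eventually[OF insert.prems(2)])
    have "open (- (E - {x}) - {e})" using insert.hyps(1) by (intro open_Diff open_Compl finite_imp_closed) auto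
    moreover have "x \<in> - (E - {x}) - {e}" using that insert.hyps(2) by auto
    ultimately have "\<forall>\<^sub>F z in nhds x. z \<in> - (E - {x}) - {e}" by (rule eventually_nhds_in_open)
    then show "\<forall>\<^sub>F z in at x. (z - x) * f z = (z - x) * g z"
      unfolding eventually_at_filter by eventually_elim (use g(2) in auto)
  qed (use that in simp)
  from insert.IH[OF g(1) this] obtain k where k: "k holomorphic_on UNIV" "\<forall>z\<in>- E. k z = g z" by blast
  then show ?case using g(2) by (intro exI[of _ k]) auto
qed

text \<open>The local extensions glue to a function on the complement of \<open>E\<close>, the
  points of \<open>E\<close> are removable, and Liouville's theorem concludes. The limits are given
  only off \<open>\<Gamma>\<close>; the glued function has them without this restriction, since
  closed inequalities extend to \<open>\<Gamma>\<close> by density.\<close>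

lemma no_jump_constant:
  fixes f :: "complex \<Rightarrow> complex"
  assumes E: "finite E" and \<Gamma>: "interior \<Gamma> = {}"
    and loc: "\<And>z. z \<notin> E \<Longrightarrow> \<exists>V h. open V \<and> z \<in> V \<and> h holomorphic_on V \<and> (\<forall>w\<in>V - \<Gamma>. h w = f w)"
    and sing: "\<And>e. e \<in> E \<Longrightarrow> ((\<lambda>z. (z - e) * f z) \<longlongrightarrow> 0) (at e within - \<Gamma>)"
    and inf: "(f \<longlongrightarrow> c) (inf at_infinity (principal (- \<Gamma>)))"
    and z: "z \<notin> \<Gamma>" and EG: "E \<subseteq> \<Gamma>"
  shows "f z = c"
proof -
  have oE: "open (- E)" using E by (simp add: finite_imp_closed open_Compl)
  obtain g where g: "g holomorphic_on - E" "\<forall>z\<in>- E - \<Gamma>. g z = f z"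
    using holomorphic_glue[OF oE \<Gamma>, of f] loc by blast
  have "((\<lambda>z. (z - e) * g z) \<longlongrightarrow> 0) (at e)" if e: "e \<in> E" for e
  proof (rule tendstoI)
    fix \<epsilon> :: real assume "\<epsilon> > 0"
    then have "\<forall>\<^sub>F z in at e within - \<Gamma>. dist ((z - e) * f z) 0 < \<epsilon> / 2" using sing[OF e] by (intro tendstoD) auto
    then obtain d where d: "d > 0" "\<And>z. z \<in> - \<Gamma> \<Longrightarrow> z \<noteq> e \<Longrightarrow> dist z e < d \<Longrightarrow> dist ((z - e) * f z) 0 < \<epsilon> / 2"
      unfolding eventually_at by blast
    \<comment> \<open>Half of \<open>\<epsilon>\<close>, because only a non-strict inequality
      carries over to points of the contour.\<close>
    have bd: "norm ((z - e) * g z) \<in> {..\<epsilon> / 2}" if "z \<in> ball e d - E" for z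
    proof (rule closed_condition_extends[OF _ _ \<Gamma> closed_atMost _ that, where h = "\<lambda>z. norm ((z - e) * g z)"])
      show "open (ball e d - E)" using E by (intro open_Diff finite_imp_closed) auto
      have "continuous_on (ball e d - E) g"
        by (rule holomorphic_on_imp_continuous_on[OF holomorphic_on_subset[OF g(1)]]) auto
      then show "continuous_on (ball e d - E) (\<lambda>z. norm ((z - e) * g z))" by (intro continuous_intros)
      fix z assume z: "z \<in> ball e d - E - \<Gamma>"
      then show "norm ((z - e) * g z) \<in> {..\<epsilon> / 2}"
        using d(2)[of z] g(2) e by (cases "z = e") (auto simp: dist_commute less_imp_le)
    qed
    have "open (- (E - {e}))" using E by (intro open_Compl finite_imp_closed) auto
    then have "\<forall>\<^sub>F z in nhds e. z \<in> - (E - {e})" by (rule eventually_nhds_in_open) auto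
    moreover have "\<forall>\<^sub>F z in nhds e. z \<in> ball e d" using d(1) by (intro eventually_nhds_in_open) auto
    ultimately show "\<forall>\<^sub>F z in at e. dist ((z - e) * g z) 0 < \<epsilon>"
      unfolding eventually_at_filter
    proof eventually_elim
      case (elim z)
      show ?case
      proof (intro impI)
        assume "z \<noteq> e"
        with elim have "z \<in> ball e d - E" by auto
        from bd[OF this] show "dist ((z - e) * g z) 0 < \<epsilon>" using \<open>\<epsilon> > 0\<close> by simp
      qed
    qed
  qed
  from remove_singularities[OF E g(1) this] obtain k where k: "k holomorphic_on UNIV" "\<forall>z\<in>- E. k z = g z" by blast
  have kf: "k z = f z" if "z \<notin> \<Gamma>" for z using k(2) g(2) that EG by (metis ComplI DiffI subsetD)
  have "(k \<longlongrightarrow> c) at_infinity"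
  proof (rule tendstoI)
    fix \<epsilon> :: real assume "\<epsilon> > 0"
    then have "\<forall>\<^sub>F z in inf at_infinity (principal (- \<Gamma>)). dist (f z) c < \<epsilon> / 2" using inf by (intro tendstoD) auto
    then obtain B where B: "\<And>z. B \<le> norm z \<Longrightarrow> z \<notin> \<Gamma> \<Longrightarrow> dist (f z) c < \<epsilon> / 2"
      unfolding eventually_inf_principal eventually_at_infinity by auto
    have "dist (k z) c \<in> {..\<epsilon> / 2}" if "z \<in> - cball 0 B" for z
    proof (rule closed_condition_extends[OF _ _ \<Gamma> closed_atMost _ that, where h = "\<lambda>z. dist (k z) c"])
      have "continuous_on (- cball 0 B) k" using k(1) holomorphic_on_imp_continuous_on holomorphic_on_subset by blast
      then show "continuous_on (- cball 0 B) (\<lambda>z. dist (k z) c)" by (intro continuous_intros)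
    qed (use B kf in \<open>auto simp: less_imp_le\<close>)
    then have "dist (k z) c < \<epsilon>" if "B + 1 \<le> norm z" for z
      using that \<open>\<epsilon> > 0\<close> by (smt (verit) ComplI atMost_iff field_sum_of_halves mem_cball_0)
    then show "\<forall>\<^sub>F z in at_infinity. dist (k z) c < \<epsilon>" unfolding eventually_at_infinity by blast
  qed
  from Liouville_weak[OF k(1) this, of z] kf[OF z] show ?thesis by simp
qed

text \<open>Near each of its points the contour is required to be a full straight segment belonging
  to this one arc. This excludes endpoints and crossings and gives the local half-plane picture in
  which sides are defined.\<close>

definition straight_arc :: "complex set \<Rightarrow> complex set \<Rightarrow> complex \<Rightarrow> bool" where
  "straight_arc \<Gamma> S t \<longleftrightarrow> t \<noteq> 0 \<and>
     (\<forall>z\<in>S. \<forall>\<^sub>F w in nhds z. (w \<in> \<Gamma> \<longleftrightarrow> Im ((w - z) / t) = 0) \<and> (w \<in> S \<longleftrightarrow> Im ((w - z) / t) = 0))"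

lemma straight_arc_extension:
  fixes f F :: "complex \<Rightarrow> complex"
  assumes arc: "straight_arc \<Gamma> S t" and f: "f analytic_on - \<Gamma>" and F: "continuous_on S F"
    and lim: "\<And>z. z \<in> S \<Longrightarrow> (f \<longlongrightarrow> F z) (at z within left_side t z)" "\<And>z. z \<in> S \<Longrightarrow> (f \<longlongrightarrow> F z) (at z within right_side t z)"
    and z: "z \<in> S"
  shows "\<exists>V h. open V \<and> z \<in> V \<and> h holomorphic_on V \<and> (\<forall>w\<in>V - \<Gamma>. h w = f w)"
proof -
  obtain V where V: "open V" "z \<in> V" "\<And>w. w \<in> V \<Longrightarrow> (w \<in> \<Gamma> \<longleftrightarrow> Im ((w - z) / t) = 0) \<and> (w \<in> S \<longleftrightarrow> Im ((w - z) / t) = 0)"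
    using arc z unfolding straight_arc_def eventually_nhds by meson
  \<comment> \<open>The normal vector for which the inner product with \<open>w\<close> is
    \<open>Im (w / t)\<close>, translating the sides of the arc into half-planes.\<close>
  define d where "d = Complex (Im (inverse t)) (Re (inverse t))"
  define k where "k = d \<bullet> z"
  have im: "Im ((w - x) / t) = d \<bullet> w - d \<bullet> x" for w x
    by (simp only: divide_inverse d_def inner_complex_def complex.sel times_complex.sel minus_complex.sel) algebra
  have "inverse t \<noteq> 0" using arc by (simp add: straight_arc_def)
  then have d: "d \<noteq> 0" unfolding d_def complex_eq_iff by auto
  have on: "w \<in> \<Gamma> \<longleftrightarrow> d \<bullet> w = k" "w \<in> S \<longleftrightarrow> d \<bullet> w = k" if "w \<in> V" for w using V(3)[OF that] by (simp_all add: im k_def)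
  have side: "left_side t x = {w. k < d \<bullet> w}" "right_side t x = {w. d \<bullet> w < k}" if "d \<bullet> x = k" for x
    using that by (simp_all add: left_side_def right_side_def im)
  have "(\<lambda>w. if d \<bullet> w = k then F w else f w) holomorphic_on V"
  proof (rule holomorphic_paste_limits[OF V(1) d])
    show "f holomorphic_on V \<inter> {w. d \<bullet> w < k}" "f holomorphic_on V \<inter> {w. k < d \<bullet> w}"
      by (rule holomorphic_on_subset[OF analytic_imp_holomorphic[OF f]], use on in auto)+
    show "continuous_on (V \<inter> {w. d \<bullet> w = k}) F" by (rule continuous_on_subset[OF F]) (use on in auto)
    fix x assume x: "x \<in> V" "d \<bullet> x = k"
    then have "x \<in> S" using on by simp
    from lim[OF this] show "(f \<longlongrightarrow> F x) (at x within {w. d \<bullet> w < k})" "(f \<longlongrightarrow> F x) (at x within {w. k < d \<bullet> w})"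
      unfolding side[OF x(2)] by auto
  qed
  then show ?thesis using V(1,2) on by (intro exI[of _ V] exI[of _ "\<lambda>w. if d \<bullet> w = k then F w else f w"]) auto
qed

text \<open>The determinant of row \<open>i\<close> of \<open>A\<close> above row \<open>k\<close>
  of \<open>B\<close>. Up to sign and order these are the entries of \<open>A\<close> times the
  adjugate of \<open>B\<close>, so solutions can be compared without inverting either.\<close>

definition row_wedge :: "cmat2 \<Rightarrow> cmat2 \<Rightarrow> 2 \<Rightarrow> 2 \<Rightarrow> complex" where
  "row_wedge A B i k = A $ i $ 1 * B $ k $ 2 - A $ i $ 2 * B $ k $ 1"

lemma row_wedge_mult:
  "row_wedge (A ** J) (B ** J) i k = row_wedge A B i k * det J"
  unfolding row_wedge_def matrix_matrix_mult_def det_2 by (simp add: sum_2) algebra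

lemma tendsto_row_wedge:
  assumes "(F \<longlongrightarrow> A) net" "(G \<longlongrightarrow> B) net"
  shows "((\<lambda>x. row_wedge (F x) (G x) i k) \<longlongrightarrow> row_wedge A B i k) net"
  unfolding row_wedge_def by (intro tendsto_intros tendsto_vec_nth assms)

lemma row_wedge_jump:
  fixes M N J :: "complex \<Rightarrow> cmat2"
  assumes arc: "straight_arc \<Gamma> S t" and M: "\<And>i j. (\<lambda>z. M z $ i $ j) analytic_on - \<Gamma>" "satisfies_jump M (S, t, J)"
    and N: "\<And>i j. (\<lambda>z. N z $ i $ j) analytic_on - \<Gamma>" "satisfies_jump N (S, t, J)"
    and J: "\<And>z. det (J z) = 1" and z: "z \<in> S"
  shows "\<exists>V h. open V \<and> z \<in> V \<and> h holomorphic_on V \<and> (\<forall>w\<in>V - \<Gamma>. h w = row_wedge (M w) (N w) i k)"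
proof -
  obtain Mp Mm where M': "continuous_on S Mp" "\<And>z. z \<in> S \<Longrightarrow> (M \<longlongrightarrow> Mp z) (at z within left_side t z)"
    "\<And>z. z \<in> S \<Longrightarrow> (M \<longlongrightarrow> Mm z) (at z within right_side t z)" "\<And>z. z \<in> S \<Longrightarrow> Mp z = Mm z ** J z"
    using M(2) unfolding satisfies_jump_def prod.case by blast
  obtain Np Nm where N': "continuous_on S Np" "\<And>z. z \<in> S \<Longrightarrow> (N \<longlongrightarrow> Np z) (at z within left_side t z)"
    "\<And>z. z \<in> S \<Longrightarrow> (N \<longlongrightarrow> Nm z) (at z within right_side t z)" "\<And>z. z \<in> S \<Longrightarrow> Np z = Nm z ** J z"
    using N(2) unfolding satisfies_jump_def prod.case by blast
  have eq: "row_wedge (Mm z) (Nm z) i k = row_wedge (Mp z) (Np z) i k" if "z \<in> S" for z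
    unfolding M'(4)[OF that] N'(4)[OF that] row_wedge_mult J by simp
  show ?thesis
  proof (rule straight_arc_extension[OF arc _ _ _ _ z, where F = "\<lambda>z. row_wedge (Mp z) (Np z) i k"])
    show "(\<lambda>w. row_wedge (M w) (N w) i k) analytic_on - \<Gamma>"
      unfolding row_wedge_def by (intro analytic_intros M N)
    show "continuous_on S (\<lambda>z. row_wedge (Mp z) (Np z) i k)"
      using M'(1) N'(1) unfolding continuous_on_def by (blast intro: tendsto_row_wedge)
    fix x assume "x \<in> S"
    then show "((\<lambda>w. row_wedge (M w) (N w) i k) \<longlongrightarrow> row_wedge (Mp x) (Np x) i k) (at x within left_side t x)"
      by (intro tendsto_row_wedge M' N')
    show "((\<lambda>w. row_wedge (M w) (N w) i k) \<longlongrightarrow> row_wedge (Mp x) (Np x) i k) (at x within right_side t x)"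
      unfolding eq[OF \<open>x \<in> S\<close>, symmetric] by (intro tendsto_row_wedge M' N' \<open>x \<in> S\<close>)
  qed
qed

lemma tendsto_id_ln_square: "((\<lambda>z::complex. (z - e) * of_real ((ln (norm (z - e)))\<^sup>2)) \<longlongrightarrow> 0) (at e)"
proof -
  have "((\<lambda>z. norm (z - e)) \<longlongrightarrow> norm (e - e)) (at e)" by (intro tendsto_intros)
  then have "filterlim (\<lambda>z. norm (z - e)) (at_right 0) (at e)"
    unfolding filterlim_at by (auto simp: eventually_at_filter)
  moreover have "((\<lambda>x::real. x * (ln x)\<^sup>2) \<longlongrightarrow> 0) (at_right 0)" by real_asymp
  ultimately have "((\<lambda>z. norm (z - e) * (ln (norm (z - e)))\<^sup>2) \<longlongrightarrow> 0) (at e)" by (rule filterlim_compose[rotated])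
  then show ?thesis by (subst tendsto_norm_zero_iff[symmetric]) (simp add: norm_mult norm_power)
qed

text \<open>Each solution contributes one logarithm, and the factor \<open>z - e\<close> still beats
  the square of a logarithm, which makes the point removable.\<close>

lemma row_wedge_log_singularity:
  assumes "log_singularity \<Gamma> M e" "log_singularity \<Gamma> N e"
  shows "((\<lambda>z. (z - e) * row_wedge (M z) (N z) i k) \<longlongrightarrow> 0) (at e within - \<Gamma>)"
proof -
  let ?F = "at e within - \<Gamma>" and ?L = "\<lambda>z. complex_of_real (ln (norm (z - e)))"
  have "(\<lambda>z. row_wedge (M z) (N z) i k) \<in> O[?F](\<lambda>z. ?L z * ?L z)"
    unfolding row_wedge_def using assms by (intro sum_in_bigo landau_o.big.mult) (auto simp: log_singularity_def)
  then have "(\<lambda>z. (z - e) * row_wedge (M z) (N z) i k) \<in> O[?F](\<lambda>z. (z - e) * (?L z * ?L z))"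
    by (rule landau_o.big.mult_left)
  then obtain C where "C > 0" "\<forall>\<^sub>F z in ?F. norm ((z - e) * row_wedge (M z) (N z) i k) \<le> C * norm ((z - e) * (?L z * ?L z))"
    by (elim landau_o.bigE)
  then have C: "\<forall>\<^sub>F z in ?F. norm ((z - e) * row_wedge (M z) (N z) i k) \<le> norm ((z - e) * of_real ((ln (norm (z - e)))\<^sup>2)) * C"
    by (elim eventually_mono) (simp add: power2_eq_square mult.commute)
  have "((\<lambda>z. (z - e) * of_real ((ln (norm (z - e)))\<^sup>2)) \<longlongrightarrow> 0) ?F"
    by (rule tendsto_within_subset[OF tendsto_id_ln_square]) simp
  then show ?thesis by (rule tendsto_0_le) (rule C)
qed

text \<open>The factor \<open>mfrak\<close> has no limit at infinity, but a common right factor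
  enters the wedge only through its determinant, and that is 1.\<close>

lemma row_wedge_at_infinity:
  assumes "normalized_at_infinity \<Gamma> M" "normalized_at_infinity \<Gamma> N"
  shows "((\<lambda>z. row_wedge (M z) (N z) i k) \<longlongrightarrow> row_wedge (mat 1) (mat 1) i k) (inf at_infinity (principal (- \<Gamma>)))"
proof -
  let ?F = "inf at_infinity (principal (- \<Gamma>))"
  have lim: "((\<lambda>z. mat 1 + R z) \<longlongrightarrow> mat 1) ?F" if R: "\<And>i j. (\<lambda>z. R z $ i $ j) \<in> O[?F](\<lambda>z. 1 / z)" for R :: "complex \<Rightarrow> cmat2"
  proof -
    have "((\<lambda>z. R z $ i $ j) \<longlongrightarrow> 0) ?F" for i j
    proof -
      have "((\<lambda>z::complex. 1 / z) \<longlongrightarrow> 0) ?F"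
        by (rule Lim_transform_eventually[OF tendsto_mono[OF inf_le1 tendsto_inverse_0]]) (simp add: inverse_eq_divide)
      moreover obtain C where "\<forall>\<^sub>F z in ?F. norm (R z $ i $ j) \<le> C * norm (1 / z)" using R[of i j] by (elim landau_o.bigE)
      ultimately show ?thesis by (elim tendsto_0_le) (simp add: mult.commute)
    qed
    then have "(R \<longlongrightarrow> 0) ?F" by (intro cmat2_tendstoI) simp
    then show ?thesis using tendsto_add[OF tendsto_const] by fastforce
  qed
  obtain R :: "complex \<Rightarrow> cmat2" where R: "\<And>i j. (\<lambda>z. R z $ i $ j) \<in> O[?F](\<lambda>z. 1 / z)" "\<forall>\<^sub>F z in ?F. M z = (mat 1 + R z) ** mfrak z"
    using assms(1) unfolding normalized_at_infinity_def by blast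
  obtain R' :: "complex \<Rightarrow> cmat2" where R': "\<And>i j. (\<lambda>z. R' z $ i $ j) \<in> O[?F](\<lambda>z. 1 / z)" "\<forall>\<^sub>F z in ?F. N z = (mat 1 + R' z) ** mfrak z"
    using assms(2) unfolding normalized_at_infinity_def by blast
  have det: "det (mfrak z) = 1" if "z \<noteq> 0" for z
  proof -
    define s where "s = complex_of_real (sqrt 2)"
    define m where "m = csqrt (csqrt z)"
    have s: "s * s = 2" "s \<noteq> 0" and m: "m \<noteq> 0" using that by (simp_all add: s_def m_def flip: of_real_mult)
    have c: "cis (- pi / 4) * cis (pi / 4) = 1" by (simp add: cis_mult)
    have "det (mfrak z) = 2 * (cis (- pi / 4) * cis (pi / 4)) / (s * s)"
      unfolding det_2 mfrak_eq[OF that] mat2_nth s_def[symmetric] m_def[symmetric] using s(2) m by (simp add: field_simps del: cis_mult)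
    then show ?thesis by (simp only: c s) simp
  qed
  have "\<forall>\<^sub>F z::complex in ?F. z \<noteq> 0"
    unfolding eventually_inf_principal by (rule eventually_mono[OF eventually_at_infinityI[of 1]]) auto
  with R(2) R'(2) have "\<forall>\<^sub>F z in ?F. row_wedge (mat 1 + R z) (mat 1 + R' z) i k = row_wedge (M z) (N z) i k"
    by eventually_elim (simp add: row_wedge_mult det)
  then show ?thesis
    by (rule Lim_transform_eventually[OF tendsto_row_wedge[OF lim[OF R(1)] lim[OF R'(1)]]])
qed

text \<open>The wedges of rows are constants fixed by the normalization, the same for the pair
  \<open>M\<close>, \<open>N\<close> as for \<open>N\<close>, \<open>N\<close>. A row of
  \<open>M z - N z\<close> thus has wedge 0 with both rows of \<open>N z\<close>; these are
  independent since the determinant of \<open>N z\<close> is 1, so the difference is 0.\<close>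

theorem rh_solution_unique:
  fixes M N :: "complex \<Rightarrow> cmat2"
  assumes E: "finite E" and \<Gamma>: "interior (contour arcs E) = {}"
    and arcs: "\<And>S t J. (S, t, J) \<in> arcs \<Longrightarrow> straight_arc (contour arcs E) S t"
      "\<And>S t J z. (S, t, J) \<in> arcs \<Longrightarrow> det (J z) = 1"
    and M: "rh_solution arcs E M" and N: "rh_solution arcs E N" and z: "z \<notin> contour arcs E"
  shows "M z = N z"
proof -
  have wedge: "row_wedge (A z) (B z) i k = row_wedge (mat 1) (mat 1) i k"
    if A: "rh_solution arcs E A" and B: "rh_solution arcs E B" for A B i k
  proof (rule no_jump_constant[OF E \<Gamma> _ _ _ z])
    show "E \<subseteq> contour arcs E" by (auto simp: contour_def)
    show "((\<lambda>z. (z - e) * row_wedge (A z) (B z) i k) \<longlongrightarrow> 0) (at e within - contour arcs E)" if "e \<in> E" for e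
      using A B that by (intro row_wedge_log_singularity) (auto simp: rh_solution_def)
    show "((\<lambda>z. row_wedge (A z) (B z) i k) \<longlongrightarrow> row_wedge (mat 1) (mat 1) i k) (inf at_infinity (principal (- contour arcs E)))"
      using A B by (intro row_wedge_at_infinity) (auto simp: rh_solution_def)
    fix x assume x: "x \<notin> E"
    have an: "(\<lambda>z. A z $ i $ j) analytic_on - contour arcs E" "(\<lambda>z. B z $ i $ j) analytic_on - contour arcs E" for i j
      using A B by (auto simp: rh_solution_def)
    show "\<exists>V h. open V \<and> x \<in> V \<and> h holomorphic_on V \<and> (\<forall>w\<in>V - contour arcs E. h w = row_wedge (A w) (B w) i k)"
    proof (cases "x \<in> contour arcs E")
      case False
      have "(\<lambda>w. row_wedge (A w) (B w) i k) analytic_on - contour arcs E"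
        unfolding row_wedge_def by (intro analytic_intros an)
      then have "(\<lambda>w. row_wedge (A w) (B w) i k) analytic_on {x}" using False by (meson ComplI analytic_on_analytic_at)
      then show ?thesis unfolding analytic_at by blast
    next
      case True
      then obtain S t J where S: "(S, t, J) \<in> arcs" "x \<in> S" using x by (auto simp: contour_def)
      show ?thesis
        by (rule row_wedge_jump[OF arcs(1)[OF S(1)] an(1) _ an(2) _ arcs(2)[OF S(1)] S(2)])
          (use A B S(1) in \<open>auto simp: rh_solution_def\<close>)
    qed
  qed
  have d: "row_wedge (N z) (N z) 1 2 = 1" using wedge[OF N N, of 1 2] by (simp add: row_wedge_def mat_def)
  show ?thesis
  proof (rule cmat2_eqI)
    fix i :: 2
    have e: "row_wedge (M z) (N z) i k = row_wedge (N z) (N z) i k" for k using wedge[OF M N] wedge[OF N N] by simp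
    have "(M z $ i $ 1 - N z $ i $ 1) * row_wedge (N z) (N z) 1 2 = 0" "(M z $ i $ 2 - N z $ i $ 2) * row_wedge (N z) (N z) 1 2 = 0"
      using e[of 1] e[of 2] unfolding row_wedge_def by algebra+
    then show "M z $ i $ 1 = N z $ i $ 1" "M z $ i $ 2 = N z $ i $ 2" unfolding d by simp_all
  qed
qed

section \<open>Local geometry of the two contours\<close>

lemma ray_line: "z \<in> ray \<phi> \<Longrightarrow> Im (z * cis (- \<phi>)) = 0"
  unfolding Im_mult_cis_uminus by (simp add: ray_def)

lemma sin_120: "sin (2 / 3 * pi) \<noteq> 0"
  using sin_gt_zero[of "2 / 3 * pi"] pi_gt_zero by fastforce

lemma eventually_Im_mult_neq: "Im (z * c) \<noteq> 0 \<Longrightarrow> \<forall>\<^sub>F w in nhds z. Im (w * c) \<noteq> 0"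
proof -
  assume "Im (z * c) \<noteq> 0"
  moreover have "((\<lambda>w. Im (w * c)) \<longlongrightarrow> Im (z * c)) (nhds z)" by (intro tendsto_intros filterlim_ident)
  ultimately show ?thesis by (simp add: tendsto_imp_eventually_ne)
qed

lemma interior_rh_contour: "interior (rh_contour \<gamma>) = {}"
proof -
  define H where "H = (\<lambda>\<phi>. {w. Im (w * cis (- \<phi>)) = 0})"
  have eq: "H \<phi> = {w. Complex (- sin \<phi>) (cos \<phi>) \<bullet> w = 0}" for \<phi>
    by (auto simp: H_def inner_complex_def algebra_simps)
  have ne: "Complex (- sin \<phi>) (cos \<phi>) \<noteq> 0" for \<phi>
    using sin_zero_abs_cos_one[of \<phi>] by (auto simp: complex_eq_iff)
  have H: "closed (H \<phi>)" "interior (H \<phi>) = {}" for \<phi>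
    unfolding eq using ne by (auto simp: closed_hyperplane)
  have "rh_contour \<gamma> \<subseteq> H 0 \<union> H (2 / 3 * pi) \<union> H (- (2 / 3 * pi))"
  proof -
    have "{z. Im z = 0 \<and> Re z \<le> \<gamma>} \<subseteq> H 0" by (auto simp: H_def)
    moreover have "ray \<phi> \<subseteq> H \<phi>" for \<phi> using ray_line unfolding H_def by blast
    ultimately show ?thesis unfolding rh_contour_def by blast
  qed
  moreover have "interior (H 0 \<union> H (2 / 3 * pi) \<union> H (- (2 / 3 * pi))) = {}"
    using H by (subst interior_closed_Un_empty_interior; simp add: closed_Un interior_closed_Un_empty_interior)
  ultimately show ?thesis using interior_mono by blast
qed

lemma eventually_not_ray:
  assumes "Im z = 0" "Re z \<noteq> 0"
  shows "\<forall>\<^sub>F w in nhds z. w \<notin> ray (2 / 3 * pi) \<and> w \<notin> ray (- (2 / 3 * pi))"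
proof -
  have "Im (z * cis (- (2 / 3 * pi))) \<noteq> 0" "Im (z * cis (- (- (2 / 3 * pi)))) \<noteq> 0" using assms sin_120 by simp_all
  from this[THEN eventually_Im_mult_neq] show ?thesis by eventually_elim (use ray_line in blast)
qed

lemma straight_arc_real:
  assumes S: "S = {z. Im z = 0 \<and> Re z \<in> I}" and I: "open I" "0 \<notin> I" "I \<subseteq> {..\<gamma>}"
  shows "straight_arc (rh_contour \<gamma>) S 1"
  unfolding straight_arc_def
proof (intro conjI ballI)
  fix z assume z: "z \<in> S"
  have "Re z \<noteq> 0" using z I(2) by (auto simp: S)
  then have 1: "\<forall>\<^sub>F w in nhds z. w \<notin> ray (2 / 3 * pi) \<and> w \<notin> ray (- (2 / 3 * pi))"
    using z by (intro eventually_not_ray) (auto simp: S)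
  have "(Re \<longlongrightarrow> Re z) (nhds z)" by (intro tendsto_intros filterlim_ident)
  then have "\<forall>\<^sub>F w in nhds z. Re w \<in> I" using z by (intro topological_tendstoD I(1)) (auto simp: S)
  with 1 show "\<forall>\<^sub>F w in nhds z. (w \<in> rh_contour \<gamma> \<longleftrightarrow> Im ((w - z) / 1) = 0) \<and> (w \<in> S \<longleftrightarrow> Im ((w - z) / 1) = 0)"
    by eventually_elim (use z I(3) in \<open>auto simp: S rh_contour_def\<close>)
qed simp

lemma straight_arc_ray:
  assumes \<phi>: "\<phi> = 2 / 3 * pi \<or> \<phi> = - (2 / 3 * pi)"
  shows "straight_arc (rh_contour \<gamma>) (ray \<phi>) (- cis \<phi>)"
  unfolding straight_arc_def
proof (intro conjI ballI)
  fix z assume z: "z \<in> ray \<phi>"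
  have im: "Im z \<noteq> 0" using z \<phi> Im_ray less_irrefl by metis
  have lim: "(Im \<longlongrightarrow> Im z) (nhds z)" by (intro tendsto_intros filterlim_ident)
  \<comment> \<open>A fixed sign of the imaginary part keeps the real axis and the opposite ray out
    of the neighbourhood, so that only the ray itself remains of the contour.\<close>
  have sgn: "\<forall>\<^sub>F w in nhds z. Im w * Im z > 0"
  proof -
    have "((\<lambda>w. Im w * Im z) \<longlongrightarrow> Im z * Im z) (nhds z)" by (intro tendsto_intros lim)
    moreover have "Im z * Im z > 0" using im by (simp add: zero_less_mult_iff) linarith
    ultimately show ?thesis by (rule order_tendstoD)
  qed
  have nn: "z \<notin> \<real>\<^sub>\<le>\<^sub>0" using im by (auto simp: complex_nonpos_Reals_iff)
  have A: "Arg z = \<phi>" using z by (simp add: ray_def)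
  have "\<forall>\<^sub>F w in nhds z. Arg w < \<phi> + pi \<and> \<phi> - pi < Arg w"
    using nn A by (intro eventually_conj eventually_Arg_less eventually_Arg_greater) auto
  with sgn show "\<forall>\<^sub>F w in nhds z. (w \<in> rh_contour \<gamma> \<longleftrightarrow> Im ((w - z) / (- cis \<phi>)) = 0) \<and> (w \<in> ray \<phi> \<longleftrightarrow> Im ((w - z) / (- cis \<phi>)) = 0)"
  proof eventually_elim
    case (elim w)
    have w0: "w \<noteq> 0" "Im w \<noteq> 0" using elim by auto
    have "\<bar>Arg w - \<phi>\<bar> < pi" using elim by auto
    note side = ray_sides_iff[OF z this w0(1)]
    have "Im ((w - z) / (- cis \<phi>)) = 0 \<longleftrightarrow> w \<notin> left_side (- cis \<phi>) z \<and> w \<notin> right_side (- cis \<phi>) z"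
      unfolding left_side_def right_side_def mem_Collect_eq by linarith
    also have "\<dots> \<longleftrightarrow> Arg w = \<phi>" unfolding side by linarith
    also have "\<dots> \<longleftrightarrow> w \<in> ray \<phi>" using w0 by (simp add: ray_def)
    finally have 1: "Im ((w - z) / (- cis \<phi>)) = 0 \<longleftrightarrow> w \<in> ray \<phi>" .
    have "w \<in> rh_contour \<gamma> \<longleftrightarrow> w \<in> ray \<phi>"
      using \<phi>
    proof
      assume p: "\<phi> = 2 / 3 * pi"
      have "Im z > 0" using Im_ray(1) z unfolding p by blast
      then have "Im w > 0" using elim(1) by (simp add: zero_less_mult_iff)
      then show ?thesis using Im_ray(2)[of w] unfolding p rh_contour_def by auto
    next
      assume p: "\<phi> = - (2 / 3 * pi)"
      have "Im z < 0" using Im_ray(2) z unfolding p by blast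
      then have "Im w < 0" using elim(1) by (simp add: zero_less_mult_iff)
      then show ?thesis using Im_ray(1)[of w] unfolding p rh_contour_def by auto
    qed
    with 1 show ?case by simp
  qed
qed simp

lemma det_mat2: "det (mat2 a b c d) = a * d - b * c"
  by (simp add: det_2)

theorem RHP_left_unique:
  assumes "RHP_left \<alpha> M" "RHP_left \<alpha> N" "z \<notin> Sigma_left \<alpha>"
  shows "M z = N z"
proof (rule rh_solution_unique[where arcs = "arcs_left \<alpha>" and E = "{0}"])
  note eq = Sigma_left_eq[of \<alpha>, unfolded Sigma_left_def]
  show "interior (contour (arcs_left \<alpha>) {0}) = {}" unfolding eq by (rule interior_rh_contour)
  have neg: "straight_arc (rh_contour 0) (of_real ` {..<0::real}) 1"
    by (rule straight_arc_real[where I = "{..<0}"]) (auto simp: image_iff complex_eq_iff)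
  show "straight_arc (contour (arcs_left \<alpha>) {0}) S t" if "(S, t, J) \<in> arcs_left \<alpha>" for S t J
    using that[unfolded arcs_left_def] neg straight_arc_ray[OF disjI1[OF refl]] straight_arc_ray[OF disjI2[OF refl]] unfolding eq by auto
qed (use assms in \<open>auto simp: RHP_left_def Sigma_left_def arcs_left_def det_mat2\<close>)

theorem RHP_right_unique:
  assumes "\<alpha> > 0" "RHP_right \<alpha> M" "RHP_right \<alpha> N" "z \<notin> Sigma_right \<alpha>"
  shows "M z = N z"
proof (rule rh_solution_unique[where arcs = "arcs_right \<alpha>" and E = "{0, of_real \<alpha>}"])
  note eq = Sigma_right_eq[OF assms(1), unfolded Sigma_right_def]
  show "interior (contour (arcs_right \<alpha>) {0, of_real \<alpha>}) = {}" unfolding eq by (rule interior_rh_contour)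
  have neg: "straight_arc (rh_contour \<alpha>) (of_real ` {..<0::real}) 1"
    by (rule straight_arc_real[where I = "{..<0}"]) (use assms(1) in \<open>auto simp: image_iff complex_eq_iff\<close>)
  have seg: "straight_arc (rh_contour \<alpha>) (of_real ` {0<..<\<alpha>}) 1"
    by (rule straight_arc_real[where I = "{0<..<\<alpha>}"]) (auto simp: image_iff complex_eq_iff)
  show "straight_arc (contour (arcs_right \<alpha>) {0, of_real \<alpha>}) S t" if "(S, t, J) \<in> arcs_right \<alpha>" for S t J
    using that[unfolded arcs_right_def] neg seg straight_arc_ray[OF disjI1[OF refl]] straight_arc_ray[OF disjI2[OF refl]] unfolding eq by auto
qed (use assms in \<open>auto simp: RHP_right_def Sigma_right_def arcs_right_def det_mat2\<close>)

theorem mainTheorem5: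
  "(\<forall>\<alpha>::real. \<alpha> > 0 \<longrightarrow>
      (\<exists>M. RHP_right \<alpha> M) \<and>
      (\<forall>M N. RHP_right \<alpha> M \<and> RHP_right \<alpha> N \<longrightarrow> (\<forall>z. z \<notin> Sigma_right \<alpha> \<longrightarrow> M z = N z))) \<and>
   (\<forall>\<alpha>::real. \<alpha> \<le> 0 \<longrightarrow>
      (\<exists>M. RHP_left \<alpha> M) \<and>
      (\<forall>M N. RHP_left \<alpha> M \<and> RHP_left \<alpha> N \<longrightarrow> (\<forall>z. z \<notin> Sigma_left \<alpha> \<longrightarrow> M z = N z)))"
  using RHP_right_exists RHP_right_unique RHP_left_exists RHP_left_unique by blast

end
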